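(* Let $f=\frac{P}{Q}$ be a germ of a meromorphic function at the origin of $\mathbb{C}^{n+1}$. Then there exists a finite set $\Sigma\subset\mathbb{CP}^1$ such that for all $c\in\mathbb{CP}^1\setminus\Sigma$ the $c$-Milnor fibres of $f$ are diffeomorphic to each other and the $c$-monodromy transformations of $f$ are isotopic to the identity. In particular, the set of atypical values of $f$ is finite.
   Context: A meromorphic germ at the origin of $\mathbb{C}^{n+1}$ is a ratio $f=P/Q$ of two holomorphic germs $P,Q$ on $(\mathbb{C}^{n+1},0)$; two such germs $P/Q$ and $P'/Q'$ are considered equal iff $P'=PU$, $Q'=QU$ for a holomorphic germ $U$ with $U(0)\neq 0$. The germ $f$ defines a map $f:B_\varepsilon\setminus\{P=Q=0\}\to\mathbb{CP}^1$, where $B_\varepsilon$ is the closed ball of radius $\varepsilon$ centred at the origin. For every $c\in\mathbb{CP}^1$ there is $\varepsilon_0>0$ such that for every $0<\varepsilon\le\varepsilon_0$ this map is a $C^\infty$ locally trivial fibration over a punctured neighbourhood of $c$. The $c$-Milnor fibre of $f$ is the fibre $\mathcal{M}^c_f=\{z\in B_\varepsilon: f(z)=c'\}$ of this fibration, for $c'\neq c$ close enough to $c$; the $c$-monodromy transformation is the monodromy of this fibration along a small simple loop around $c$. A value $c\in\mathbb{CP}^1$ is typical if for all sufficiently small $\varepsilon>0$ the map $f:B_\varepsilon\setminus\{P=Q=0\}\to\mathbb{CP}^1$ is a $C^\infty$ locally trivial fibration over a neighbourhood of $c$ (including $c$ itself); otherwise it is atypical. *)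

theory Defs
  imports "HOL-Analysis.Analysis"
begin

fun mf_dd :: "'a::real_normed_vector list \<Rightarrow> ('a \<Rightarrow> 'b::real_normed_vector) \<Rightarrow> 'a \<Rightarrow> 'b" where
  "mf_dd [] g = g"
| "mf_dd (v # vs) g = (\<lambda>x. frechet_derivative (mf_dd vs g) (at x) v)"

definition mf_smooth_on :: "'a::euclidean_space set \<Rightarrow> ('a \<Rightarrow> 'b::euclidean_space) \<Rightarrow> bool" where
  "mf_smooth_on U g \<longleftrightarrow> open U \<and> (\<forall>vs. mf_dd vs g differentiable_on U)"

definition mf_smooth_map_on :: "'a::euclidean_space set \<Rightarrow> ('a \<Rightarrow> 'b::euclidean_space) \<Rightarrow> bool" where
  "mf_smooth_map_on S g \<longleftrightarrow>
     (\<forall>x\<in>S. \<exists>U G. open U \<and> x \<in> U \<and> mf_smooth_on U G \<and> (\<forall>y\<in>U \<inter> S. G y = g y))"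

definition mf_diffeo :: "'a::euclidean_space set \<Rightarrow> 'b::euclidean_space set \<Rightarrow> ('a \<Rightarrow> 'b) \<Rightarrow> bool" where
  "mf_diffeo S T g \<longleftrightarrow> (\<exists>h. mf_smooth_map_on S g \<and> mf_smooth_map_on T h \<and> g ` S \<subseteq> T \<and> h ` T \<subseteq> S
        \<and> (\<forall>x\<in>S. h (g x) = x) \<and> (\<forall>y\<in>T. g (h y) = y))"

definition mf_diffeomorphic :: "'a::euclidean_space set \<Rightarrow> 'b::euclidean_space set \<Rightarrow> bool" where
  "mf_diffeomorphic S T \<longleftrightarrow> (\<exists>g. mf_diffeo S T g)"

text \<open>The point [a:b] of CP^1 (i.e. a/b, with [a:0] = infinity) corresponds to the point below of the
  unit sphere of C x R (inverse stereographic projection; infinity is (0,1)).\<close>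
definition mf_hopf :: "complex \<Rightarrow> complex \<Rightarrow> complex \<times> real" where
  "mf_hopf a b = (2 * a * cnj b / complex_of_real ((cmod a)^2 + (cmod b)^2),
                  ((cmod a)^2 - (cmod b)^2) / ((cmod a)^2 + (cmod b)^2))"

abbreviation mf_CP1 :: "(complex \<times> real) set" where
  "mf_CP1 \<equiv> sphere 0 1"

definition mf_holomorphic_on :: "(complex ^ 'n::finite \<Rightarrow> complex) \<Rightarrow> (complex ^ 'n) set \<Rightarrow> bool" where
  "mf_holomorphic_on P U \<longleftrightarrow> open U \<and>
     (\<forall>z\<in>U. \<exists>D. (P has_derivative D) (at z) \<and> (\<forall>h. D (\<i> *s h) = \<i> * D h))"

definition mf_map :: "(complex ^ 'n \<Rightarrow> complex) \<Rightarrow> (complex ^ 'n \<Rightarrow> complex) \<Rightarrow> complex ^ 'n \<Rightarrow> complex \<times> real" where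
  "mf_map P Q z = mf_hopf (P z) (Q z)"

definition mf_dom :: "(complex ^ 'n \<Rightarrow> complex) \<Rightarrow> (complex ^ 'n \<Rightarrow> complex) \<Rightarrow> real \<Rightarrow> (complex ^ 'n) set" where
  "mf_dom P Q \<epsilon> = {z \<in> cball 0 \<epsilon>. \<not> (P z = 0 \<and> Q z = 0)}"

definition mf_fibre :: "(complex ^ 'n \<Rightarrow> complex) \<Rightarrow> (complex ^ 'n \<Rightarrow> complex) \<Rightarrow> real \<Rightarrow> complex \<times> real \<Rightarrow> (complex ^ 'n) set" where
  "mf_fibre P Q \<epsilon> c = {z \<in> mf_dom P Q \<epsilon>. mf_map P Q z = c}"

definition mf_fibration_over :: "'a::euclidean_space set \<Rightarrow> ('a \<Rightarrow> 'b::euclidean_space) \<Rightarrow> 'b set \<Rightarrow> bool" where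
  "mf_fibration_over E f V \<longleftrightarrow>
     (\<forall>b\<in>V. \<exists>r>0. \<exists>\<phi>.
        mf_diffeo {x \<in> E. f x \<in> V \<inter> ball b r} ((V \<inter> ball b r) \<times> {x \<in> E. f x = b}) \<phi>
        \<and> (\<forall>x\<in>{x \<in> E. f x \<in> V \<inter> ball b r}. fst (\<phi> x) = f x))"

text \<open>A trivialisation of the pullback of f : E \<rightarrow> base along a path gamma : [0,1] \<rightarrow> base, starting at the
  identity of the fibre F over gamma 0: (x,t) \<mapsto> (Phi (x,t), t) is a diffeomorphism from F x [0,1] onto the
  pullback total space, and Phi (x,0) = x.  Its monodromy is Phi(-,1).\<close>
definition mf_trivialisation_along ::
  "'a::euclidean_space set \<Rightarrow> ('a \<Rightarrow> 'b::euclidean_space) \<Rightarrow> (real \<Rightarrow> 'b) \<Rightarrow> ('a \<times> real \<Rightarrow> 'a) \<Rightarrow> bool" where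
  "mf_trivialisation_along E f \<gamma> \<Phi> \<longleftrightarrow>
     mf_diffeo ({x \<in> E. f x = \<gamma> 0} \<times> {0..1}) {(y, t). y \<in> E \<and> t \<in> {0..1} \<and> f y = \<gamma> t}
               (\<lambda>(x, t). (\<Phi> (x, t), t))
     \<and> (\<forall>x \<in> {x \<in> E. f x = \<gamma> 0}. \<Phi> (x, 0) = x)"

definition mf_isotopic_to_id :: "'a::euclidean_space set \<Rightarrow> ('a \<Rightarrow> 'a) \<Rightarrow> bool" where
  "mf_isotopic_to_id F h \<longleftrightarrow>
     (\<exists>H. mf_diffeo (F \<times> {0..1::real}) (F \<times> {0..1::real}) (\<lambda>(x, t). (H (x, t), t))
          \<and> (\<forall>x\<in>F. H (x, 0) = x \<and> H (x, 1) = h x))"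

definition mf_monodromy_isotopic_to_id ::
  "'a::euclidean_space set \<Rightarrow> ('a \<Rightarrow> 'b::euclidean_space) \<Rightarrow> (real \<Rightarrow> 'b) \<Rightarrow> bool" where
  "mf_monodromy_isotopic_to_id E f \<gamma> \<longleftrightarrow>
     (\<forall>\<Phi>. mf_trivialisation_along E f \<gamma> \<Phi> \<longrightarrow>
           mf_isotopic_to_id {x \<in> E. f x = \<gamma> 0} (\<lambda>x. \<Phi> (x, 1)))"

text \<open>Small simple loop on the sphere around c: circle of angular radius r, with (u,v) an orthonormal
  basis of the tangent plane at c.\<close>
definition mf_circle_loop :: "complex \<times> real \<Rightarrow> complex \<times> real \<Rightarrow> complex \<times> real \<Rightarrow> real \<Rightarrow> real \<Rightarrow> complex \<times> real" where
  "mf_circle_loop c u v r t = cos r *\<^sub>R c + sin r *\<^sub>R (cos (2 * pi * t) *\<^sub>R u + sin (2 * pi * t) *\<^sub>R v)"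

definition mf_tangent_frame :: "complex \<times> real \<Rightarrow> complex \<times> real \<Rightarrow> complex \<times> real \<Rightarrow> bool" where
  "mf_tangent_frame c u v \<longleftrightarrow> inner u u = 1 \<and> inner v v = 1 \<and> inner u v = 0 \<and> inner c u = 0 \<and> inner c v = 0"

definition mf_typical :: "(complex ^ 'n \<Rightarrow> complex) \<Rightarrow> (complex ^ 'n \<Rightarrow> complex) \<Rightarrow> complex \<times> real \<Rightarrow> bool" where
  "mf_typical P Q c \<longleftrightarrow>
     (\<exists>\<epsilon>0>0. \<forall>\<epsilon>. 0 < \<epsilon> \<and> \<epsilon> \<le> \<epsilon>0 \<longrightarrow>
        (\<exists>\<delta>>0. mf_fibration_over (mf_dom P Q \<epsilon>) (mf_map P Q) (mf_CP1 \<inter> ball c \<delta>)))"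

end

theory Submission
  imports Defs "HOL-Complex_Analysis.Complex_Analysis"
begin

text \<open>Write f = P/Q. After local monomialisation of holomorphic germs, P, Q and f - c become monomials times
  units in finitely many charts covering a neighbourhood of the origin. For all but finitely many c
  this yields, near the origin and near f = c, two vector fields with bounded norm and bounded
  logarithmic derivative of Q: a field V tangent to the spheres with df(V) = 1, and a field W tangent to the
  fibres of f with radial part that of the Euler field. Boundedness of dlog Q along the fields implies, by
  Gronwall, that their flows do not reach Q = 0 in bounded time. Hence the flow of a V + b W moves
  f by a and multiplies |z| by exp (Re b): it trivialises f over a small disc inside every small ball, compares the
  fibres in balls of different radii, and deforms monodromies to the identity. The values c outside
  a finite set form a connected set, so all their Milnor fibres are diffeomorphic.\<close>

section \<open>Holomorphic functions of several variables\<close>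

no_notation fps_nth (infixl "$" 75)

text \<open>The obstacle is uniformity near the points \<open>P = Q = 0\<close>, where neither
  \<open>f\<close> nor its derivative is controlled. Pointwise estimates are enough there: at each
  point it suffices to exhibit vectors obeying bounds with constants independent of the point, since
  the solution of least norm for a suitable Hermitian form is then bounded as well and depends
  real-analytically on the point. Hence the charts of the monomialisation need neither be injective
  nor fit together; they only have to cover a neighbourhood. This admits ramified substitutions
  \<open>z $ i -> z $ i ^ e\<close>, which clear the denominators of fractional exponents, and
  reduces the monomialisation to an induction on the number of variables and on the order in one of
  them. Finiteness of the exceptional set comes from charts in which \<open>P\<close> and
  \<open>Q\<close> have equal exponents: there \<open>f\<close> extends to a holomorphic unit, which
  takes only finitely many values at points of a compact piece where all its logarithmic derivatives
  vanish. The remaining exceptional values are infinity, possibly 0, and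
  \<open>P 0 / Q 0\<close>.\<close>

abbreviation (input) hol :: "(complex ^ 'n::finite => complex) => (complex ^ 'n) set => bool" where
 "hol \<equiv> mf_holomorphic_on"

abbreviation ax :: "'n => complex ^ 'n::finite" where
 "ax k \<equiv> axis k 1"

text \<open>Defined through a one-variable slice, so that it makes sense before differentiability in
  several variables is known and Cauchy's estimate applies to it directly.\<close>

definition pd :: "'n::finite => (complex ^ 'n => complex) => complex ^ 'n => complex" where
 "pd k f z = deriv (%ze. f (z + ze *s ax k)) 0"

lemma norm_vector_smult [simp]: "norm (c *s (a :: complex ^ 'n)) = cmod c * norm a"
 by (simp add: norm_vec_def L2_set_def norm_mult power_mult_distrib sum_distrib_left[symmetric] real_sqrt_mult)

lemma norm_ax [simp]: "norm (ax k) = 1"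
 by (simp add: norm_axis_1)

lemma clinear_expand:
 fixes D :: "complex ^ 'n::finite => complex"
 assumes "bounded_linear D" "!!h. D (\<i> *s h) = \<i> * D h"
 shows "D (c *s h) = c * D h" and "D h = (\<Sum>k\<in>UNIV. h $ k * D (ax k))"
proof -
 interpret bounded_linear D by fact
 have c: "D (c *s h) = c * D h" for c h
 proof -
  have "c *s h = Re c *\<^sub>R h + Im c *\<^sub>R (\<i> *s h)"
   by (simp add: vec_eq_iff complex_eq_iff)
  then have "D (c *s h) = Re c *\<^sub>R D h + Im c *\<^sub>R (\<i> * D h)"
   by (simp add: add scaleR assms(2))
  then show ?thesis by (simp add: complex_eq_iff)
 qed
 show "D (c *s h) = c * D h" by (rule c)
 have "h = (\<Sum>k\<in>UNIV. h $ k *s ax k)"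
  by (simp add: basis_expansion)
 then have "D h = D (\<Sum>k\<in>UNIV. h $ k *s ax k)" by simp
 then show "D h = (\<Sum>k\<in>UNIV. h $ k * D (ax k))"
  by (simp add: sum c)
qed

lemma bounded_linear_smult_left: "bounded_linear (%ze. ze *s (a :: complex ^ 'n::finite))"
proof (rule bounded_linear_intro[where K="norm a"])
 show "(x + y) *s a = x *s a + y *s a" for x y by (simp add: vec_eq_iff algebra_simps)
 show "(r *\<^sub>R x) *s a = r *\<^sub>R (x *s a)" for r x by (simp add: vec_eq_iff)
qed simp

lemma slice_deriv:
 assumes "(f has_derivative D) (at (z + ze0 *s a))" "!!h. D (\<i> *s h) = \<i> * D h"
 shows "((%ze. f (z + ze *s a)) has_field_derivative D a) (at ze0)"
proof -
 have "((%ze. z + ze *s a) has_derivative (%ze. ze *s a)) (at ze0)"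
  by (auto intro!: derivative_eq_intros bounded_linear.has_derivative[OF bounded_linear_smult_left])
 from diff_chain_at[OF this assms(1)]
 have "((%ze. f (z + ze *s a)) has_derivative (%ze. D (ze *s a))) (at ze0)"
  by (simp add: o_def)
 moreover have "D (ze *s a) = D a * ze" for ze
  using clinear_expand(1)[OF has_derivative_bounded_linear[OF assms(1)] assms(2)] by (simp add: mult.commute)
 ultimately show ?thesis by (simp add: has_field_derivative_def)
qed

lemma hol_D:
 assumes "hol f U" "z \<in> U"
 obtains D where "(f has_derivative D) (at z)" "!!h. D (\<i> *s h) = \<i> * D h"
 using assms unfolding mf_holomorphic_on_def by blast

lemma hol_open: "hol f U ==> open U"
 by (simp add: mf_holomorphic_on_def)

lemma hol_cont: "hol f U ==> continuous_on U f"
 by (metis continuous_at_imp_continuous_on has_derivative_continuous mf_holomorphic_on_def)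

lemma hol_has_derivative:
 assumes "hol f U" "z \<in> U"
 shows "(f has_derivative (%h. \<Sum>k\<in>UNIV. h $ k * pd k f z)) (at z)"
proof -
 obtain D where D: "(f has_derivative D) (at z)" "!!h. D (\<i> *s h) = \<i> * D h"
  using hol_D[OF assms] by blast
 have "pd k f z = D (ax k)" for k
  unfolding pd_def using D slice_deriv[of f D z 0 "ax k"] by (intro DERIV_imp_deriv) simp
 then have "D = (%h. \<Sum>k\<in>UNIV. h $ k * pd k f z)"
  by (intro ext) (simp add: clinear_expand(2)[OF has_derivative_bounded_linear[OF D(1)] D(2), symmetric])
 then show ?thesis using D by simp
qed

lemma hol_slice_deriv:
 assumes "hol f U" "z + ze *s a \<in> U"
 shows "((%ze. f (z + ze *s a)) has_field_derivative (\<Sum>k\<in>UNIV. a $ k * pd k f (z + ze *s a))) (at ze)"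
 by (rule slice_deriv[OF hol_has_derivative[OF assms]])
  (simp add: sum_distrib_left mult.assoc)

lemma hol_slice_ax_deriv:
 assumes "hol f U" "z + ze *s ax k \<in> U"
 shows "((%ze. f (z + ze *s ax k)) has_field_derivative pd k f (z + ze *s ax k)) (at ze)"
proof -
 have "(\<Sum>i\<in>UNIV. ax k $ i * g i) = g k" for g :: "_ => complex"
  by (simp add: axis_def if_distrib[of "%x. x * _"] cong: if_cong)
 then show ?thesis using hol_slice_deriv[OF assms] by simp
qed

lemma continuous_on_smult_line: "continuous_on S (%ze. z + ze *s (a :: complex ^ 'n::finite))"
 by (intro continuous_intros bounded_linear.continuous_on[OF bounded_linear_smult_left])

lemma open_slice: "open U ==> open {ze. z + ze *s (a :: complex ^ 'n::finite) \<in> U}"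
 using open_vimage[OF _ continuous_on_smult_line[of UNIV z a]] by (simp add: vimage_def)

lemma hol_slice:
 assumes "hol f U"
 shows "(%ze. f (z + ze *s a)) holomorphic_on {ze. z + ze *s a \<in> U}"
 using hol_slice_deriv[OF assms] open_slice[OF hol_open[OF assms]]
 by (subst holomorphic_on_open) auto

lemma hol_subset: "hol f U ==> open V ==> V \<subseteq> U ==> hol f V"
 unfolding mf_holomorphic_on_def by blast

lemma hol_cong:
 assumes "hol f U" "!!z. z \<in> U ==> f z = g z"
 shows "hol g U"
 unfolding mf_holomorphic_on_def
proof (intro conjI ballI)
 show op: "open U" using assms(1) by (rule hol_open)
 fix z assume z: "z \<in> U"
 obtain D where D: "(f has_derivative D) (at z)" "!!h. D (\<i> *s h) = \<i> * D h"
  using hol_D[OF assms(1) z] by blast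
 have "(g has_derivative D) (at z)"
  by (rule has_derivative_transform_within_open[OF D(1) op z assms(2)])
 then show "\<exists>D. (g has_derivative D) (at z) & (\<forall>h. D (\<i> *s h) = \<i> * D h)" using D by blast
qed

lemma hol_local:
 assumes "open U" "!!z. z \<in> U ==> \<exists>V. z \<in> V & hol f V"
 shows "hol f U"
 using assms unfolding mf_holomorphic_on_def by meson

lemma hol_const: "open U ==> hol (%z. c) U"
 unfolding mf_holomorphic_on_def by (auto intro!: exI[of _ "%h. 0"])

lemma hol_coord: "open U ==> hol (%z. z $ i) U"
 unfolding mf_holomorphic_on_def
 by (auto intro!: exI[of _ "%h. h $ i"] bounded_linear.has_derivative[OF bounded_linear_vec_nth] has_derivative_ident)

lemma hol_add:
 assumes "hol f U" "hol g U"
 shows "hol (%z. f z + g z) U"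
 unfolding mf_holomorphic_on_def
proof (intro conjI ballI)
 show "open U" using assms(1) by (rule hol_open)
 fix z assume z: "z \<in> U"
 obtain D where D: "(f has_derivative D) (at z)" "!!h. D (\<i> *s h) = \<i> * D h"
  using hol_D[OF assms(1) z] by blast
 obtain E where E: "(g has_derivative E) (at z)" "!!h. E (\<i> *s h) = \<i> * E h"
  using hol_D[OF assms(2) z] by blast
 show "\<exists>D. ((%z. f z + g z) has_derivative D) (at z) & (\<forall>h. D (\<i> *s h) = \<i> * D h)"
  by (rule exI[of _ "%h. D h + E h"]) (auto simp: D E algebra_simps intro!: derivative_eq_intros)
qed

lemma hol_mult:
 assumes "hol f U" "hol g U"
 shows "hol (%z. f z * g z) U"
 unfolding mf_holomorphic_on_def
proof (intro conjI ballI)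
 show "open U" using assms(1) by (rule hol_open)
 fix z assume z: "z \<in> U"
 obtain D where D: "(f has_derivative D) (at z)" "!!h. D (\<i> *s h) = \<i> * D h"
  using hol_D[OF assms(1) z] by blast
 obtain E where E: "(g has_derivative E) (at z)" "!!h. E (\<i> *s h) = \<i> * E h"
  using hol_D[OF assms(2) z] by blast
 show "\<exists>D. ((%z. f z * g z) has_derivative D) (at z) & (\<forall>h. D (\<i> *s h) = \<i> * D h)"
  by (rule exI[of _ "%h. f z * E h + D h * g z"])
   (use D(2) E(2) has_derivative_mult[OF D(1) E(1)] in \<open>auto simp: algebra_simps\<close>)
qed

lemma hol_compose1:
 assumes "hol f U" "g holomorphic_on T" "open T" "!!z. z \<in> U ==> f z \<in> T"
 shows "hol (%z. g (f z)) U"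
 unfolding mf_holomorphic_on_def
proof (intro conjI ballI)
 show "open U" using assms(1) by (rule hol_open)
 fix z assume z: "z \<in> U"
 obtain D where D: "(f has_derivative D) (at z)" "!!h. D (\<i> *s h) = \<i> * D h"
  using hol_D[OF assms(1) z] by blast
 obtain g' where "(g has_field_derivative g') (at (f z))"
  using assms z by (metis holomorphic_on_open)
 then have "(g has_derivative (*) g') (at (f z))" by (simp add: has_field_derivative_def)
 from diff_chain_at[OF D(1) this]
 show "\<exists>D. ((%z. g (f z)) has_derivative D) (at z) & (\<forall>h. D (\<i> *s h) = \<i> * D h)"
  by (intro exI[of _ "%h. g' * D h"]) (auto simp: D o_def)
qed

lemma hol_minus: "hol f U ==> hol (%z. - f z) U"
 using hol_mult[OF hol_const[of U "-1"], of f] hol_open by force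

lemma hol_diff: "hol f U ==> hol g U ==> hol (%z. f z - g z) U"
 using hol_add[OF _ hol_minus, of f U g] by simp

lemma hol_inverse:
 assumes "hol f U" "!!z. z \<in> U ==> f z ~= 0"
 shows "hol (%z. inverse (f z)) U"
 by (rule hol_compose1[OF assms(1), of inverse "-{0}"]) (use assms(2) in \<open>auto intro!: holomorphic_intros\<close>)

lemma hol_divide:
 assumes "hol f U" "hol g U" "!!z. z \<in> U ==> g z ~= 0"
 shows "hol (%z. f z / g z) U"
 using hol_mult[OF assms(1) hol_inverse[OF assms(2,3)]] by (simp add: divide_inverse)

section \<open>Holomorphic maps and the chain rule\<close>

lemma hol_map_has_derivative:
 fixes g :: "complex ^ 'm::finite => complex ^ 'n::finite"
 assumes "!!i. hol (%z. g z $ i) U" "z \<in> U"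
 shows "(g has_derivative (%h. \<chi> i. \<Sum>k\<in>UNIV. h $ k * pd k (%z. g z $ i) z)) (at z)"
proof -
 have "(g has_derivative (%h. \<Sum>i\<in>UNIV. (\<Sum>k\<in>UNIV. h $ k * pd k (%z. g z $ i) z) *s ax i)) (at z)"
 proof -
  have "((%z. \<Sum>i\<in>UNIV. (g z $ i) *s ax i) has_derivative (%h. \<Sum>i\<in>UNIV. (\<Sum>k\<in>UNIV. h $ k * pd k (%z. g z $ i) z) *s ax i)) (at z)"
   by (intro has_derivative_sum bounded_linear.has_derivative[OF bounded_linear_smult_left] hol_has_derivative[OF assms])
  then show ?thesis by (simp add: basis_expansion)
 qed
 moreover have "(\<Sum>i\<in>UNIV. F i *s ax i) = (\<chi> i. F i)" for F :: "'n => complex"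
  using basis_expansion[of "\<chi> i. F i"] by simp
 ultimately show ?thesis by simp
qed

lemma hol_compose:
 fixes g :: "complex ^ 'm::finite => complex ^ 'n::finite"
 assumes f: "hol f V" and g: "!!i. hol (%z. g z $ i) U" and "g ` U \<subseteq> V"
 shows "hol (%z. f (g z)) U"
 unfolding mf_holomorphic_on_def
proof (intro conjI ballI)
 show "open U" using g by (rule hol_open)
 fix z assume z: "z \<in> U"
 have "g z \<in> V" using assms z by auto
 then obtain D where D: "(f has_derivative D) (at (g z))" "!!h. D (\<i> *s h) = \<i> * D h"
  using hol_D[OF f] by blast
 let ?G = "%h. \<chi> i. \<Sum>k\<in>UNIV. h $ k * pd k (%z. g z $ i) z"
 have "?G (\<i> *s h) = \<i> *s ?G h" for h
  by (simp add: vec_eq_iff sum_distrib_left mult.assoc)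
 with diff_chain_at[OF hol_map_has_derivative[OF g z] D(1)]
 show "\<exists>D. ((%z. f (g z)) has_derivative D) (at z) & (\<forall>h. D (\<i> *s h) = \<i> * D h)"
  by (intro exI[of _ "%h. D (?G h)"]) (auto simp: D o_def)
qed

lemma hol_compose_pd:
 fixes g :: "complex ^ 'm::finite => complex ^ 'n::finite"
 assumes f: "hol f V" and g: "!!i. hol (%z. g z $ i) U" and "g ` U \<subseteq> V" "z \<in> U"
 shows "pd k (%z. f (g z)) z = (\<Sum>i\<in>UNIV. pd k (%z. g z $ i) z * pd i f (g z))"
proof -
 let ?G = "%h. \<chi> i. \<Sum>k\<in>UNIV. h $ k * pd k (%z. g z $ i) z"
 have "((%z. f (g z)) has_derivative (%h. \<Sum>i\<in>UNIV. ?G h $ i * pd i f (g z))) (at z)"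
  using diff_chain_at[OF hol_map_has_derivative[OF g \<open>z \<in> U\<close>] hol_has_derivative[OF f]] assms by (auto simp: o_def)
 then have "(\<Sum>i\<in>UNIV. ?G h $ i * pd i f (g z)) = (\<Sum>k\<in>UNIV. h $ k * pd k (%z. f (g z)) z)" for h
  using fun_cong[OF has_derivative_unique[OF _ hol_has_derivative[OF hol_compose[OF f g assms(3)] \<open>z \<in> U\<close>]]] by blast
 from this[of "ax k"] show ?thesis
  by (simp add: axis_def if_distrib[of "%x. x * _"] cong: if_cong)
qed

text \<open>The partial derivatives are continuous by the Cauchy estimate applied to the difference of two
 slices, and this suffices for differentiability (Osgood).\<close>

lemma pd_diff_bound:
 assumes "0 < r" "!!w ze. w \<in> {z, z'} ==> cmod ze \<le> r ==> w + ze *s ax k \<in> U"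
  and cont: "continuous_on U f"
  and sep: "!!z. z \<in> U ==> (%ze. f (z + ze *s ax k)) field_differentiable (at 0)"
  and B: "!!ze. cmod ze \<le> r ==> cmod (f (z + ze *s ax k) - f (z' + ze *s ax k)) \<le> B"
 shows "cmod (pd k f z - pd k f z') \<le> B / r"
proof -
 have fd: "(%ze. f (w + ze *s ax k)) field_differentiable (at ze)" if "w + ze *s ax k \<in> U" for w ze
 proof -
  have "(%\<xi>. f ((w + ze *s ax k) + \<xi> *s ax k)) field_differentiable (at 0)" by (rule sep[OF that])
  moreover have "(w + ze *s ax k) + \<xi> *s ax k = w + (\<xi> + ze) *s ax k" for \<xi>
   by (simp add: vec_eq_iff algebra_simps)
  ultimately have "(%\<xi>. f (w + (\<xi> + ze) *s ax k)) field_differentiable (at 0)" by simp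
  then obtain d where "((%\<xi>. f (w + (\<xi> + ze) *s ax k)) has_field_derivative d) (at 0)"
   by (auto simp: field_differentiable_def)
  then have "((%\<xi>. f (w + \<xi> *s ax k)) has_field_derivative d) (at (0 + ze))"
   using DERIV_shift[of "%\<xi>. f (w + \<xi> *s ax k)" d 0 ze] by simp
  then show ?thesis by (auto simp: field_differentiable_def)
 qed
 let ?g = "%ze. f (z + ze *s ax k) - f (z' + ze *s ax k)"
 have fdg: "?g field_differentiable (at ze)" if "cmod ze \<le> r" for ze
  by (intro field_differentiable_diff fd assms(2) that) auto
 have "cmod ((deriv ^^ 1) ?g 0) \<le> fact 1 * B / r ^ 1"
 proof (rule Cauchy_inequality)
  show "?g holomorphic_on ball 0 r"
   unfolding holomorphic_on_def using fdg by (force intro: field_differentiable_at_within)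
  show "continuous_on (cball 0 r) ?g"
   by (intro continuous_at_imp_continuous_on ballI field_differentiable_imp_continuous_at fdg) auto
 qed (use assms in auto)
 moreover have "deriv ?g 0 = pd k f z - pd k f z'"
  unfolding pd_def using assms(1) by (intro deriv_diff fd assms(2)) auto
 ultimately show ?thesis by simp
qed

lemma pd_continuous:
 assumes "open U" and cont: "continuous_on U f"
  and sep: "!!z. z \<in> U ==> (%ze. f (z + ze *s ax k)) field_differentiable (at 0)"
 shows "continuous_on U (pd k f)"
proof (rule continuous_at_imp_continuous_on, rule ballI)
 fix z0 assume "z0 \<in> U"
 then obtain R where R: "R > 0" "cball z0 R \<subseteq> U" using \<open>open U\<close> open_contains_cball by blast
 have uc: "uniformly_continuous_on (cball z0 R) f"
  by (intro compact_uniformly_continuous continuous_on_subset[OF cont R(2)]) auto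
 show "isCont (pd k f) z0"
  unfolding continuous_at_eps_delta
 proof (intro allI impI)
  fix e :: real assume "e > 0"
  \<comment> \<open>Half of \<open>R\<close> leaves room both for the step from \<open>z0\<close> to
    \<open>y\<close> and for the Cauchy circle of radius \<open>r\<close>, so all points used stay
    in the compact ball. The modulus \<open>e * r / 2\<close> for \<open>f\<close> becomes
    \<open>e / 2\<close> after the division by \<open>r\<close>.\<close>
  define r where "r = R / 2"
  have r: "r > 0" using R by (simp add: r_def)
  obtain d where d: "d > 0" "!!x y. x \<in> cball z0 R ==> y \<in> cball z0 R ==> dist y x < d ==> dist (f y) (f x) < e * r / 2"
   using uc[unfolded uniformly_continuous_on_def, rule_format, of "e * r / 2"] \<open>e > 0\<close> r by auto
  show "\<exists>d>0. \<forall>y. dist y z0 < d \<longrightarrow> dist (pd k f y) (pd k f z0) < e"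
  proof (intro exI[of _ "min d r"] conjI allI impI)
   fix y assume y: "dist y z0 < min d r"
   have in_cb: "w + ze *s ax k \<in> cball z0 R" if "w \<in> {y, z0}" "cmod ze \<le> r" for w ze
   proof -
    have "norm (w - z0) \<le> r" using that y r by (auto simp: dist_norm)
    then have "norm ((w - z0) + ze *s ax k) \<le> R"
     using that(2) norm_triangle_ineq[of "w - z0" "ze *s ax k"] by (auto simp: r_def)
    then show ?thesis by (simp add: dist_norm norm_minus_commute algebra_simps)
   qed
   have "cmod (pd k f y - pd k f z0) \<le> (e * r / 2) / r"
   proof (rule pd_diff_bound[OF r _ cont sep])
    show "w + ze *s ax k \<in> U" if "w \<in> {y, z0}" "cmod ze \<le> r" for w ze
     using in_cb[OF that] R by auto
    show "cmod (f (y + ze *s ax k) - f (z0 + ze *s ax k)) \<le> e * r / 2" if "cmod ze \<le> r" for ze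
    proof -
     have "dist (y + ze *s ax k) (z0 + ze *s ax k) < d" using y by simp
     from d(2)[OF in_cb in_cb this] that show ?thesis by (simp add: dist_norm)
    qed
   qed
   then show "dist (pd k f y) (pd k f z0) < e" using r \<open>e > 0\<close> by (simp add: dist_norm)
  qed (use d r in auto)
 qed
qed

lemma pd_shift:
 assumes sep: "!!z. z \<in> U ==> (%ze. f (z + ze *s ax k)) field_differentiable (at 0)"
  and U: "w + ze *s ax k \<in> U"
 shows "((%ze. f (w + ze *s ax k)) has_field_derivative pd k f (w + ze *s ax k)) (at ze)"
proof -
 have "((%\<xi>. f ((w + ze *s ax k) + \<xi> *s ax k)) has_field_derivative pd k f (w + ze *s ax k)) (at 0)"
  unfolding pd_def using sep[OF U] field_differentiable_derivI by blast
 moreover have "(w + ze *s ax k) + \<xi> *s ax k = w + (\<xi> + ze) *s ax k" for \<xi>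
  by (simp add: vec_eq_iff algebra_simps)
 ultimately have "((%\<xi>. f (w + (\<xi> + ze) *s ax k)) has_field_derivative pd k f (w + ze *s ax k)) (at 0)" by simp
 then show ?thesis using DERIV_shift[of "%\<xi>. f (w + \<xi> *s ax k)" _ 0 ze] by simp
qed

lemma add_in_ball: "z + x \<in> ball z d \<longleftrightarrow> norm (x :: 'a::real_normed_vector) < d"
 by (metis add_diff_cancel_left' dist_commute dist_norm mem_ball)

text \<open>The mean value inequality for \<open>g ze - ze * c\<close>. It turns closeness of a
  derivative to a constant into the linear error bound needed for differentials and for difference
  quotients.\<close>

lemma linear_approx_bound:
 fixes g g' :: "complex => complex" and t c :: complex
 assumes "!!ze. cmod ze \<le> cmod t ==> (g has_field_derivative g' ze) (at ze)"
  "!!ze. cmod ze \<le> cmod t ==> cmod (g' ze - c) \<le> B"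
 shows "cmod (g t - g 0 - t * c) \<le> B * cmod t"
proof -
 have "cmod ((g t - t * c) - (g 0 - 0 * c)) \<le> B * cmod (t - 0)"
 proof (rule field_differentiable_bound[of "cball 0 (cmod t)" "%ze. g ze - ze * c" "%ze. g' ze - c" B t 0])
  fix ze :: complex assume "ze \<in> cball 0 (cmod t)"
  then have l: "cmod ze \<le> cmod t" by simp
  have "((%ze. ze * c) has_field_derivative c) (at ze)" by (auto intro!: derivative_eq_intros)
  from has_field_derivative_at_within[OF DERIV_diff[OF assms(1)[OF l] this]] show "((%ze. g ze - ze * c) has_field_derivative g' ze - c) (at ze within cball 0 (cmod t))"
   .
  show "cmod (g' ze - c) \<le> B" by (rule assms(2)[OF l])
 qed auto
 then show ?thesis by (simp add: algebra_simps)
qed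

lemma osgood:
 fixes f :: "complex ^ 'n::finite => complex"
 assumes "open U" and cont: "continuous_on U f"
  and sep: "!!z k. z \<in> U ==> (%ze. f (z + ze *s ax k)) field_differentiable (at 0)"
 shows "hol f U"
 unfolding mf_holomorphic_on_def
proof (intro conjI ballI)
 fix z assume z: "z \<in> U"
 let ?D = "%h. \<Sum>k\<in>UNIV. h $ k * pd k f z"
 have "(f has_derivative ?D) (at z)"
  unfolding has_derivative_at_alt
 proof (intro conjI allI impI)
  show "bounded_linear ?D"
   by (intro bounded_linear_sum bounded_linear_mult_const bounded_linear_vec_nth)
  fix e :: real assume "e > 0"
  define e' where "e' = e / CARD('n)"
  have e': "e' > 0" using \<open>e > 0\<close> by (simp add: e'_def)
  have "\<exists>d>0. ball z d \<subseteq> U & (\<forall>y\<in>ball z d. \<forall>k. cmod (pd k f y - pd k f z) \<le> e')"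
  proof -
   have "\<forall>k. \<exists>d>0. \<forall>y. dist y z < d \<longrightarrow> dist (pd k f y) (pd k f z) < e'"
    using pd_continuous[OF \<open>open U\<close> cont sep] \<open>open U\<close> z e'
    by (metis continuous_at_eps_delta continuous_on_eq_continuous_at)
   then obtain d where d: "!!k. d k > 0" "!!k y. dist y z < d k ==> dist (pd k f y) (pd k f z) < e'"
    by metis
   obtain d0 where d0: "d0 > 0" "ball z d0 \<subseteq> U" using \<open>open U\<close> z open_contains_ball by blast
   let ?d = "min d0 (Min (range d))"
   have "?d > 0" using d d0 by simp
   moreover have dk: "?d \<le> d k" for k by (simp add: min.coboundedI2)
   have "cmod (pd k f y - pd k f z) \<le> e'" if "y \<in> ball z ?d" for y k
   proof -
    have "dist y z < ?d" using that by (metis dist_commute mem_ball)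
    then have "dist y z < d k" using dk[of k] by linarith
    from d(2)[OF this] show ?thesis by (simp add: dist_norm)
   qed
   moreover have "ball z ?d \<subseteq> U" using d0(2) by auto
   ultimately show ?thesis by blast
  qed
  then obtain d where d: "d > 0" "ball z d \<subseteq> U" "!!y k. y \<in> ball z d ==> cmod (pd k f y - pd k f z) \<le> e'"
   by blast
  show "\<exists>d>0. \<forall>y. norm (y - z) < d \<longrightarrow> norm (f y - f z - ?D (y - z)) \<le> e * norm (y - z)"
  proof (intro exI[of _ d] conjI allI impI)
   fix y assume y: "norm (y - z) < d"
   let ?h = "y - z"
   \<comment> \<open>\<open>?hA A\<close> is the increment with only the coordinates in
     \<open>A\<close> switched on, so the induction on \<open>A\<close> moves from \<open>z\<close>
     to \<open>y\<close> one coordinate at a time. The tolerance \<open>e'\<close> is the share of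
     \<open>e\<close> that each of the \<open>CARD('n)\<close> moves may consume.\<close>
   let ?hA = "%A. (\<chi> i. if i \<in> A then ?h $ i else 0) :: complex ^ 'n"
   have nA: "norm (?hA A + ze *s ax k) \<le> norm ?h" if "k \<notin> A" "cmod ze \<le> cmod (?h $ k)" for A ze k
    unfolding norm_vec_def
    by (rule L2_set_mono) (use that in \<open>auto simp: axis_def\<close>)
   have "cmod (f (z + ?hA A) - f z - (\<Sum>k\<in>A. ?h $ k * pd k f z)) \<le> (\<Sum>k\<in>A. e' * cmod (?h $ k))" if "finite A" for A
    using that
   proof (induction A rule: finite_induct)
    case empty
    have "?hA {} = 0" by (simp add: vec_eq_iff)
    then show ?case by simp
   next
    case (insert k A)
    have inb: "z + ?hA A + ze *s ax k \<in> ball z d" if "cmod ze \<le> cmod (?h $ k)" for ze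
    proof -
     have "norm (?hA A + ze *s ax k) < d" using nA[OF insert(2) that] y by linarith
     then show ?thesis unfolding add.assoc add_in_ball .
    qed
    have "cmod (f ((z + ?hA A) + ?h $ k *s ax k) - f ((z + ?hA A) + 0 *s ax k) - ?h $ k * pd k f z) \<le> e' * cmod (?h $ k)"
    proof (rule linear_approx_bound)
     fix ze assume l: "cmod ze \<le> cmod (?h $ k)"
     show "((%ze. f ((z + ?hA A) + ze *s ax k)) has_field_derivative pd k f ((z + ?hA A) + ze *s ax k)) (at ze)"
      by (rule pd_shift[of U, OF sep]) (use inb[OF l] d(2) in auto)
     show "cmod (pd k f ((z + ?hA A) + ze *s ax k) - pd k f z) \<le> e'"
      using d(3)[OF inb[OF l]] .
    qed
    moreover have "?hA (insert k A) = ?hA A + ?h $ k *s ax k"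
     using insert(2) by (auto simp: vec_eq_iff axis_def)
    ultimately have 1: "cmod (f (z + ?hA (insert k A)) - f (z + ?hA A) - ?h $ k * pd k f z) \<le> e' * cmod (?h $ k)"
     by (simp add: add.assoc)
    have "f (z + ?hA (insert k A)) - f z - (\<Sum>k\<in>insert k A. ?h $ k * pd k f z)
      = (f (z + ?hA (insert k A)) - f (z + ?hA A) - ?h $ k * pd k f z) + (f (z + ?hA A) - f z - (\<Sum>k\<in>A. ?h $ k * pd k f z))"
     using insert by (simp add: algebra_simps)
    with norm_triangle_le[OF add_mono[OF 1 insert.IH]] show ?case
     unfolding sum.insert[OF insert(1,2)] by (simp only: )
   qed
   from this[OF finite_class.finite_UNIV]
   have "cmod (f (z + ?hA UNIV) - f z - (\<Sum>k\<in>UNIV. ?h $ k * pd k f z)) \<le> (\<Sum>k\<in>(UNIV::'n set). e' * cmod (?h $ k))"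
    .
   moreover have "z + ?hA UNIV = y" by (simp add: vec_eq_iff)
   ultimately have "cmod (f y - f z - ?D ?h) \<le> (\<Sum>k\<in>(UNIV::'n set). e' * cmod (?h $ k))" by (simp only:)
   also have "\<dots> \<le> (\<Sum>k\<in>(UNIV::'n set). e' * norm ?h)"
    by (intro sum_mono mult_left_mono) (use e' in \<open>auto simp: Finite_Cartesian_Product.norm_nth_le simp del: vector_minus_component\<close>)
   also have "\<dots> = e * norm ?h" by (simp add: e'_def)
   finally show "norm (f y - f z - ?D ?h) \<le> e * norm ?h" .
  qed (use d in auto)
 qed
 then show "\<exists>D. (f has_derivative D) (at z) & (\<forall>h. D (\<i> *s h) = \<i> * D h)"
  by (intro exI[of _ ?D]) (simp add: sum_distrib_left mult.assoc)
qed (fact \<open>open U\<close>)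

lemma hol_sep: "hol f U ==> z \<in> U ==> (%ze. f (z + ze *s ax k)) field_differentiable (at 0)"
 using hol_slice_ax_deriv[of f U z 0 k] by (auto simp: field_differentiable_def)

lemma pd_cont: "hol f U ==> continuous_on U (pd k f)"
 by (rule pd_continuous) (auto intro: hol_open hol_cont hol_sep)

text \<open>Weierstrass' theorem on each coordinate line gives separate holomorphy of the limit, and
  Osgood's lemma does the rest.\<close>

lemma hol_uniform_limit:
 fixes f :: "nat => complex ^ 'n::finite => complex"
 assumes "open U" and f: "!!m. hol (f m) U" and "uniform_limit U f g sequentially"
 shows "hol g U"
proof (rule osgood[OF \<open>open U\<close>])
 show "continuous_on U g"
  by (rule uniform_limit_theorem[OF _ assms(3)]) (auto intro!: always_eventually hol_cont f)
 fix z k assume z: "z \<in> U"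
 obtain r where r: "r > 0" "cball z r \<subseteq> U" using \<open>open U\<close> z open_contains_cball by blast
 have sub: "cball 0 r \<subseteq> {ze. z + ze *s ax k \<in> U}"
  using r by (auto simp: subset_eq dist_norm)
 have h: "(%ze. f m (z + ze *s ax k)) holomorphic_on cball 0 r" for m
  using holomorphic_on_subset[OF hol_slice[OF f] sub] .
 have ul: "uniform_limit (cball 0 r) (%m ze. f m (z + ze *s ax k)) (%ze. g (z + ze *s ax k)) sequentially"
  using assms(3) sub unfolding uniform_limit_iff by (fastforce elim: eventually_mono)
 have "(%ze. g (z + ze *s ax k)) holomorphic_on ball 0 r"
  by (rule holomorphic_uniform_limit[OF _ ul])
   (auto intro!: always_eventually holomorphic_on_imp_continuous_on h holomorphic_on_subset[OF h])
 then show "(%ze. g (z + ze *s ax k)) field_differentiable (at 0)"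
  using r holomorphic_on_imp_differentiable_at by (metis centre_in_ball open_ball)
qed

text \<open>A partial derivative is locally the uniform limit of difference quotients.\<close>

lemma hol_pd:
 fixes f :: "complex ^ 'n::finite => complex"
 assumes f: "hol f U"
 shows "hol (pd k f) U"
proof (rule hol_local[OF hol_open[OF f]])
 fix z0 assume "z0 \<in> U"
 then obtain R where R: "R > 0" "cball z0 R \<subseteq> U" using hol_open[OF f] open_contains_cball by blast
 define V where "V = ball z0 (R/2)"
 have uc: "uniformly_continuous_on (cball z0 R) (pd k f)"
  by (intro compact_uniformly_continuous continuous_on_subset[OF pd_cont[OF f] R(2)]) auto
 obtain N0 :: nat where N0: "1 / (real N0 + 1) < R / 2"
  using R by (metis half_gt_zero nat_approx_posE of_nat_Suc add.commute)
 \<comment> \<open>The offset \<open>N0\<close> keeps every step shorter than \<open>R / 2\<close>,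
   so that all quotients \<open>q m\<close>, not only those with large \<open>m\<close>, are
   holomorphic on the whole of \<open>V\<close>.\<close>
 define t where "t m = 1 / (of_nat (m + N0 + 1) :: complex)" for m
 have tN: "cmod (t m) = 1 / real (m + N0 + 1)" for m by (simp only: t_def norm_divide norm_one norm_of_nat)
 have tpos: "cmod (t m) > 0" for m by (simp add: tN)
 have tR: "cmod (t m) < R / 2" for m
 proof -
  have "1 / real (m + N0 + 1) \<le> 1 / (real N0 + 1)" by (intro divide_left_mono) auto
  then show ?thesis using N0 tN by simp
 qed
 have inR: "z + ze *s ax k \<in> cball z0 R" if "z \<in> V" "cmod ze \<le> cmod (t m)" for z ze m
 proof -
  have "norm ((z - z0) + ze *s ax k) \<le> R"
   using that tR[of m] norm_triangle_ineq[of "z - z0" "ze *s ax k"] by (auto simp: V_def dist_norm norm_minus_commute)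
  then show ?thesis by (simp add: dist_norm norm_minus_commute algebra_simps)
 qed
 define q where "q m z = (f (z + t m *s ax k) - f z) / t m" for m z
 have t0: "t m ~= 0" for m using tpos[of m] by auto
 have "hol (pd k f) V"
 proof (rule hol_uniform_limit)
  show "open V" by (simp add: V_def)
  have "hol (%z. f (z + t m *s ax k)) V" for m
  proof (rule hol_compose[OF f])
   show "hol (%z. (z + t m *s ax k) $ i) V" for i
    by (simp, intro hol_add hol_coord hol_const) (auto simp: V_def)
   show "(%z. z + t m *s ax k) ` V \<subseteq> U" using inR[of _ "t m" m] R by auto
  qed
  moreover have "hol f V" by (rule hol_subset[OF f]) (use R in \<open>auto simp: V_def subset_eq\<close>)
  ultimately show "hol (q m) V" for m
   unfolding q_def using t0 by (intro hol_divide hol_diff hol_const) (auto simp: V_def)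
  show "uniform_limit V q (pd k f) sequentially"
   unfolding uniform_limit_iff
  proof (intro allI impI)
   fix e :: real assume "e > 0"
   obtain d where d: "d > 0" "!!x y. x \<in> cball z0 R ==> y \<in> cball z0 R ==> dist y x < d ==> dist (pd k f y) (pd k f x) < e/2"
    using uc[unfolded uniformly_continuous_on_def, rule_format, of "e / 2"] \<open>e > 0\<close> by auto
   obtain M :: nat where M: "1 / (real M + 1) < d" using d(1) by (metis nat_approx_posE of_nat_Suc add.commute)
   show "\<forall>\<^sub>F m in sequentially. \<forall>z\<in>V. dist (q m z) (pd k f z) < e"
    unfolding eventually_sequentially
   proof (intro exI[of _ M] allI impI ballI)
    fix m z assume m: "M \<le> m" and z: "z \<in> V"
    have "1 / real (m + N0 + 1) \<le> 1 / (real M + 1)" using m by (intro divide_left_mono) auto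
    then have td: "cmod (t m) < d" using M tN by simp
    have "cmod (f (z + t m *s ax k) - f (z + 0 *s ax k) - t m * pd k f z) \<le> e/2 * cmod (t m)"
    proof (rule linear_approx_bound)
     fix ze assume l: "cmod ze \<le> cmod (t m)"
     have iU: "z + ze *s ax k \<in> U" using inR[OF z l] R by auto
     show "((%ze. f (z + ze *s ax k)) has_field_derivative pd k f (z + ze *s ax k)) (at ze)"
      by (rule hol_slice_ax_deriv[OF f iU])
     have "dist (z + ze *s ax k) z < d" using l td by (simp add: dist_norm)
     then show "cmod (pd k f (z + ze *s ax k) - pd k f z) \<le> e/2"
      using d(2)[of z "z + ze *s ax k"] inR[OF z l] inR[OF z, of 0 m] by (simp add: dist_norm)
    qed
    then have "cmod (f (z + t m *s ax k) - f z - t m * pd k f z) \<le> e/2 * cmod (t m)" by simp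
    moreover have "q m z - pd k f z = (f (z + t m *s ax k) - f z - t m * pd k f z) / t m"
     using t0 by (simp add: q_def field_simps)
    ultimately have "cmod (q m z - pd k f z) \<le> e/2"
     using tpos[of m] by (simp add: norm_divide divide_le_eq)
    then show "dist (q m z) (pd k f z) < e" using \<open>e > 0\<close> by (simp add: dist_norm)
   qed
  qed
 qed
 then show "\<exists>V. z0 \<in> V & hol (pd k f) V" using R by (intro exI[of _ V]) (auto simp: V_def)
qed

section \<open>Germs at a point and the identity principle\<close>

definition hol_at :: "(complex ^ 'n::finite => complex) => complex ^ 'n => bool" where
 "hol_at f x \<longleftrightarrow> (\<exists>U. x \<in> U & hol f U)"

definition nz_germ :: "(complex ^ 'n::finite => complex) => bool" where
 "nz_germ f \<longleftrightarrow> \<not> (\<forall>\<^sub>F z in nhds 0. f z = 0)"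

lemma hol_atI: "hol f U ==> x \<in> U ==> hol_at f x"
 by (auto simp: hol_at_def)

lemma hol_at_ball: "hol_at f x \<longleftrightarrow> (\<exists>r>0. hol f (ball x r))"
proof
 assume "hol_at f x"
 then obtain U where U: "x \<in> U" "hol f U" by (auto simp: hol_at_def)
 then obtain r where "r > 0" "ball x r \<subseteq> U" using hol_open open_contains_ball by blast
 then show "\<exists>r>0. hol f (ball x r)" using hol_subset[OF U(2) open_ball] by blast
qed (auto intro: hol_atI)

lemma hol_at_ball2:
 assumes "hol_at f x" "hol_at g x"
 obtains r where "r > 0" "hol f (ball x r)" "hol g (ball x r)"
proof -
 obtain r s where "r > 0" "hol f (ball x r)" "s > 0" "hol g (ball x s)"
  using assms by (auto simp: hol_at_ball)
 then show ?thesis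
  using that[of "min r s"] hol_subset[of f "ball x r" "ball x (min r s)"] hol_subset[of g "ball x s" "ball x (min r s)"]
  by (simp add: subset_ball)
qed

lemma hol_at_eventually: "hol_at f x ==> \<forall>\<^sub>F z in nhds x. hol_at f z"
 unfolding hol_at_def eventually_nhds using hol_open by blast

lemma hol_at_isCont: "hol_at f x ==> isCont f x"
 unfolding hol_at_def using hol_cont hol_open continuous_on_eq_continuous_at by blast

lemma hol_at_cong_ev:
 assumes "hol_at f x" "\<forall>\<^sub>F z in nhds x. f z = g z"
 shows "hol_at g x"
proof -
 obtain U where U: "x \<in> U" "hol f U" using assms by (auto simp: hol_at_def)
 obtain V where V: "open V" "x \<in> V" "!!z. z \<in> V ==> f z = g z" using assms(2) by (auto simp: eventually_nhds)
 have "hol g (U \<inter> V)"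
  by (rule hol_cong[OF hol_subset[OF U(2)]]) (use U V hol_open in auto)
 then show ?thesis using U V hol_atI[of g "U \<inter> V" x] by auto
qed

lemma hol_at_const [simp]: "hol_at (%z. c) x"
 by (rule hol_atI[OF hol_const[OF open_UNIV]]) simp

lemma hol_at_coord [simp]: "hol_at (%z. z $ i) x"
 by (rule hol_atI[OF hol_coord[OF open_UNIV]]) simp

lemma hol_at_add: "hol_at f x ==> hol_at g x ==> hol_at (%z. f z + g z) x"
 by (erule (1) hol_at_ball2) (rule hol_atI[OF hol_add], auto)

lemma hol_at_mult: "hol_at f x ==> hol_at g x ==> hol_at (%z. f z * g z) x"
 by (erule (1) hol_at_ball2) (rule hol_atI[OF hol_mult], auto)

lemma hol_at_diff: "hol_at f x ==> hol_at g x ==> hol_at (%z. f z - g z) x"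
 by (erule (1) hol_at_ball2) (rule hol_atI[OF hol_diff], auto)

lemma hol_at_power: "hol_at f x ==> hol_at (%z. f z ^ m) x"
 by (induction m) (auto intro: hol_at_mult)

lemma hol_at_sum: "(!!i. i \<in> A ==> hol_at (f i) x) ==> hol_at (%z. \<Sum>i\<in>A. f i z) x"
 by (induction A rule: infinite_finite_induct) (auto intro: hol_at_add)

lemma hol_at_prod: "(!!i. i \<in> A ==> hol_at (f i) x) ==> hol_at (%z. \<Prod>i\<in>A. f i z) x"
 by (induction A rule: infinite_finite_induct) (auto intro: hol_at_mult)

lemma hol_at_pd: "hol_at f x ==> hol_at (pd k f) x"
 unfolding hol_at_def using hol_pd by blast

lemma hol_at_map_isCont:
 assumes "!!i. hol_at (%z. g z $ i) (x :: complex ^ 'm::finite)"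
 shows "isCont (g :: _ => complex ^ 'n::finite) x"
proof -
 have "isCont (%z. \<chi> i. g z $ i) x"
  using hol_at_isCont[OF assms] unfolding isCont_def by (intro vec_tendstoI) auto
 then show ?thesis by simp
qed

lemma isCont_nhds: "isCont f x ==> filterlim f (nhds (f x)) (nhds x)"
 by (simp add: isCont_def tendsto_at_iff_tendsto_nhds)

lemma hol_at_compose:
 fixes g :: "complex ^ 'm::finite => complex ^ 'n::finite"
 assumes "hol_at f (g x)" and g: "!!i. hol_at (%z. g z $ i) x"
 shows "hol_at (%z. f (g z)) x"
proof -
 obtain V where V: "g x \<in> V" "hol f V" using assms by (auto simp: hol_at_def)
 obtain W where W: "!!i. x \<in> W i" "!!i. hol (%z. g z $ i) (W i)"
  using g unfolding hol_at_def by metis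
 have "\<forall>\<^sub>F z in nhds x. g z \<in> V"
  using topological_tendstoD[OF isCont_nhds[OF hol_at_map_isCont[OF g]] hol_open[OF V(2)] V(1)] .
 then obtain T where T: "open T" "x \<in> T" "!!z. z \<in> T ==> g z \<in> V" by (auto simp: eventually_nhds)
 let ?U = "T \<inter> (\<Inter>i. W i)"
 have "open (W i)" for i using hol_open[OF W(2)] .
 then have op: "open ?U" using T by (intro open_Int open_INT) auto
 have "hol (%z. f (g z)) ?U"
  by (rule hol_compose[OF V(2)]) (use T op in \<open>auto intro: hol_subset[OF W(2)]\<close>)
 then show ?thesis using T W hol_atI[of _ ?U x] by auto
qed

lemma hol_at_inverse:
 assumes "hol_at f x" "f x ~= 0"
 shows "hol_at (%z. inverse (f z)) x"
proof -
 obtain U where U: "x \<in> U" "hol f U" using assms by (auto simp: hol_at_def)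
 let ?V = "U \<inter> f -` (- {0})"
 have op: "open ?V" using continuous_open_preimage[OF hol_cont[OF U(2)] hol_open[OF U(2)], of "-{0}"] by auto
 have "hol (%z. inverse (f z)) ?V"
  by (rule hol_inverse[OF hol_subset[OF U(2) op]]) auto
 then show ?thesis using U assms hol_atI[of _ ?V x] by auto
qed

lemma hol_at_divide: "hol_at f x ==> hol_at g x ==> g x ~= 0 ==> hol_at (%z. f z / g z) x"
 using hol_at_mult[OF _ hol_at_inverse] by (simp add: divide_inverse)

lemma hol_at_nonzero_ev: "hol_at f x ==> f x ~= 0 ==> \<forall>\<^sub>F z in nhds x. f z ~= 0"
 by (metis hol_at_isCont isCont_def tendsto_at_iff_tendsto_nhds tendsto_imp_eventually_ne)

text \<open>On the complex line through \<open>w\<close> and a point \<open>p\<close> of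
  \<open>V\<close>, the parameters that stay in \<open>U\<close> form a convex and hence connected
  set, so the one-variable identity theorem applies to the slice.\<close>

lemma hol_identity:
 assumes f: "hol f U" and "convex U" "open V" "V ~= {}" "V \<subseteq> U" "!!z. z \<in> V ==> f z = 0" "w \<in> U"
 shows "f w = 0"
proof -
 obtain p where p: "p \<in> V" using assms by auto
 let ?S = "{ze. p + ze *s (w - p) \<in> U}" and ?T = "{ze. p + ze *s (w - p) \<in> V}"
 have cS: "convex ?S"
 proof (rule convexI)
  fix x y :: complex and u v :: real assume *: "x \<in> ?S" "y \<in> ?S" "0 \<le> u" "0 \<le> v" "u + v = 1"
  have "p + (u *\<^sub>R x + v *\<^sub>R y) *s (w - p) = u *\<^sub>R (p + x *s (w - p)) + v *\<^sub>R (p + y *s (w - p))"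
  proof -
   have "u *\<^sub>R p + v *\<^sub>R p = p" using *(5) by (metis scaleR_add_left scaleR_one)
   then show ?thesis by (simp add: vec_eq_iff algebra_simps)
  qed
  then show "u *\<^sub>R x + v *\<^sub>R y \<in> ?S" using * \<open>convex U\<close> by (simp add: convexD)
 qed
 have z: "p + 0 *s (w - p) = p" "p + 1 *s (w - p) = w" by (auto simp: vec_eq_iff)
 have "f (p + 1 *s (w - p)) = (%ze. 0) (1::complex)"
 proof (rule analytic_continuation_open[of ?T ?S "%ze. f (p + ze *s (w - p))" "%ze. 0"])
  show "open ?T" using open_slice assms by blast
  show "open ?S" using open_slice hol_open[OF f] by blast
  show "?T ~= {}" using p z(1) by (metis (mono_tags, lifting) empty_iff mem_Collect_eq)
  show "connected ?S" using cS convex_connected by blast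
  show "(%ze. f (p + ze *s (w - p))) holomorphic_on ?S" by (rule hol_slice[OF f])
 qed (use assms z in auto)
 then show ?thesis using z by simp
qed

text \<open>A germ vanishing on an open piece of a ball would vanish on the whole ball. The density
  obtained this way shows that germs have no zero divisors, and later lets estimates proved at
  generic points pass to all points by a limit.\<close>

lemma nz_germ_dense:
 assumes "hol_at f 0" "nz_germ f"
 shows "\<exists>r>0. \<forall>V. open V & V \<subseteq> ball 0 r & V ~= {} \<longrightarrow> (\<exists>z\<in>V. f z ~= 0)"
proof -
 obtain r where r: "r > 0" "hol f (ball 0 r)" using assms hol_at_ball by blast
 have "\<exists>z\<in>V. f z ~= 0" if "open V" "V \<subseteq> ball 0 r" "V ~= {}" for V
 proof (rule ccontr)
  assume "\<not> ?thesis"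
  then have "f w = 0" if "w \<in> ball 0 r" for w
   using hol_identity[OF r(2) convex_ball] \<open>open V\<close> \<open>V \<subseteq> ball 0 r\<close> \<open>V ~= {}\<close> that by blast
  then have "\<forall>\<^sub>F z in nhds 0. f z = 0" using r(1) unfolding eventually_nhds by (metis centre_in_ball open_ball)
  then show False using assms by (simp add: nz_germ_def)
 qed
 then show ?thesis using r by blast
qed

lemma nz_germ_mult:
 assumes "hol_at f 0" "hol_at g 0" "nz_germ f" "nz_germ g"
 shows "nz_germ (%z. f z * g z)"
 unfolding nz_germ_def
proof
 assume "\<forall>\<^sub>F z in nhds 0. f z * g z = 0"
 then obtain T where T: "open T" "0 \<in> T" "!!z. z \<in> T ==> f z * g z = 0" by (auto simp: eventually_nhds)
 obtain r where r: "r > 0" "!!V. open V ==> V \<subseteq> ball 0 r ==> V ~= {} ==> (\<exists>z\<in>V. g z ~= 0)"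
  using nz_germ_dense[OF assms(2,4)] by blast
 obtain s where s: "s > 0" "hol f (ball 0 s)" using assms hol_at_ball by blast
 let ?B = "T \<inter> ball 0 r \<inter> ball 0 s"
 have oB: "open ?B" using T by auto
 let ?V = "?B \<inter> f -` (- {0})"
 have "continuous_on ?B f" by (rule continuous_on_subset[OF hol_cont[OF s(2)]]) auto
 then have oV: "open ?V" using continuous_open_preimage[of ?B f "-{0}"] oB by auto
 have "0 \<in> ?B" using T r s by auto
 then have "\<exists>z\<in>?B. f z ~= 0" using assms(3) oB unfolding nz_germ_def eventually_nhds by blast
 then have "?V ~= {}" by auto
 then obtain z where "z \<in> ?V" "g z ~= 0" using r(2)[OF oV] by blast
 then show False using T(3)[of z] by auto
qed

lemma nz_germ_prod:
 assumes "finite A" "!!i. i \<in> A ==> hol_at (f i) 0" "!!i. i \<in> A ==> nz_germ (f i)"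
 shows "nz_germ (%z. \<Prod>i\<in>A. f i z)"
 using assms
proof (induction A rule: finite_induct)
 case empty
 then show ?case using eventually_nhds_x_imp_x by (fastforce simp: nz_germ_def)
next
 case (insert a A)
 then show ?case using nz_germ_mult[of "f a" "%z. \<Prod>i\<in>A. f i z"] hol_at_prod[of A f 0] by simp
qed

lemma nz_germI: "hol_at f 0 ==> f 0 ~= 0 ==> nz_germ f"
 unfolding nz_germ_def using eventually_nhds_x_imp_x by blast

lemma nz_germ_coord: "nz_germ (%z. z $ i)"
 unfolding nz_germ_def
proof
 assume "\<forall>\<^sub>F z in nhds 0. z $ i = (0::complex)"
 then obtain e where e: "e > 0" "!!z::complex^'a. dist z 0 < e ==> z $ i = 0" by (auto simp: eventually_nhds_metric)
 have "norm (complex_of_real (e/2) *s ax i) = e/2" using e by (simp add: norm_vector_smult)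
 then have "dist (complex_of_real (e/2) *s ax i) 0 < e" using e by (simp only: dist_norm diff_zero)
 from e(2)[OF this] e(1) show False by (simp add: axis_def)
qed

section \<open>Division by a coordinate and Taylor coefficients\<close>

definition rk :: "'n => complex ^ 'n::finite => complex ^ 'n" where
 "rk k z = (\<chi> i. if i = k then 0 else z $ i)"

lemma rk_nth [simp]: "rk k z $ i = (if i = k then 0 else z $ i)"
 by (simp add: rk_def)

lemma rk_decomp: "z = rk k z + z $ k *s ax k"
 by (simp add: vec_eq_iff axis_def)

lemma rk_id: "z $ k = 0 ==> rk k z = z"
 by (auto simp: vec_eq_iff)

lemma hol_at_rk: "hol_at (%z. rk k z $ i) x"
 by (cases "i = k") auto

lemma norm_vec_le:
 assumes "!!i. norm (x $ i) \<le> norm (y $ i)"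
 shows "norm (x :: 'a::real_normed_vector ^ 'n::finite) \<le> norm (y :: 'b::real_normed_vector ^ 'n)"
 unfolding norm_vec_def by (rule L2_set_mono) (use assms in auto)

text \<open>The value on the hyperplane is the limit of the difference quotient, which makes
  \<open>dv k f\<close> holomorphic again. Its iterates, restricted to the hyperplane, are the
  Taylor coefficients in \<open>z $ k\<close> as functions of the other coordinates.\<close>

definition dv :: "'n::finite => (complex ^ 'n => complex) => complex ^ 'n => complex" where
 "dv k f z = (if z $ k = 0 then pd k f z else (f z - f (rk k z)) / z $ k)"

lemma dv_eq: "f z = f (rk k z) + z $ k * dv k f z"
 by (auto simp: dv_def rk_id)

text \<open>Off the hyperplane \<open>dv k f\<close> is a quotient. On it Osgood's lemma asks for
  continuity, which the mean value estimate gives, and for holomorphy on coordinate lines: in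
  direction \<open>k\<close> the singularity is removable, in the others \<open>dv k f\<close>
  coincides with \<open>pd k f\<close>.\<close>

lemma hol_dv:
 fixes f :: "complex ^ 'n::finite => complex"
 assumes f: "hol f (ball 0 r)"
 shows "hol (dv k f) (ball 0 r)"
proof -
 let ?U = "ball (0 :: complex ^ 'n) r"
 have rkU: "rk k z \<in> ?U" if "z \<in> ?U" for z
 proof -
  have "norm (rk k z) \<le> norm z" by (rule norm_vec_le) auto
  then show ?thesis using that by simp
 qed
 have frk: "hol (%z. f (rk k z)) ?U"
 proof (rule hol_compose[OF f])
  show "hol (%z. rk k z $ i) ?U" for i
   by (cases "i = k") (auto intro: hol_const hol_coord)
 qed (use rkU in auto)
 let ?N = "?U \<inter> {z. z $ k ~= 0}"
 have opN: "open ?N"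
  by (intro open_Int open_ball open_Collect_neq continuous_intros)
 have qN: "hol (dv k f) ?N"
 proof (rule hol_cong)
  show "hol (%z. (f z - f (rk k z)) / z $ k) ?N"
   by (intro hol_divide hol_diff hol_subset[OF f] hol_subset[OF frk] hol_coord opN) auto
 qed (auto simp: dv_def)
 show ?thesis
 proof (rule osgood)
  show "continuous_on ?U (dv k f)"
  proof (rule continuous_at_imp_continuous_on, rule ballI)
   fix z0 assume z0: "z0 \<in> ?U"
   show "isCont (dv k f) z0"
   proof (cases "z0 $ k = 0")
    case False
    then show ?thesis using z0 hol_at_isCont[OF hol_atI[OF qN]] by simp
   next
    case True
    show ?thesis unfolding continuous_at_eps_delta
    proof (intro allI impI)
     fix e :: real assume "e > 0"
     have "isCont (pd k f) z0"
      using pd_cont[OF f] z0 continuous_on_eq_continuous_at[OF open_ball] by blast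
     then obtain d where d: "d > 0" "!!y. dist y z0 < d ==> dist (pd k f y) (pd k f z0) < e/2"
      unfolding continuous_at_eps_delta using \<open>e > 0\<close> by (meson half_gt_zero)
     obtain d0 where d0: "d0 > 0" "ball z0 d0 \<subseteq> ?U" using open_contains_ball z0 open_ball by blast
     show "\<exists>d>0. \<forall>y. dist y z0 < d \<longrightarrow> dist (dv k f y) (dv k f z0) < e"
     proof (intro exI[of _ "min d d0"] conjI allI impI)
      fix y assume y: "dist y z0 < min d d0"
      have dv0: "dv k f z0 = pd k f z0" using True by (simp add: dv_def)
      show "dist (dv k f y) (dv k f z0) < e"
      proof (cases "y $ k = 0")
       case True
       then show ?thesis using d(2)[of y] y dv0 \<open>e > 0\<close> by (simp add: dv_def)
      next
       case False
       have near: "dist (rk k y + ze *s ax k) z0 < min d d0" if "cmod ze \<le> cmod (y $ k)" for ze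
       proof -
        have "norm (rk k y + ze *s ax k - z0) \<le> norm (y - z0)"
         by (rule norm_vec_le) (use that True in \<open>auto simp: axis_def\<close>)
        then show ?thesis using y by (simp add: dist_norm)
       qed
       have "cmod (f (rk k y + y $ k *s ax k) - f (rk k y + 0 *s ax k) - y $ k * pd k f z0) \<le> e/2 * cmod (y $ k)"
       proof (rule linear_approx_bound)
        fix ze assume l: "cmod ze \<le> cmod (y $ k)"
        have "rk k y + ze *s ax k \<in> ?U" using near[OF l] d0(2) by (auto simp: dist_commute)
        then show "((%ze. f (rk k y + ze *s ax k)) has_field_derivative pd k f (rk k y + ze *s ax k)) (at ze)"
         by (rule hol_slice_ax_deriv[OF f])
        show "cmod (pd k f (rk k y + ze *s ax k) - pd k f z0) \<le> e/2"
         using d(2)[of "rk k y + ze *s ax k"] near[OF l] by (simp add: dist_norm)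
       qed
       then have "cmod (f y - f (rk k y) - y $ k * pd k f z0) \<le> e/2 * cmod (y $ k)"
        by (simp add: rk_decomp[symmetric])
       moreover have "dv k f y - pd k f z0 = (f y - f (rk k y) - y $ k * pd k f z0) / y $ k"
        using False by (simp add: dv_def field_simps)
       ultimately have "cmod (dv k f y - pd k f z0) \<le> e/2"
        using False by (simp add: norm_divide divide_le_eq)
       then show ?thesis using dv0 \<open>e > 0\<close> by (simp add: dist_norm)
      qed
     qed (use d d0 in auto)
    qed
   qed
  qed
  fix z j assume z: "z \<in> ?U"
  show "(%ze. dv k f (z + ze *s ax j)) field_differentiable (at 0)"
  proof (cases "z $ k = 0")
   case False
   then show ?thesis using hol_sep[OF qN] z by simp
  next
   case True
   show ?thesis
   proof (cases "j = k")
    case False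
    then have "dv k f (z + ze *s ax j) = pd k f (z + ze *s ax j)" for ze
     using True by (simp add: dv_def axis_def)
    then show ?thesis using hol_sep[OF hol_pd[OF f] z] by simp
   next
    case jk: True
    let ?g = "%ze. f (z + ze *s ax k)" and ?S = "{ze. z + ze *s ax k \<in> ?U}"
    have S: "open ?S" "0 \<in> ?S" using open_slice[OF open_ball, of z "ax k" 0 r] z by simp_all
    have "(%ze. if ze = 0 then deriv ?g 0 else (?g ze - ?g 0) / (ze - 0)) holomorphic_on ?S"
     by (rule pole_lemma[OF hol_slice[OF f]]) (use S in \<open>auto simp: interior_open\<close>)
    moreover have "dv k f (z + ze *s ax k) = (if ze = 0 then deriv ?g 0 else (?g ze - ?g 0) / (ze - 0))" for ze
    proof -
     have "rk k (z + ze *s ax k) = z" using True by (auto simp: vec_eq_iff axis_def)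
     then show ?thesis using True by (simp add: dv_def pd_def axis_def)
    qed
    ultimately show ?thesis using S jk by (simp add: holomorphic_on_imp_differentiable_at)
   qed
  qed
 qed simp
qed

lemma hol_at_dv: "hol_at f 0 ==> hol_at (dv k f) 0"
 unfolding hol_at_ball using hol_dv by blast

lemma hol_at_dv_iter: "hol_at f 0 ==> hol_at ((dv k ^^ i) f) 0"
 by (induction i) (auto intro: hol_at_dv)

lemma hol_at_pd_iter: "hol_at f x ==> hol_at ((pd k ^^ i) f) x"
 by (induction i) (auto intro: hol_at_pd)

lemma taylor_dv: "f z = (\<Sum>i<d. z $ k ^ i * (dv k ^^ i) f (rk k z)) + z $ k ^ d * (dv k ^^ d) f z"
proof (induction d)
 case (Suc d)
 then show ?case using dv_eq[of "(dv k ^^ d) f" z k] by (simp add: algebra_simps)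
qed simp

lemma pd_cong_ev:
 assumes "\<forall>\<^sub>F z in nhds x. f z = g z"
 shows "\<forall>\<^sub>F z in nhds x. pd k f z = pd k g z"
proof -
 obtain T where T: "open T" "x \<in> T" "!!z. z \<in> T ==> f z = g z" using assms by (auto simp: eventually_nhds)
 have "pd k f z = pd k g z" if "z \<in> T" for z
  unfolding pd_def
 proof (rule deriv_cong_ev)
  have "0 \<in> {ze. z + ze *s ax k \<in> T}" using that by simp
  then show "\<forall>\<^sub>F ze in nhds 0. f (z + ze *s ax k) = g (z + ze *s ax k)"
   unfolding eventually_nhds using open_slice[OF T(1), of z "ax k"] T(3) by blast
 qed simp
 then show ?thesis using T unfolding eventually_nhds by blast
qed

lemma hol_at_pd_deriv:
 assumes "hol_at f z"
 shows "((%ze. f (z + ze *s ax k)) has_field_derivative pd k f z) (at 0)"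
proof -
 obtain U where "z \<in> U" "hol f U" using assms by (auto simp: hol_at_def)
 then show ?thesis using hol_slice_ax_deriv[of f U z 0 k] by simp
qed

lemma pd_unique: "((%ze. f (z + ze *s ax k)) has_field_derivative D) (at 0) ==> pd k f z = D"
 unfolding pd_def by (rule DERIV_imp_deriv)

lemma pd_add: "hol_at f z ==> hol_at g z ==> pd k (%z. f z + g z) z = pd k f z + pd k g z"
 by (rule pd_unique) (intro DERIV_add hol_at_pd_deriv)

lemma pd_mult: "hol_at f z ==> hol_at g z ==> pd k (%z. f z * g z) z = pd k f z * g z + f z * pd k g z"
 using DERIV_mult[OF hol_at_pd_deriv[of f z k] hol_at_pd_deriv[of g z k]]
 by (intro pd_unique) (simp add: algebra_simps)

lemma pd_const [simp]: "pd k (%z. c) z = 0"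
 by (rule pd_unique) simp

lemma pd_coord: "pd k (%z. z $ i) z = (if i = k then 1 else 0)"
 by (rule pd_unique) (auto simp: axis_def intro!: derivative_eq_intros)

lemma pd_rk_invariant: "pd k (%z. f (rk k z)) z = 0"
proof -
 have "rk k (z + ze *s ax k) = rk k z" for ze by (auto simp: vec_eq_iff axis_def)
 then show ?thesis by (intro pd_unique) simp
qed

text \<open>Leibniz' rule for \<open>f z = f (rk k z) + z $ k * dv k f z\<close>: the first summand
  is constant along \<open>k\<close> and the factor \<open>z $ k\<close> has no second derivative,
  so only two terms survive.\<close>

lemma pd_iter_dv:
 assumes f: "hol_at f 0"
 shows "\<forall>\<^sub>F z in nhds 0. (pd k ^^ Suc i) f z = z $ k * (pd k ^^ Suc i) (dv k f) z + of_nat (Suc i) * (pd k ^^ i) (dv k f) z"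
proof (induction i)
 case 0
 have fr: "hol_at (%z. f (rk k z)) 0"
  by (rule hol_at_compose) (use f hol_at_rk rk_id[of 0 k] in auto)
 have "\<forall>\<^sub>F z in nhds 0. hol_at (dv k f) z & hol_at (%z. f (rk k z)) z"
  by (intro eventually_conj hol_at_eventually hol_at_dv f fr)
 then show ?case
 proof eventually_elim
  case (elim z)
  have "pd k f z = pd k (%z. f (rk k z) + z $ k * dv k f z) z" by (simp add: dv_eq[symmetric])
  also have "\<dots> = z $ k * pd k (dv k f) z + dv k f z"
   using elim by (simp add: pd_add pd_mult hol_at_mult pd_coord pd_rk_invariant)
  finally show ?case by simp
 qed
next
 case (Suc i)
 let ?E = "dv k f"
 have ev: "\<forall>\<^sub>F z in nhds 0. hol_at ((pd k ^^ i) ?E) z & hol_at ((pd k ^^ Suc i) ?E) z"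
  by (intro eventually_conj hol_at_eventually hol_at_pd_iter hol_at_dv f)
 from pd_cong_ev[OF Suc, of k] ev show ?case
 proof eventually_elim
  case (elim z)
  have "(pd k ^^ Suc (Suc i)) f z = pd k (%z. z $ k * (pd k ^^ Suc i) ?E z + of_nat (Suc i) * (pd k ^^ i) ?E z) z"
   using elim by simp
  also have "\<dots> = (pd k ^^ Suc i) ?E z + z $ k * pd k ((pd k ^^ Suc i) ?E) z + of_nat (Suc i) * pd k ((pd k ^^ i) ?E) z"
   using elim by (simp add: pd_add pd_mult hol_at_mult pd_coord del: of_nat_Suc)
  finally show ?case by (simp add: algebra_simps)
 qed
qed

text \<open>On the hyperplane the term with the factor \<open>z $ k\<close> drops out, and a
  factorial remains. Derivatives are convenient under translations, divided differences in
  expansions; this identity converts between them.\<close>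

lemma pd_dv_rk:
 assumes "hol_at f 0"
 shows "\<forall>\<^sub>F z in nhds 0. (pd k ^^ i) f (rk k z) = fact i * (dv k ^^ i) f (rk k z)"
 using assms
proof (induction i arbitrary: f)
 case (Suc i)
 have "filterlim (rk k) (nhds 0) (nhds 0)"
  using isCont_nhds[OF hol_at_map_isCont[of "rk k" 0, OF hol_at_rk]] rk_id[of 0 k] by simp
 then have "\<forall>\<^sub>F z in nhds 0. (pd k ^^ Suc i) f (rk k z) = rk k z $ k * (pd k ^^ Suc i) (dv k f) (rk k z) + of_nat (Suc i) * (pd k ^^ i) (dv k f) (rk k z)"
  using pd_iter_dv[OF Suc.prems] by (rule eventually_compose_filterlim[rotated])
 moreover have "\<forall>\<^sub>F z in nhds 0. (pd k ^^ i) (dv k f) (rk k z) = fact i * (dv k ^^ i) (dv k f) (rk k z)"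
  by (rule Suc.IH[OF hol_at_dv[OF Suc.prems]])
 ultimately show ?case
  by eventually_elim (simp add: funpow_swap1 algebra_simps)
qed simp

section \<open>Inverse and implicit functions\<close>

lemma hol_at_map_inverse_local:
 fixes F :: "complex ^ 'n::finite => complex ^ 'n"
 assumes F: "!!i. hol (%z. F z $ i) U" "x \<in> U"
  and inv: "bounded_linear J" "!!h. J (\<chi> i. \<Sum>k\<in>UNIV. h $ k * pd k (%z. F z $ i) x) = h"
 obtains V G where "open V" "F x \<in> V" "!!y. y \<in> V ==> G y \<in> U & F (G y) = y" "G (F x) = x"
  "!!i. hol (%z. G z $ i) V"
proof -
 define D where "D z = Blinfun (%h. \<chi> i. \<Sum>k\<in>UNIV. h $ k * pd k (%z. F z $ i) z)" for z
 have Dap: "blinfun_apply (D z) = (%h. \<chi> i. \<Sum>k\<in>UNIV. h $ k * pd k (%z. F z $ i) z)" if "z \<in> U" for z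
  unfolding D_def by (intro bounded_linear_Blinfun_apply has_derivative_bounded_linear[OF hol_map_has_derivative[OF F(1) that]])
 have "open U" using hol_open[OF F(1)] .
 have derF: "(F has_derivative blinfun_apply (D z)) (at z)" if "z \<in> U" for z
  using hol_map_has_derivative[OF F(1) that] Dap[OF that] by simp
 have cont: "continuous_on U D"
 proof (rule continuous_on_blinfun_componentwise)
  fix b :: "complex ^ 'n"
  have "continuous_on U (%z. \<chi> i. \<Sum>k\<in>UNIV. b $ k * pd k (%z. F z $ i) z)"
   by (intro continuous_intros pd_cont[OF F(1)])
  then show "continuous_on U (%z. blinfun_apply (D z) b)"
   using Dap by (simp cong: continuous_on_cong)
 qed
 have inv': "Blinfun J o\<^sub>L D x = id_blinfun"
  by (rule blinfun_eqI) (simp add: bounded_linear_Blinfun_apply[OF inv(1)] Dap[OF F(2)] inv(2))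
 obtain U' V G G' where G: "open U'" "U' \<subseteq> U" "x \<in> U'" "open V" "F x \<in> V" "homeomorphism U' V F G"
  "!!y. y \<in> V ==> (G has_derivative (G' y)) (at y)"
  "!!y. y \<in> V ==> G' y = inv (blinfun_apply (D (G y)))"
  "!!y. y \<in> V ==> bij (blinfun_apply (D (G y)))"
  using inverse_function_theorem[OF \<open>open U\<close> derF cont F(2) inv'] by metis
 have GU: "G y \<in> U & F (G y) = y" if "y \<in> V" for y
  using G(2,6) that by (auto simp: homeomorphism_def)
 have "hol (%z. G z $ i) V" for i
  unfolding mf_holomorphic_on_def
 proof (intro conjI ballI exI)
  fix y assume y: "y \<in> V"
  show "((%z. G z $ i) has_derivative (%h. G' y h $ i)) (at y)"
   by (rule bounded_linear.has_derivative[OF bounded_linear_vec_nth G(7)[OF y]])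
  \<comment> \<open>The inverse of a complex-linear bijection is complex-linear, so the inverse
    supplied by the real inverse function theorem is already holomorphic.\<close>
  show "\<forall>h. G' y (\<i> *s h) $ i = \<i> * G' y h $ i"
  proof
   fix h
   let ?L = "blinfun_apply (D (G y))"
   have L: "?L (\<i> *s h) = \<i> *s ?L h" for h
    using GU[OF y] by (simp add: Dap vec_eq_iff sum_distrib_left mult.assoc)
   have b: "bij ?L" by (rule G(9)[OF y])
   have "inv ?L (\<i> *s h) = \<i> *s inv ?L h"
    by (metis L b bij_inv_eq_iff)
   then show "G' y (\<i> *s h) $ i = \<i> * G' y h $ i" by (simp add: G(8)[OF y])
  qed
 qed (fact G(4))
 moreover have "G (F x) = x" using G(3,6) by (auto simp: homeomorphism_def)
 ultimately show ?thesis using that G(4,5) GU by blast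
qed

lemma hol_implicit:
 fixes f :: "complex ^ 'n::finite => complex"
 assumes f: "hol_at f 0" "f 0 = 0" "pd k f 0 ~= 0"
 obtains ph where "hol_at ph 0" "ph 0 = 0" "!!z. ph (rk k z) = ph z" "\<forall>\<^sub>F z in nhds 0. f (rk k z + ph z *s ax k) = 0"
proof -
 obtain r where r: "r > 0" "hol f (ball 0 r)" using f hol_at_ball by blast
 \<comment> \<open>Replacing coordinate \<open>k\<close> by the value of \<open>f\<close>
   straightens the zero set into a hyperplane. The inverse map, restricted to that hyperplane,
   parametrises the zero set, and its \<open>k\<close>-th component is the implicit
   function.\<close>
 define F where "F z = (\<chi> i. if i = k then f z else z $ i)" for z
 let ?U = "ball (0 :: complex ^ 'n) r"
 have F: "hol (%z. F z $ i) ?U" for i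
  by (cases "i = k") (auto simp: F_def r intro: hol_coord)
 define c where "c i = pd i f 0" for i
 \<comment> \<open>The differential of \<open>F\<close> at 0 inverted by hand: subtract the
   contributions of the other coordinates and divide by \<open>pd k f 0\<close>.\<close>
 define J where "J y = (\<chi> i. if i = k then (y $ k - (\<Sum>j\<in>UNIV - {k}. y $ j * c j)) / c k else y $ i)" for y
 have J: "bounded_linear J"
  unfolding linear_conv_bounded_linear[symmetric]
  by (rule linearI) (auto simp: J_def vec_eq_iff sum.distrib sum_distrib_left scaleR_conv_of_real[where 'a=complex]
    add_divide_distrib diff_divide_distrib algebra_simps)
 have JF: "J (\<chi> i. \<Sum>j\<in>UNIV. h $ j * pd j (%z. F z $ i) 0) = h" for h
 proof -
  have 1: "(\<Sum>j\<in>UNIV. h $ j * pd j (%z. F z $ i) 0) = h $ i" if "i ~= k" for i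
   using that by (simp add: F_def pd_coord if_distrib[of "%x. _ * x"] cong: if_cong)
  have 2: "(\<Sum>j\<in>UNIV. h $ j * pd j (%z. F z $ k) 0) = h $ k * c k + (\<Sum>j\<in>UNIV - {k}. h $ j * c j)"
   by (simp add: F_def c_def sum.remove[of UNIV k])
  have 3: "(\<Sum>j\<in>UNIV - {k}. (\<chi> i. \<Sum>j\<in>UNIV. h $ j * pd j (%z. F z $ i) 0) $ j * c j) = (\<Sum>j\<in>UNIV - {k}. h $ j * c j)"
   by (rule sum.cong) (auto simp: 1)
  show ?thesis unfolding J_def 3 using f(3) 1 2 by (auto simp: vec_eq_iff c_def)
 qed
 have F0: "F 0 = 0" using f(2) by (simp add: F_def vec_eq_iff)
 obtain V G where G: "open V" "0 \<in> V" "!!y. y \<in> V ==> G y \<in> ?U & F (G y) = y" "G 0 = 0"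
  "!!i. hol (%z. G z $ i) V"
  using hol_at_map_inverse_local[OF F _ J JF] r(1) F0 by (metis centre_in_ball)
 define ph where "ph z = G (rk k z) $ k" for z
 have rk0: "rk k 0 = 0" by (simp add: rk_id)
 have rkrk: "rk k (rk k z) = rk k z" for z by (simp add: rk_id)
 have "hol_at ph 0"
  unfolding ph_def by (rule hol_at_compose) (use hol_atI[OF G(5) G(2)] rk0 hol_at_rk in auto)
 moreover have "ph 0 = 0" by (simp add: ph_def rk0 G(4))
 moreover have "ph (rk k z) = ph z" for z by (simp add: ph_def rkrk)
 moreover have "\<forall>\<^sub>F z in nhds 0. f (rk k z + ph z *s ax k) = 0"
 proof -
  have "filterlim (rk k) (nhds (rk k 0)) (nhds 0)"
   by (intro isCont_nhds hol_at_map_isCont hol_at_rk)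
  then have "\<forall>\<^sub>F z in nhds 0. rk k z \<in> V"
   using topological_tendstoD[OF _ G(1)] G(2) rk0 by metis
  then show ?thesis
  proof eventually_elim
   case (elim z)
   have FG: "F (G (rk k z)) = rk k z" using G(3)[OF elim] by blast
   have "G (rk k z) $ i = rk k z $ i" if "i ~= k" for i
    using arg_cong[OF FG, of "%v. v $ i"] that by (simp add: F_def)
   then have "G (rk k z) = rk k z + ph z *s ax k"
    by (auto simp: vec_eq_iff ph_def axis_def)
   moreover have "f (G (rk k z)) = 0" using arg_cong[OF FG, of "%v. v $ k"] by (simp add: F_def)
   ultimately show ?case by simp
  qed
 qed
 ultimately show ?thesis using that by blast
qed

section \<open>Monomialisation\<close>

text \<open>All germs live on the full space, and a set \<open>S\<close> marks the active
  coordinates. With \<open>cyl\<close>, \<open>sub\<close>, \<open>restr\<close> and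
  \<open>dep\<close>, functions of fewer variables are treated without a change of type, as the
  induction on the number of variables requires.\<close>

definition cyl :: "'n set => real => (complex ^ 'n::finite) set" where
 "cyl S r = {z. \<forall>i\<in>S. cmod (z $ i) < r}"

definition sub :: "'n set => (complex ^ 'n::finite) set" where
 "sub S = {z. \<forall>i. i \<notin> S \<longrightarrow> z $ i = 0}"

definition restr :: "'n set => complex ^ 'n::finite => complex ^ 'n" where
 "restr S z = (\<chi> i. if i \<in> S then z $ i else 0)"

definition dep :: "'n set => (complex ^ 'n::finite => complex) => bool" where
 "dep S h \<longleftrightarrow> (\<forall>z w. (\<forall>i\<in>S. z $ i = w $ i) \<longrightarrow> h z = h w)"

text \<open>An admissible change of coordinates leaves the inactive coordinates alone and computes
  the active ones from active ones only; thus dependence on \<open>S\<close> survives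
  composition.\<close>

definition adm :: "'n set => (complex ^ 'n::finite => complex ^ 'n) => bool" where
 "adm S pj \<longleftrightarrow> (\<forall>w i. i \<notin> S \<longrightarrow> pj w $ i = w $ i) & (\<forall>i\<in>S. dep S (%w. pj w $ i))"

definition mon :: "('n => nat) => complex ^ 'n::finite => complex" where
 "mon gm z = (\<Prod>i\<in>UNIV. z $ i ^ gm i)"

definition supp_in :: "'n set => ('n => nat) => bool" where
 "supp_in S gm \<longleftrightarrow> (\<forall>i. i \<notin> S \<longrightarrow> gm i = 0)"

definition mu :: "'n set => (complex ^ 'n::finite => complex) => bool" where
 "mu S h \<longleftrightarrow> (\<exists>gm u. supp_in S gm & dep S u & hol_at u 0 & u 0 ~= 0 & (\<forall>\<^sub>F z in nhds 0. h z = mon gm z * u z))"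

definition good_chart :: "'n set => real => (complex ^ 'n::finite => complex) => (complex ^ 'n => complex ^ 'n) => bool" where
 "good_chart S dl h pj \<longleftrightarrow> adm S pj & (\<forall>i. hol (%w. pj w $ i) (cyl S 1)) & pj ` cyl S 1 \<subseteq> cyl S dl &
  (\<exists>gm u. supp_in S gm & hol u (cyl S 1) & (\<forall>w\<in>cyl S 1. u w ~= 0 & h (pj w) = mon gm w * u w))"

text \<open>A weak form of resolution: finitely many charts whose images cover a neighbourhood in
  the active coordinates, without injectivity. Points are covered from the polydisc of radius
  \<open>1/2\<close>, so that a chart can be recentred at each point used, well inside its domain.
  Smallness of \<open>dl\<close> confines the charts to any neighbourhood given in advance.\<close>

definition Res :: "'n set => (complex ^ 'n::finite => complex) => bool" where
 "Res S h \<longleftrightarrow> (\<forall>dl>0. \<exists>\<nu>>0. \<exists>F. finite F & (\<forall>pj\<in>F. good_chart S dl h pj) &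
  (\<forall>z\<in>sub S \<inter> cyl S \<nu>. \<exists>pj\<in>F. \<exists>w\<in>sub S \<inter> cyl S (1/2). pj w = z))"

section \<open>Rules for active coordinates and admissible changes\<close>

lemma restr_nth [simp]: "restr S z $ i = (if i \<in> S then z $ i else 0)"
 by (simp add: restr_def)

lemma restr_0 [simp]: "restr S 0 = 0"
 by (simp add: vec_eq_iff)

lemma restr_sub: "restr S z \<in> sub S"
 by (simp add: sub_def)

lemma dep_restr: "dep S h ==> h (restr S z) = h z"
 unfolding dep_def by (metis restr_nth)

lemma dep_restrI: "dep S (%z. h (restr S z))"
proof -
 have "restr S z = restr S w" if "\<forall>i\<in>S. z $ i = w $ i" for z w :: "complex ^ 'a"
  using that by (simp add: vec_eq_iff)
 then show ?thesis unfolding dep_def by metis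
qed

lemma depD: "dep S h ==> (!!i. i \<in> S ==> z $ i = w $ i) ==> h z = h w"
 unfolding dep_def by blast

lemma hol_at_restr: "hol_at (%z. restr S z $ i) x"
 by (cases "i \<in> S") auto

lemma open_cyl: "open (cyl S r)"
proof -
 have "cyl S r = (\<Inter>i\<in>S. {z. cmod (z $ i) < r})" by (auto simp: cyl_def)
 moreover have "open {z :: complex ^ 'a. cmod (z $ i) < r}" for i
  by (intro open_Collect_less continuous_intros)
 ultimately show ?thesis by auto
qed

lemma zero_in_cyl: "r > 0 ==> 0 \<in> cyl S r"
 by (simp add: cyl_def)

lemma cyl_mono: "r \<le> s ==> cyl S r \<subseteq> cyl S s"
 by (force simp: cyl_def)

lemma cyl_nhds: "r > 0 ==> \<forall>\<^sub>F z in nhds 0. z \<in> cyl S r"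
 using open_cyl zero_in_cyl unfolding eventually_nhds by blast

lemma norm_le_card:
 fixes z :: "complex ^ 'n::finite" and r :: real
 assumes "!!i. cmod (z $ i) \<le> r"
 shows "norm z \<le> CARD('n) * r"
proof -
 have "norm z \<le> (\<Sum>i\<in>UNIV. cmod (z $ i))" unfolding norm_vec_def by (rule L2_set_le_sum) auto
 also have "\<dots> \<le> (\<Sum>i\<in>(UNIV :: 'n set). r)" by (intro sum_mono assms)
 finally show ?thesis by simp
qed

lemma restr_small:
 assumes "\<forall>\<^sub>F z in nhds (0 :: complex ^ 'n::finite). P z"
 obtains r where "r > 0" "!!z. z \<in> cyl S r ==> P (restr S z)"
proof -
 obtain d where d: "d > 0" "!!z. dist z 0 < d ==> P z" using assms by (auto simp: eventually_nhds_metric)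
 define r where "r = d / (2 * CARD('n))"
 have r: "r > 0" using d by (simp add: r_def)
 have "P (restr S z)" if "z \<in> cyl S r" for z
 proof (rule d(2))
  have "norm (restr S z) \<le> CARD('n) * r"
   by (rule norm_le_card) (use that r in \<open>auto simp: cyl_def less_imp_le\<close>)
  then show "dist (restr S z) 0 < d" using d by (simp add: r_def)
 qed
 with r that show ?thesis by blast
qed

lemma dep_const [simp]: "dep S (%z. c)"
 by (simp add: dep_def)

lemma dep_coord: "i \<in> S ==> dep S (%z. z $ i)"
 by (simp add: dep_def)

lemma dep_mult: "dep S f ==> dep S g ==> dep S (%z. f z * g z)"
 unfolding dep_def by metis

lemma dep_add: "dep S f ==> dep S g ==> dep S (%z. f z + g z)"
 unfolding dep_def by metis

lemma dep_diff: "dep S f ==> dep S g ==> dep S (%z. f z - g z)"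
 unfolding dep_def by metis

lemma dep_power: "dep S f ==> dep S (%z. f z ^ m)"
 unfolding dep_def by metis

lemma dep_prod: "(!!i. i \<in> A ==> dep S (f i)) ==> dep S (%z. \<Prod>i\<in>A. f i z)"
 unfolding dep_def by (auto intro!: prod.cong)

lemma dep_sum: "(!!i. i \<in> A ==> dep S (f i)) ==> dep S (%z. \<Sum>i\<in>A. f i z)"
 unfolding dep_def by (auto intro!: sum.cong)

lemma dep_mono: "dep S f ==> S \<subseteq> T ==> dep T f"
 unfolding dep_def by blast

lemma dep_mon: "supp_in S gm ==> dep S (mon gm)"
 unfolding dep_def mon_def supp_in_def
proof (intro allI impI prod.cong refl)
 fix z w :: "complex ^ 'a" and i assume "\<forall>i. i \<notin> S \<longrightarrow> gm i = 0" "\<forall>i\<in>S. z $ i = w $ i"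
 then show "z $ i ^ gm i = w $ i ^ gm i" by (cases "i \<in> S") auto
qed

lemma adm_nth: "adm S ps ==> i \<notin> S ==> ps w $ i = w $ i"
 by (simp add: adm_def)

lemma adm_dep: "adm S ps ==> i \<in> S ==> dep S (%w. ps w $ i)"
 by (simp add: adm_def)

lemma dep_compose: "dep S h ==> adm S ps ==> dep S (%z. h (ps z))"
 unfolding dep_def[of S "%z. h (ps z)"]
 by (intro allI impI depD[of S h]) (auto intro: depD[OF adm_dep])

lemma adm_compose: "adm S ph ==> adm S ps ==> adm S (%z. ph (ps z))"
 unfolding adm_def[of S "%z. ph (ps z)"] using dep_compose[OF adm_dep, of S ph _ ps]
 by (auto simp: adm_nth)

lemma adm_translate: "w0 \<in> sub S ==> adm S (%x. w0 + x)"
 by (simp add: adm_def sub_def dep_def)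

text \<open>A function of the \<open>S\<close> coordinates is invariant under translations in the
  remaining ones, so holomorphy spreads from points with vanishing inactive coordinates to a
  cylinder unbounded in those directions.\<close>

lemma hol_at_dep_shift:
 assumes "dep S g" "hol_at g x" "!!i. i \<in> S ==> x $ i = y $ i"
 shows "hol_at g y"
proof -
 have "hol_at (%z. g (z + (x - y))) y"
 proof (rule hol_at_compose)
  show "hol_at (%z. (z + (x - y)) $ i) y" for i by (auto intro: hol_at_add)
 qed (use assms in simp)
 moreover have "g (z + (x - y)) = g z" for z by (rule depD[OF assms(1)]) (simp add: assms(3))
 ultimately show ?thesis by simp
qed

section \<open>Monomials and monomials times units\<close>

lemma mon_0 [simp]: "mon (%i. 0) z = 1"
 by (simp add: mon_def)

lemma mon_add: "mon (%i. al i + bt i) z = mon al z * mon bt z"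
 by (simp add: mon_def power_add prod.distrib)

lemma mon_mult: "mon (%i. m * al i) z = mon al z ^ m"
 unfolding mon_def prod_power_distrib by (simp add: power_mult[symmetric] mult.commute)

lemma mon_single: "mon (%j. if j = i then m else 0) z = z $ i ^ m"
 by (simp add: mon_def if_distrib[of "power _"] cong: if_cong)

lemma hol_at_mon: "hol_at (mon gm) x"
 unfolding mon_def by (intro hol_at_prod hol_at_power hol_at_coord)

lemma mon_at_0: "mon gm 0 = (if gm = (%i. 0) then 1 else 0)"
 by (auto simp: mon_def fun_eq_iff power_0_left)

lemma mon_eq_0: "mon gm z = 0 \<longleftrightarrow> (\<exists>i. gm i ~= 0 & z $ i = 0)"
 by (auto simp: mon_def)

lemma nz_germ_mon: "nz_germ (mon gm)"
proof -
 have "nz_germ (%z. z $ i ^ m)" for i :: 'a and m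
  using nz_germ_mult[OF hol_at_coord hol_at_power[OF hol_at_coord] nz_germ_coord, of i]
  by (induction m) (auto intro: nz_germI)
 then show ?thesis unfolding mon_def by (intro nz_germ_prod hol_at_power) auto
qed

lemma supp_in_add: "supp_in S al ==> supp_in S bt ==> supp_in S (%i. al i + bt i)"
 by (simp add: supp_in_def)

lemma muI:
 assumes "supp_in S gm" "dep S u" "hol_at u 0" "u 0 ~= 0" "\<forall>\<^sub>F z in nhds 0. h z = mon gm z * u z"
 shows "mu S h"
 unfolding mu_def using assms by blast

lemma muE:
 assumes "mu S h"
 obtains gm u where "supp_in S gm" "dep S u" "hol_at u 0" "u 0 ~= 0" "\<forall>\<^sub>F z in nhds 0. h z = mon gm z * u z"
 using assms unfolding mu_def by blast

lemma mu_mono: "mu S h ==> S \<subseteq> T ==> mu T h"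
 unfolding mu_def supp_in_def using dep_mono by blast

lemma mu_unit: "dep S u ==> hol_at u 0 ==> u 0 ~= 0 ==> mu S u"
 by (rule muI[of _ "%i. 0" u]) (auto simp: supp_in_def)

lemma mu_coord: "i \<in> S ==> mu S (%z. z $ i)"
 by (rule muI[of _ "%j. if j = i then 1 else 0" "%z. 1"]) (auto simp: supp_in_def mon_single)

lemma mu_mult:
 assumes "mu S f" "mu S g"
 shows "mu S (%z. f z * g z)"
proof -
 obtain al u where f: "supp_in S al" "dep S u" "hol_at u 0" "u 0 ~= 0" "\<forall>\<^sub>F z in nhds 0. f z = mon al z * u z"
  using assms(1) by (rule muE)
 obtain bt v where g: "supp_in S bt" "dep S v" "hol_at v 0" "v 0 ~= 0" "\<forall>\<^sub>F z in nhds 0. g z = mon bt z * v z"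
  using assms(2) by (rule muE)
 show ?thesis
 proof (rule muI[of _ "%i. al i + bt i" "%z. u z * v z"])
  show "\<forall>\<^sub>F z in nhds 0. f z * g z = mon (%i. al i + bt i) z * (u z * v z)"
   using f(5) g(5) by eventually_elim (simp add: mon_add)
 qed (use f g in \<open>auto intro: supp_in_add dep_mult hol_at_mult\<close>)
qed

lemma mu_power: "mu S f ==> mu S (%z. f z ^ m)"
 by (induction m) (auto intro: mu_mult mu_unit)

lemma mu_prod: "(!!i. i \<in> A ==> mu S (f i)) ==> mu S (%z. \<Prod>i\<in>A. f i z)"
 by (induction A rule: infinite_finite_induct) (auto intro: mu_mult mu_unit)

lemma mu_mon_compose:
 assumes "supp_in T gm" "!!i. i \<in> T ==> mu S (%z. ps z $ i)"
 shows "mu S (%z. mon gm (ps z))"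
 unfolding mon_def
proof (rule mu_prod)
 fix i show "mu S (%z. ps z $ i ^ gm i)"
  using assms by (cases "i \<in> T") (auto simp: supp_in_def intro: mu_power mu_unit)
qed

lemma mu_cong_ev: "mu S f ==> \<forall>\<^sub>F z in nhds 0. f z = g z ==> mu S g"
proof -
 assume "mu S f" and fg: "\<forall>\<^sub>F z in nhds 0. f z = g z"
 then obtain gm u where *: "supp_in S gm" "dep S u" "hol_at u 0" "u 0 ~= 0" "\<forall>\<^sub>F z in nhds 0. f z = mon gm z * u z"
  by (auto elim: muE)
 have "\<forall>\<^sub>F z in nhds 0. g z = mon gm z * u z" using *(5) fg by eventually_elim simp
 with * show "mu S g" by (blast intro: muI)
qed

text \<open>After recentring at \<open>w0\<close> a coordinate is still a coordinate if
  \<open>w0 $ i = 0\<close>, and a unit otherwise. For this reason monomials stay monomials times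
  units at every point of a chart.\<close>

lemma mu_translate_coord:
 assumes "i \<in> S" shows "mu S (%x. (w0 + x) $ i)"
proof (cases "w0 $ i = 0")
 case True then show ?thesis using mu_coord[OF assms] by simp
next
 case False
 then show ?thesis by (intro mu_unit) (auto simp: dep_def assms intro: hol_at_add)
qed

text \<open>Restrictions to the hyperplane are germs again, and germs have no zero divisors: the
  coordinate \<open>z $ i\<close> is a prime element.\<close>

lemma rk_slice_nz:
 fixes A B :: "complex ^ 'n::finite => complex"
 assumes "hol_at A 0" "hol_at B 0" "\<forall>\<^sub>F z in nhds 0. z $ i = 0 \<longrightarrow> A z * B z = 0"
 shows "(\<forall>\<^sub>F z in nhds 0. A (rk i z) = 0) \<or> (\<forall>\<^sub>F z in nhds 0. B (rk i z) = 0)"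
proof (rule ccontr)
 assume "\<not> ?thesis"
 then have nz: "nz_germ (%z. A (rk i z))" "nz_germ (%z. B (rk i z))" by (auto simp: nz_germ_def)
 have rk0: "rk i 0 = 0" by (simp add: rk_id)
 have h: "hol_at (%z. A (rk i z)) 0" "hol_at (%z. B (rk i z)) 0"
  using assms rk0 hol_at_compose[of A "rk i" 0, OF _ hol_at_rk] hol_at_compose[of B "rk i" 0, OF _ hol_at_rk]
  by simp_all
 have "filterlim (rk i) (nhds 0) (nhds 0)"
  using isCont_nhds[OF hol_at_map_isCont[of "rk i" 0, OF hol_at_rk]] rk0 by simp
 from eventually_compose_filterlim[OF assms(3) this]
 have "\<forall>\<^sub>F z in nhds 0. A (rk i z) * B (rk i z) = 0" by simp
 then show False using nz_germ_mult[OF h nz] by (simp add: nz_germ_def)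
qed

text \<open>Induction on the total degree of the monomial: every coordinate function is irreducible.\<close>

lemma mu_factor_aux:
 assumes "hol_at A 0" "hol_at B 0" "supp_in S gm" "hol_at u 0" "u 0 ~= 0" "\<forall>\<^sub>F z in nhds 0. A z * B z = mon gm z * u z"
 shows "\<exists>al v. supp_in S al & hol_at v 0 & v 0 ~= 0 & (\<forall>\<^sub>F z in nhds 0. A z = mon al z * v z)"
 using assms
proof (induction "\<Sum>i\<in>UNIV. gm i" arbitrary: A B gm u)
 case 0
 then have "gm = (%i. 0)" by (simp add: fun_eq_iff)
 then have "A 0 * B 0 = u 0" using eventually_nhds_x_imp_x[OF 0(7)] by simp
 then have "A 0 ~= 0" using 0 by auto
 then show ?case using 0 by (intro exI[of _ "%i. 0"] exI[of _ A]) (auto simp: supp_in_def)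
next
 case (Suc n)
 then obtain i where i: "gm i > 0" by (metis (no_types, lifting) Zero_neq_Suc gr0I sum.neutral)
 define gm' where "gm' = gm(i := gm i - 1)"
 have gam: "mon gm z = z $ i * mon gm' z" for z
 proof -
  have "gm = (%j. (if j = i then 1 else 0) + gm' j)" using i by (auto simp: gm'_def fun_eq_iff)
  then show ?thesis using mon_add[of "%j. if j = i then 1 else 0" gm' z] by (simp add: mon_single)
 qed
 have sum': "n = (\<Sum>i\<in>UNIV. gm' i)"
 proof -
  have "(\<Sum>j\<in>UNIV. gm j) = gm i + (\<Sum>j\<in>UNIV-{i}. gm j)" "(\<Sum>j\<in>UNIV. gm' j) = gm' i + (\<Sum>j\<in>UNIV-{i}. gm' j)"
   by (auto simp: sum.remove)
  moreover have "(\<Sum>j\<in>UNIV-{i}. gm' j) = (\<Sum>j\<in>UNIV-{i}. gm j)" by (auto simp: gm'_def)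
  ultimately show ?thesis using Suc(2) i by (simp add: gm'_def)
 qed
 have supp': "supp_in S gm'" using Suc(5) by (auto simp: supp_in_def gm'_def)
 have cancel: "\<forall>\<^sub>F z in nhds 0. f z = g z"
  if "hol_at f 0" "hol_at g 0" "\<forall>\<^sub>F z in nhds 0. z $ i * f z = z $ i * g z" for f g :: "complex ^ 'a => complex"
 proof (rule ccontr)
  assume "\<not> ?thesis"
  then have "nz_germ (%z. f z - g z)" by (simp add: nz_germ_def)
  from nz_germ_mult[OF hol_at_coord hol_at_diff[OF that(1,2)] nz_germ_coord this, of i]
  show False using that(3) by (auto simp: nz_germ_def algebra_simps)
 qed
 have "\<forall>\<^sub>F z in nhds 0. z $ i = 0 \<longrightarrow> A z * B z = 0"
  using Suc(8) by eventually_elim (simp add: gam)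
 from rk_slice_nz[OF Suc(3,4) this] show ?case
 proof
  assume "\<forall>\<^sub>F z in nhds 0. A (rk i z) = 0"
  then have A: "\<forall>\<^sub>F z in nhds 0. A z = z $ i * dv i A z"
   by eventually_elim (metis add_0 dv_eq)
  have "\<forall>\<^sub>F z in nhds 0. z $ i * (dv i A z * B z) = z $ i * (mon gm' z * u z)"
   using A Suc(8) by eventually_elim (simp add: gam mult.assoc)
  then have "\<forall>\<^sub>F z in nhds 0. dv i A z * B z = mon gm' z * u z"
   by (rule cancel[OF hol_at_mult[OF hol_at_dv[OF Suc(3)] Suc(4)] hol_at_mult[OF hol_at_mon Suc(6)]])
  from Suc(1)[OF sum' hol_at_dv[OF Suc(3)] Suc(4) supp' Suc(6,7) this]
  obtain al v where v: "supp_in S al" "hol_at v 0" "v 0 ~= 0" "\<forall>\<^sub>F z in nhds 0. dv i A z = mon al z * v z" by blast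
  show ?case
  proof (intro exI conjI)
   show "supp_in S (%j. (if j = i then 1 else 0) + al j)"
    using v(1) Suc(5) i by (auto simp: supp_in_def)
   show "\<forall>\<^sub>F z in nhds 0. A z = mon (%j. (if j = i then 1 else 0) + al j) z * v z"
    using A v(4) by eventually_elim (simp add: mon_add mon_single mult.assoc)
  qed (use v in auto)
 next
  assume "\<forall>\<^sub>F z in nhds 0. B (rk i z) = 0"
  then have B: "\<forall>\<^sub>F z in nhds 0. B z = z $ i * dv i B z"
   by eventually_elim (metis add_0 dv_eq)
  have "\<forall>\<^sub>F z in nhds 0. z $ i * (A z * dv i B z) = z $ i * (mon gm' z * u z)"
   using B Suc(8) by eventually_elim (simp add: gam mult.left_commute mult.assoc)
  then have "\<forall>\<^sub>F z in nhds 0. A z * dv i B z = mon gm' z * u z"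
   by (rule cancel[OF hol_at_mult[OF Suc(3) hol_at_dv[OF Suc(4)]] hol_at_mult[OF hol_at_mon Suc(6)]])
  from Suc(1)[OF sum' Suc(3) hol_at_dv[OF Suc(4)] supp' Suc(6,7) this]
  show ?case .
 qed
qed

text \<open>The factorisation gives the exponents but a unit in all variables. Evaluating this unit
  at \<open>restr S z\<close> makes it depend on \<open>S\<close> only, without spoiling the
  equation, because \<open>A\<close> and the monomial depend on \<open>S\<close> only.\<close>

lemma mu_factor:
 assumes "hol_at A 0" "hol_at B 0" "mu S (%z. A z * B z)" "dep S A"
 shows "mu S A"
proof -
 obtain gm u where "supp_in S gm" "hol_at u 0" "u 0 ~= 0" "\<forall>\<^sub>F z in nhds 0. A z * B z = mon gm z * u z"
  using assms(3) by (rule muE)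
 then obtain al v where v: "supp_in S al" "hol_at v 0" "v 0 ~= 0" "\<forall>\<^sub>F z in nhds 0. A z = mon al z * v z"
  using mu_factor_aux[OF assms(1,2)] by blast
 show ?thesis
 proof (rule muI[OF v(1) dep_restrI[of S v]])
  show "hol_at (%z. v (restr S z)) 0" using hol_at_compose[of v "restr S" 0, OF _ hol_at_restr] v by simp
  have "filterlim (restr S) (nhds 0) (nhds 0)"
   using isCont_nhds[OF hol_at_map_isCont[of "restr S" 0, OF hol_at_restr]] by simp
  from eventually_compose_filterlim[OF v(4) this]
  show "\<forall>\<^sub>F z in nhds 0. A z = mon al z * v (restr S z)"
   by eventually_elim (simp add: dep_restr[OF assms(4)] dep_restr[OF dep_mon[OF v(1)]])
 qed (use v in auto)
qed

lemma nz_germ_prod_mu_factor: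
 assumes "finite A" "a \<in> A" "!!i. i \<in> A ==> hol_at (f i) 0" "mu S (%z. \<Prod>i\<in>A. f i z)" "dep S (f a)"
 shows "mu S (f a)"
proof (rule mu_factor[of _ "%z. \<Prod>i\<in>A-{a}. f i z"])
 show "mu S (%z. f a z * (\<Prod>i\<in>A-{a}. f i z))" using assms by (simp add: prod.remove)
qed (use assms in \<open>auto intro: hol_at_prod\<close>)

text \<open>If the difference of two monomials times units is again one, the two exponents are comparable:
 otherwise the quotient by the common part vanishes at the origin but on no coordinate hyperplane.\<close>

lemma monomial_exponents_comparable:
 fixes al bt :: "'n::finite => nat"
 assumes u: "hol_at u 0" "u 0 ~= 0" and v: "hol_at v 0" "v 0 ~= 0"
  and diff: "(\<forall>\<^sub>F z in nhds 0. mon al z * u z = mon bt z * v z) \<or> mu UNIV (%z. mon al z * u z - mon bt z * v z)"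
 shows "al \<le> bt \<or> bt \<le> al"
proof (rule ccontr)
 assume "\<not> ?thesis"
 then obtain i j where i: "al i < bt i" and j: "bt j < al j"
  by (auto simp: le_fun_def not_le)
 define m where "m l = min (al l) (bt l)" for l
 define a where "a l = al l - m l" for l
 define b where "b l = bt l - m l" for l
 have ab: "a l = 0 \<or> b l = 0" for l by (auto simp: a_def b_def m_def)
 have aj: "a j > 0" "b j = 0" and bi: "b i > 0" "a i = 0" using i j by (auto simp: a_def b_def m_def)
 have al: "mon al z = mon m z * mon a z" for z
  using mon_add[of m a z] by (simp add: a_def m_def)
 have bt: "mon bt z = mon m z * mon b z" for z
  using mon_add[of m b z] by (simp add: b_def m_def)
 define R where "R z = mon a z * u z - mon b z * v z" for z
 have holR: "hol_at R 0" unfolding R_def by (intro hol_at_diff hol_at_mult hol_at_mon u v)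
 have mR: "mon al z * u z - mon bt z * v z = mon m z * R z" for z
  by (simp add: al bt R_def algebra_simps)
 have R0: "R 0 = 0" using aj bi by (auto simp: R_def mon_at_0 fun_eq_iff)
 have ev: "\<forall>\<^sub>F z in nhds 0. u z ~= 0 & v z ~= 0"
  using hol_at_nonzero_ev[OF u] hol_at_nonzero_ev[OF v] by eventually_elim auto
 \<comment> \<open>The reduced monomials \<open>a\<close> and \<open>b\<close> have disjoint
   supports, with \<open>j\<close> in that of \<open>a\<close> and \<open>i\<close> in that of
   \<open>b\<close>. On the hyperplane \<open>z $ l = 0\<close> at least one of them does not
   contain \<open>z $ l\<close>; the other is made zero by \<open>z $ j = 0\<close> or
   \<open>z $ i = 0\<close>, and all further coordinates get a small nonzero value
   \<open>t\<close>.\<close>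
 have nonvan: "\<not> (\<forall>\<^sub>F z in nhds 0. z $ l = 0 \<longrightarrow> R z = 0)" for l
 proof
  assume "\<forall>\<^sub>F z in nhds 0. z $ l = 0 \<longrightarrow> R z = 0"
  with ev have "\<forall>\<^sub>F z in nhds 0. u z ~= 0 & v z ~= 0 & (z $ l = 0 \<longrightarrow> R z = 0)" by eventually_elim auto
  then obtain d where d: "d > 0" "!!z. dist z 0 < d ==> u z ~= 0 & v z ~= 0 & (z $ l = 0 \<longrightarrow> R z = 0)"
   by (auto simp: eventually_nhds_metric)
  define t where "t = complex_of_real (d / (2 * CARD('n)))"
  have t: "t ~= 0" using d by (simp add: t_def)
  have near: "dist z 0 < d" if "!!q. z $ q \<in> {0, t}" for z :: "complex ^ 'n"
  proof -
   have "norm z \<le> CARD('n) * (d / (2 * CARD('n)))"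
   proof (rule norm_le_card)
    fix q show "cmod (z $ q) \<le> d / (2 * CARD('n))"
     using that[of q] d(1) by (auto simp: t_def norm_divide norm_mult)
   qed
   then show ?thesis using d by simp
  qed
  show False
  proof (cases "b l = 0")
   case True
   define z :: "complex ^ 'n" where "z = (\<chi> q. if q = l \<or> q = j then 0 else t)"
   have "mon a z = 0" "mon b z ~= 0" using aj True t by (auto simp: mon_eq_0 z_def)
   moreover have zd: "dist z 0 < d" by (rule near) (simp add: z_def)
   ultimately have "R z ~= 0" using d(2)[OF zd] by (simp add: R_def)
   moreover have "z $ l = 0" by (simp add: z_def)
   ultimately show False using d(2)[OF zd] by blast
  next
   case False
   then have "a l = 0" using ab[of l] by simp
   define z :: "complex ^ 'n" where "z = (\<chi> q. if q = l \<or> q = i then 0 else t)"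
   have "mon b z = 0" using bi(1) unfolding mon_eq_0 by (intro exI[of _ i]) (simp add: z_def)
   moreover have "mon a z ~= 0" using bi(2) \<open>a l = 0\<close> t by (simp add: mon_eq_0 z_def)
   moreover have zd: "dist z 0 < d" by (rule near) (simp add: z_def)
   ultimately have "R z ~= 0" using d(2)[OF zd] by (simp add: R_def)
   moreover have "z $ l = 0" by (simp add: z_def)
   ultimately show False using d(2)[OF zd] by blast
  qed
 qed
 have "nz_germ R" unfolding nz_germ_def
 proof
  assume "\<forall>\<^sub>F z in nhds 0. R z = 0"
  then have "\<forall>\<^sub>F z in nhds 0. z $ i = 0 \<longrightarrow> R z = 0" by eventually_elim simp
  then show False using nonvan by blast
 qed
 then have "nz_germ (%z. mon m z * R z)" by (intro nz_germ_mult hol_at_mon holR nz_germ_mon)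
 have "\<not> (\<forall>\<^sub>F z in nhds 0. mon al z * u z = mon bt z * v z)"
 proof
  assume "\<forall>\<^sub>F z in nhds 0. mon al z * u z = mon bt z * v z"
  then have "\<forall>\<^sub>F z in nhds 0. mon m z * R z = 0" by eventually_elim (simp add: mR[symmetric])
  then show False using \<open>nz_germ (%z. mon m z * R z)\<close> by (simp add: nz_germ_def)
 qed
 then have "mu UNIV (%z. mon m z * R z)" using diff by (simp add: mR)
 then have "mu UNIV (%z. R z * mon m z)" by (simp add: mult.commute)
 then have "mu UNIV R" by (rule mu_factor[OF holR hol_at_mon]) (auto simp: dep_def vec_eq_iff[symmetric])
 then obtain gm s where s: "s 0 ~= 0" "\<forall>\<^sub>F z in nhds 0. R z = mon gm z * s z" by (rule muE)
 have "mon gm 0 * s 0 = 0" using eventually_nhds_x_imp_x[OF s(2)] R0 by simp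
 then obtain l where "gm l ~= 0" using s(1) by (auto simp: mon_at_0 fun_eq_iff split: if_splits)
 then have van: "z $ l = 0 \<longrightarrow> mon gm z = 0" for z unfolding mon_eq_0 by blast
 have "\<forall>\<^sub>F z in nhds 0. z $ l = 0 \<longrightarrow> R z = 0" using s(2)
 proof eventually_elim
  case (elim z)
  then show ?case using van[of z] by simp
 qed
 then show False using nonvan by blast
qed

section \<open>Stability and assembly of chart coverings\<close>

lemma good_chart_cong:
 assumes "good_chart S dl h pj" "!!z. z \<in> cyl S dl ==> h z = h' z"
 shows "good_chart S dl h' pj"
proof -
 have "h (pj w) = h' (pj w)" if "w \<in> cyl S 1" for w
  using assms that unfolding good_chart_def by blast
 then show ?thesis using assms(1) unfolding good_chart_def by metis
qed

lemma good_chart_mono: "good_chart S dl h pj ==> dl \<le> dl' ==> good_chart S dl' h pj"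
 unfolding good_chart_def using cyl_mono by blast

lemma ResI_small:
 assumes "dl0 > 0" "!!dl. 0 < dl ==> dl \<le> dl0 ==> \<exists>\<nu>>0. \<exists>F. finite F & (\<forall>pj\<in>F. good_chart S dl h pj) &
  (\<forall>z\<in>sub S \<inter> cyl S \<nu>. \<exists>pj\<in>F. \<exists>w\<in>sub S \<inter> cyl S (1/2). pj w = z)"
 shows "Res S h"
 unfolding Res_def
proof (intro allI impI)
 fix dl :: real assume "dl > 0"
 then obtain \<nu> F where *: "\<nu> > 0" "finite F" "\<forall>pj\<in>F. good_chart S (min dl dl0) h pj"
  "\<forall>z\<in>sub S \<inter> cyl S \<nu>. \<exists>pj\<in>F. \<exists>w\<in>sub S \<inter> cyl S (1/2). pj w = z"
  using assms(2)[of "min dl dl0"] assms(1) by auto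
 have "\<forall>pj\<in>F. good_chart S dl h pj" using *(3) good_chart_mono by fastforce
 with * show "\<exists>\<nu>>0. \<exists>F. finite F & (\<forall>pj\<in>F. good_chart S dl h pj) &
  (\<forall>z\<in>sub S \<inter> cyl S \<nu>. \<exists>pj\<in>F. \<exists>w\<in>sub S \<inter> cyl S (1/2). pj w = z)" by blast
qed

lemma Res_cong_ev:
 assumes "Res S h" "dep S h" "dep S h'" "\<forall>\<^sub>F z in nhds 0. h z = h' z"
 shows "Res S h'"
proof -
 obtain r where r: "r > 0" "!!z. z \<in> cyl S r ==> h (restr S z) = h' (restr S z)"
  using restr_small[OF assms(4)] by blast
 then have eq: "h z = h' z" if "z \<in> cyl S r" for z using that by (simp add: dep_restr assms)
 show ?thesis
 proof (rule ResI_small[OF r(1)])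
  fix dl :: real assume d: "0 < dl" "dl \<le> r"
  obtain \<nu> F where *: "\<nu> > 0" "finite F" "\<forall>pj\<in>F. good_chart S dl h pj"
  "\<forall>z\<in>sub S \<inter> cyl S \<nu>. \<exists>pj\<in>F. \<exists>w\<in>sub S \<inter> cyl S (1/2). pj w = z"
   using assms(1) d unfolding Res_def by metis
  have "\<forall>pj\<in>F. good_chart S dl h' pj"
   using *(3) good_chart_cong[of S dl h _ h'] eq cyl_mono[OF d(2)] by blast
  with * show "\<exists>\<nu>>0. \<exists>F. finite F & (\<forall>pj\<in>F. good_chart S dl h' pj) &
  (\<forall>z\<in>sub S \<inter> cyl S \<nu>. \<exists>pj\<in>F. \<exists>w\<in>sub S \<inter> cyl S (1/2). pj w = z)" by blast
 qed
qed

lemma hol_on_cyl: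
 assumes "dep S u" "!!z. z \<in> cyl S r ==> hol_at u (restr S z)"
 shows "hol u (cyl S r)"
proof (rule hol_local[OF open_cyl])
 fix z :: "complex ^ 'a" assume "z \<in> cyl S r"
 then have "hol_at u z" using hol_at_dep_shift[OF assms(1) assms(2)] by simp
 then show "\<exists>V. z \<in> V & hol u V" by (auto simp: hol_at_def)
qed

lemma dep_unit_cyl:
 assumes "dep S u" "hol_at u 0" "u 0 ~= 0"
 obtains r where "r > 0" "hol u (cyl S r)" "!!z. z \<in> cyl S r ==> u z ~= 0"
proof -
 have "\<forall>\<^sub>F z in nhds 0. hol_at u z & u z ~= 0"
  using hol_at_eventually[OF assms(2)] hol_at_nonzero_ev[OF assms(2,3)] by eventually_elim simp
 then obtain r where r: "r > 0" "!!z. z \<in> cyl S r ==> hol_at u (restr S z) & u (restr S z) ~= 0"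
  using restr_small[of "%z. hol_at u z & u z ~= 0" S] by blast
 show ?thesis
  by (rule that[OF r(1)]) (use r(2) in \<open>auto intro: hol_on_cyl[OF assms(1)] simp: dep_restr[OF assms(1)]\<close>)
qed

lemma Res_unit:
 assumes "Res S h" "dep S u" "hol_at u 0" "u 0 ~= 0"
 shows "Res S (%z. u z * h z)"
proof -
 obtain r where r: "r > 0" "hol u (cyl S r)" "!!z. z \<in> cyl S r ==> u z ~= 0"
  using dep_unit_cyl[OF assms(2-4)] by blast
 show ?thesis
 proof (rule ResI_small[OF r(1)])
  fix dl :: real assume d: "0 < dl" "dl \<le> r"
  obtain \<nu> F where *: "\<nu> > 0" "finite F" "\<forall>pj\<in>F. good_chart S dl h pj"
  "\<forall>z\<in>sub S \<inter> cyl S \<nu>. \<exists>pj\<in>F. \<exists>w\<in>sub S \<inter> cyl S (1/2). pj w = z"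
   using assms(1) d unfolding Res_def by metis
  have "good_chart S dl (%z. u z * h z) pj" if "pj \<in> F" for pj
  proof -
   have g: "good_chart S dl h pj" using *(3) that by blast
   then obtain gm v where v: "supp_in S gm" "hol v (cyl S 1)"
    "!!w. w \<in> cyl S 1 ==> v w ~= 0 & h (pj w) = mon gm w * v w"
    unfolding good_chart_def by blast
   have im: "pj ` cyl S 1 \<subseteq> cyl S r" using g cyl_mono[OF d(2)] unfolding good_chart_def by blast
   have "hol (%w. u (pj w) * v w) (cyl S 1)"
    using g v im by (intro hol_mult hol_compose[OF r(2)]) (auto simp: good_chart_def)
   moreover have "u (pj w) * v w ~= 0 & u (pj w) * h (pj w) = mon gm w * (u (pj w) * v w)" if "w \<in> cyl S 1" for w
    using v(3)[OF that] r(3) im that by auto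
   ultimately show ?thesis using g v(1) unfolding good_chart_def by blast
  qed
  with * show "\<exists>\<nu>>0. \<exists>F. finite F & (\<forall>pj\<in>F. good_chart S dl (%z. u z * h z) pj) &
  (\<forall>z\<in>sub S \<inter> cyl S \<nu>. \<exists>pj\<in>F. \<exists>w\<in>sub S \<inter> cyl S (1/2). pj w = z)" by blast
 qed
qed

lemma Res_mu:
 assumes "mu S h" "dep S h"
 shows "Res S h"
proof -
 obtain gm u where u: "supp_in S gm" "dep S u" "hol_at u 0" "u 0 ~= 0" "\<forall>\<^sub>F z in nhds 0. h z = mon gm z * u z"
  using assms(1) by (rule muE)
 have "Res S (mon gm)"
  unfolding Res_def
 proof (intro allI impI)
  fix dl :: real assume d: "dl > 0"
  \<comment> \<open>Scaling the active coordinates by \<open>dl\<close> sends the unit polydisc into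
    the required cylinder and changes the monomial by a nonzero constant only. The unit of
    \<open>h\<close> is restored afterwards by \<open>Res_unit\<close>.\<close>
  define pj :: "complex ^ 'a => complex ^ 'a" where "pj w = (\<chi> i. if i \<in> S then of_real dl * w $ i else w $ i)" for w
  have "adm S pj" by (simp add: adm_def pj_def dep_def)
  moreover have "hol (%w. pj w $ i) (cyl S 1)" for i
   by (cases "i \<in> S") (auto simp: pj_def intro!: hol_mult hol_const hol_coord open_cyl)
  moreover have "pj ` cyl S 1 \<subseteq> cyl S dl" using d by (auto simp: cyl_def pj_def norm_mult)
  moreover have "mon gm (pj w) = mon gm w * (\<Prod>i\<in>UNIV. of_real dl ^ gm i)" for w
   unfolding mon_def prod.distrib[symmetric]
  proof (rule prod.cong[OF refl])
   fix i show "pj w $ i ^ gm i = w $ i ^ gm i * of_real dl ^ gm i"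
    using u(1) by (cases "i \<in> S") (auto simp: pj_def supp_in_def power_mult_distrib)
  qed
  moreover have "(\<Prod>i\<in>UNIV. complex_of_real dl ^ gm i) ~= 0" using d by simp
  ultimately have g: "good_chart S dl (mon gm) pj"
   unfolding good_chart_def using u(1) hol_const[OF open_cyl, where c="\<Prod>i\<in>UNIV. complex_of_real dl ^ gm i"] by blast
  have "\<exists>w\<in>sub S \<inter> cyl S (1/2). pj w = z" if "z \<in> sub S \<inter> cyl S (dl/2)" for z
   by (rule bexI[of _ "\<chi> i. z $ i / of_real dl"])
    (use that d in \<open>auto simp: pj_def sub_def cyl_def vec_eq_iff norm_divide field_simps\<close>)
  with g show "\<exists>\<nu>>0. \<exists>F. finite F & (\<forall>pj\<in>F. good_chart S dl (mon gm) pj) &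
  (\<forall>z\<in>sub S \<inter> cyl S \<nu>. \<exists>pj\<in>F. \<exists>w\<in>sub S \<inter> cyl S (1/2). pj w = z)"
   using d by (intro exI[of _ "dl/2"] conjI exI[of _ "{pj}"]) auto
 qed
 then have "Res S (%z. u z * mon gm z)" using u by (intro Res_unit)
 then show ?thesis
 proof (rule Res_cong_ev)
  show "\<forall>\<^sub>F z in nhds 0. u z * mon gm z = h z" using u(5) by eventually_elim simp
 qed (use u assms in \<open>auto intro: dep_mult dep_mon\<close>)
qed

lemma Res_one_chart:
 fixes ps :: "complex ^ 'n::finite => complex ^ 'n"
 assumes K: "compact K" "K \<subseteq> sub S" and ps: "adm S ps" "!!w i. w \<in> K ==> hol_at (%z. ps z $ i) w"
  and res: "!!w. w \<in> K ==> ps w = 0 ==> Res S (%x. h (ps (w + x)))" and "dl > 0"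
 shows "\<exists>\<nu>>0. \<exists>F. finite F & (\<forall>pj\<in>F. good_chart S dl h pj) &
  (\<forall>z\<in>sub S \<inter> cyl S \<nu>. z \<in> ps ` K \<longrightarrow> (\<exists>pj\<in>F. \<exists>w\<in>sub S \<inter> cyl S (1/2). pj w = z))"
proof -
 define K0 where "K0 = {w \<in> K. ps w = 0}"
 have contK: "continuous_on K ps"
  by (intro continuous_at_imp_continuous_on ballI hol_at_map_isCont ps(2))
 have loc: "\<exists>\<nu>>0. \<exists>F. finite F & (\<forall>pj\<in>F. good_chart S dl h pj) &
  (\<forall>x\<in>sub S \<inter> cyl S \<nu>. \<exists>pj\<in>F. \<exists>w\<in>sub S \<inter> cyl S (1/2). pj w = ps (w0 + x))" if w0: "w0 \<in> K0" for w0
 proof -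
  have w0K: "w0 \<in> K" "ps w0 = 0" "w0 \<in> sub S" using w0 K by (auto simp: K0_def)
  have ev: "\<forall>\<^sub>F x in nhds 0. (\<forall>i. hol_at (%z. ps z $ i) (w0 + x)) & ps (w0 + x) \<in> cyl S dl"
  proof -
   have lim: "filterlim (%x. w0 + x) (nhds w0) (nhds 0)"
    using isCont_nhds[where f="%x. w0 + x" and x=0] by simp
   have "\<forall>\<^sub>F z in nhds w0. ps z \<in> cyl S dl"
    using topological_tendstoD[OF isCont_nhds[OF hol_at_map_isCont[OF ps(2)[OF w0K(1)]]] open_cyl] w0K(2) zero_in_cyl[OF \<open>dl > 0\<close>]
    by metis
   moreover have "\<forall>\<^sub>F z in nhds w0. \<forall>i. hol_at (%z. ps z $ i) z"
    using hol_at_eventually[OF ps(2)[OF w0K(1)]] by (rule eventually_all_finite)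
   ultimately have "\<forall>\<^sub>F z in nhds w0. (\<forall>i. hol_at (%z. ps z $ i) z) & ps z \<in> cyl S dl"
    by eventually_elim blast
   from eventually_compose_filterlim[OF this lim] show ?thesis .
  qed
  obtain r where r: "r > 0" "!!x. x \<in> cyl S r ==> (\<forall>i. hol_at (%z. ps z $ i) (w0 + restr S x)) & ps (w0 + restr S x) \<in> cyl S dl"
   using restr_small[OF ev] by metis
  have r1: "hol_at (%z. ps z $ i) (w0 + x)" if "x \<in> cyl S r" for x i
  proof (cases "i \<in> S")
   case True
   show ?thesis by (rule hol_at_dep_shift[OF adm_dep[OF ps(1) True], of "w0 + restr S x"]) (use r(2)[OF that] in auto)
  next
   case False
   then show ?thesis by (simp add: adm_nth[OF ps(1)])
  qed
  have r2: "ps (w0 + x) \<in> cyl S dl" if "x \<in> cyl S r" for x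
  proof -
   have "ps (w0 + x) $ i = ps (w0 + restr S x) $ i" if "i \<in> S" for i
    by (rule depD[OF adm_dep[OF ps(1) that]]) simp
   then show ?thesis using r(2)[OF that] by (simp add: cyl_def)
  qed
  obtain \<nu> F where F: "\<nu> > 0" "finite F" "\<forall>pj\<in>F. good_chart S r (%x. h (ps (w0 + x))) pj"
   "\<forall>z\<in>sub S \<inter> cyl S \<nu>. \<exists>pj\<in>F. \<exists>w\<in>sub S \<inter> cyl S (1/2). pj w = z"
   using res[OF w0K(1,2)] r(1) unfolding Res_def by metis
  have "good_chart S dl h (%y. ps (w0 + pj y))" if "pj \<in> F" for pj
  proof -
   have g: "good_chart S r (%x. h (ps (w0 + x))) pj" using F(3) that by blast
   have "adm S (%y. ps (w0 + pj y))"
    using g adm_compose[OF adm_compose[OF ps(1) adm_translate[OF w0K(3)]], of pj] by (simp add: good_chart_def)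
   moreover have "hol (%y. ps (w0 + pj y) $ i) (cyl S 1)" for i
   proof (rule hol_local[OF open_cyl])
    fix y :: "complex ^ 'n" assume y: "y \<in> cyl S 1"
    have pjy: "pj y \<in> cyl S r" using g y unfolding good_chart_def by blast
    have hpj: "hol_at (%y. pj y $ j) y" for j using g y hol_atI unfolding good_chart_def by blast
    have "hol_at (%y. ps (w0 + pj y) $ i) y"
    proof (rule hol_at_compose[of "%z. ps z $ i" "%y. w0 + pj y"])
     show "hol_at (%z. (w0 + pj z) $ j) y" for j using hpj[of j] by (simp add: hol_at_add)
    qed (rule r1[OF pjy])
    then show "\<exists>V. y \<in> V & hol (%y. ps (w0 + pj y) $ i) V" by (auto simp: hol_at_def)
   qed
   moreover have "(%y. ps (w0 + pj y)) ` cyl S 1 \<subseteq> cyl S dl"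
    using g r2 unfolding good_chart_def by blast
   ultimately show ?thesis using g unfolding good_chart_def by blast
  qed
  moreover have "\<exists>pj\<in>(%pj y. ps (w0 + pj y)) ` F. \<exists>w\<in>sub S \<inter> cyl S (1/2). pj w = ps (w0 + x)" if x: "x \<in> sub S \<inter> cyl S \<nu>" for x
  proof -
   obtain pj w where "pj \<in> F" "w \<in> sub S \<inter> cyl S (1/2)" "pj w = x" using F(4) x by blast
   then show ?thesis by (intro bexI[of _ "%y. ps (w0 + pj y)"] bexI[of _ w]) auto
  qed
  ultimately show ?thesis using F(1) finite_imageI[OF F(2), of "%pj y. ps (w0 + pj y)"]
   by (intro exI[of _ \<nu>] conjI exI[of _ "(%pj y. ps (w0 + pj y)) ` F"]) (assumption | blast)+
 qed
 define G where "G w0 \<nu> F \<longleftrightarrow> \<nu> > 0 & finite F & (\<forall>pj\<in>F. good_chart S dl h pj) &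
  (\<forall>x\<in>sub S \<inter> cyl S \<nu>. \<exists>pj\<in>F. \<exists>w\<in>sub S \<inter> cyl S (1/2). pj w = ps (w0 + x))" for w0 \<nu> F
 have "\<forall>w0\<in>K0. \<exists>\<nu> F. G w0 \<nu> F"
 proof
  fix w0 assume "w0 \<in> K0"
  from loc[OF this] show "\<exists>\<nu> F. G w0 \<nu> F" unfolding G_def by (elim exE conjE) (intro exI conjI; assumption)
 qed
 then obtain \<nu> F where GF: "!!w0. w0 \<in> K0 ==> G w0 (\<nu> w0) (F w0)" by metis
 note GF' = GF[unfolded G_def]
 have \<nu>F1: "!!w0. w0 \<in> K0 ==> \<nu> w0 > 0" by (rule GF'[THEN conjunct1])
 have \<nu>F2: "!!w0. w0 \<in> K0 ==> finite (F w0)" by (rule GF'[THEN conjunct2, THEN conjunct1])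
 have \<nu>F3: "!!w0 pj. w0 \<in> K0 ==> pj \<in> F w0 ==> good_chart S dl h pj"
  by (rule GF'[THEN conjunct2, THEN conjunct2, THEN conjunct1, THEN bspec])
 have \<nu>F4: "!!w0 x. w0 \<in> K0 ==> x \<in> sub S \<inter> cyl S (\<nu> w0) ==> \<exists>pj\<in>F w0. \<exists>w\<in>sub S \<inter> cyl S (1/2). pj w = ps (w0 + x)"
  by (rule GF'[THEN conjunct2, THEN conjunct2, THEN conjunct2, THEN bspec])
 note \<nu>F = \<nu>F1 \<nu>F2 \<nu>F3 \<nu>F4
 define N where "N w0 = {w. w - w0 \<in> cyl S (\<nu> w0)}" for w0
 have opN: "open (N w0)" for w0
  using continuous_open_vimage[OF open_cyl[of S "\<nu> w0"], of "%w. w - w0"] by (simp add: N_def vimage_def)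
 have cK0: "compact K0"
 proof -
  have "closedin (top_of_set K) (K \<inter> ps -` {0})" by (rule continuous_closedin_preimage[OF contK]) simp
  moreover have "K \<inter> ps -` {0} = K0" by (auto simp: K0_def)
  ultimately show ?thesis using K(1) closedin_compact by metis
 qed
 have "K0 \<subseteq> (\<Union>w0\<in>K0. N w0)" using zero_in_cyl \<nu>F(1) by (force simp: N_def)
 then obtain I where I: "I \<subseteq> K0" "finite I" "K0 \<subseteq> (\<Union>w0\<in>I. N w0)"
  using compactE_image[OF cK0, of K0 N] opN by blast
 define L where "L = K - (\<Union>w0\<in>I. N w0)"
 have cL: "compact L" unfolding L_def using K(1) opN by (intro compact_diff) auto
 have L0: "ps w ~= 0" if "w \<in> L" for w using that I(3) by (auto simp: L_def K0_def)
 have "\<exists>\<eta>>0. \<forall>w\<in>L. norm (ps w) \<ge> \<eta>"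
 proof (cases "L = {}")
  case True then show ?thesis by (intro exI[of _ 1]) auto
 next
  case False
  have "continuous_on L (%w. norm (ps w))"
   by (intro continuous_on_norm continuous_on_subset[OF contK]) (auto simp: L_def)
  from continuous_attains_inf[OF cL False this] obtain w1 where "w1 \<in> L" "\<forall>w\<in>L. norm (ps w1) \<le> norm (ps w)" by blast
  then show ?thesis using L0 by (intro exI[of _ "norm (ps w1)"]) auto
 qed
 then obtain \<eta> where \<eta>: "\<eta> > 0" "!!w. w \<in> L ==> norm (ps w) \<ge> \<eta>" by blast
 \<comment> \<open>The divisor turns a bound on each coordinate into a bound on the norm: a point of
   this cylinder in \<open>sub S\<close> has norm below \<open>\<eta>\<close>.\<close>
 define \<mu> where "\<mu> = \<eta> / (2 * CARD('n))"
 have mu: "\<mu> > 0" using \<eta> by (simp add: \<mu>_def)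
 show ?thesis
 proof (intro exI[of _ \<mu>] conjI exI[of _ "\<Union>w0\<in>I. F w0"] ballI impI)
  show "finite (\<Union>w0\<in>I. F w0)" using I \<nu>F(2) by blast
  show "good_chart S dl h pj" if "pj \<in> (\<Union>w0\<in>I. F w0)" for pj using that I \<nu>F(3) by blast
  fix z assume z: "z \<in> sub S \<inter> cyl S \<mu>" "z \<in> ps ` K"
  then obtain w where w: "w \<in> K" "z = ps w" by blast
  have "norm z \<le> CARD('n) * \<mu>"
  proof (rule norm_le_card)
   fix i show "cmod (z $ i) \<le> \<mu>" using z(1) mu by (cases "i \<in> S") (auto simp: sub_def cyl_def less_imp_le)
  qed
  then have "norm (ps w) < \<eta>" using w \<eta> by (simp add: \<mu>_def)
  then have "w \<notin> L" using \<eta>(2) by force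
  then obtain w0 where w0: "w0 \<in> I" "w \<in> N w0" using w by (auto simp: L_def)
  have "w0 \<in> K" using w0 I by (auto simp: K0_def)
  then have "w \<in> sub S" "w0 \<in> sub S" using w(1) K(2) by blast+
  then have "w - w0 \<in> sub S" by (simp add: sub_def)
  then have "\<exists>pj\<in>F w0. \<exists>y\<in>sub S \<inter> cyl S (1/2). pj y = ps (w0 + (w - w0))"
   using w0 I by (intro \<nu>F(4)) (auto simp: N_def)
  then show "\<exists>pj\<in>(\<Union>w0\<in>I. F w0). \<exists>w\<in>sub S \<inter> cyl S (1/2). pj w = z" using w w0 by auto
 qed (rule mu)
qed

text \<open>Each preliminary map contributes finitely many charts and a radius, and finitely many
  radii have a positive minimum. Every change of coordinates used below (blow-up, translation, root
  extraction, linear shear, charts in fewer variables) enters through this lemma.\<close>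

lemma Res_cover:
 fixes C :: "((complex ^ 'n::finite => complex ^ 'n) \<times> (complex ^ 'n) set) set"
 assumes "finite C" "!!ps K. (ps, K) \<in> C ==> compact K & K \<subseteq> sub S & adm S ps"
  and "!!ps K w i. (ps, K) \<in> C ==> w \<in> K ==> hol_at (%z. ps z $ i) w"
  and "!!ps K w. (ps, K) \<in> C ==> w \<in> K ==> ps w = 0 ==> Res S (%x. h (ps (w + x)))"
  and "\<nu>0 > 0" and cover: "!!z. z \<in> sub S ==> z \<in> cyl S \<nu>0 ==> \<exists>(ps, K)\<in>C. z \<in> ps ` K"
 shows "Res S h"
 unfolding Res_def
proof (intro allI impI)
 fix dl :: real assume d: "dl > 0"
 have ex: "\<forall>c\<in>C. \<exists>\<nu>>0. \<exists>F. finite F & (\<forall>pj\<in>F. good_chart S dl h pj) &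
  (\<forall>z\<in>sub S \<inter> cyl S \<nu>. z \<in> fst c ` snd c \<longrightarrow> (\<exists>pj\<in>F. \<exists>w\<in>sub S \<inter> cyl S (1/2). pj w = z))"
 proof
  fix c assume "c \<in> C"
  then have cc: "(fst c, snd c) \<in> C" by simp
  have A: "compact (snd c)" "snd c \<subseteq> sub S" "adm S (fst c)" using assms(2)[OF cc] by auto
  show "\<exists>\<nu>>0. \<exists>F. finite F & (\<forall>pj\<in>F. good_chart S dl h pj) &
  (\<forall>z\<in>sub S \<inter> cyl S \<nu>. z \<in> fst c ` snd c \<longrightarrow> (\<exists>pj\<in>F. \<exists>w\<in>sub S \<inter> cyl S (1/2). pj w = z))"
   by (rule Res_one_chart[OF A assms(3)[OF cc] assms(4)[OF cc] d])
 qed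
 define G where "G c \<nu> F \<longleftrightarrow> \<nu> > 0 & finite F & (\<forall>pj\<in>F. good_chart S dl h pj) &
  (\<forall>z\<in>sub S \<inter> cyl S \<nu>. z \<in> fst c ` snd c \<longrightarrow> (\<exists>pj\<in>F. \<exists>w\<in>sub S \<inter> cyl S (1/2). pj w = z))"
  for c :: "(complex ^ 'n => complex ^ 'n) \<times> (complex ^ 'n) set" and \<nu> F
 have "\<forall>c\<in>C. \<exists>\<nu> F. G c \<nu> F"
 proof
  fix c assume "c \<in> C"
  from bspec[OF ex this] show "\<exists>\<nu> F. G c \<nu> F" unfolding G_def by (elim exE conjE) (intro exI conjI; assumption)
 qed
 then obtain \<nu> F where GF: "!!c. c \<in> C ==> G c (\<nu> c) (F c)" by metis
 note GF' = GF[unfolded G_def]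
 have \<nu>F1: "!!c. c \<in> C ==> \<nu> c > 0" by (rule GF'[THEN conjunct1])
 have \<nu>F2: "!!c. c \<in> C ==> finite (F c)" by (rule GF'[THEN conjunct2, THEN conjunct1])
 have \<nu>F3: "!!c pj. c \<in> C ==> pj \<in> F c ==> good_chart S dl h pj"
  by (rule GF'[THEN conjunct2, THEN conjunct2, THEN conjunct1, THEN bspec])
 have \<nu>F4: "!!c z. c \<in> C ==> z \<in> sub S \<inter> cyl S (\<nu> c) ==> z \<in> fst c ` snd c ==> \<exists>pj\<in>F c. \<exists>w\<in>sub S \<inter> cyl S (1/2). pj w = z"
  by (rule GF'[THEN conjunct2, THEN conjunct2, THEN conjunct2, THEN bspec, THEN mp])
 note \<nu>F = \<nu>F1 \<nu>F2 \<nu>F3 \<nu>F4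
 define n0 where "n0 = Min (insert \<nu>0 (\<nu> ` C))"
 have n0: "n0 > 0" "n0 \<le> \<nu>0" "!!c. c \<in> C ==> n0 \<le> \<nu> c"
  using assms(1,5) \<nu>F(1) by (auto simp: n0_def)
 show "\<exists>\<nu>>0. \<exists>F. finite F & (\<forall>pj\<in>F. good_chart S dl h pj) &
  (\<forall>z\<in>sub S \<inter> cyl S \<nu>. \<exists>pj\<in>F. \<exists>w\<in>sub S \<inter> cyl S (1/2). pj w = z)"
 proof (intro exI[of _ n0] conjI exI[of _ "\<Union>c\<in>C. F c"] ballI)
  show "finite (\<Union>c\<in>C. F c)" using assms(1) \<nu>F(2) by blast
  show "good_chart S dl h pj" if "pj \<in> (\<Union>c\<in>C. F c)" for pj using that \<nu>F(3) by blast
  fix z assume z: "z \<in> sub S \<inter> cyl S n0"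
  then obtain ps K where c: "(ps, K) \<in> C" "z \<in> ps ` K" using cover[of z] cyl_mono[OF n0(2)] by blast
  have "\<exists>pj\<in>F (ps, K). \<exists>w\<in>sub S \<inter> cyl S (1/2). pj w = z"
   using c z cyl_mono[OF n0(3)[OF c(1)]] by (intro \<nu>F(4)) auto
  then show "\<exists>pj\<in>(\<Union>c\<in>C. F c). \<exists>w\<in>sub S \<inter> cyl S (1/2). pj w = z" using c by blast
 qed (rule n0)
qed

text \<open>The radii may differ from coordinate to coordinate because the two charts of a blow-up
  use polydiscs of different shapes.\<close>

definition cpoly :: "'n set => ('n => real) => (complex ^ 'n::finite) set" where
 "cpoly S r = {z \<in> sub S. \<forall>i. cmod (z $ i) \<le> r i}"

lemma compact_cpoly: "compact (cpoly S r)"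
proof -
 have "closed (sub S)"
 proof -
  have "sub S = (\<Inter>i\<in>-S. {z. z $ i = (0::complex)})" by (auto simp: sub_def)
  moreover have "closed {z :: complex ^ 'a. z $ i = 0}" for i
   by (intro closed_Collect_eq continuous_intros)
  ultimately show ?thesis by auto
 qed
 moreover have "closed {z :: complex ^ 'a. \<forall>i. cmod (z $ i) \<le> r i}"
  by (intro closed_Collect_all closed_Collect_le continuous_intros)
 ultimately have "closed (cpoly S r)" unfolding cpoly_def by (simp add: closed_Int Collect_conj_eq)
 moreover have "bounded (cpoly S r)"
 proof (rule boundedI)
  fix z assume "z \<in> cpoly S r"
  then have "cmod (z $ i) \<le> Max (range r)" for i
   using Max_ge[of "range r" "r i"] by (auto simp: cpoly_def intro: order_trans)
  then show "norm z \<le> CARD('a) * Max (range r)" by (rule norm_le_card)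
 qed
 ultimately show ?thesis by (simp add: compact_eq_bounded_closed)
qed

text \<open>Coordinates that do not vanish at the new centre turn into units and the others remain
  coordinates, so the pulled-back germ is monomial times unit at every point of the chart, not just
  at its origin.\<close>

lemma good_chart_mu:
 assumes "good_chart S dl h pj" "w0 \<in> cyl S 1" "w0 \<in> sub S" "dep S h"
 shows "mu S (%x. h (pj (w0 + x)))"
proof -
 obtain gm u where u: "supp_in S gm" "hol u (cyl S 1)" "!!w. w \<in> cyl S 1 ==> u w ~= 0 & h (pj w) = mon gm w * u w"
  and ad: "adm S pj"
  using assms(1) unfolding good_chart_def by blast
 have hu: "hol_at (%x. u (w0 + x)) 0"
  by (rule hol_at_compose) (use hol_atI[OF u(2) assms(2)] in \<open>auto intro: hol_at_add\<close>)
 have "hol_at (%x. u (w0 + restr S x)) 0"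
  by (rule hol_at_compose[of "%x. u (w0 + x)" "restr S" 0]) (use hu in \<open>simp_all only: hol_at_restr restr_0\<close>)
 then have 1: "mu S (%x. u (w0 + restr S x))"
  by (rule mu_unit[OF dep_restrI]) (use u(3)[OF assms(2)] in simp)
 have 2: "mu S (%x. mon gm (w0 + x))"
  by (rule mu_mon_compose[OF u(1)]) (rule mu_translate_coord)
 have "filterlim (%x. w0 + x) (nhds w0) (nhds 0)" using isCont_nhds[where f="%x. w0 + x" and x=0] by simp
 from topological_tendstoD[OF this open_cyl assms(2)]
 have "\<forall>\<^sub>F x in nhds 0. mon gm (w0 + x) * u (w0 + restr S x) = h (pj (w0 + x))"
 proof eventually_elim
  case (elim x)
  have w: "w0 + restr S x \<in> cyl S 1" using elim by (simp add: cyl_def)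
  have "h (pj (w0 + x)) = h (pj (w0 + restr S x))"
   by (rule depD[OF dep_compose[OF assms(4) ad]]) simp
  also have "\<dots> = mon gm (w0 + restr S x) * u (w0 + restr S x)" using u(3)[OF w] by simp
  also have "mon gm (w0 + restr S x) = mon gm (w0 + x)" by (rule depD[OF dep_mon[OF u(1)]]) simp
  finally show ?case by simp
 qed
 then show ?thesis by (rule mu_cong_ev[OF mu_mult[OF 2 1]])
qed

lemma adm_insert:
 assumes "adm S' ps" "k \<notin> S'"
 shows "adm (insert k S') ps"
 using assms unfolding adm_def
proof (intro conjI allI impI ballI)
 fix i assume "i \<in> insert k S'"
 then show "dep (insert k S') (%w. ps w $ i)"
  using assms by (cases "i = k") (auto simp: adm_def dep_def intro: depD)
qed auto

text \<open>The charts for \<open>H\<close> in the variables \<open>S'\<close>, extended by the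
  identity in \<open>z $ k\<close>, serve as preliminary maps; after them \<open>H\<close> is a
  monomial times a unit. In the applications \<open>H\<close> is a product of everything that has to
  be monomial simultaneously.\<close>

lemma Res_base:
 assumes k: "k \<notin> S'" and R: "Res S' H" and depH: "dep S' H"
  and step: "!!ps. adm S' ps ==> (!!i. hol_at (%x. ps x $ i) 0) ==> ps 0 = 0 ==> mu S' (%x. H (ps x)) ==>
   Res (insert k S') (%x. h (ps x))"
 shows "Res (insert k S') h"
proof -
 let ?S = "insert k S'"
 obtain \<nu> F where F: "\<nu> > 0" "finite F" "\<forall>pj\<in>F. good_chart S' 1 H pj"
  "\<forall>z\<in>sub S' \<inter> cyl S' \<nu>. \<exists>pj\<in>F. \<exists>w\<in>sub S' \<inter> cyl S' (1/2). pj w = z"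
  using R unfolding Res_def by (metis zero_less_one)
 let ?K = "cpoly ?S (%i. 1/2)"
 have Kc: "w \<in> cyl S' 1" if "w \<in> ?K" for w
  unfolding cyl_def
 proof (intro CollectI ballI)
  fix i have "cmod (w $ i) \<le> 1/2" using that by (simp add: cpoly_def)
  then show "cmod (w $ i) < 1" by linarith
 qed
 show ?thesis
 proof (rule Res_cover[of "(%pj. (pj, ?K)) ` F" _ _ "min \<nu> (1/2)"])
  fix ps K assume c: "(ps, K) \<in> (%pj. (pj, ?K)) ` F"
  then have K: "K = ?K" and g: "good_chart S' 1 H ps" using F by auto
  have ad: "adm S' ps" and hol: "!!i. hol (%w. ps w $ i) (cyl S' 1)" using g by (auto simp: good_chart_def)
  show "compact K & K \<subseteq> sub ?S & adm ?S ps"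
  proof (intro conjI)
   show "compact K" unfolding K by (rule compact_cpoly)
   show "K \<subseteq> sub ?S" unfolding K by (auto simp: cpoly_def)
  qed (rule adm_insert[OF ad k])
  show hol': "hol_at (%z. ps z $ i) w" if "w \<in> K" for w i using hol_atI[OF hol Kc] that K by blast
  fix w assume w: "w \<in> K" "ps w = 0"
  have "w $ i = 0" if "i \<notin> S'" for i using w(2) adm_nth[OF ad that, of w] by simp
  then have ws: "w \<in> sub S'" by (simp add: sub_def)
  show "Res ?S (%x. h (ps (w + x)))"
  proof (rule step[of "%x. ps (w + x)"])
   show "adm S' (%x. ps (w + x))" by (rule adm_compose[OF ad adm_translate[OF ws]])
   show "hol_at (%x. ps (w + x) $ i) 0" for i
    by (rule hol_at_compose[of "%z. ps z $ i" "%x. w + x"]) (use hol'[OF w(1)] in \<open>auto intro: hol_at_add\<close>)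
   show "mu S' (%x. H (ps (w + x)))" using good_chart_mu[OF g Kc ws depH] w K by blast
  qed (use w in simp)
 next
  fix z assume z: "z \<in> sub ?S" "z \<in> cyl ?S (min \<nu> (1/2))"
  have "restr S' z \<in> sub S' \<inter> cyl S' \<nu>" using z by (auto simp: restr_sub cyl_def)
  then obtain pj w where w: "pj \<in> F" "w \<in> sub S'" "w \<in> cyl S' (1/2)" "pj w = restr S' z" using F(4) by blast
  have ad: "adm S' pj" using F w by (auto simp: good_chart_def)
  let ?w = "\<chi> i. if i = k then z $ k else w $ i"
  have "cmod (w $ i) \<le> 1/2" for i
   using w(2,3) by (cases "i \<in> S'") (auto simp: sub_def cyl_def less_imp_le)
  moreover have "cmod (z $ k) \<le> 1/2" using z(2) by (auto simp: cyl_def)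
  ultimately have "?w \<in> ?K" using w(2) by (auto simp: cpoly_def sub_def)
  moreover have "pj ?w = z"
  proof (subst vec_eq_iff, rule allI)
   fix i
   show "pj ?w $ i = z $ i"
   proof (cases "i \<in> S'")
    case True
    have "pj ?w $ i = pj w $ i" by (rule depD[OF adm_dep[OF ad True]]) (use k in auto)
    then show ?thesis using w(4) True by simp
   next
    case False
    then show ?thesis using z(1) w(2) adm_nth[OF ad False, of ?w] by (auto simp: sub_def)
   qed
  qed
  ultimately have "z \<in> pj ` ?K" by (simp only: image_eqI[where x="?w"])
  then show "\<exists>(ps, K)\<in>(%pj. (pj, ?K)) ` F. z \<in> ps ` K"
   using imageI[OF w(1), of "%pj. (pj, ?K)"] by (intro bexI[of _ "(pj, ?K)"]) (simp only: prod.case)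
 qed (use F in auto)
qed

section \<open>Order in a distinguished variable and the blow-up step\<close>

definition ord_in :: "'n::finite => (complex ^ 'n => complex) => nat => bool" where
 "ord_in k h m \<longleftrightarrow> (\<forall>i<m. (dv k ^^ i) h 0 = 0) & (dv k ^^ m) h 0 ~= 0"

lemma poly_divisible_low_coeffs:
 fixes r :: "complex poly"
 assumes "\<forall>\<^sub>F ze in nhds 0. poly r ze = ze ^ d * q ze" "isCont q 0" "i < d"
 shows "coeff r i = 0"
 using assms(3)
proof (induction i rule: less_induct)
 case (less i)
 have low: "coeff r j = 0" if "j < i" for j using less.IH[OF that] less.prems that by simp
 obtain s where s: "r = monom 1 i * s"
 proof -
  have "monom 1 i dvd r" using low by (simp add: monom_1_dvd_iff')
  then show ?thesis using that by (auto elim: dvdE)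
 qed
 have ev: "\<forall>\<^sub>F ze in at 0. poly s ze = ze ^ (d - i) * q ze"
 proof -
  have "\<forall>\<^sub>F ze in at 0. poly r ze = ze ^ d * q ze" using assms(1) by (simp add: eventually_nhds_conv_at)
  moreover have "\<forall>\<^sub>F ze in at 0. ze ~= (0::complex)" by (simp add: eventually_at_filter)
  ultimately show ?thesis
  proof eventually_elim
   case (elim ze)
   have "ze ^ i * poly s ze = ze ^ i * (ze ^ (d - i) * q ze)"
    using elim(1) less.prems by (simp add: s poly_monom mult.assoc[symmetric] power_add[symmetric])
   then show ?case using elim(2) by simp
  qed
 qed
 have "((%ze. ze ^ (d - i) * q ze) \<longlongrightarrow> 0 ^ (d - i) * q 0) (at 0)"
  using assms(2) by (intro tendsto_intros) (simp add: isCont_def)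
 moreover have "((poly s) \<longlongrightarrow> poly s 0) (at 0)" using poly_isCont[of 0 s] by (simp add: isCont_def)
 then have "((%ze. ze ^ (d - i) * q ze) \<longlongrightarrow> poly s 0) (at 0)"
  using tendsto_cong[OF ev] by blast
 ultimately have "poly s 0 = 0 ^ (d - i) * q 0" using tendsto_unique[of "at (0::complex)"] by (metis trivial_limit_at)
 then have "coeff s 0 = 0" using less.prems by (simp add: poly_0_coeff_0 power_0_left)
 then show ?case by (simp add: s coeff_monom_mult)
qed

text \<open>A polynomial of degree \<open>d\<close> with a \<open>d\<close>-fold root
  \<open>y0\<close> equals \<open>E\<close> times the \<open>d\<close>-th power of the linear
  factor. As its coefficient of degree \<open>d - 1\<close> is zero and the characteristic is zero,
  \<open>y0 = 0\<close>; but then all lower coefficients vanish, contrary to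
  \<open>b i0 ~= 0\<close>. This is why the order drops once the blow-ups are done.\<close>

lemma no_full_root:
 fixes E :: complex and b :: "nat => complex"
 assumes "E ~= 0" "i0 + 2 \<le> d" "b i0 ~= 0" "isCont q 0"
  and ev: "\<forall>\<^sub>F ze in nhds 0. E * (y0 + ze) ^ d + (\<Sum>i<d-1. b i * (y0 + ze) ^ i) = ze ^ d * q ze"
 shows False
proof -
 define p where "p = monom E d + (\<Sum>i<d-1. monom (b i) i)"
 define r where "r = pcompose p [:y0, 1:]"
 have cp: "coeff p i = (if i = d then E else if i < d - 1 then b i else 0)" for i
 proof -
  have "(\<Sum>j<d-1. if j = i then b j else 0) = (if i < d - 1 then b i else 0)" by (simp add: sum.delta)
  then show ?thesis using assms(2) by (auto simp: p_def coeff_sum)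
 qed
 have degp: "degree p = d"
 proof (rule antisym)
  show "degree p \<le> d" by (rule degree_le) (auto simp: cp)
  show "d \<le> degree p" by (rule le_degree) (simp add: cp assms)
 qed
 have degr: "degree r = d" by (simp add: r_def degree_pcompose degp)
 have "poly r ze = E * (y0 + ze) ^ d + (\<Sum>i<d-1. b i * (y0 + ze) ^ i)" for ze
  by (simp add: r_def poly_pcompose p_def poly_monom poly_sum)
 then have "\<forall>\<^sub>F ze in nhds 0. poly r ze = ze ^ d * q ze" using ev by simp
 then have low: "coeff r i = 0" if "i < d" for i using poly_divisible_low_coeffs assms(4) that by blast
 have rm: "r = monom (coeff r d) d"
 proof (rule poly_eqI)
  fix i show "coeff r i = coeff (monom (coeff r d) d) i"
   by (cases i d rule: linorder_cases) (simp_all add: low degr coeff_eq_0)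
 qed
 have "p = pcompose r [:- y0, 1:]"
 proof -
  have "pcompose r [:- y0, 1:] = pcompose p (pcompose [:y0, 1:] [:- y0, 1:])"
   by (simp add: r_def pcompose_assoc)
  also have "pcompose [:y0, 1:] [:- y0, 1:] = [:0, 1:]" by (simp add: pcompose_pCons)
  finally show ?thesis by (simp add: pcompose_idR)
 qed
 also have "\<dots> = smult (coeff r d) ([:- y0, 1:] ^ d)"
  by (subst rm) (simp add: poly_eq_poly_eq_iff[symmetric] fun_eq_iff poly_pcompose poly_monom poly_power)
 finally have p: "p = smult (coeff r d) ([:- y0, 1:] ^ d)" .
 have c: "coeff p i = coeff r d * (of_nat (d choose i) * (- y0) ^ (d - i))" if "i \<le> d" for i
  unfolding p coeff_smult using coeff_linear_poly_power[OF that, of "- y0" 1] by simp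
 have rd: "coeff r d = E" using c[of d] cp[of d] by simp
 have "coeff p (d - 1) = 0" using assms(2) by (simp add: cp)
 then have "y0 = 0" using c[of "d - 1"] rd assms(1,2) by (auto simp: binomial_eq_0_iff power_0_left)
 then have "coeff p i0 = 0" using c[of i0] assms(2) by (simp add: power_0_left)
 then show False using assms(2,3) by (auto simp: cp split: if_splits)
qed

lemma ord_in_exists:
 assumes "hol_at G 0" "m0 < d" "(dv k ^^ m0) G 0 ~= 0"
 obtains m where "m < d" "ord_in k G m"
proof -
 define m where "m = (LEAST m. (dv k ^^ m) G 0 ~= 0)"
 have "(dv k ^^ m) G 0 ~= 0" unfolding m_def using assms(3) by (rule LeastI)
 moreover have "(dv k ^^ i) G 0 = 0" if "i < m" for i using that not_less_Least unfolding m_def by blast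
 moreover have "m \<le> m0" unfolding m_def using assms(3) by (rule Least_le)
 ultimately show ?thesis using that[of m] assms(2) by (simp add: ord_in_def)
qed

lemma mon_split: "mon bt z = z $ j ^ bt j * mon (bt(j := 0)) z"
proof -
 have "bt = (%i. (if i = j then bt j else 0) + (bt(j := 0)) i)" by (auto simp: fun_eq_iff)
 then show ?thesis using mon_add[of "%i. if i = j then bt j else 0" "bt(j := 0)" z] by (simp add: mon_single)
qed

lemma mon_cong: "(!!i. gm i ~= 0 ==> z $ i = w $ i) ==> mon gm z = mon gm w"
 unfolding mon_def by (rule prod.cong[OF refl]) (metis power_0)

text \<open>The two charts of the blow-up of \<open>z $ j = z $ k = 0\<close>, separated by the
  slope \<open>z $ k / z $ j\<close>: one for slopes up to \<open>R\<close>, the reciprocal one for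
  steeper directions. Making \<open>R\<close> large leaves only steep directions to the second
  chart.\<close>

lemma cyl_sub_blowup:
 assumes "R > 0" "z \<in> sub S" "z \<in> cyl S \<nu>" "j ~= k" "j \<in> S" "k \<in> S" "\<nu> \<le> 1" "R \<ge> 1"
 shows "z \<in> (%w. \<chi> i. if i = k then w $ j * w $ k else w $ i) ` cpoly S (%i. if i = k then R else 1) \<or>
  z \<in> (%w. \<chi> i. if i = j then w $ j * w $ k else w $ i) ` cpoly S (%i. if i = j then 1 / R else 1)"
proof -
 have z1: "cmod (z $ i) \<le> 1" for i
 proof (cases "i \<in> S")
  case True
  then have "cmod (z $ i) < \<nu>" using assms(3) by (simp add: cyl_def)
  then show ?thesis using assms(7) by linarith
 qed (use assms(2) in \<open>simp add: sub_def\<close>)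
 show ?thesis
 proof (cases "cmod (z $ k) \<le> R * cmod (z $ j)")
  case True
  define w where "w = (\<chi> i. if i = k then (if z $ j = 0 then 0 else z $ k / z $ j) else z $ i)"
  have "z = (\<chi> i. if i = k then w $ j * w $ k else w $ i)"
   using True assms(4) by (auto simp: w_def vec_eq_iff)
  moreover have "w \<in> cpoly S (%i. if i = k then R else 1)"
   using True assms z1 by (auto simp: cpoly_def w_def sub_def norm_divide divide_le_eq)
  ultimately show ?thesis by blast
 next
  case False
  have "R * cmod (z $ j) \<ge> 0" using assms(1) by simp
  then have zk: "z $ k ~= 0" using False by auto
  define w where "w = (\<chi> i. if i = j then z $ j / z $ k else z $ i)"
  have "z = (\<chi> i. if i = j then w $ j * w $ k else w $ i)"
   using zk assms(4) by (auto simp: w_def vec_eq_iff)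
  moreover have "cmod (z $ j) / cmod (z $ k) \<le> 1 / R"
   using False zk assms(1) by (simp add: field_simps)
  then have "w \<in> cpoly S (%i. if i = j then 1 / R else 1)"
   using assms z1 by (auto simp: cpoly_def w_def sub_def norm_divide)
  ultimately show ?thesis by blast
 qed
qed

context
 fixes S' :: "'n::finite set" and k :: 'n and d :: nat
 assumes k: "k \<notin> S'"
  and T: "!!m g h. m < d ==> hol_at g 0 ==> dep S' g ==> nz_germ g ==> hol_at h 0 ==> dep (insert k S') h ==>
   ord_in k h m ==> Res (insert k S') (%z. g z * h z)"
begin

text \<open>The weights make the bracket homogeneous of degree \<open>d\<close> in
  \<open>mon bt\<close> and \<open>z $ k\<close>, and blowing up \<open>z $ j = z $ k = 0\<close>
  with \<open>j\<close> in the support of \<open>bt\<close> preserves this shape. One chart replaces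
  \<open>bt\<close> by an exponent of smaller total degree, the other gives a monomial times a unit.
  Once \<open>bt\<close> is used up, \<open>no_full_root\<close> brings the order below
  \<open>d\<close> and \<open>T\<close>, the induction hypothesis on the order, applies. The
  exponent \<open>dl\<close> collects the exceptional factors.\<close>

lemma Res_form:
 assumes "hol_at E 0" "dep (insert k S') E" "E 0 ~= 0"
  and "!!i. hol_at (b i) 0" "!!i. dep (insert k S') (b i)" "b i0 0 ~= 0" "i0 + 2 \<le> d"
  and "supp_in S' bt" "bt ~= (%i. 0)" "supp_in S' dl"
 shows "Res (insert k S') (%z. mon dl z * (E z * z $ k ^ d + (\<Sum>i<d-1. b i z * mon bt z ^ (d - i) * z $ k ^ i)))"
 using assms
proof (induction "\<Sum>i\<in>UNIV. bt i" arbitrary: E b bt dl rule: less_induct)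
 case less
 note E = less.prems(1-3) and b = less.prems(4-7) and bt = less.prems(8,9) and dl = less.prems(10)
 let ?S = "insert k S'"
 let ?h = "%z. mon dl z * (E z * z $ k ^ d + (\<Sum>i<d-1. b i z * mon bt z ^ (d - i) * z $ k ^ i))"
 obtain j where j: "bt j > 0" using bt(2) by (auto simp: fun_eq_iff)
 then have jS: "j \<in> S'" using bt(1) by (auto simp: supp_in_def)
 have jk: "j ~= k" using jS k by auto
 define bt' where "bt' = bt(j := bt j - 1)"
 have mb: "mon bt z = z $ j * mon bt' z" for z
 proof -
  have "bt = (%i. (if i = j then 1 else 0) + bt' i)" using j by (auto simp: bt'_def fun_eq_iff)
  then show ?thesis using mon_add[of "%i. if i = j then 1 else 0" bt' z] by (simp add: mon_single)
 qed
 have supp': "supp_in S' bt'" using bt(1) by (auto simp: supp_in_def bt'_def)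
 have sum': "(\<Sum>i\<in>UNIV. bt' i) < (\<Sum>i\<in>UNIV. bt i)"
  by (rule sum_strict_mono_ex1) (use j in \<open>auto simp: bt'_def\<close>)
 have btk: "bt k = 0" "bt' k = 0" "dl k = 0" using k bt(1) supp' dl by (auto simp: supp_in_def)
 define B where "B = (\<Sum>i<d-1. cmod (b i 0))"
 \<comment> \<open>Beyond slope \<open>R\<close> the leading coefficient \<open>E\<close> dominates
   the sum of all the others, so no cancellation is possible in the second chart.\<close>
 define R where "R = max 1 ((B + 1) / cmod (E 0))"
 have R: "R \<ge> 1" "R > 0" "B < cmod (E 0) * R"
 proof -
  have "cmod (E 0) * R \<ge> cmod (E 0) * ((B + 1) / cmod (E 0))" unfolding R_def by (intro mult_left_mono) auto
  then show "B < cmod (E 0) * R" using E(3) by simp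
 qed (auto simp: R_def)
 define psA :: "complex ^ 'n => complex ^ 'n" where "psA w = (\<chi> i. if i = k then w $ j * w $ k else w $ i)" for w
 define psB :: "complex ^ 'n => complex ^ 'n" where "psB w = (\<chi> i. if i = j then w $ j * w $ k else w $ i)" for w
 define KA where "KA = cpoly ?S (%i. if i = k then R else 1)"
 define KB where "KB = cpoly ?S (%i. if i = j then 1 / R else 1)"
 have admA: "adm ?S psA" and admB: "adm ?S psB"
  using jS by (auto simp: adm_def psA_def psB_def dep_def)
 have holA: "hol_at (%w. psA w $ i) x" for i x by (cases "i = k") (auto simp: psA_def intro: hol_at_mult)
 have holB: "hol_at (%w. psB w $ i) x" for i x by (cases "i = j") (auto simp: psB_def intro: hol_at_mult)
 have tr: "hol_at (%x. f (ps (w + x))) 0 & dep ?S (%x. f (ps (w + x)))"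
  if "hol_at f 0" "dep ?S f" "ps w = 0" "adm ?S ps" "!!i x. hol_at (%w. ps w $ i) x" "w \<in> sub ?S" for f ps w
 proof
  have "hol_at (%x. ps (w + x) $ i) 0" for i
   by (rule hol_at_compose[of "%z. ps z $ i" "%x. w + x"]) (auto intro: hol_at_add that(5))
  then show "hol_at (%x. f (ps (w + x))) 0" by (rule hol_at_compose[rotated]) (use that in simp)
  show "dep ?S (%x. f (ps (w + x)))" by (rule dep_compose[OF that(2) adm_compose[OF that(4) adm_translate[OF that(6)]]])
 qed
 have dep_h: "dep ?S ?h"
  using dep_mono[OF dep_mon[OF dl], of ?S] dep_mono[OF dep_mon[OF bt(1)], of ?S] E b
  by (intro dep_mult dep_add dep_sum dep_power dep_coord) auto
 show ?case
 proof (rule Res_cover[of "{(psA, KA), (psB, KB)}" _ _ 1])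
  fix ps K assume c: "(ps, K) \<in> {(psA, KA), (psB, KB)}"
  have "compact KA" "compact KB" unfolding KA_def KB_def by (rule compact_cpoly)+
  moreover have "KA \<subseteq> sub ?S" "KB \<subseteq> sub ?S" by (auto simp: KA_def KB_def cpoly_def)
  ultimately show "compact K & K \<subseteq> sub ?S & adm ?S ps"
   using c admA admB by auto
  show "hol_at (%z. ps z $ i) w" for w i using c holA holB by auto
  fix w assume w: "w \<in> K" "ps w = 0"
  have ws: "w \<in> sub ?S" using w c by (auto simp: KA_def KB_def cpoly_def)
  from c consider (A) "ps = psA" "K = KA" | (B) "ps = psB" "K = KB" by auto
  then show "Res ?S (%x. ?h (ps (w + x)))"
  proof cases
   case A
   \<comment> \<open>The chart is centred at slope \<open>y0\<close>. \<open>G\<close> is the strict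
     transform; the exceptional factor \<open>x $ j ^ d\<close> goes into the exponent
     \<open>dl'\<close>.\<close>
   define y0 where "y0 = w $ k"
   have wi: "w $ i = 0" if "i ~= k" for i using arg_cong[OF w(2), of "%v. v $ i"] that A by (simp add: psA_def)
   define E' where "E' x = E (psA (w + x))" for x
   define b' where "b' i x = b i (psA (w + x))" for i x
   have w0: "psA w = 0" using w A by simp
   have E': "hol_at E' 0" "dep ?S E'" "E' 0 = E 0"
    unfolding E'_def using tr[OF E(1,2) w0 admA holA ws] w0 by auto
   have b': "hol_at (b' i) 0" "dep ?S (b' i)" "b' i 0 = b i 0" for i
    unfolding b'_def using tr[OF b(1,2) w0 admA holA ws] w0 by auto
   have co: "psA (w + x) $ k = x $ j * (y0 + x $ k)" "i ~= k ==> psA (w + x) $ i = x $ i" for i x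
    using wi jk by (auto simp: psA_def y0_def)
   have mo: "mon gm (psA (w + x)) = mon gm x" if "gm k = 0" for gm x
    by (rule mon_cong) (use that co(2) in metis)
   define G where "G x = E' x * (y0 + x $ k) ^ d + (\<Sum>i<d-1. b' i x * mon bt' x ^ (d - i) * (y0 + x $ k) ^ i)" for x
   define dl' where "dl' = (%i. dl i + (if i = j then d else 0))"
   have dl': "supp_in S' dl'" using dl jS by (auto simp: supp_in_def dl'_def)
   have hG: "?h (psA (w + x)) = mon dl' x * G x" for x
   proof -
    have mdl: "mon dl' x = mon dl x * x $ j ^ d" unfolding dl'_def by (simp add: mon_add mon_single)
    have "b' i x * mon bt x ^ (d - i) * (x $ j * (y0 + x $ k)) ^ i = x $ j ^ d * (b' i x * mon bt' x ^ (d - i) * (y0 + x $ k) ^ i)"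
     if "i < d - 1" for i
    proof -
     have "x $ j ^ d = x $ j ^ (d - i) * x $ j ^ i" using that by (simp add: power_add[symmetric])
     then show ?thesis by (simp add: mb power_mult_distrib)
    qed
    then have "(\<Sum>i<d-1. b' i x * mon bt x ^ (d - i) * (x $ j * (y0 + x $ k)) ^ i)
      = x $ j ^ d * (\<Sum>i<d-1. b' i x * mon bt' x ^ (d - i) * (y0 + x $ k) ^ i)"
     unfolding sum_distrib_left by (intro sum.cong) auto
    then have sm: "E' x * (x $ j * (y0 + x $ k)) ^ d + (\<Sum>i<d-1. b' i x * mon bt x ^ (d - i) * (x $ j * (y0 + x $ k)) ^ i) = x $ j ^ d * G x"
     unfolding G_def power_mult_distrib by (simp add: distrib_left mult.left_commute)
    show ?thesis
     unfolding mo[of bt, OF btk(1)] mo[of dl, OF btk(3)] co(1) E'_def[symmetric] b'_def[symmetric] sm mdl by (simp add: mult.assoc)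
   qed
   have hol1: "hol_at (%x. y0 + x $ k) 0" by (intro hol_at_add) auto
   have depG: "dep ?S G" unfolding G_def using E' b' dep_mono[OF dep_mon[OF supp'], of ?S]
    by (intro dep_mult dep_add dep_sum dep_power dep_coord dep_const) auto
   have holG: "hol_at G 0" unfolding G_def using E' b' hol1
    by (intro hol_at_mult hol_at_add hol_at_sum hol_at_power hol_at_mon) auto
   show ?thesis
   proof (cases "bt' = (%i. 0)")
    case True
    \<comment> \<open>With \<open>bt'\<close> exhausted, \<open>G\<close> restricted to the
      \<open>k\<close>-axis is a polynomial of degree \<open>d\<close> in \<open>y0 + ze\<close>
      without a term of degree \<open>d - 1\<close>. Vanishing to order \<open>d\<close> at the
      centre would give it a full root.\<close>
    have "\<exists>m0<d. (dv k ^^ m0) G 0 ~= 0"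
    proof (rule ccontr)
     assume "\<not> ?thesis"
     then have z: "(dv k ^^ i) G 0 = 0" if "i < d" for i using that by blast
     let ?q = "%ze. (dv k ^^ d) G (ze *s ax k)"
     have Gax: "G (ze *s ax k) = ze ^ d * ?q ze" for ze
     proof -
      have "rk k (ze *s ax k) = 0" by (simp add: vec_eq_iff axis_def)
      then show ?thesis using taylor_dv[of G "ze *s ax k" k d] z by (simp add: axis_def)
     qed
     have "psA (w + ze *s ax k) = 0" for ze using wi jk by (simp add: psA_def vec_eq_iff axis_def)
     then have Gax2: "G (ze *s ax k) = E 0 * (y0 + ze) ^ d + (\<Sum>i<d-1. b i 0 * (y0 + ze) ^ i)" for ze
      by (simp add: G_def E'_def b'_def True axis_def)
     have "isCont ?q 0"
     proof -
      have "isCont (%ze. ze *s ax k) (0 :: complex)"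
       using continuous_on_smult_line[of UNIV 0 "ax k"] by (simp add: continuous_on_eq_continuous_at)
      moreover have "isCont ((dv k ^^ d) G) (0 *s ax k)"
       using hol_at_isCont[OF hol_at_dv_iter[OF holG]] by simp
      ultimately show ?thesis by (rule isCont_o2)
     qed
     moreover have "\<forall>\<^sub>F ze in nhds 0. E 0 * (y0 + ze) ^ d + (\<Sum>i<d-1. b i 0 * (y0 + ze) ^ i) = ze ^ d * ?q ze"
      using Gax Gax2 by simp
     ultimately show False using no_full_root[OF E(3) b(4), of "%i. b i 0" ?q y0] b(3) by blast
    qed
    then obtain m where "m < d" "ord_in k G m" using ord_in_exists[OF holG] by blast
    then have "Res ?S (%x. mon dl' x * G x)"
     by (intro T holG depG hol_at_mon dep_mon dl' nz_germ_mon)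
    then show ?thesis by (simp only: A(1) hG)
   next
    case False
    show ?thesis
    \<comment> \<open>At slope zero \<open>G\<close> has the original shape with the smaller
      exponent \<open>bt'\<close>, so the inner induction applies. At any other slope
      \<open>E 0 * y0 ^ d\<close> is the only term left at the centre, and \<open>G\<close> is a
      unit.\<close>
    proof (cases "y0 = 0")
     case True
     have "Res ?S (%z. mon dl' z * (E' z * z $ k ^ d + (\<Sum>i<d-1. b' i z * mon bt' z ^ (d - i) * z $ k ^ i)))"
      by (rule less.hyps[OF sum']) (use E E' b b' supp' False dl' in auto)
     then have "Res ?S (%x. mon dl' x * G x)" by (simp add: G_def True)
     then show ?thesis by (simp only: A(1) hG)
    next
     case y0: False
     have "mon bt' 0 = 0" using False by (simp add: mon_at_0)
     then have "(\<Sum>i<d-1. b' i 0 * mon bt' 0 ^ (d - i) * (y0 + 0 $ k) ^ i) = 0"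
      by (intro sum.neutral) auto
     then have "G 0 = E 0 * y0 ^ d" by (simp only: G_def E'(3)) simp
     then have "mu ?S G" using y0 E by (intro mu_unit depG holG) simp
     moreover have "mu ?S (mon dl')"
      using mu_mon_compose[OF dl', of ?S "%z. z"] mu_coord[of _ ?S] by auto
     ultimately have "mu ?S (%x. mon dl' x * G x)" by (intro mu_mult)
     then have "Res ?S (%x. mon dl' x * G x)"
      by (rule Res_mu) (intro dep_mult depG dep_mono[OF dep_mon[OF dl']], auto)
     then show ?thesis by (simp only: A(1) hG)
    qed
   qed
  next
   case B
   define x0 where "x0 = w $ j"
   have x0R: "cmod x0 \<le> 1 / R" using w(1) B by (auto simp: KB_def cpoly_def x0_def dest: spec[of _ j])
   have wi: "w $ i = 0" if "i ~= j" for i using arg_cong[OF w(2), of "%v. v $ i"] that B by (simp add: psB_def)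
   have w0: "psB w = 0" using w B by simp
   have co: "psB (w + x) $ j = (x0 + x $ j) * x $ k" "i ~= j ==> psB (w + x) $ i = x $ i" for i x
    using wi jk by (auto simp: psB_def x0_def)
   define E' where "E' x = E (psB (w + x))" for x
   define b' where "b' i x = b i (psB (w + x))" for i x
   have E': "hol_at E' 0" "dep ?S E'" "E' 0 = E 0"
    unfolding E'_def using tr[OF E(1,2) w0 admB holB ws] w0 by auto
   have b': "hol_at (b' i) 0" "dep ?S (b' i)" "b' i 0 = b i 0" for i
    unfolding b'_def using tr[OF b(1,2) w0 admB holB ws] w0 by auto
   \<comment> \<open>In this chart \<open>mon bt\<close> is divisible by \<open>x $ k\<close> with
     quotient \<open>M\<close>. At the centre the modulus of \<open>M\<close> is at most the
     reciprocal slope bound \<open>1 / R\<close>, so the choice of \<open>R\<close> makes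
     \<open>G\<close> a unit.\<close>
   define M where "M x = (x0 + x $ j) * mon bt' (psB (w + x))" for x
   have mB: "mon bt (psB (w + x)) = x $ k * M x" for x
    by (simp add: mb M_def co)
   define G where "G x = E' x + (\<Sum>i<d-1. b' i x * M x ^ (d - i))" for x
   have hG: "?h (psB (w + x)) = mon dl (psB (w + x)) * (x $ k ^ d * G x)" for x
   proof -
    have "b' i x * (x $ k * M x) ^ (d - i) * x $ k ^ i = x $ k ^ d * (b' i x * M x ^ (d - i))" if "i < d - 1" for i
    proof -
     have "x $ k ^ d = x $ k ^ (d - i) * x $ k ^ i" using that by (simp add: power_add[symmetric])
     then show ?thesis by (simp add: power_mult_distrib)
    qed
    then have "(\<Sum>i<d-1. b' i x * (x $ k * M x) ^ (d - i) * x $ k ^ i) = x $ k ^ d * (\<Sum>i<d-1. b' i x * M x ^ (d - i))"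
     unfolding sum_distrib_left by (intro sum.cong) auto
    then show ?thesis using jk
     by (simp add: mB co(2)[of k] E'_def[symmetric] b'_def[symmetric] G_def algebra_simps)
   qed
   have aw: "adm ?S (%x. psB (w + x))" by (rule adm_compose[OF admB adm_translate[OF ws]])
   have M: "hol_at M 0" "dep ?S M"
    unfolding M_def using tr[OF hol_at_mon dep_mono[OF dep_mon[OF supp'], of ?S] w0 admB holB ws] jS
    by (auto intro!: hol_at_mult hol_at_add dep_mult simp: dep_def)
   have depG: "dep ?S G" unfolding G_def using E' b' M by (intro dep_mult dep_add dep_sum dep_power) auto
   have holG: "hol_at G 0" unfolding G_def using E' b' M by (intro hol_at_mult hol_at_add hol_at_sum hol_at_power) auto
   have M0: "cmod (M 0) \<le> 1 / R"
   proof -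
    have "cmod (mon bt' (psB w)) \<le> 1" using w0 by (simp add: mon_at_0)
    then show ?thesis using x0R mult_mono[OF x0R, of "cmod (mon bt' (psB w))" 1] R by (simp add: M_def norm_mult)
   qed
   have "G 0 ~= 0"
   proof
    assume "G 0 = 0"
    then have "E 0 = - (\<Sum>i<d-1. b i 0 * M 0 ^ (d - i))" by (simp add: G_def E' b' eq_neg_iff_add_eq_0)
    then have "cmod (E 0) = cmod (\<Sum>i<d-1. b i 0 * M 0 ^ (d - i))" by simp
    also have "\<dots> \<le> (\<Sum>i<d-1. cmod (b i 0 * M 0 ^ (d - i)))" by (rule norm_sum)
    also have "\<dots> \<le> (\<Sum>i<d-1. cmod (b i 0) * (1 / R))"
    proof (rule sum_mono)
     fix i assume "i \<in> {..<d-1}"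
     then obtain e where e: "d - i = Suc e" by (metis Suc_diff_Suc lessThan_iff less_diff_conv add_lessD1)
     have R1: "1 / R \<le> 1" using R by simp
     have "cmod (M 0) ^ (d - i) \<le> (1 / R) ^ (d - i)" using M0 by (intro power_mono) auto
     also have "\<dots> \<le> 1 / R" unfolding e using R power_le_one[of "1/R" e] R1
      by (simp add: divide_right_mono)
     finally show "cmod (b i 0 * M 0 ^ (d - i)) \<le> cmod (b i 0) * (1 / R)"
      unfolding norm_mult norm_power by (rule mult_left_mono) simp
    qed
    also have "\<dots> = B / R" by (simp add: B_def sum_distrib_right[symmetric] sum_divide_distrib[symmetric])
    finally have "cmod (E 0) * R \<le> B" using R by (simp add: field_simps)
    then show False using R(3) by simp
   qed
   then have "mu ?S G" by (intro mu_unit depG holG)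
   moreover have "mu ?S (%x. mon dl (psB (w + x)))"
   proof (rule mu_mon_compose[OF dl])
    fix i assume i: "i \<in> S'"
    show "mu ?S (%x. psB (w + x) $ i)"
    proof (cases "i = j")
     case True
     have "mu ?S (%x. (w + x) $ j * x $ k)" using jS by (intro mu_mult mu_translate_coord mu_coord) auto
     then show ?thesis by (simp add: True co x0_def)
    next
     case False
     then show ?thesis using i mu_coord[of i ?S] by (simp add: co)
    qed
   qed
   moreover have "mu ?S (%x. x $ k ^ d)" by (intro mu_power mu_coord) simp
   ultimately have "mu ?S (%x. mon dl (psB (w + x)) * (x $ k ^ d * G x))" by (intro mu_mult)
   then have "mu ?S (%x. ?h (psB (w + x)))" by (simp only: hG)
   then have "Res ?S (%x. ?h (psB (w + x)))" by (rule Res_mu[OF _ dep_compose[OF dep_h aw]])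
   then show ?thesis by (simp only: B(1))
  qed
 next
  fix z assume z: "z \<in> sub ?S" "z \<in> cyl ?S 1"
  have "z \<in> psA ` KA \<or> z \<in> psB ` KB"
   unfolding psA_def psB_def KA_def KB_def
   by (rule cyl_sub_blowup[of R z ?S 1 j k]) (use z R jk jS in auto)
  then show "\<exists>(ps, K)\<in>{(psA, KA), (psB, KB)}. z \<in> ps ` K" by simp
 qed auto
qed

end

section \<open>Coordinate changes that prepare the induction\<close>

lemma dep_dv:
 assumes "dep S h" "k \<in> S"
 shows "dep S (dv k h)"
 unfolding dep_def
proof (intro allI impI)
 fix z w :: "complex ^ 'a" assume zw: "\<forall>i\<in>S. z $ i = w $ i"
 have "h (z + ze *s ax k) = h (w + ze *s ax k)" for ze by (rule depD[OF assms(1)]) (simp add: zw)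
 then have "pd k h z = pd k h w" by (simp add: pd_def)
 moreover have "h z = h w" "h (rk k z) = h (rk k w)" by (rule depD[OF assms(1)]; simp add: zw)+
 ultimately show "dv k h z = dv k h w" using zw assms(2) by (simp add: dv_def)
qed

lemma dep_pd:
 assumes "dep S h"
 shows "dep S (pd k h)"
 unfolding dep_def
proof (intro allI impI)
 fix z w :: "complex ^ 'a" assume zw: "\<forall>i\<in>S. z $ i = w $ i"
 have "h (z + ze *s ax k) = h (w + ze *s ax k)" for ze by (rule depD[OF assms(1)]) (simp add: zw)
 then show "pd k h z = pd k h w" by (simp add: pd_def)
qed

lemma dep_dv_iter: "dep S h ==> k \<in> S ==> dep S ((dv k ^^ i) h)"
 by (induction i) (auto intro: dep_dv)

lemma dep_pd_iter: "dep S h ==> dep S ((pd k ^^ i) h)"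
 by (induction i) (auto intro: dep_pd)

text \<open>As \<open>ph\<close> ignores \<open>z $ k\<close>, the shear adding \<open>ph\<close> to
  \<open>z $ k\<close> is inverted by subtracting it, and the origin is the only point over the
  origin. The lemma serves to remove the coefficient of degree \<open>d - 1\<close>.\<close>

lemma Res_translate:
 fixes S' :: "'n::finite set"
 assumes k: "k \<notin> S'" and ph: "hol_at ph 0" "ph 0 = 0" "dep S' ph"
  and R: "Res (insert k S') (%z. f (z + ph z *s ax k))"
 shows "Res (insert k S') f"
proof -
 let ?S = "insert k S'"
 define ps where "ps z = z + ph z *s ax k" for z
 have psn: "ps z $ i = (if i = k then z $ k + ph z else z $ i)" for z i by (simp add: ps_def axis_def)
 have dS: "dep ?S ph" using dep_mono[OF ph(3)] by auto
 have ad: "adm ?S ps" unfolding adm_def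
 proof (intro conjI allI impI ballI)
  fix i assume "i \<in> ?S"
  then show "dep ?S (%w. ps w $ i)" unfolding psn using dS by (cases "i = k") (auto intro: dep_add dep_coord)
 qed (auto simp: psn)
 obtain r0 where r0: "r0 > 0" "!!z. z \<in> cyl ?S r0 ==> hol_at ph (restr ?S z)"
  using restr_small[OF hol_at_eventually[OF ph(1)], of ?S] by blast
 define r where "r = r0 / 2"
 have r: "r > 0" using r0 by (simp add: r_def)
 have "\<forall>\<^sub>F z in nhds 0. dist (ph z) (ph 0) < r / 2"
  using tendstoD[OF isCont_nhds[OF hol_at_isCont[OF ph(1)]], of "r/2"] r by simp
 then obtain \<nu> where \<nu>: "\<nu> > 0" "!!z. z \<in> cyl ?S \<nu> ==> dist (ph (restr ?S z)) (ph 0) < r / 2"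
  using restr_small[of "%z. dist (ph z) (ph 0) < r / 2" ?S] by blast
 show ?thesis
 proof (rule Res_cover[of "{(ps, cpoly ?S (%i. r))}" _ _ "min \<nu> (r/2)"])
  fix ps' K assume "(ps', K) \<in> {(ps, cpoly ?S (%i. r))}"
  then have c: "ps' = ps" "K = cpoly ?S (%i. r)" by auto
  show "compact K & K \<subseteq> sub ?S & adm ?S ps'"
   unfolding c using ad compact_cpoly[of ?S "%i. r"] by (simp add: cpoly_def)
  show "hol_at (%z. ps' z $ i) w" if w: "w \<in> K" for w i
  proof -
   have ws: "restr ?S w = w" using w by (auto simp: c cpoly_def sub_def vec_eq_iff)
   have "cmod (w $ i) < r0" for i
   proof -
    have "cmod (w $ i) \<le> r" using w by (simp add: c cpoly_def)
    then show ?thesis using r0(1) by (simp add: r_def)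
   qed
   then have "hol_at ph w" using r0(2)[of w] ws by (simp add: cyl_def)
   then show ?thesis unfolding c psn by (cases "i = k") (auto intro: hol_at_add)
  qed
  fix w assume w: "w \<in> K" "ps' w = 0"
  have wi: "w $ i = 0" if "i ~= k" for i using arg_cong[OF w(2), of "%v. v $ i"] that by (simp add: c psn)
  have "ph w = ph 0" by (rule depD[OF ph(3)]) (use k in \<open>metis wi zero_index\<close>)
  then have "w $ k = 0" using arg_cong[OF w(2), of "%v. v $ k"] by (simp add: c psn ph(2))
  with wi have "w = 0" by (metis vec_eq_iff zero_index)
  then show "Res ?S (%x. f (ps' (w + x)))" using R by (simp add: c ps_def)
 next
  fix z assume z: "z \<in> sub ?S" "z \<in> cyl ?S (min \<nu> (r/2))"
  have zr: "restr ?S z = z" using z(1) by (auto simp: sub_def vec_eq_iff)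
  have "z \<in> cyl ?S \<nu>" using z(2) cyl_mono[of "min \<nu> (r/2)" \<nu>] by auto
  then have small: "cmod (ph z) < r / 2" using \<nu>(2)[of z] by (simp add: zr ph(2))
  have zi: "cmod (z $ i) \<le> r / 2" for i
   using z r by (cases "i \<in> ?S") (auto simp: cyl_def sub_def less_imp_le)
  define w where "w = z - ph z *s ax k"
  have wn: "w $ i = (if i = k then z $ k - ph z else z $ i)" for i by (simp add: w_def axis_def)
  have "ph w = ph z" by (rule depD[OF ph(3)]) (use k in \<open>auto simp: wn\<close>)
  then have "ps w = z" by (simp add: vec_eq_iff psn wn)
  moreover have "w \<in> cpoly ?S (%i. r)"
  proof -
   have "cmod (w $ i) \<le> r" for i
    using zi[of i] small norm_triangle_ineq4[of "z $ k" "ph z"] r by (cases "i = k") (auto simp: wn)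
   then show ?thesis using z(1) by (auto simp: cpoly_def sub_def wn)
  qed
  ultimately show "\<exists>(ps, K)\<in>{(ps, cpoly ?S (%i. r))}. z \<in> ps ` K" by auto
 qed (use \<nu> r in auto)
qed

text \<open>Complex roots exist, and those of numbers in the unit disc stay in it, so taking
  \<open>e\<close>-th powers maps the polydisc onto itself. Though not injective, the substitution
  is a legitimate preliminary map; it makes all exponents in \<open>S'\<close> divisible by
  \<open>e\<close>.\<close>

lemma Res_ramify:
 fixes S' :: "'n::finite set"
 assumes k: "k \<notin> S'" and e: "e > 0" and R: "Res (insert k S') (%z. f (\<chi> i. if i \<in> S' then z $ i ^ e else z $ i))"
 shows "Res (insert k S') f"
proof -
 let ?S = "insert k S'"
 define ps :: "complex ^ 'n => complex ^ 'n" where "ps z = (\<chi> i. if i \<in> S' then z $ i ^ e else z $ i)" for z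
 have ad: "adm ?S ps" by (auto simp: adm_def ps_def dep_def)
 show ?thesis
 proof (rule Res_cover[of "{(ps, cpoly ?S (%i. 1))}" _ _ 1])
  fix ps' K assume "(ps', K) \<in> {(ps, cpoly ?S (%i. 1))}"
  then have c: "ps' = ps" "K = cpoly ?S (%i. 1)" by auto
  show "compact K & K \<subseteq> sub ?S & adm ?S ps'"
   unfolding c using ad compact_cpoly[of ?S "%i. 1"] by (simp add: cpoly_def)
  show "hol_at (%z. ps' z $ i) w" for w i
   unfolding c ps_def by (cases "i \<in> S'") (auto intro: hol_at_power)
  fix w assume w: "w \<in> K" "ps' w = 0"
  have "w $ i = 0" for i using arg_cong[OF w(2), of "%v. v $ i"] e by (cases "i \<in> S'") (auto simp: c ps_def)
  then have "w = 0" by (simp add: vec_eq_iff)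
  then show "Res ?S (%x. f (ps' (w + x)))" using R by (simp add: c ps_def)
 next
  fix z assume z: "z \<in> sub ?S" "z \<in> cyl ?S 1"
  have zi: "cmod (z $ i) \<le> 1" for i using z by (cases "i \<in> ?S") (auto simp: cyl_def sub_def less_imp_le)
  have "\<forall>i. \<exists>w. w ^ e = z $ i"
  proof
   fix i
   have "\<exists>w. w ^ e = z $ i"
   proof (cases "z $ i = 0")
    case True then show ?thesis using e by (intro exI[of _ 0]) simp
   next
    case False
    have "exp (Ln (z $ i) / of_nat e) ^ e = z $ i"
     using e False by (simp add: exp_of_nat_mult[symmetric])
    then show ?thesis by blast
   qed
   then show "\<exists>w. w ^ e = z $ i" .
  qed
  then obtain w where w: "!!i. w i ^ e = z $ i" by metis
  define v where "v = (\<chi> i. if i \<in> S' then w i else z $ i)"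
  have "ps v = z" by (simp add: ps_def v_def w vec_eq_iff)
  moreover have "cmod (w i) \<le> 1" for i
  proof (rule ccontr)
   assume "\<not> ?thesis"
   then have "1 < cmod (w i) ^ e" using e by (intro one_less_power) auto
   then show False using zi[of i] by (simp add: w[symmetric] norm_power)
  qed
  then have "v \<in> cpoly ?S (%i. 1)" using z(1) zi by (auto simp: cpoly_def v_def sub_def)
  ultimately show "\<exists>(ps, K)\<in>{(ps, cpoly ?S (%i. 1))}. z \<in> ps ` K" by auto
 qed auto
qed

text \<open>The shear carries the \<open>k\<close>-axis to the line through \<open>a\<close>.
  Choosing a line on which the germ is not identically zero gives it a finite order in the variable
  \<open>z $ k\<close>.\<close>

lemma Res_linear:
 fixes S :: "'n::finite set"
 assumes k: "k \<in> S" and a: "a \<in> sub S" "a $ k ~= 0" and R: "Res S (%z. f (rk k z + z $ k *s a))"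
 shows "Res S f"
proof -
 define ps where "ps z = rk k z + z $ k *s a" for z
 have psn: "ps z $ i = (if i = k then z $ k * a $ k else z $ i + z $ k * a $ i)" for z i by (simp add: ps_def)
 have ad: "adm S ps" using k a by (auto simp: adm_def psn dep_def sub_def)
 \<comment> \<open>\<open>M + M\<close> bounds the coordinates of the inverse shear on the unit
   polydisc.\<close>
 define M where "M = (1 + norm a) / cmod (a $ k) + 1"
 have M: "M \<ge> 1" by (simp add: M_def)
 show ?thesis
 proof (rule Res_cover[of "{(ps, cpoly S (%i. M + M))}" _ _ 1])
  fix ps' K assume "(ps', K) \<in> {(ps, cpoly S (%i. M + M))}"
  then have c: "ps' = ps" "K = cpoly S (%i. M + M)" by auto
  show "compact K & K \<subseteq> sub S & adm S ps'"
   unfolding c using ad compact_cpoly[of S "%i. M + M"] by (simp add: cpoly_def)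
  show "hol_at (%z. ps' z $ i) w" for w i
   unfolding c psn by (cases "i = k") (auto intro!: hol_at_mult hol_at_add)
  fix w assume w: "w \<in> K" "ps' w = 0"
  have wk: "w $ k = 0" using arg_cong[OF w(2), of "%v. v $ k"] a by (simp add: c psn)
  have "w $ i = 0" for i using arg_cong[OF w(2), of "%v. v $ i"] wk by (cases "i = k") (auto simp: c psn)
  then have "w = 0" by (simp add: vec_eq_iff)
  then show "Res S (%x. f (ps' (w + x)))" using R by (simp add: c ps_def)
 next
  fix z assume z: "z \<in> sub S" "z \<in> cyl S 1"
  have zi: "cmod (z $ i) \<le> 1" for i using z by (cases "i \<in> S") (auto simp: cyl_def sub_def less_imp_le)
  define v where "v = (\<chi> i. if i = k then z $ k / a $ k else z $ i - z $ k / a $ k * a $ i)"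
  have "ps v = z" using a by (simp add: psn v_def vec_eq_iff)
  moreover have "cmod (v $ i) \<le> M + M" for i
  proof -
   have q: "cmod (z $ k / a $ k) \<le> 1 / cmod (a $ k)" using zi[of k] a by (simp add: norm_divide divide_right_mono)
   have n: "norm a / cmod (a $ k) \<ge> 0" "1 / cmod (a $ k) \<ge> 0" by auto
   have Me: "M = 1 / cmod (a $ k) + norm a / cmod (a $ k) + 1" by (simp add: M_def add_divide_distrib)
   show ?thesis
   proof (cases "i = k")
    case True
    then have "cmod (v $ i) \<le> 1 / cmod (a $ k)" using q by (simp add: v_def)
    then show ?thesis using n Me by linarith
   next
    case False
    have "cmod (z $ k / a $ k * a $ i) \<le> 1 / cmod (a $ k) * norm a"
     unfolding norm_mult by (intro mult_mono q Finite_Cartesian_Product.norm_nth_le) auto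
    then have "cmod (v $ i) \<le> 1 + norm a / cmod (a $ k)"
     using False zi[of i] norm_triangle_ineq4[of "z $ i" "z $ k / a $ k * a $ i"] by (simp add: v_def)
    then show ?thesis using n Me by linarith
   qed
  qed
  then have "v \<in> cpoly S (%i. M + M)" using z(1) a k by (auto simp: cpoly_def v_def sub_def)
  ultimately show "\<exists>(ps, K)\<in>{(ps, cpoly S (%i. M + M))}. z \<in> ps ` K" by auto
 qed auto
qed

lemma pd_translate:
 assumes "!!z. ph (rk k z) = ph z"
 shows "(pd k ^^ i) (%z. f (z + ph z *s ax k)) = (%z. (pd k ^^ i) f (z + ph z *s ax k))"
proof (induction i)
 case (Suc i)
 have "ph (z + ze *s ax k) = ph z" for z ze
 proof -
  have "rk k (z + ze *s ax k) = rk k z" by (simp add: vec_eq_iff axis_def)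
  then show ?thesis by (metis assms)
 qed
 then have "pd k (%z. g (z + ph z *s ax k)) z = pd k g (z + ph z *s ax k)" for g z
  by (simp add: pd_def add.assoc add.commute add.left_commute)
 then show ?case by (simp add: Suc)
qed simp

lemma ord_in_pd:
 assumes "hol_at h 0"
 shows "ord_in k h m \<longleftrightarrow> (\<forall>i<m. (pd k ^^ i) h 0 = 0) & (pd k ^^ m) h 0 ~= 0"
proof -
 have "rk k 0 = 0" by (simp add: vec_eq_iff)
 then have "(pd k ^^ i) h 0 = fact i * (dv k ^^ i) h 0" for i
  using eventually_nhds_x_imp_x[OF pd_dv_rk[OF assms, of i k]] by simp
 then show ?thesis by (simp add: ord_in_def)
qed

text \<open>Among comparable exponents the total degree decides the order, so an exponent of least
  total degree divides all others.\<close>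

lemma finite_chain_min:
 fixes bt :: "'i => 'n::finite => nat"
 assumes "finite A" "A ~= {}" "!!i j. i \<in> A ==> j \<in> A ==> bt i \<le> bt j \<or> bt j \<le> bt i"
 obtains i0 where "i0 \<in> A" "!!i. i \<in> A ==> bt i0 \<le> bt i"
proof -
 obtain i0 where i0: "i0 \<in> A" "!!i. i \<in> A ==> (\<Sum>l\<in>UNIV. bt i0 l) \<le> (\<Sum>l\<in>UNIV. bt i l)"
  using ex_min_if_finite[of "(%i. \<Sum>l\<in>UNIV. bt i l) ` A"] assms(1,2) by (force simp: not_less)
 have "bt i0 \<le> bt i" if i: "i \<in> A" for i
 proof (rule ccontr)
  assume "\<not> ?thesis"
  then have "bt i \<le> bt i0" "bt i ~= bt i0" using assms(3)[OF i i0(1)] by auto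
  then obtain l where "bt i l < bt i0 l" by (metis le_funD le_neq_implies_less ext)
  then have "(\<Sum>l\<in>UNIV. bt i l) < (\<Sum>l\<in>UNIV. bt i0 l)"
   using \<open>bt i \<le> bt i0\<close> by (intro sum_strict_mono_ex1) (auto simp: le_fun_def)
  then show False using i0(2)[OF i] by simp
 qed
 then show ?thesis using that i0 by blast
qed

lemma mon_ramify:
 assumes "supp_in S' gm"
 shows "mon gm (\<chi> i. if i \<in> S' then z $ i ^ e else z $ i) = mon (%i. e * gm i) z"
 unfolding mon_def
proof (rule prod.cong[OF refl])
 fix i show "(\<chi> i. if i \<in> S' then z $ i ^ e else z $ i) $ i ^ gm i = z $ i ^ (e * gm i)"
  using assms by (cases "i \<in> S'") (auto simp: supp_in_def power_mult)
qed

text \<open>The relevant slopes are the fractional exponents of \<open>c i\<close> divided by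
  \<open>d - i\<close>. Raising \<open>c i\<close> to the power \<open>fact d div (d - i)\<close>
  clears the denominators, and by \<open>monomial_exponents_comparable\<close> the resulting
  exponents \<open>bt i\<close> form a chain with a least element \<open>bt i0\<close>. After
  ramification by \<open>fact d\<close> the exponent of \<open>c i\<close> is \<open>d - i\<close>
  times \<open>bt i\<close>, so the power \<open>d - i\<close> of \<open>mon (bt i0)\<close> splits
  off: the shape treated by \<open>Res_form\<close>.\<close>

lemma Res_monomial_coeffs:
 fixes S' :: "'n::finite set" and k :: 'n and d :: nat
 assumes k: "k \<notin> S'"
  and T: "!!m g h. m < d ==> hol_at g 0 ==> dep S' g ==> nz_germ g ==> hol_at h 0 ==> dep (insert k S') h ==>
   ord_in k h m ==> Res (insert k S') (%z. g z * h z)"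
  and g: "mu S' g" "dep S' g" and A: "A ~= {}" "A \<subseteq> {..<d-1}"
  and c: "!!i. i \<in> A ==> mu S' (c i)" "!!i. i \<in> A ==> c i 0 = 0"
  and comp: "!!i j. i \<in> A ==> j \<in> A ==> (\<forall>\<^sub>F z in nhds 0. c i z ^ (fact d div (d - i)) = c j z ^ (fact d div (d - j))) \<or>
   mu S' (%z. c i z ^ (fact d div (d - i)) - c j z ^ (fact d div (d - j)))"
  and E: "hol_at E 0" "dep (insert k S') E" "E 0 ~= 0"
  and h: "dep (insert k S') h" "\<forall>\<^sub>F z in nhds 0. h z = E z * z $ k ^ d + (\<Sum>i\<in>A. c i z * z $ k ^ i)"
 shows "Res (insert k S') (%z. g z * h z)"
proof -
 let ?S = "insert k S'"
 define e where "e = (fact d :: nat)"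
 define q where "q i = e div (d - i)" for i
 have e: "e > 0" by (simp add: e_def)
 have q: "(d - i) * q i = e" "q i > 0" if "i \<in> A" for i
 proof -
  have "i < d - 1" using that A by auto
  then have "d - i dvd e" unfolding e_def by (intro dvd_fact) auto
  then show "(d - i) * q i = e" by (simp add: q_def)
  then show "q i > 0" using e by (metis gr0I mult_0_right)
 qed
 have finA: "finite A" using A(2) finite_subset by blast
 obtain dl0 ug where ug: "supp_in S' dl0" "dep S' ug" "hol_at ug 0" "ug 0 ~= 0" "\<forall>\<^sub>F z in nhds 0. g z = mon dl0 z * ug z"
  using g(1) by (rule muE)
 define M where "M i al u \<longleftrightarrow> supp_in S' al & dep S' u & hol_at u 0 & u 0 ~= 0 & (\<forall>\<^sub>F z in nhds 0. c i z = mon al z * u z)" for i al u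
 have "\<forall>i\<in>A. \<exists>al u. M i al u" using c(1) unfolding mu_def M_def by blast
 then obtain al u where "!!i. i \<in> A ==> M i (al i) (u i)" by metis
 note au = this[unfolded M_def]
 define bt where "bt i = (%l. q i * al i l)" for i
 have pw: "\<forall>\<^sub>F z in nhds 0. c i z ^ q i = mon (bt i) z * u i z ^ q i" if "i \<in> A" for i
 proof -
  have "\<forall>\<^sub>F z in nhds 0. c i z = mon (al i) z * u i z" using au[OF that] by blast
  then show ?thesis by eventually_elim (simp add: bt_def mon_mult power_mult_distrib)
 qed
 have chain: "bt i \<le> bt j \<or> bt j \<le> bt i" if i: "i \<in> A" and j: "j \<in> A" for i j
 proof (rule monomial_exponents_comparable[of "%z. u i z ^ q i" "%z. u j z ^ q j"])
  from comp[OF i j, folded e_def, folded q_def]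
  show "(\<forall>\<^sub>F z in nhds 0. mon (bt i) z * u i z ^ q i = mon (bt j) z * u j z ^ q j) \<or>
   mu UNIV (%z. mon (bt i) z * u i z ^ q i - mon (bt j) z * u j z ^ q j)"
  proof
   assume "\<forall>\<^sub>F z in nhds 0. c i z ^ q i = c j z ^ q j"
   with pw[OF i] pw[OF j] have "\<forall>\<^sub>F z in nhds 0. mon (bt i) z * u i z ^ q i = mon (bt j) z * u j z ^ q j"
    by eventually_elim simp
   then show ?thesis by blast
  next
   assume "mu S' (%z. c i z ^ q i - c j z ^ q j)"
   then have m: "mu UNIV (%z. c i z ^ q i - c j z ^ q j)" by (rule mu_mono) simp
   have "\<forall>\<^sub>F z in nhds 0. c i z ^ q i - c j z ^ q j = mon (bt i) z * u i z ^ q i - mon (bt j) z * u j z ^ q j"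
    using pw[OF i] pw[OF j] by eventually_elim simp
   from mu_cong_ev[OF m this] show ?thesis by blast
  qed
 qed (use au[OF i] au[OF j] in \<open>auto intro: hol_at_power\<close>)
 obtain i0 where i0: "i0 \<in> A" "!!i. i \<in> A ==> bt i0 \<le> bt i"
  using finite_chain_min[OF finA A(1), of bt] chain by blast
 have "al i0 ~= (%i. 0)"
 proof
  assume "al i0 = (%i. 0)"
  moreover have "\<forall>\<^sub>F z in nhds 0. c i0 z = mon (al i0) z * u i0 z" using au[OF i0(1)] by blast
  ultimately have "c i0 0 = u i0 0" using eventually_nhds_x_imp_x by fastforce
  then show False using c(2)[OF i0(1)] au[OF i0(1)] by simp
 qed
 then have bt0: "bt i0 ~= (%i. 0)" using q(2)[OF i0(1)] by (auto simp: bt_def fun_eq_iff)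
 have suppbt: "supp_in S' (bt i)" if "i \<in> A" for i using au[OF that] by (simp add: supp_in_def bt_def)
 define \<rho> :: "complex ^ 'n => complex ^ 'n" where "\<rho> z = (\<chi> i. if i \<in> S' then z $ i ^ e else z $ i)" for z
 have \<rho>0: "\<rho> 0 = 0" using e by (simp add: \<rho>_def vec_eq_iff)
 have \<rho>k: "\<rho> z $ k = z $ k" for z using k by (simp add: \<rho>_def)
 have ad\<rho>: "adm ?S \<rho>" "adm S' \<rho>" by (auto simp: adm_def \<rho>_def dep_def)
 have hol\<rho>: "hol_at (%z. \<rho> z $ i) x" for i x unfolding \<rho>_def by (cases "i \<in> S'") (auto intro: hol_at_power)
 have lim\<rho>: "filterlim \<rho> (nhds 0) (nhds 0)"
  using isCont_nhds[OF hol_at_map_isCont[OF hol\<rho>, of 0]] \<rho>0 by simp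
 have mon\<rho>: "mon gm (\<rho> z) = mon (%i. e * gm i) z" if "supp_in S' gm" for gm z
  unfolding \<rho>_def by (rule mon_ramify[OF that])
 have hol\<rho>c: "hol_at (%z. f (\<rho> z)) 0" if "hol_at f 0" for f
  by (rule hol_at_compose[of f \<rho> 0, OF _ hol\<rho>]) (use that \<rho>0 in simp)
 \<comment> \<open>For \<open>i = i0\<close> the difference of exponents is zero, so
   \<open>b i0\<close> is a unit. This is the nonzero coefficient on which the argument with a full
   root depends.\<close>
 define b where "b i z = (if i \<in> A then mon (%l. (d - i) * (bt i l - bt i0 l)) z * u i (\<rho> z) else 0)" for i z
 have holb: "hol_at (b i) 0" and depb: "dep ?S (b i)" for i
 proof -
  show "hol_at (b i) 0"
   by (cases "i \<in> A") (auto simp: b_def[abs_def] intro!: hol_at_mult hol_at_mon hol\<rho>c dest: au)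
  show "dep ?S (b i)"
  proof (cases "i \<in> A")
   case True
   have "dep S' (%z. u i (\<rho> z))" using au[OF True] dep_compose[OF _ ad\<rho>(2)] by blast
   moreover have "dep S' (mon (%l. (d - i) * (bt i l - bt i0 l)))"
    by (rule dep_mon) (use suppbt[OF True] in \<open>simp add: supp_in_def\<close>)
   ultimately have "dep S' (%z. mon (%l. (d - i) * (bt i l - bt i0 l)) z * u i (\<rho> z))" by (rule dep_mult[rotated])
   then show ?thesis using dep_mono[of S' _ ?S] True by (auto simp: b_def[abs_def])
  qed (simp add: b_def[abs_def])
 qed
 have cb: "\<forall>\<^sub>F z in nhds 0. c i (\<rho> z) = b i z * mon (bt i0) z ^ (d - i)" if i: "i \<in> A" for i
 proof -
  have "\<forall>\<^sub>F z in nhds 0. c i z = mon (al i) z * u i z" using au[OF i] by blast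
  from eventually_compose_filterlim[OF this lim\<rho>] show ?thesis
  proof eventually_elim
   case (elim z)
   have "(%l. e * al i l) = (%l. (d - i) * (bt i l - bt i0 l) + (d - i) * bt i0 l)"
   proof
    fix l
    have "bt i0 l \<le> bt i l" using i0(2)[OF i] by (simp add: le_fun_def)
    then have "(d - i) * (bt i l - bt i0 l) + (d - i) * bt i0 l = (d - i) * bt i l"
     by (simp add: distrib_left[symmetric])
    also have "\<dots> = e * al i l" using q(1)[OF i] by (simp add: bt_def mult.assoc[symmetric])
    finally show "e * al i l = (d - i) * (bt i l - bt i0 l) + (d - i) * bt i0 l" by simp
   qed
   then have "mon (al i) (\<rho> z) = mon (%l. (d - i) * (bt i l - bt i0 l)) z * mon (bt i0) z ^ (d - i)"
    using mon\<rho>[of "al i" z] au[OF i] by (simp add: mon_add mon_mult[of _ "bt i0"])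
   then show ?case using elim i by (simp add: b_def)
  qed
 qed
 let ?F = "%z. mon (%l. e * dl0 l) z * (E (\<rho> z) * z $ k ^ d + (\<Sum>i<d-1. b i z * mon (bt i0) z ^ (d - i) * z $ k ^ i))"
 have suppd: "supp_in S' (%l. e * dl0 l)" using ug(1) by (simp add: supp_in_def)
 have E\<rho>: "hol_at (%z. E (\<rho> z)) 0" "dep ?S (%z. E (\<rho> z))" using hol\<rho>c[OF E(1)] dep_compose[OF E(2) ad\<rho>(1)] by auto
 have R1: "Res ?S ?F"
 proof (rule Res_form[OF k T, of d])
  show "b i0 0 ~= 0" using i0(1) au[OF i0(1)] \<rho>0 by (simp add: b_def)
  show "i0 + 2 \<le> d" using i0(1) A(2) by auto
 qed (use E\<rho> E \<rho>0 holb depb suppbt[OF i0(1)] bt0 suppd in auto)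
 have dS: "dep ?S f" if "dep S' f" for f using dep_mono[OF that, of ?S] by auto
 have ug\<rho>: "dep ?S (%z. ug (\<rho> z))" using dS[OF dep_compose[OF ug(2) ad\<rho>(2)]] .
 have R2: "Res ?S (%z. ug (\<rho> z) * ?F z)"
  by (rule Res_unit[OF R1 ug\<rho> hol\<rho>c[OF ug(3)]]) (use ug(4) \<rho>0 in simp)
 have "Res ?S (%z. g (\<rho> z) * h (\<rho> z))"
 proof (rule Res_cong_ev[OF R2])
  show "dep ?S (%z. ug (\<rho> z) * ?F z)"
   using ug\<rho> E\<rho> depb dS[OF dep_mon[OF suppd]] dS[OF dep_mon[OF suppbt[OF i0(1)]]]
   by (intro dep_mult dep_add dep_sum dep_power dep_coord) auto
  show "dep ?S (%z. g (\<rho> z) * h (\<rho> z))"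
   using dep_compose[OF dS[OF g(2)] ad\<rho>(1)] dep_compose[OF h(1) ad\<rho>(1)] by (rule dep_mult)
  have "\<forall>\<^sub>F z in nhds 0. \<forall>i\<in>A. c i (\<rho> z) = b i z * mon (bt i0) z ^ (d - i)"
   using finA cb by (intro eventually_ball_finite) auto
  with eventually_compose_filterlim[OF h(2) lim\<rho>] eventually_compose_filterlim[OF ug(5) lim\<rho>]
  show "\<forall>\<^sub>F z in nhds 0. ug (\<rho> z) * ?F z = g (\<rho> z) * h (\<rho> z)"
  proof eventually_elim
   case (elim z)
   have "(\<Sum>i\<in>A. c i (\<rho> z) * z $ k ^ i) = (\<Sum>i\<in>A. b i z * mon (bt i0) z ^ (d - i) * z $ k ^ i)"
    using elim(3) by (intro sum.cong) auto
   also have "\<dots> = (\<Sum>i<d-1. b i z * mon (bt i0) z ^ (d - i) * z $ k ^ i)"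
    by (rule sum.mono_neutral_left) (use A(2) in \<open>auto simp: b_def\<close>)
   finally have "h (\<rho> z) = E (\<rho> z) * z $ k ^ d + (\<Sum>i<d-1. b i z * mon (bt i0) z ^ (d - i) * z $ k ^ i)"
    using elim(1) by (simp add: \<rho>k)
   then show ?case using elim(2) mon\<rho>[OF ug(1), of z] by simp
  qed
 qed
 then show ?thesis unfolding \<rho>_def by (rule Res_ramify[OF k e])
qed

section \<open>Induction on the order and on the number of variables\<close>

lemma hol_at_compose0:
 fixes ps :: "complex ^ 'm::finite => complex ^ 'n::finite"
 assumes "hol_at f 0" "ps 0 = 0" "!!i. hol_at (%x. ps x $ i) 0"
 shows "hol_at (%x. f (ps x)) 0"
 by (rule hol_at_compose[of f ps 0, OF _ assms(3)]) (use assms in simp)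

text \<open>A translation in \<open>z $ k\<close> kills the coefficient of degree
  \<open>d - 1\<close>. The remaining coefficients and the differences of their normalised powers
  involve only \<open>S'\<close>; together with \<open>g\<close> they are multiplied into one germ
  \<open>H\<close>, which \<open>IH\<close> monomialises, and every factor of a monomial times a
  unit is of the same kind. The factor \<open>g\<close> is carried along because blow-ups split off
  exceptional monomials before the order decreases.\<close>

lemma Res_order:
 fixes S' :: "'n::finite set" and k :: 'n
 assumes k: "k \<notin> S'" and IH: "!!h. hol_at h 0 ==> dep S' h ==> nz_germ h ==> Res S' h"
 shows "hol_at g 0 ==> dep S' g ==> nz_germ g ==> hol_at h 0 ==> dep (insert k S') h ==> ord_in k h d ==>
  Res (insert k S') (%z. g z * h z)"
proof (induction d arbitrary: g h rule: less_induct)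
 case (less d)
 note g = less.prems(1-3) and h = less.prems(4-6)
 let ?S = "insert k S'"
 have dS: "dep ?S f" if "dep S' f" for f using dep_mono[OF that, of ?S] by auto
 show ?case
 proof (cases "d = 0")
  case True
  then have h0: "h 0 ~= 0" using h(3) by (simp add: ord_in_def)
  show ?thesis
  proof (rule Res_base[OF k IH[OF g] g(2)])
   fix ps assume ps: "adm S' ps" "!!i. hol_at (%x. ps x $ i) 0" "ps 0 = 0" "mu S' (%x. g (ps x))"
   have ad: "adm ?S ps" by (rule adm_insert[OF ps(1) k])
   have 1: "mu ?S (%x. g (ps x))" by (rule mu_mono[OF ps(4)]) auto
   have 2: "mu ?S (%x. h (ps x))"
    by (rule mu_unit[OF dep_compose[OF h(2) ad] hol_at_compose0[OF h(1) ps(3,2)]]) (use h0 ps(3) in simp)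
   show "Res ?S (%x. g (ps x) * h (ps x))"
    by (rule Res_mu[OF mu_mult[OF 1 2] dep_mult[OF dep_compose[OF dS[OF g(2)] ad] dep_compose[OF h(2) ad]]])
  qed
 next
  case False
  then obtain d' where d': "d = Suc d'" by (cases d) auto
  \<comment> \<open>As the order is exactly \<open>d = Suc d'\<close>, this derivative vanishes at
    the origin while its own \<open>k\<close>-derivative does not. Its zero set is thus a graph over
    the other coordinates, and the translation moves that graph to the hyperplane
    \<open>z $ k = 0\<close>.\<close>
  define G where "G = (pd k ^^ d') h"
  have G: "hol_at G 0" "dep ?S G" "G 0 = 0" "pd k G 0 ~= 0"
   using h ord_in_pd[OF h(1), of k d] by (auto simp: G_def d' hol_at_pd_iter dep_pd_iter)
  obtain ph0 where ph0: "hol_at ph0 0" "ph0 0 = 0" "!!z. ph0 (rk k z) = ph0 z" "\<forall>\<^sub>F z in nhds 0. G (rk k z + ph0 z *s ax k) = 0"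
   using hol_implicit[OF G(1,3,4)] by blast
  define ph where "ph z = ph0 (restr ?S z)" for z
  have rr: "restr ?S (rk k z) = rk k (restr ?S z)" for z by (auto simp: vec_eq_iff)
  have ph: "hol_at ph 0" "ph 0 = 0" "!!z. ph (rk k z) = ph z"
   unfolding ph_def using hol_at_compose0[OF ph0(1) restr_0 hol_at_restr] ph0(2,3) by (auto simp: rr)
  have depph: "dep S' ph" unfolding dep_def
  proof (intro allI impI)
   fix z w :: "complex ^ 'n" assume "\<forall>i\<in>S'. z $ i = w $ i"
   then have "rk k (restr ?S z) = rk k (restr ?S w)" by (auto simp: vec_eq_iff)
   then show "ph z = ph w" unfolding ph_def using ph0(3) by metis
  qed
  have "filterlim (restr ?S) (nhds 0) (nhds 0)"
   using isCont_nhds[OF hol_at_map_isCont[of "restr ?S" 0, OF hol_at_restr]] by simp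
  from eventually_compose_filterlim[OF ph0(4) this]
  have Gph: "\<forall>\<^sub>F z in nhds 0. G (rk k z + ph z *s ax k) = 0"
  proof eventually_elim
   case (elim z)
   have "G (rk k z + ph z *s ax k) = G (rk k (restr ?S z) + ph0 (restr ?S z) *s ax k)"
    by (rule depD[OF G(2)]) (auto simp: ph_def)
   then show ?case using elim by simp
  qed
  define h' where "h' z = h (z + ph z *s ax k)" for z
  have "hol_at (%z. (z + ph z *s ax k) $ i) 0" for i
   using ph(1) by (auto simp: axis_def intro!: hol_at_add hol_at_mult)
  then have holh': "hol_at h' 0" unfolding h'_def using hol_at_compose0[OF h(1), of "%z. z + ph z *s ax k"] ph(2) by simp
  have deph': "dep ?S h'" unfolding dep_def
  proof (intro allI impI)
   fix z w :: "complex ^ 'n" assume zw: "\<forall>i\<in>?S. z $ i = w $ i"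
   then have "ph z = ph w" by (intro depD[OF depph]) auto
   then show "h' z = h' w" unfolding h'_def using zw by (intro depD[OF h(2)]) auto
  qed
  have pdh': "(pd k ^^ i) h' = (%z. (pd k ^^ i) h (z + ph z *s ax k))" for i
   unfolding h'_def[abs_def] by (rule pd_translate[of ph k, OF ph(3)])
  have ordh': "ord_in k h' d" unfolding ord_in_pd[OF holh'] pdh' using h(3) ord_in_pd[OF h(1), of k d] ph(2) by simp
  have "Res ?S (%z. g z * h' z)"
  proof -
   define c where "c i z = (dv k ^^ i) h' (rk k z)" for i z
   define E where "E = (dv k ^^ d) h'"
   have rk0: "rk k 0 = 0" by (simp add: vec_eq_iff)
   have E: "hol_at E 0" "dep ?S E" "E 0 ~= 0"
    using ordh' by (auto simp: E_def ord_in_def holh' deph' hol_at_dv_iter dep_dv_iter)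
   have holc: "hol_at (c i) 0" for i
    unfolding c_def by (rule hol_at_compose0[OF hol_at_dv_iter[OF holh'] rk0 hol_at_rk])
   have depc: "dep S' (c i)" for i unfolding dep_def c_def
   proof (intro allI impI)
    fix z w :: "complex ^ 'n" assume "\<forall>i\<in>S'. z $ i = w $ i"
    then show "(dv k ^^ i) h' (rk k z) = (dv k ^^ i) h' (rk k w)"
     by (intro depD[OF dep_dv_iter[OF deph', of k]]) auto
   qed
   have c0: "c i 0 = 0" if "i < d" for i using ordh' that by (simp add: c_def rk0 ord_in_def)
   \<comment> \<open>Up to a factorial, \<open>c d'\<close> is the derivative of order
     \<open>d'\<close> on the hyperplane, which vanishes there after the translation.\<close>
   have "\<forall>\<^sub>F z in nhds 0. c d' z = 0"
    using Gph pd_dv_rk[OF holh', of d' k]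
   proof eventually_elim
    case (elim z)
    have "(pd k ^^ d') h' (rk k z) = 0" unfolding pdh' using elim(1) by (simp add: G_def ph(3))
    then show ?case using elim(2) by (simp add: c_def)
   qed
   then have exp: "\<forall>\<^sub>F z in nhds 0. h' z = E z * z $ k ^ d + (\<Sum>i<d-1. c i z * z $ k ^ i)"
   proof eventually_elim
    case (elim z)
    then show ?case using taylor_dv[of h' z k d] by (simp add: d' c_def E_def mult.commute add.commute)
   qed
   define A where "A = {i. i < d - 1 & nz_germ (c i)}"
   have finA: "finite A" by (simp add: A_def)
   have "\<forall>\<^sub>F z in nhds 0. \<forall>i\<in>{..<d-1} - A. c i z = 0"
    by (intro eventually_ball_finite) (auto simp: A_def nz_germ_def)
   with exp have expA: "\<forall>\<^sub>F z in nhds 0. h' z = E z * z $ k ^ d + (\<Sum>i\<in>A. c i z * z $ k ^ i)"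
   proof eventually_elim
    case (elim z)
    have "(\<Sum>i\<in>A. c i z * z $ k ^ i) = (\<Sum>i<d-1. c i z * z $ k ^ i)"
     by (rule sum.mono_neutral_left) (use elim(2) in \<open>auto simp: A_def\<close>)
    then show ?case using elim(1) by simp
   qed
   define q :: "nat => nat" where "q i = fact d div (d - i)" for i
   \<comment> \<open>Pairs whose difference vanishes identically are omitted so that
     \<open>H\<close> is a nonzero germ; for them the equality alternative of the comparability
     condition holds.\<close>
   define X where "X = {p \<in> A \<times> A. nz_germ (%z. c (fst p) z ^ q (fst p) - c (snd p) z ^ q (snd p))}"
   have "finite (A \<times> A)" using finA by simp
   then have finX: "finite X" unfolding X_def by (rule rev_finite_subset) auto
   define D where "D p z = c (fst p) z ^ q (fst p) - c (snd p) z ^ q (snd p)" for p z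
   have D: "hol_at (D p) 0" "dep S' (D p)" for p
    using hol_at_diff[OF hol_at_power[OF holc] hol_at_power[OF holc], of "fst p" "q (fst p)" "snd p" "q (snd p)"]
     dep_diff[OF dep_power[OF depc] dep_power[OF depc], of "fst p" "q (fst p)" "snd p" "q (snd p)"]
    by (simp_all add: D_def[abs_def])
   define H1 where "H1 z = (\<Prod>i\<in>A. c i z)" for z
   define H2 where "H2 z = (\<Prod>p\<in>X. D p z)" for z
   define H where "H z = g z * (H1 z * H2 z)" for z
   have H1: "hol_at H1 0" "dep S' H1" "nz_germ H1"
    unfolding H1_def[abs_def] using hol_at_prod[of A c 0, OF holc] dep_prod[of A S' c, OF depc]
     nz_germ_prod[OF finA holc] by (simp_all add: A_def)
   have H2: "hol_at H2 0" "dep S' H2" "nz_germ H2"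
    unfolding H2_def[abs_def] using hol_at_prod[of X D 0, OF D(1)] dep_prod[of X S' D, OF D(2)]
     nz_germ_prod[OF finX D(1)] by (simp_all add: X_def D_def[abs_def])
   have H: "hol_at H 0" "dep S' H" "nz_germ H"
    unfolding H_def[abs_def]
    using hol_at_mult[OF g(1) hol_at_mult[OF H1(1) H2(1)]] dep_mult[OF g(2) dep_mult[OF H1(2) H2(2)]]
     nz_germ_mult[OF g(1) hol_at_mult[OF H1(1) H2(1)] g(3) nz_germ_mult[OF H1(1) H2(1) H1(3) H2(3)]] by auto
   show ?thesis
   proof (rule Res_base[OF k IH[OF H] H(2)])
    fix ps assume ps: "adm S' ps" "!!i. hol_at (%x. ps x $ i) 0" "ps 0 = 0" "mu S' (%x. H (ps x))"
    have ad: "adm ?S ps" by (rule adm_insert[OF ps(1) k])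
    have psk: "ps x $ k = x $ k" for x using adm_nth[OF ps(1) k] by simp
    have lim: "filterlim ps (nhds 0) (nhds 0)"
     using isCont_nhds[OF hol_at_map_isCont[OF ps(2)]] ps(3) by simp
    note hc = hol_at_compose0[OF _ ps(3,2)] and dc = dep_compose[OF _ ps(1)]
    have "mu S' (%x. g (ps x) * (H1 (ps x) * H2 (ps x)))" using ps(4) by (simp add: H_def)
    then have mg: "mu S' (%x. g (ps x))" and m12: "mu S' (%x. H1 (ps x) * H2 (ps x))"
     using mu_factor[OF hc[OF g(1)] hol_at_mult[OF hc[OF H1(1)] hc[OF H2(1)]] _ dc[OF g(2)]]
      mu_factor[OF hol_at_mult[OF hc[OF H1(1)] hc[OF H2(1)]] hc[OF g(1)] _ dep_mult[OF dc[OF H1(2)] dc[OF H2(2)]]]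
     by (simp_all add: mult.commute)
    have m1: "mu S' (%x. H1 (ps x))" by (rule mu_factor[OF hc[OF H1(1)] hc[OF H2(1)] m12 dc[OF H1(2)]])
    have m2: "mu S' (%x. H2 (ps x))"
     by (rule mu_factor[OF hc[OF H2(1)] hc[OF H1(1)] _ dc[OF H2(2)]]) (use m12 in \<open>simp add: mult.commute\<close>)
    have mc: "mu S' (%x. c i (ps x))" if "i \<in> A" for i
     using nz_germ_prod_mu_factor[OF finA that hc[OF holc] m1[unfolded H1_def] dc[OF depc]] .
    have mD: "mu S' (%x. D p (ps x))" if "p \<in> X" for p
     using nz_germ_prod_mu_factor[OF finX that hc[OF D(1)] m2[unfolded H2_def] dc[OF D(2)]] .
    have Eps: "hol_at (%x. E (ps x)) 0" "dep ?S (%x. E (ps x))" "E (ps 0) ~= 0"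
     using hc[OF E(1)] dep_compose[OF E(2) ad] E(3) ps(3) by auto
    have hps: "dep ?S (%x. h' (ps x))" by (rule dep_compose[OF deph' ad])
    have expps: "\<forall>\<^sub>F x in nhds 0. h' (ps x) = E (ps x) * x $ k ^ d + (\<Sum>i\<in>A. c i (ps x) * x $ k ^ i)"
     using eventually_compose_filterlim[OF expA lim] by (simp add: psk)
    show "Res ?S (%x. g (ps x) * h' (ps x))"
    proof (cases "A = {}")
     case True
     have "mu ?S (%x. g (ps x) * (E (ps x) * x $ k ^ d))"
      by (intro mu_mult mu_mono[OF mg] mu_power mu_coord mu_unit Eps) auto
     moreover have "\<forall>\<^sub>F x in nhds 0. g (ps x) * (E (ps x) * x $ k ^ d) = g (ps x) * h' (ps x)"
      using expps by eventually_elim (simp add: True)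
     ultimately have "mu ?S (%x. g (ps x) * h' (ps x))" by (rule mu_cong_ev)
     then show ?thesis by (rule Res_mu[OF _ dep_mult[OF dep_compose[OF dS[OF g(2)] ad] hps]])
    next
     case False
     show ?thesis
     proof (rule Res_monomial_coeffs[OF k less.IH mg dc[OF g(2)] False _ mc _ _ Eps hps expps])
      show "A \<subseteq> {..<d-1}" by (auto simp: A_def)
      show "c i (ps 0) = 0" if "i \<in> A" for i using c0[of i] that ps(3) by (auto simp: A_def)
      fix i j assume ij: "i \<in> A" "j \<in> A"
      show "(\<forall>\<^sub>F z in nhds 0. c i (ps z) ^ (fact d div (d - i)) = c j (ps z) ^ (fact d div (d - j))) \<or>
       mu S' (%z. c i (ps z) ^ (fact d div (d - i)) - c j (ps z) ^ (fact d div (d - j)))"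
      proof (cases "(i, j) \<in> X")
       case True
       from mD[OF this] show ?thesis by (simp add: D_def q_def)
      next
       case False
       then have "\<forall>\<^sub>F z in nhds 0. c i z ^ q i - c j z ^ q j = 0" using ij by (simp add: X_def nz_germ_def)
       from eventually_compose_filterlim[OF this lim] show ?thesis by (simp add: q_def)
      qed
     qed
    qed
   qed
  qed
  moreover have "g (z + ph z *s ax k) = g z" for z
   by (rule depD[OF g(2)]) (use k in \<open>auto simp: axis_def\<close>)
  ultimately have "Res ?S (%z. g (z + ph z *s ax k) * h (z + ph z *s ax k))" by (simp add: h'_def)
  then show ?thesis by (rule Res_translate[OF k ph(1,2) depph, of "%z. g z * h z"])
 qed
qed

text \<open>Adding one active variable \<open>k\<close>: a line through a point with
  \<open>h a ~= 0\<close> and \<open>a $ k ~= 0\<close> is turned into the \<open>k\<close>-axis, so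
  that \<open>h\<close> has a finite order in \<open>z $ k\<close>, and \<open>Res_order\<close>
  applies with the trivial factor 1. With no active variable a nonzero germ is a nonzero
  constant.\<close>

theorem resolvable:
 fixes S :: "'n::finite set"
 assumes "hol_at h 0" "dep S h" "nz_germ h"
 shows "Res S h"
 using finite[of S] assms
proof (induction S arbitrary: h rule: finite_induct)
 case empty
 have "h z = h 0" for z by (rule depD[OF empty(2)]) simp
 moreover have "\<exists>z. h z ~= 0" using empty(3) unfolding nz_germ_def by (meson always_eventually)
 ultimately have "h 0 ~= 0" by metis
 then show ?case by (intro Res_mu mu_unit empty)
next
 case (insert k S')
 let ?S = "insert k S'"
 obtain r where r: "r > 0" "hol h (ball 0 r)" using insert.prems(1) hol_at_ball by blast
 have "\<exists>a\<in>sub ?S. a $ k ~= 0 & norm a < r & h a ~= 0"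
 proof -
  have "nz_germ (%z. z $ k * h z)"
   by (intro nz_germ_mult nz_germ_coord insert.prems hol_at_coord)
  then obtain a where a: "norm a < r" "a $ k * h a ~= 0"
   using r(1) unfolding nz_germ_def eventually_nhds_metric by (auto simp: dist_norm)
  have "norm (restr ?S a) \<le> norm a" by (rule norm_vec_le) auto
  then show ?thesis using a restr_sub[of ?S a] dep_restr[OF insert.prems(2), of a]
   by (intro bexI[of _ "restr ?S a"]) auto
 qed
 then obtain a where a: "a \<in> sub ?S" "a $ k ~= 0" "norm a < r" "h a ~= 0" by blast
 define h' where "h' z = h (rk k z + z $ k *s a)" for z
 have "hol_at (%z. (rk k z + z $ k *s a) $ i) 0" for i
  by (cases "i = k") (auto intro!: hol_at_add hol_at_mult)
 then have holh': "hol_at h' 0" unfolding h'_def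
  using hol_at_compose0[OF insert.prems(1), of "%z. rk k z + z $ k *s a"] by (simp add: rk_id)
 have deph': "dep ?S h'" unfolding dep_def
 proof (intro allI impI)
  fix z w :: "complex ^ 'n" assume "\<forall>i\<in>?S. z $ i = w $ i"
  then show "h' z = h' w" unfolding h'_def by (intro depD[OF insert.prems(2)]) auto
 qed
 \<comment> \<open>If all derivatives along the line vanished at 0, the one-variable identity
   theorem would propagate the zero to the point \<open>a\<close>.\<close>
 have "\<exists>m. (dv k ^^ m) h' 0 ~= 0"
 proof (rule ccontr)
  assume "\<not> ?thesis"
  then have z: "(pd k ^^ m) h' 0 = 0" for m
   using eventually_nhds_x_imp_x[OF pd_dv_rk[OF holh', of m k]] rk_id[of 0 k] by simp
  let ?f = "%ze. h (0 + ze *s a)"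
  have f_eq: "h' (ze *s ax k) = ?f ze" for ze
  proof -
   have "rk k (ze *s ax k) + (ze *s ax k) $ k *s a = ze *s a" by (simp add: vec_eq_iff axis_def)
   then show ?thesis by (simp add: h'_def)
  qed
  let ?T = "{ze. 0 + ze *s a \<in> ball 0 r}"
  have holf: "?f holomorphic_on ?T" by (rule hol_slice[OF r(2)])
  have der: "(deriv ^^ m) ?f 0 = 0" for m
  proof -
   have "\<forall>\<^sub>F ze in nhds 0. (deriv ^^ m) ?f ze = (pd k ^^ m) h' (0 + ze *s ax k)"
   proof (induction m)
    case 0 then show ?case using f_eq by simp
   next
    case (Suc m)
    have "\<forall>\<^sub>F ze in nhds 0. deriv ((deriv ^^ m) ?f) ze = deriv (%ze. (pd k ^^ m) h' (0 + ze *s ax k)) ze"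
    proof -
     have "\<forall>\<^sub>F ze in nhds 0. \<forall>\<^sub>F \<xi> in nhds ze. (deriv ^^ m) ?f \<xi> = (pd k ^^ m) h' (0 + \<xi> *s ax k)"
      using Suc by (simp add: eventually_eventually)
     then show ?thesis by eventually_elim (rule deriv_cong_ev[OF _ refl])
    qed
    then show ?case
    proof eventually_elim
     case (elim ze)
     have "deriv (%ze. (pd k ^^ m) h' (0 + ze *s ax k)) ze = pd k ((pd k ^^ m) h') (0 + ze *s ax k)"
     proof -
      have "deriv (%\<xi>. g (0 + \<xi> *s ax k)) ze = deriv (%\<xi>. g (0 + (ze + \<xi>) *s ax k)) 0" for g :: "complex ^ 'n => complex"
       using deriv_shift_0[of "%\<xi>. g (0 + \<xi> *s ax k)" ze] by (simp add: o_def add.commute)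
      then show ?thesis by (simp add: pd_def vec.scale_left_distrib add.assoc)
     qed
     then show ?case using elim by simp
    qed
   qed
   from eventually_nhds_x_imp_x[OF this] show ?thesis using z by simp
  qed
  have conv: "convex ?T"
  proof (rule convexI)
   fix x y :: complex and u v :: real assume *: "x \<in> ?T" "y \<in> ?T" "0 \<le> u" "0 \<le> v" "u + v = 1"
   have "norm (u *\<^sub>R (x *s a) + v *\<^sub>R (y *s a)) < r"
    using * convexD[OF convex_ball[of 0 r], of "x *s a" "y *s a" u v] by simp
   moreover have "(u *\<^sub>R x + v *\<^sub>R y) *s a = u *\<^sub>R (x *s a) + v *\<^sub>R (y *s a)"
    by (simp add: vec_eq_iff algebra_simps)
   ultimately show "u *\<^sub>R x + v *\<^sub>R y \<in> ?T" by (simp del: norm_vector_smult)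
  qed
  have "?f 1 = 0"
   by (rule holomorphic_fun_eq_0_on_connected[OF holf open_slice[OF open_ball] convex_connected[OF conv], of 0])
    (use der a r in auto)
  then show False using a(4) by (simp add: vec_eq_iff)
 qed
 then obtain m0 where "(dv k ^^ m0) h' 0 ~= 0" by blast
 then obtain m where m: "ord_in k h' m" using ord_in_exists[OF holh', of m0 "Suc m0" k] by blast
 have "Res ?S (%z. 1 * h' z)"
  by (rule Res_order[OF insert(2) insert.IH _ _ _ holh' deph' m]) (auto intro: nz_germI)
 then show ?case using Res_linear[of k ?S a h] a by (simp add: h'_def)
qed

section \<open>Logarithmic vector fields\<close>

definition dd :: "(complex ^ 'n::finite => complex) => complex ^ 'n => complex ^ 'n => complex" where
 "dd g z v = (\<Sum>j\<in>UNIV. v $ j * pd j g z)"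

lemma dd_smult: "dd g z (c *s v) = c * dd g z v"
 by (simp add: dd_def sum_distrib_left mult.assoc)

lemma dd_diff: "dd g z (v - w) = dd g z v - dd g z w"
 by (simp add: dd_def sum_subtractf left_diff_distrib)

lemma chain_pd:
 fixes pj :: "complex ^ 'm::finite => complex ^ 'n::finite"
 assumes "hol_at g (pj x)" and p: "!!i. hol_at (%z. pj z $ i) x"
 shows "pd i (%x. g (pj x)) x = (\<Sum>j\<in>UNIV. pd i (%x. pj x $ j) x * pd j g (pj x))"
proof -
 obtain V where V: "pj x \<in> V" "hol g V" using assms by (auto simp: hol_at_def)
 have "\<forall>\<^sub>F z in nhds x. pj z \<in> V"
  using topological_tendstoD[OF isCont_nhds[OF hol_at_map_isCont[OF p]] hol_open[OF V(2)] V(1)] .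
 moreover have "\<forall>\<^sub>F z in nhds x. \<forall>i. hol_at (%z. pj z $ i) z"
  using hol_at_eventually[OF p] by (rule eventually_all_finite)
 ultimately have "\<forall>\<^sub>F z in nhds x. pj z \<in> V & (\<forall>i. hol_at (%z. pj z $ i) z)" by eventually_elim blast
 then obtain U where U: "open U" "x \<in> U" "!!z. z \<in> U ==> pj z \<in> V & (\<forall>i. hol_at (%z. pj z $ i) z)"
  unfolding eventually_nhds by blast
 show ?thesis
 proof (rule hol_compose_pd[OF V(2) _ _ U(2)])
  show "hol (%z. pj z $ i) U" for i
   by (rule hol_local[OF U(1)]) (use U(3) in \<open>auto simp: hol_at_def\<close>)
  show "pj ` U \<subseteq> V" using U(3) by blast
 qed
qed

lemma eventually_nhds_seq:
 assumes "x \<longlonglongrightarrow> a" "\<forall>\<^sub>F z in nhds a. P z"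
 shows "\<forall>\<^sub>F m in sequentially. P (x m)"
 using eventually_compose_filterlim[OF assms(2,1)] .

lemma sub_UNIV [simp]: "sub UNIV = UNIV"
 by (simp add: sub_def)

lemma dep_UNIV [simp]: "dep UNIV h"
 by (simp add: dep_def vec_eq_iff[symmetric])

section \<open>Charts along sequences tending to the origin\<close>

lemma resolution_charts:
 fixes h :: "complex ^ 'n::finite => complex"
 assumes "hol_at h 0" "nz_germ h"
 obtains \<nu> and F :: "(complex ^ 'n => complex ^ 'n) set" where "\<nu> > 0" "finite F"
  "!!pj i w. pj \<in> F ==> w \<in> cpoly UNIV (%i. 1/2) ==> hol_at (%w. pj w $ i) w"
  "!!pj w. pj \<in> F ==> w \<in> cpoly UNIV (%i. 1/2) ==> mu UNIV (%x. h (pj (w + x)))"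
  "!!z. z \<in> cyl UNIV \<nu> ==> \<exists>pj\<in>F. z \<in> pj ` cpoly UNIV (%i. 1/2)"
proof -
 obtain \<nu> F where F: "\<nu> > 0" "finite F" "\<forall>pj\<in>F. good_chart UNIV 1 h pj"
  "\<forall>z\<in>sub UNIV \<inter> cyl UNIV \<nu>. \<exists>pj\<in>F. \<exists>w\<in>sub UNIV \<inter> cyl UNIV (1/2). pj w = z"
  using resolvable[OF assms(1) dep_UNIV assms(2)] unfolding Res_def by (metis zero_less_one)
 have cp: "w \<in> cyl UNIV 1" if "w \<in> cpoly UNIV (%i. 1/2)" for w :: "complex ^ 'n"
  unfolding cyl_def
 proof (intro CollectI ballI)
  fix i have "cmod (w $ i) \<le> 1/2" using that by (simp add: cpoly_def)
  then show "cmod (w $ i) < 1" by linarith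
 qed
 have pc: "w \<in> cpoly UNIV (%i. 1/2)" if "w \<in> cyl UNIV (1/2)" for w :: "complex ^ 'n"
  using that by (simp add: cyl_def cpoly_def less_imp_le)
 show ?thesis
 proof (rule that[OF F(1,2)])
  show "hol_at (%w. pj w $ i) w" if "pj \<in> F" "w \<in> cpoly UNIV (%i. 1/2)" for pj i w
   using F(3) that(1) hol_atI[OF _ cp[OF that(2)]] unfolding good_chart_def by blast
  show "mu UNIV (%x. h (pj (w + x)))" if "pj \<in> F" "w \<in> cpoly UNIV (%i. 1/2)" for pj w
   by (rule good_chart_mu[OF _ cp[OF that(2)]]) (use F(3) that(1) in auto)
  show "\<exists>pj\<in>F. z \<in> pj ` cpoly UNIV (%i. 1/2)" if "z \<in> cyl UNIV \<nu>" for z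
  proof -
   have "\<exists>pj\<in>F. \<exists>w\<in>cyl UNIV (1/2). pj w = z" using F(4) that by simp
   then show ?thesis using pc by (elim bexE) (intro bexI image_eqI[OF sym], assumption, simp, assumption)
  qed
 qed
qed

text \<open>There are finitely many charts with compact domains, so one of them is hit infinitely
  often and the preimages have a convergent subsequence. An estimate near the origin can thus be
  refuted along a sequence that sits at a single chart centre.\<close>

lemma seq_in_charts:
 fixes z :: "nat => complex ^ 'n::finite" and F :: "(complex ^ 'n => complex ^ 'n) set"
 assumes F: "\<nu> > 0" "finite F"
  "!!pj i w. pj \<in> F ==> w \<in> cpoly UNIV (%i. 1/2) ==> hol_at (%w. pj w $ i) w"
  "!!z. z \<in> cyl UNIV \<nu> ==> \<exists>pj\<in>F. z \<in> pj ` cpoly UNIV (%i. 1/2)"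
  and z0: "z \<longlonglongrightarrow> 0"
 shows "\<exists>pj w w0 r. pj \<in> F & w0 \<in> cpoly UNIV (%i. 1/2) & pj w0 = 0 & w \<longlonglongrightarrow> w0 & strict_mono (r :: nat => nat) & (\<forall>m. z (r m) = pj (w m))"
proof -
 let ?K = "cpoly UNIV (%i. 1/2) :: (complex ^ 'n) set"
 have "\<forall>\<^sub>F m in sequentially. z m \<in> cyl UNIV \<nu>"
  by (rule eventually_nhds_seq[OF z0 cyl_nhds[OF F(1)]])
 then obtain M where M: "!!m. m \<ge> M ==> z m \<in> cyl UNIV \<nu>" unfolding eventually_sequentially by blast
 define G where "G m pj w \<longleftrightarrow> pj \<in> F & w \<in> ?K & z (m + M) = pj w" for m pj w
 have "\<forall>m. \<exists>pj w. G m pj w"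
 proof
  fix m have "z (m + M) \<in> cyl UNIV \<nu>" by (rule M) simp
  then obtain pj where "pj \<in> F" "z (m + M) \<in> pj ` ?K" using F(4) by blast
  then show "\<exists>pj w. G m pj w" unfolding G_def by blast
 qed
 then obtain p w where pw: "!!m. G m (p m) (w m)" by metis
 have pF: "p m \<in> F" and wK: "w m \<in> ?K" and zp: "z (m + M) = p m (w m)" for m
  using pw[of m] by (auto simp: G_def)
 have "\<exists>pj\<in>F. infinite {m. p m = pj}"
 proof -
  have "range p \<subseteq> F" using pF by blast
  then have "finite (range p)" using F(2) finite_subset by blast
  then obtain a where a: "infinite (p -` {p a})"
   using inf_img_fin_dom[of p UNIV] by auto
  then show ?thesis using pF[of a] by (intro bexI[of _ "p a"]) (auto simp: vimage_def)
 qed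
 then obtain pj where pj: "pj \<in> F" "infinite {m. p m = pj}" by blast
 define s where "s = enumerate {m. p m = pj}"
 have s: "strict_mono s" "!!m. p (s m) = pj"
  using pj(2) enumerate_in_set[OF pj(2)] by (auto simp: s_def strict_mono_enumerate)
 have "seq_compact ?K" using compact_cpoly compact_eq_seq_compact_metric by blast
 then obtain w0 t where t: "w0 \<in> ?K" "strict_mono t" "(%m. w (s (t m))) \<longlonglongrightarrow> w0"
  using wK by (elim seq_compactE[of ?K "%m. w (s m)"]) (auto simp: o_def)
 define r where "r m = s (t m) + M" for m
 have rm: "strict_mono r"
  using strict_monoD[OF s(1)] strict_monoD[OF t(2)] by (auto simp: r_def strict_mono_def)
 have zr: "z (r m) = pj (w (s (t m)))" for m
  by (simp add: r_def zp s(2))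
 have "pj w0 = 0"
 proof -
  have "(%m. pj (w (s (t m)))) \<longlonglongrightarrow> pj w0"
   using filterlim_compose[OF isCont_nhds[OF hol_at_map_isCont[OF F(3)[OF pj(1) t(1)]]] t(3)] .
  moreover have "(%m. pj (w (s (t m)))) \<longlonglongrightarrow> 0"
   using LIMSEQ_subseq_LIMSEQ[OF z0 rm] by (simp add: o_def zr)
  ultimately show ?thesis by (rule LIMSEQ_unique)
 qed
 then show ?thesis using pj(1) t(1,3) rm zr
  by (intro exI[of _ pj] exI[of _ "%m. w (s (t m))"] exI[of _ w0] exI[of _ r]) simp
qed

lemma seq_chart:
 fixes h :: "complex ^ 'n::finite => complex" and z :: "nat => complex ^ 'n"
 assumes "hol_at h 0" "nz_germ h" "z \<longlonglongrightarrow> 0"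
 obtains pj :: "complex ^ 'n => complex ^ 'n" and x r where "!!i. hol_at (%w. pj w $ i) 0" "pj 0 = 0" "mu UNIV (%x. h (pj x))"
  "x \<longlonglongrightarrow> 0" "strict_mono (r :: nat => nat)" "!!m. z (r m) = pj (x m)"
proof -
 obtain \<nu> and F :: "(complex ^ 'n => complex ^ 'n) set" where F: "\<nu> > 0" "finite F"
  "!!pj i w. pj \<in> F ==> w \<in> cpoly UNIV (%i. 1/2) ==> hol_at (%w. pj w $ i) w"
  "!!pj w. pj \<in> F ==> w \<in> cpoly UNIV (%i. 1/2) ==> mu UNIV (%x. h (pj (w + x)))"
  "!!z. z \<in> cyl UNIV \<nu> ==> \<exists>pj\<in>F. z \<in> pj ` cpoly UNIV (%i. 1/2)"
  by (rule resolution_charts[OF assms(1,2)]) (rule that; (assumption | simp))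
 have "\<exists>pj w w0 r. pj \<in> F & w0 \<in> cpoly UNIV (%i. 1/2) & pj w0 = 0 & w \<longlonglongrightarrow> w0 & strict_mono (r :: nat => nat) & (\<forall>m. z (r m) = pj (w m))"
  by (rule seq_in_charts[OF F(1,2) F(3) F(5) assms(3)])
 then obtain pj w w0 r where c: "pj \<in> F" "w0 \<in> cpoly UNIV (%i. 1/2)" "pj w0 = 0" "w \<longlonglongrightarrow> w0" "strict_mono (r :: nat => nat)"
  "\<forall>m. z (r m) = pj (w m)"
  by (elim exE conjE)
 define pj' where "pj' x = pj (w0 + x)" for x
 define x where "x m = w m - w0" for m
 have hol: "hol_at (%w. pj' w $ i) 0" for i
  unfolding pj'_def by (rule hol_at_compose[of "%w. pj w $ i" "%x. w0 + x"]) (use F(3)[OF c(1,2)] in \<open>auto intro: hol_at_add\<close>)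
 have x0: "x \<longlonglongrightarrow> 0" unfolding x_def using tendsto_diff[OF c(4) tendsto_const[of w0]] by simp
 have zr: "z (r m) = pj' (x m)" for m by (simp add: c(6) pj'_def x_def)
 have mu': "mu UNIV (%x. h (pj' x))" unfolding pj'_def by (rule F(4)[OF c(1,2)])
 show ?thesis by (rule that[OF hol _ mu' x0 c(5) zr]) (simp add: pj'_def c(3))
qed

section \<open>Logarithmic derivatives and logarithmically critical values\<close>

lemma pd_mon: "x $ i * pd i (mon gm) x = of_nat (gm i) * mon gm x"
proof -
 have eq: "mon gm = (%z. z $ i ^ gm i * mon (gm(i := 0)) z)" by (rule ext) (rule mon_split)
 have 1: "pd i (mon (gm(i := 0))) x = 0"
 proof (rule pd_unique)
  have "mon (gm(i := 0)) (x + ze *s ax i) = mon (gm(i := 0)) x" for ze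
   by (rule mon_cong) (auto simp: axis_def split: if_splits)
  then show "((%ze. mon (gm(i := 0)) (x + ze *s ax i)) has_field_derivative 0) (at 0)" by simp
 qed
 have 2: "pd i (%z. z $ i ^ m) x = of_nat m * x $ i ^ (m - 1)" for m
  by (rule pd_unique) (auto simp: axis_def intro!: derivative_eq_intros)
 have "pd i (mon gm) x = of_nat (gm i) * x $ i ^ (gm i - 1) * mon (gm(i := 0)) x"
  by (subst eq) (simp add: pd_mult hol_at_power hol_at_mon 1 2)
 then show ?thesis by (cases "gm i") (simp_all add: mon_split[of gm x i])
qed

text \<open>The operator \<open>x $ i * pd i\<close> multiplies a monomial by its exponent. On the
  unit it adds the relative error \<open>x $ i * pd i u x / u x\<close>, which tends to 0 at the
  origin.\<close>

lemma mu_log_derivative: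
 fixes g :: "complex ^ 'n::finite => complex"
 assumes u: "hol_at u 0" "u 0 ~= 0" "\<forall>\<^sub>F z in nhds 0. g z = mon gm z * u z" and "ep > 0"
 shows "\<forall>\<^sub>F x in nhds 0. hol_at g x & (\<forall>i. cmod (x $ i * pd i g x - of_nat (gm i) * g x) \<le> ep * cmod (g x))"
proof -
 have small: "\<forall>\<^sub>F x in nhds 0. \<forall>i. cmod (x $ i * pd i u x / u x) < ep"
 proof (rule eventually_all_finite)
  fix i
  have h: "hol_at (%x. x $ i * pd i u x / u x) 0"
   by (intro hol_at_divide hol_at_mult hol_at_coord hol_at_pd u)
  show "\<forall>\<^sub>F x in nhds 0. cmod (x $ i * pd i u x / u x) < ep"
   using tendstoD[OF isCont_nhds[OF hol_at_isCont[OF h]] assms(4)] by simp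
 qed
 have evev: "\<forall>\<^sub>F x in nhds 0. \<forall>\<^sub>F z in nhds x. g z = mon gm z * u z"
  using u(3) by (simp add: eventually_eventually)
 from small evev u(3) hol_at_eventually[OF u(1)] hol_at_nonzero_ev[OF u(1,2)] show ?thesis
 proof eventually_elim
  case (elim x)
  have "\<forall>\<^sub>F z in nhds x. mon gm z * u z = g z" using elim(2) by eventually_elim simp
  then have "hol_at g x" by (rule hol_at_cong_ev[OF hol_at_mult[OF hol_at_mon elim(4)]])
  moreover have "cmod (x $ i * pd i g x - of_nat (gm i) * g x) \<le> ep * cmod (g x)" for i
  proof -
   have "pd i g x = pd i (%z. mon gm z * u z) x"
    using eventually_nhds_x_imp_x[OF pd_cong_ev[OF elim(2), of i]] .
   also have "\<dots> = pd i (mon gm) x * u x + mon gm x * pd i u x" by (rule pd_mult[OF hol_at_mon elim(4)])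
   finally have "x $ i * pd i g x = (x $ i * pd i (mon gm) x) * u x + mon gm x * (x $ i * pd i u x)"
    by (simp add: algebra_simps)
   then have "x $ i * pd i g x - of_nat (gm i) * g x = (mon gm x * u x) * (x $ i * pd i u x / u x)"
    using elim(5) by (simp add: pd_mon elim(3))
   then have A: "x $ i * pd i g x - of_nat (gm i) * g x = g x * (x $ i * pd i u x / u x)"
    by (simp only: elim(3)[symmetric])
   have "cmod (x $ i * pd i g x - of_nat (gm i) * g x) = cmod (g x) * cmod (x $ i * pd i u x / u x)"
    unfolding A by (rule norm_mult)
   also have "\<dots> \<le> cmod (g x) * ep" by (intro mult_left_mono less_imp_le[OF elim(1)[rule_format]]) simp
   finally show ?thesis by (simp add: mult.commute)
  qed
  ultimately show ?case by blast
 qed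
qed

text \<open>After monomialisation, an Euler derivative of a nonzero value cannot vanish.\<close>

lemma crit_const:
 fixes F :: "complex ^ 'n::finite => complex"
 assumes F: "hol_at F 0"
 shows "\<forall>\<^sub>F z in nhds 0. (\<forall>i. pd i F z = 0) \<longrightarrow> F z = F 0"
proof (rule ccontr)
 assume neg: "\<not> ?thesis"
 define h where "h z = F z - F 0" for z
 have h: "hol_at h 0" unfolding h_def by (intro hol_at_diff F) simp
 have "\<exists>z. norm z < 1 / real (Suc m) & (\<forall>i. pd i F z = 0) & F z ~= F 0" for m
 proof (rule ccontr)
  assume "\<not> ?thesis"
  then have "\<forall>z. dist z 0 < 1 / real (Suc m) \<longrightarrow> ((\<forall>i. pd i F z = 0) \<longrightarrow> F z = F 0)" by auto
  moreover have "1 / real (Suc m) > 0" by simp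
  ultimately show False using neg unfolding eventually_nhds_metric by blast
 qed
 then obtain z where z: "!!m. norm (z m) < 1 / real (Suc m)" "!!m i. pd i F (z m) = 0" "!!m. F (z m) ~= F 0" by metis
 have z0: "z \<longlonglongrightarrow> 0"
  by (rule Lim_null_comparison[OF _ LIMSEQ_inverse_real_of_nat])
   (use z(1) in \<open>auto intro!: always_eventually less_imp_le simp: inverse_eq_divide\<close>)
 have "nz_germ h" unfolding nz_germ_def
 proof
  assume "\<forall>\<^sub>F z in nhds 0. h z = 0"
  from eventually_nhds_seq[OF z0 this] show False using z(3) by (simp add: h_def)
 qed
 from this z0 obtain pj :: "complex ^ 'n => complex ^ 'n" and x r where c: "!!i. hol_at (%w. pj w $ i) 0" "pj 0 = 0" "mu UNIV (%x. h (pj x))"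
  "x \<longlonglongrightarrow> 0" "strict_mono (r :: nat => nat)" "!!m. z (r m) = pj (x m)"
  by (rule seq_chart[OF h]) (rule that; (assumption | simp))
 obtain gm u where u: "hol_at u 0" "u 0 ~= 0" "\<forall>\<^sub>F z in nhds 0. h (pj z) = mon gm z * u z" using c(3) by (rule muE)
 have "mon gm 0 = 0" using eventually_nhds_x_imp_x[OF u(3)] u(2) c(2) by (simp add: h_def)
 then obtain i where i: "gm i > 0" by (auto simp: mon_eq_0)
 have "\<forall>\<^sub>F y in nhds 0. hol_at F (pj y)"
  using eventually_compose_filterlim[OF hol_at_eventually[OF F] isCont_nhds[OF hol_at_map_isCont[OF c(1)], unfolded c(2)]] .
 moreover have "\<forall>\<^sub>F y in nhds 0. \<forall>i. hol_at (%w. pj w $ i) y"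
  using hol_at_eventually[OF c(1)] by (rule eventually_all_finite)
 moreover have "\<forall>\<^sub>F y in nhds 0. hol_at (%x. h (pj x)) y & (\<forall>i. cmod (y $ i * pd i (%x. h (pj x)) y - of_nat (gm i) * h (pj y)) \<le> (1/2) * cmod (h (pj y)))"
  using mu_log_derivative[OF u, of "1/2"] by simp
 ultimately have "\<forall>\<^sub>F y in nhds 0. (\<forall>i. pd i F (pj y) = 0) \<longrightarrow> h (pj y) = 0"
 proof eventually_elim
  case (elim y)
  show ?case
  proof
   assume cr: "\<forall>i. pd i F (pj y) = 0"
   have "pd j h (pj y) = pd j F (pj y)" for j
   proof (rule pd_unique)
    have "((%ze. F (pj y + ze *s ax j) - F 0) has_field_derivative (pd j F (pj y) - 0)) (at 0)"
     by (intro DERIV_diff hol_at_pd_deriv elim(1) DERIV_const)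
    then show "((%ze. h (pj y + ze *s ax j)) has_field_derivative pd j F (pj y)) (at 0)" by (simp add: h_def)
   qed
   then have "pd i (%x. h (pj x)) y = 0"
    using cr elim(1,2) chain_pd[of h pj y i] by (simp add: h_def[abs_def] hol_at_diff)
   then have "cmod (of_nat (gm i) * h (pj y)) \<le> (1/2) * cmod (h (pj y))" using elim(3)[THEN conjunct2, rule_format, of i] by simp
   then have "real (gm i) * cmod (h (pj y)) \<le> (1/2) * cmod (h (pj y))" by (simp add: norm_mult)
   moreover have "1 * cmod (h (pj y)) \<le> real (gm i) * cmod (h (pj y))" using i by (intro mult_right_mono) auto
   ultimately have "cmod (h (pj y)) \<le> 0" by linarith
   then show "h (pj y) = 0" by simp
  qed
 qed
 from eventually_happens'[OF sequentially_bot eventually_nhds_seq[OF c(4) this]]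
 obtain m where "(\<forall>i. pd i F (pj (x m)) = 0) \<longrightarrow> h (pj (x m)) = 0" by (elim exE)
 then show False unfolding c(6)[symmetric] using z(2) z(3)[of "r m"] by (simp add: h_def)
qed

lemma eventually_nhds_translate:
 fixes y :: "'a::real_normed_vector"
 assumes "\<forall>\<^sub>F x in nhds 0. P (y + x)"
 shows "\<forall>\<^sub>F z in nhds y. P z"
proof -
 have "filterlim (%z. z - y) (nhds (y - y)) (nhds y)" by (intro tendsto_intros filterlim_ident)
 then have "filterlim (%z. z - y) (nhds 0) (nhds y)" by simp
 from eventually_compose_filterlim[OF assms this] show ?thesis by simp
qed

lemma hol_at_translate: "hol_at (%x. f (y + x)) 0 \<longleftrightarrow> hol_at f y"
proof
 assume h: "hol_at (%x. f (y + x)) 0"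
 have "hol_at (%z. (%x. f (y + x)) (z - y)) y"
  by (rule hol_at_compose[of "%x. f (y + x)" "%z. z - y"]) (use h in \<open>auto intro: hol_at_diff\<close>)
 then show "hol_at f y" by simp
next
 assume h: "hol_at f y"
 show "hol_at (%x. f (y + x)) 0"
  by (rule hol_at_compose[of f "%x. y + x"]) (use h in \<open>auto intro: hol_at_add\<close>)
qed

lemma crit_const_at:
 fixes F :: "complex ^ 'n::finite => complex"
 assumes "hol_at F y"
 shows "\<forall>\<^sub>F z in nhds y. (\<forall>i. pd i F z = 0) \<longrightarrow> F z = F y"
proof (rule eventually_nhds_translate)
 have "pd i (%x. F (y + x)) x = pd i F (y + x)" for i x by (simp add: pd_def add.assoc)
 then show "\<forall>\<^sub>F x in nhds 0. (\<forall>i. pd i F (y + x) = 0) \<longrightarrow> F (y + x) = F y"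
  using crit_const[of "%x. F (y + x)"] assms by (simp add: hol_at_translate)
qed

text \<open>Where \<open>z $ i = 0\<close> the hypothesis says nothing about \<open>pd i F\<close>.
  On the stratum where exactly the coordinates in \<open>J\<close> vanish, \<open>z\<close> is an
  ordinary critical point of \<open>F\<close> restricted to that stratum, and there are only
  finitely many strata.\<close>

lemma log_crit_const:
 fixes F :: "complex ^ 'n::finite => complex"
 assumes F: "hol_at F y"
 shows "\<forall>\<^sub>F z in nhds y. (\<forall>i. z $ i * pd i F z = 0) \<longrightarrow> F z = F y"
proof -
 have J: "\<forall>\<^sub>F z in nhds y. restr (-J) y = y \<longrightarrow> (\<forall>i. pd i (%z. F (restr (-J) z)) z = 0) \<longrightarrow> F (restr (-J) z) = F y" for J
 proof (cases "restr (-J) y = y")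
  case True
  have "hol_at (%z. F (restr (-J) z)) y"
   by (rule hol_at_compose[of F "restr (-J)", OF _ hol_at_restr]) (use F True in simp)
  from crit_const_at[OF this] show ?thesis by eventually_elim (simp add: True)
 qed simp
 have "\<forall>\<^sub>F z in nhds y. \<forall>J. restr (-J) y = y \<longrightarrow> (\<forall>i. pd i (%z. F (restr (-J) z)) z = 0) \<longrightarrow> F (restr (-J) z) = F y"
  by (rule eventually_all_finite) (rule J)
 moreover have "\<forall>\<^sub>F z in nhds y. \<forall>i. y $ i ~= 0 \<longrightarrow> z $ i ~= 0"
 proof (rule eventually_all_finite)
  fix i show "\<forall>\<^sub>F z in nhds y. y $ i ~= 0 \<longrightarrow> z $ i ~= 0"
   using hol_at_nonzero_ev[OF hol_at_coord[of i y]] by (cases "y $ i = 0") auto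
 qed
 ultimately show ?thesis
 proof eventually_elim
  case (elim z)
  show ?case
  proof
   assume cr: "\<forall>i. z $ i * pd i F z = 0"
   define J where "J = {i. z $ i = 0}"
   have ry: "restr (-J) y = y" using elim(2) by (auto simp: vec_eq_iff J_def)
   have rz: "restr (-J) z = z" by (auto simp: vec_eq_iff J_def)
   have "pd i (%z. F (restr (-J) z)) z = 0" for i
   proof (cases "i \<in> J")
    case True
    have "restr (-J) (z + ze *s ax i) = z" for ze using True by (auto simp: vec_eq_iff J_def axis_def)
    then show ?thesis by (simp add: pd_def)
   next
    case False
    have "restr (-J) (z + ze *s ax i) = z + ze *s ax i" for ze using False by (auto simp: vec_eq_iff J_def axis_def)
    then have "pd i (%z. F (restr (-J) z)) z = pd i F z" by (simp add: pd_def)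
    then show ?thesis using cr False by (auto simp: J_def)
   qed
   then show "F z = F y" using elim(1)[rule_format, of J] ry rz by simp
  qed
 qed
qed

text \<open>Near each point of \<open>K\<close> at most one logarithmically critical value occurs,
  so compactness leaves finitely many. This is an exact finiteness statement in the place where a
  smooth argument would use Sard's theorem.\<close>

lemma log_crit_values_finite:
 fixes F :: "complex ^ 'n::finite => complex"
 assumes "!!y. y \<in> K ==> hol_at F y" "compact K"
 shows "finite (F ` {y \<in> K. \<forall>i. y $ i * pd i F y = 0})"
proof -
 have "\<exists>N. open N & y \<in> N & (\<forall>z\<in>N. (\<forall>i. z $ i * pd i F z = 0) \<longrightarrow> F z = F y)" if "y \<in> K" for y
  using log_crit_const[OF assms(1)[OF that]] unfolding eventually_nhds by blast
 then obtain N where N: "!!y. y \<in> K ==> open (N y)" "!!y. y \<in> K ==> y \<in> N y"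
  "!!y z. y \<in> K ==> z \<in> N y ==> (\<forall>i. z $ i * pd i F z = 0) ==> F z = F y" by metis
 have "K \<subseteq> (\<Union>y\<in>K. N y)" using N(2) by blast
 then obtain I where I: "I \<subseteq> K" "finite I" "K \<subseteq> (\<Union>y\<in>I. N y)"
  using compactE_image[OF assms(2), of K N] N(1) by blast
 have "F ` {y \<in> K. \<forall>i. y $ i * pd i F y = 0} \<subseteq> F ` I" using I N(3) by blast
 then show ?thesis using I(2) finite_subset by blast
qed

text \<open>The equation is \<open>df (v) = 1\<close> for \<open>f = P / Q\<close>, multiplied by
  \<open>Q\<close>; the bounds limit the size of \<open>v\<close> by the distance to the origin and
  the value of \<open>dlog Q\<close> on \<open>v\<close> by a constant. No continuity in
  \<open>z\<close> is demanded.\<close>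

definition liftable :: "(complex ^ 'n::finite => complex) => (complex ^ 'n => complex) => real => complex ^ 'n => bool" where
 "liftable P Q C z \<longleftrightarrow> (\<exists>v. dd P z v - (P z / Q z) * dd Q z v = Q z & norm v \<le> C * norm z & cmod (dd Q z v) \<le> C * cmod (Q z))"

text \<open>The vector is the image under the chart of the \<open>i\<close>-th logarithmic field,
  rescaled so that \<open>f\<close> grows at rate one. The hypotheses \<open>C1\<close> express that
  the field is logarithmic for the coordinates and for \<open>Q\<close>; they give the two bounds
  after multiplication by the scale.\<close>

lemma push_log_field:
 fixes pj :: "complex ^ 'n::finite => complex ^ 'n"
 assumes "hol_at P (pj x)" "hol_at Q (pj x)" "!!j. hol_at (%x. pj x $ j) x"
  and C1: "!!j. cmod (x $ i * pd i (%x. pj x $ j) x) \<le> C1 * cmod (pj x $ j)"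
   "cmod (x $ i * pd i (%x. Q (pj x)) x) \<le> C1 * cmod (Q (pj x))"
  and N: "x $ i * pd i (%x. P (pj x)) x - (P (pj x) / Q (pj x)) * (x $ i * pd i (%x. Q (pj x)) x) = n" "n ~= 0"
  and M: "cmod (Q (pj x)) \<le> M * cmod n" "C1 \<ge> 0"
 shows "liftable P Q (M * C1) (pj x)"
proof -
 define s where "s = Q (pj x) / n"
 have s: "cmod s \<le> M" using M N(2) by (simp add: s_def norm_divide divide_le_eq)
 have M0: "0 \<le> M" using s norm_ge_zero order_trans by blast
 define v where "v = s *s (\<chi> j. x $ i * pd i (%x. pj x $ j) x)"
 have d: "dd g (pj x) v = s * (x $ i * pd i (%x. g (pj x)) x)" if "hol_at g (pj x)" for g
  unfolding v_def dd_smult chain_pd[OF that assms(3)] by (simp add: dd_def sum_distrib_left mult.assoc)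
 have "dd P (pj x) v - (P (pj x) / Q (pj x)) * dd Q (pj x) v = s * n"
  unfolding d[OF assms(1)] d[OF assms(2)] N(1)[symmetric] by (simp add: algebra_simps)
 then have "dd P (pj x) v - (P (pj x) / Q (pj x)) * dd Q (pj x) v = Q (pj x)" using N(2) by (simp add: s_def)
 moreover have "norm v \<le> M * C1 * norm (pj x)"
 proof -
  have "norm (\<chi> j. x $ i * pd i (%x. pj x $ j) x) \<le> norm (of_real C1 *s pj x)"
   by (rule norm_vec_le) (use C1(1) M(2) in \<open>simp add: norm_mult\<close>)
  then have "norm (\<chi> j. x $ i * pd i (%x. pj x $ j) x) \<le> C1 * norm (pj x)" using M(2) by simp
  then show ?thesis unfolding v_def norm_vector_smult mult.assoc by (intro mult_mono s M0) auto
 qed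
 moreover have "cmod (dd Q (pj x) v) \<le> M * C1 * cmod (Q (pj x))"
  unfolding d[OF assms(2)] norm_mult[of s] mult.assoc by (intro mult_mono s C1(2) M0) auto
 ultimately show ?thesis unfolding liftable_def by blast
qed

lemma norm_perturb:
 fixes n a x y :: "'a::real_normed_vector"
 assumes "n = a + (x - y)" "p \<le> norm a" "norm x \<le> 1/4 * p" "norm y \<le> 1/4 * p"
 shows "1/2 * p \<le> norm n"
 unfolding assms(1) using assms(2-4) norm_triangle_ineq4[of x y] norm_diff_ineq[of a "x - y"] by linarith

text \<open>In the chart \<open>P / Q\<close> is a quotient of monomials times a unit. If the
  exponents differ at \<open>i\<close>, the \<open>i\<close>-th logarithmic field multiplies
  \<open>f\<close> by nearly a nonzero integer, which is good away from the value 0. If they agree,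
  \<open>P / Q\<close> extends to the holomorphic unit \<open>F\<close>, and the values to avoid are
  its logarithmically critical ones.\<close>

lemma liftable_local:
 fixes pj :: "complex ^ 'n::finite => complex ^ 'n"
 assumes P: "hol_at P 0" and Q: "hol_at Q 0" and pj: "pj 0 = 0" "!!j. hol_at (%x. pj x $ j) 0"
  and m: "mu UNIV (%x. P (pj x))" "mu UNIV (%x. Q (pj x))" "!!j. mu UNIV (%x. pj x $ j)"
 shows "\<exists>N T. open N & 0 \<in> N & finite T & (\<forall>c. c \<notin> T \<longrightarrow> (\<exists>C>0. \<exists>dl>0. \<forall>x\<in>N.
  P (pj x) ~= 0 & Q (pj x) ~= 0 & cmod (P (pj x) / Q (pj x) - c) < dl \<longrightarrow> liftable P Q C (pj x)))"
proof -
 obtain al a where a: "hol_at a 0" "a 0 ~= 0" "\<forall>\<^sub>F z in nhds 0. P (pj z) = mon al z * a z" using m(1) by (rule muE)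
 obtain bt b where b: "hol_at b 0" "b 0 ~= 0" "\<forall>\<^sub>F z in nhds 0. Q (pj z) = mon bt z * b z" using m(2) by (rule muE)
 have "\<forall>j. \<exists>gm u. hol_at u 0 & u 0 ~= 0 & (\<forall>\<^sub>F z in nhds 0. pj z $ j = mon gm z * u z)"
  using m(3) unfolding mu_def by blast
 then obtain gm where "\<forall>j. \<exists>u. hol_at u 0 & u 0 ~= 0 & (\<forall>\<^sub>F z in nhds 0. pj z $ j = mon (gm j) z * u z)" by metis
 then have g: "!!j. \<exists>u. hol_at u 0 & u 0 ~= 0 & (\<forall>\<^sub>F z in nhds 0. pj z $ j = mon (gm j) z * u z)" by blast
 \<comment> \<open>\<open>C1\<close> exceeds each exponent by more than the tolerance
   \<open>1/4\<close>, so it bounds all logarithmic derivatives of the coordinates and of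
   \<open>Q\<close>.\<close>
 define C1 where "C1 = 1 + (\<Sum>j\<in>UNIV. \<Sum>i\<in>UNIV. real (gm j i)) + (\<Sum>i\<in>UNIV. real (bt i))"
 have C1: "C1 > 0" unfolding C1_def by (intro add_pos_nonneg sum_nonneg) auto
 have C1gm: "real (gm j i) + 1/4 \<le> C1" for j i
 proof -
  have "real (gm j i) \<le> (\<Sum>i\<in>UNIV. real (gm j i))" by (rule member_le_sum) auto
  also have "\<dots> \<le> (\<Sum>j\<in>UNIV. \<Sum>i\<in>UNIV. real (gm j i))"
   by (rule member_le_sum[of j UNIV "%j. \<Sum>i\<in>UNIV. real (gm j i)"]) (auto intro: sum_nonneg)
  moreover have "(\<Sum>i\<in>UNIV. real (bt i)) \<ge> 0" by (intro sum_nonneg) auto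
  ultimately show ?thesis by (simp add: C1_def)
 qed
 have C1bt: "real (bt i) + 1/4 \<le> C1" for i
 proof -
  have "real (bt i) \<le> (\<Sum>i\<in>UNIV. real (bt i))" by (rule member_le_sum) auto
  moreover have "(\<Sum>j\<in>UNIV. \<Sum>i\<in>UNIV. real (gm j i)) \<ge> 0" by (intro sum_nonneg) auto
  ultimately show ?thesis by (simp add: C1_def)
 qed
 have limp: "filterlim pj (nhds 0) (nhds 0)" using isCont_nhds[OF hol_at_map_isCont[OF pj(2)]] pj(1) by simp
 have e1: "\<forall>\<^sub>F x in nhds 0. hol_at P (pj x) & hol_at Q (pj x)"
  using eventually_compose_filterlim[OF hol_at_eventually[OF P] limp] eventually_compose_filterlim[OF hol_at_eventually[OF Q] limp]
  by eventually_elim simp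
 have e2: "\<forall>\<^sub>F x in nhds 0. \<forall>j. hol_at (%x. pj x $ j) x"
  using hol_at_eventually[OF pj(2)] by (rule eventually_all_finite)
 have e3: "\<forall>\<^sub>F x in nhds 0. \<forall>j i. cmod (x $ i * pd i (%x. pj x $ j) x - of_nat (gm j i) * pj x $ j) \<le> 1/4 * cmod (pj x $ j)"
 proof (rule eventually_all_finite)
  fix j
  obtain u where "hol_at u 0" "u 0 ~= 0" "\<forall>\<^sub>F z in nhds 0. pj z $ j = mon (gm j) z * u z" using g by blast
  from mu_log_derivative[OF this, of "1/4"]
  show "\<forall>\<^sub>F x in nhds 0. \<forall>i. cmod (x $ i * pd i (%x. pj x $ j) x - of_nat (gm j i) * pj x $ j) \<le> 1/4 * cmod (pj x $ j)"
   by (simp add: eventually_conj_iff)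
 qed
 have e4: "\<forall>\<^sub>F x in nhds 0. \<forall>i. cmod (x $ i * pd i (%x. P (pj x)) x - of_nat (al i) * P (pj x)) \<le> 1/4 * cmod (P (pj x))"
  using mu_log_derivative[OF a, of "1/4"] by (simp add: eventually_conj_iff)
 have e5: "\<forall>\<^sub>F x in nhds 0. hol_at (%x. Q (pj x)) x & (\<forall>i. cmod (x $ i * pd i (%x. Q (pj x)) x - of_nat (bt i) * Q (pj x)) \<le> 1/4 * cmod (Q (pj x)))"
  using mu_log_derivative[OF b, of "1/4"] by simp
 define F where "F x = a x / b x" for x
 have e6: "\<forall>\<^sub>F x in nhds 0. hol_at F x & b x ~= 0 & P (pj x) = mon al x * a x & Q (pj x) = mon bt x * b x"
 proof -
  have "hol_at F 0" unfolding F_def by (intro hol_at_divide a b)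
  from hol_at_eventually[OF this] hol_at_nonzero_ev[OF b(1,2)] a(3) b(3) show ?thesis by eventually_elim simp
 qed
 have "\<forall>\<^sub>F x in nhds 0. (hol_at P (pj x) & hol_at Q (pj x)) & (\<forall>j. hol_at (%x. pj x $ j) x) &
  (\<forall>j i. cmod (x $ i * pd i (%x. pj x $ j) x - of_nat (gm j i) * pj x $ j) \<le> 1/4 * cmod (pj x $ j)) &
  (\<forall>i. cmod (x $ i * pd i (%x. P (pj x)) x - of_nat (al i) * P (pj x)) \<le> 1/4 * cmod (P (pj x))) &
  (hol_at (%x. Q (pj x)) x & (\<forall>i. cmod (x $ i * pd i (%x. Q (pj x)) x - of_nat (bt i) * Q (pj x)) \<le> 1/4 * cmod (Q (pj x)))) &
  (hol_at F x & b x ~= 0 & P (pj x) = mon al x * a x & Q (pj x) = mon bt x * b x)"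
  by (intro eventually_conj e1 e2 e3 e4 e5 e6)
 then obtain r where r: "r > 0" and rr: "!!x. dist x 0 < r ==> (hol_at P (pj x) & hol_at Q (pj x)) & (\<forall>j. hol_at (%x. pj x $ j) x) &
  (\<forall>j i. cmod (x $ i * pd i (%x. pj x $ j) x - of_nat (gm j i) * pj x $ j) \<le> 1/4 * cmod (pj x $ j)) &
  (\<forall>i. cmod (x $ i * pd i (%x. P (pj x)) x - of_nat (al i) * P (pj x)) \<le> 1/4 * cmod (P (pj x))) &
  (hol_at (%x. Q (pj x)) x & (\<forall>i. cmod (x $ i * pd i (%x. Q (pj x)) x - of_nat (bt i) * Q (pj x)) \<le> 1/4 * cmod (Q (pj x)))) &
  (hol_at F x & b x ~= 0 & P (pj x) = mon al x * a x & Q (pj x) = mon bt x * b x)"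
  unfolding eventually_nhds_metric by blast
 have logb: "cmod X \<le> C1 * cmod Y" if "cmod (X - of_nat k * Y) \<le> 1/4 * cmod Y" "real k + 1/4 \<le> C1" for X Y k
 proof -
  have "cmod X \<le> cmod (X - of_nat k * Y) + cmod (of_nat k * Y)" by (metis diff_add_cancel norm_triangle_ineq)
  also have "\<dots> \<le> (real k + 1/4) * cmod Y" using that(1) by (simp add: norm_mult algebra_simps)
  also have "\<dots> \<le> C1 * cmod Y" using that(2) by (intro mult_right_mono) auto
  finally show ?thesis .
 qed
 have lift: "liftable P Q (M * C1) (pj x)"
  if x: "dist x 0 < r" and n: "x $ i * pd i (%x. P (pj x)) x - (P (pj x) / Q (pj x)) * (x $ i * pd i (%x. Q (pj x)) x) = n" "n ~= 0"
   "cmod (Q (pj x)) \<le> M * cmod n" for x i n M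
 proof (rule push_log_field[where P=P and Q=Q and pj=pj and x=x and i=i and n=n])
  note R = rr[OF x]
  show "hol_at P (pj x)" "hol_at Q (pj x)" "hol_at (%x. pj x $ j) x" for j using R by blast+
  show "cmod (x $ i * pd i (%x. pj x $ j) x) \<le> C1 * cmod (pj x $ j)" for j
   by (rule logb[OF _ C1gm]) (use R in blast)
  show "cmod (x $ i * pd i (%x. Q (pj x)) x) \<le> C1 * cmod (Q (pj x))"
   by (rule logb[OF _ C1bt]) (use R in blast)
 qed (use n C1 in auto)
 show ?thesis
 proof (cases "al = bt")
  case False
  then obtain i where i: "al i ~= bt i" by auto
  show ?thesis
  proof (rule exI[of _ "ball 0 r"], rule exI[of _ "{0}"], intro conjI allI impI)
   fix c :: complex assume c: "c \<notin> {0}"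
   have "\<forall>x\<in>ball 0 r. P (pj x) ~= 0 & Q (pj x) ~= 0 & cmod (P (pj x) / Q (pj x) - c) < cmod c / 2 \<longrightarrow> liftable P Q (4 / cmod c * C1) (pj x)"
   proof (intro ballI impI)
    fix x :: "complex ^ 'n" assume "x \<in> ball 0 r" and h: "P (pj x) ~= 0 & Q (pj x) ~= 0 & cmod (P (pj x) / Q (pj x) - c) < cmod c / 2"
    then have x: "dist x 0 < r" by (simp add: dist_commute)
    let ?p = "P (pj x)" and ?q = "Q (pj x)"
    let ?X = "x $ i * pd i (%x. P (pj x)) x" and ?Y = "x $ i * pd i (%x. Q (pj x)) x"
    define n where "n = ?X - (?p / ?q) * ?Y"
    have X: "cmod (?X - of_nat (al i) * ?p) \<le> 1/4 * cmod ?p" and Y: "cmod (?Y - of_nat (bt i) * ?q) \<le> 1/4 * cmod ?q"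
     using rr[OF x] by blast+
    have "cmod ((?p / ?q) * (?Y - of_nat (bt i) * ?q)) \<le> 1/4 * cmod ?p"
    proof -
     have "cmod ((?p / ?q) * (?Y - of_nat (bt i) * ?q)) \<le> cmod (?p / ?q) * (1/4 * cmod ?q)"
      unfolding norm_mult by (intro mult_left_mono Y) simp
     then show ?thesis using h by (simp add: norm_divide)
    qed
    \<comment> \<open>A main term whose integer factor has modulus at least 1, and two errors of at
      most a quarter of the modulus of \<open>?p\<close> each.\<close>
    moreover have "n = (of_nat (al i) - of_nat (bt i)) * ?p + ((?X - of_nat (al i) * ?p) - (?p / ?q) * (?Y - of_nat (bt i) * ?q))"
     using h by (simp add: n_def field_simps)
    moreover have "cmod ((of_nat (al i) - of_nat (bt i)) * ?p) \<ge> cmod ?p"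
    proof -
     have "cmod (of_nat (al i) - of_nat (bt i)) = \<bar>real (al i) - real (bt i)\<bar>"
      by (metis norm_of_real of_real_diff of_real_of_nat_eq)
     moreover have "\<dots> \<ge> 1" using i by linarith
     ultimately show ?thesis unfolding norm_mult using mult_right_mono[of 1 "cmod (of_nat (al i) - of_nat (bt i))" "cmod ?p"] by simp
    qed
    ultimately have nn: "cmod n \<ge> 1/2 * cmod ?p" using norm_perturb[OF _ _ X] by blast
    then have n0: "n ~= 0" using h by auto
    have "cmod c / 2 \<le> cmod (?p / ?q)"
     using h norm_triangle_ineq2[of c "c - ?p / ?q"] by (simp add: norm_minus_commute)
    then have "cmod c / 2 * cmod ?q \<le> cmod ?p" using h by (simp add: norm_divide field_simps)
    then have "cmod ?q \<le> 4 / cmod c * cmod n" using nn c by (simp add: field_simps)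
    from lift[OF x n_def[symmetric] n0 this] show "liftable P Q (4 / cmod c * C1) (pj x)" .
   qed
   moreover have "4 / cmod c * C1 > 0" "cmod c / 2 > 0" using c C1 by auto
   ultimately show "\<exists>C>0. \<exists>dl>0. \<forall>x\<in>ball 0 r. P (pj x) ~= 0 & Q (pj x) ~= 0 & cmod (P (pj x) / Q (pj x) - c) < dl \<longrightarrow> liftable P Q C (pj x)"
    by blast
  qed (use r in auto)
 next
  case True
  let ?K = "cball (0 :: complex ^ 'n) (r/2)"
  have Kr: "dist x 0 < r" if "x \<in> ?K" for x
  proof -
   have "norm x \<le> r/2" using that by simp
   then show ?thesis using r by simp
  qed
  define T where "T = F ` {y \<in> ?K. \<forall>i. y $ i * pd i F y = 0}"
  have holF: "hol_at F y" if "y \<in> ?K" for y using rr[OF Kr[OF that]] by blast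
  have "finite T" unfolding T_def by (rule log_crit_values_finite[OF holF]) auto
  moreover have "\<exists>C>0. \<exists>dl>0. \<forall>x\<in>ball 0 (r/2). P (pj x) ~= 0 & Q (pj x) ~= 0 & cmod (P (pj x) / Q (pj x) - c) < dl \<longrightarrow> liftable P Q C (pj x)"
   if c: "c \<notin> T" for c
  proof -
   \<comment> \<open>A zero of \<open>G\<close> would be a logarithmically critical point with value
     \<open>c\<close>, and there is none in the compact ball. Half of the positive minimum, shared
     among the coordinates, bounds some logarithmic derivative of \<open>F\<close> from below
     wherever \<open>F\<close> is close to \<open>c\<close>.\<close>
   define G where "G y = cmod (F y - c) + (\<Sum>i\<in>UNIV. cmod (y $ i * pd i F y))" for y
   have "continuous_on ?K G"
   proof (rule continuous_at_imp_continuous_on, rule ballI)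
    fix y assume y: "y \<in> ?K"
    show "isCont G y" unfolding G_def
     using hol_at_isCont[OF holF[OF y]] hol_at_isCont[OF hol_at_pd[OF holF[OF y]]] hol_at_isCont[OF hol_at_coord]
     by (intro continuous_intros) auto
   qed
   moreover have "?K ~= {}" using r by auto
   ultimately obtain y0 where y0: "y0 \<in> ?K" "!!y. y \<in> ?K ==> G y0 \<le> G y"
    using continuous_attains_inf[of ?K G] by auto
   have "G y0 > 0"
   proof (rule ccontr)
    assume "\<not> G y0 > 0"
    moreover have "(\<Sum>i\<in>UNIV. cmod (y0 $ i * pd i F y0)) \<ge> 0" by (intro sum_nonneg) auto
    ultimately have z: "cmod (F y0 - c) = 0" "(\<Sum>i\<in>UNIV. cmod (y0 $ i * pd i F y0)) = 0"
     using norm_ge_zero[of "F y0 - c"] unfolding G_def by linarith+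
    have "\<forall>i. y0 $ i * pd i F y0 = 0"
     using z(2) sum_nonneg_eq_0_iff[of UNIV "%i. cmod (y0 $ i * pd i F y0)"] by simp
    then have "F y0 \<in> T" using y0(1) by (auto simp: T_def)
    then show False using z(1) c by simp
   qed
   define dl where "dl = G y0 / (2 * CARD('n))"
   have n1: "real CARD('n) \<ge> 1" by (simp add: Suc_leI)
   have d: "dl > 0" using \<open>G y0 > 0\<close> by (simp add: dl_def)
   have dG: "dl \<le> G y0 / 2" using \<open>G y0 > 0\<close> n1 by (simp add: dl_def field_simps)
   have key: "\<exists>i. cmod (y $ i * pd i F y) \<ge> dl" if "y \<in> ?K" "cmod (F y - c) < dl" for y
   proof (rule ccontr)
    assume "\<not> ?thesis"
    then have "(\<Sum>i\<in>UNIV. cmod (y $ i * pd i F y)) \<le> (\<Sum>i\<in>(UNIV :: 'n set). dl)"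
     by (intro sum_mono) (auto simp: not_le less_imp_le)
    also have "\<dots> = G y0 / 2" by (simp add: dl_def)
    finally have "G y < G y0" using that(2) dG by (simp add: G_def)
    then show False using y0(2)[OF that(1)] by simp
   qed
   have "\<forall>x\<in>ball 0 (r/2). P (pj x) ~= 0 & Q (pj x) ~= 0 & cmod (P (pj x) / Q (pj x) - c) < dl \<longrightarrow> liftable P Q (1 / dl * C1) (pj x)"
   proof (intro ballI impI)
    fix x :: "complex ^ 'n" assume xb: "x \<in> ball 0 (r/2)" and h: "P (pj x) ~= 0 & Q (pj x) ~= 0 & cmod (P (pj x) / Q (pj x) - c) < dl"
    have xK: "x \<in> ?K" using xb by simp
    have x: "dist x 0 < r" by (rule Kr[OF xK])
    have fF: "P (pj x) / Q (pj x) = F x" using rr[OF x] h True by (auto simp: F_def)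
    then obtain i where i: "cmod (x $ i * pd i F x) \<ge> dl" using key[OF xK] h by auto
    have "\<forall>\<^sub>F y in nhds x. dist y 0 < r"
     using x eventually_nhds_in_open[of "ball 0 r" x] by (simp add: dist_commute)
    then have "\<forall>\<^sub>F y in nhds x. P (pj y) = F y * Q (pj y)"
    proof eventually_elim
     case (elim y)
     then show ?case using rr[OF elim] True by (auto simp: F_def)
    qed
    from eventually_nhds_x_imp_x[OF pd_cong_ev[OF this, of i]]
    have "pd i (%y. P (pj y)) x = pd i (%y. F y * Q (pj y)) x" .
    also have "\<dots> = pd i F x * Q (pj x) + F x * pd i (%y. Q (pj y)) x"
     using rr[OF x] by (intro pd_mult) blast+
    finally have "x $ i * pd i (%x. P (pj x)) x - (P (pj x) / Q (pj x)) * (x $ i * pd i (%x. Q (pj x)) x) = x $ i * pd i F x * Q (pj x)"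
     unfolding fF by (simp add: algebra_simps)
    moreover have "x $ i * pd i F x * Q (pj x) ~= 0" using i d h by auto
    moreover have "cmod (Q (pj x)) \<le> 1 / dl * cmod (x $ i * pd i F x * Q (pj x))"
    proof -
     have "dl * cmod (Q (pj x)) \<le> cmod (x $ i * pd i F x) * cmod (Q (pj x))" using i by (rule mult_right_mono) simp
     then show ?thesis using d by (simp add: norm_mult field_simps)
    qed
    ultimately show "liftable P Q (1 / dl * C1) (pj x)" by (rule lift[OF x])
   qed
   moreover have "1 / dl * C1 > 0" using d C1 by auto
   ultimately show ?thesis using d by blast
  qed
  ultimately show ?thesis using r
   by (intro exI[of _ "ball (0 :: complex ^ 'n) (r/2)"] exI[of _ T] conjI) simp_all
 qed
qed

section \<open>From chart centres to uniform statements near the origin\<close>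

lemma liftable_mono: "liftable P Q C z ==> C \<le> C' ==> liftable P Q C' z"
 unfolding liftable_def by (meson mult_right_mono norm_ge_zero order_trans)

lemma mu_factor3:
 fixes P Q :: "complex ^ 'n::finite => complex"
 assumes "hol_at P (pj 0)" "hol_at Q (pj 0)" "!!i. hol_at (%x. pj x $ i) 0"
  and "mu UNIV (%x. P (pj x) * (Q (pj x) * (\<Prod>j\<in>UNIV. pj x $ j)))"
 shows "mu UNIV (%x. P (pj x))" "mu UNIV (%x. Q (pj x))" "mu UNIV (%x. pj x $ j)"
proof -
 have P: "hol_at (%x. P (pj x)) 0" and Q: "hol_at (%x. Q (pj x)) 0"
  using hol_at_compose[OF assms(1,3)] hol_at_compose[OF assms(2,3)] by auto
 have R: "hol_at (%x. \<Prod>j\<in>UNIV. pj x $ j) 0" by (intro hol_at_prod assms(3))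
 show "mu UNIV (%x. P (pj x))" by (rule mu_factor[OF P hol_at_mult[OF Q R] assms(4)]) simp
 have "mu UNIV (%x. (Q (pj x) * (\<Prod>j\<in>UNIV. pj x $ j)) * P (pj x))" using assms(4) by (simp add: mult.commute)
 then have QR: "mu UNIV (%x. Q (pj x) * (\<Prod>j\<in>UNIV. pj x $ j))" by (rule mu_factor[OF hol_at_mult[OF Q R] P]) simp
 show "mu UNIV (%x. Q (pj x))" by (rule mu_factor[OF Q R QR]) simp
 have "mu UNIV (%x. (\<Prod>j\<in>UNIV. pj x $ j) * Q (pj x))" using QR by (simp add: mult.commute)
 then have "mu UNIV (%x. \<Prod>j\<in>UNIV. pj x $ j)" by (rule mu_factor[OF R Q]) simp
 then show "mu UNIV (%x. pj x $ j)" by (rule nz_germ_prod_mu_factor[of UNIV j "%j x. pj x $ j", rotated 3]) (auto intro: assms(3))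
qed

lemma nz_germ_triple:
 assumes "hol_at P 0" "hol_at Q 0" "nz_germ P" "nz_germ Q"
 shows "hol_at (%z. P z * (Q z * (\<Prod>j\<in>UNIV. z $ j))) 0" "nz_germ (%z. P z * (Q z * (\<Prod>j\<in>UNIV. z $ j)))"
proof -
 have R: "hol_at (%z. \<Prod>j\<in>UNIV. z $ j) 0" by (intro hol_at_prod hol_at_coord)
 have R': "nz_germ (%z. \<Prod>j\<in>UNIV. z $ j)" by (intro nz_germ_prod hol_at_coord nz_germ_coord) auto
 show "hol_at (%z. P z * (Q z * (\<Prod>j\<in>UNIV. z $ j))) 0" by (intro hol_at_mult assms R)
 show "nz_germ (%z. P z * (Q z * (\<Prod>j\<in>UNIV. z $ j)))" by (intro nz_germ_mult hol_at_mult assms R R')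
qed

lemma eventually_real_ge: "\<forall>\<^sub>F m in sequentially. real m \<ge> a"
 using filterlim_real_sequentially unfolding filterlim_at_top by blast

lemma seq_to_0:
 assumes "!!m. norm (z m) < 1 / real (Suc m)"
 shows "(z :: nat => 'a::real_normed_vector) \<longlonglongrightarrow> 0"
 by (rule Lim_null_comparison[OF _ LIMSEQ_inverse_real_of_nat])
  (use assms in \<open>auto intro!: always_eventually less_imp_le simp: inverse_eq_divide\<close>)

text \<open>The finite set \<open>T\<close> has to be fixed before \<open>c\<close>, so it is
  collected from a finite cover of the chart points over the origin. Once \<open>c\<close> is given,
  the existence of uniform constants follows by contradiction along a sequence tending to 0.\<close>

lemma liftable_generic:
 fixes P Q :: "complex ^ 'n::finite => complex"
 assumes P: "hol_at P 0" "nz_germ P" and Q: "hol_at Q 0" "nz_germ Q"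
 shows "\<exists>T. finite T & (\<forall>c. c \<notin> T \<longrightarrow> (\<exists>C>0. \<exists>dl>0. \<forall>z. norm z < dl & P z ~= 0 & Q z ~= 0 &
  cmod (P z / Q z - c) < dl \<longrightarrow> liftable P Q C z))"
proof -
 define h where "h z = P z * (Q z * (\<Prod>j\<in>UNIV. z $ j))" for z
 have h: "hol_at h 0" "nz_germ h" unfolding h_def by (intro nz_germ_triple P Q)+
 obtain \<nu> and F :: "(complex ^ 'n => complex ^ 'n) set" where F: "\<nu> > 0" "finite F"
  "!!pj i w. pj \<in> F ==> w \<in> cpoly UNIV (%i. 1/2) ==> hol_at (%w. pj w $ i) w"
  "!!pj w. pj \<in> F ==> w \<in> cpoly UNIV (%i. 1/2) ==> mu UNIV (%x. h (pj (w + x)))"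
  "!!z. z \<in> cyl UNIV \<nu> ==> \<exists>pj\<in>F. z \<in> pj ` cpoly UNIV (%i. 1/2)"
  by (rule resolution_charts[OF h]) (rule that; (assumption | simp))
 let ?K = "cpoly UNIV (%i. 1/2) :: (complex ^ 'n) set"
 define G where "G pj w N T \<longleftrightarrow> open N & 0 \<in> N & finite T & (\<forall>c. c \<notin> T \<longrightarrow> (\<exists>C>0. \<exists>dl>0. \<forall>x\<in>N.
  P (pj (w + x)) ~= 0 & Q (pj (w + x)) ~= 0 & cmod (P (pj (w + x)) / Q (pj (w + x)) - c) < dl \<longrightarrow> liftable P Q C (pj (w + x))))"
  for pj :: "complex ^ 'n => complex ^ 'n" and w N T
 have loc: "\<exists>N T. G pj w N T" if "pj \<in> F" "w \<in> ?K" "pj w = 0" for pj w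
 proof -
  have hol: "hol_at (%x. pj (w + x) $ i) 0" for i
   using F(3)[OF that(1,2), of i] hol_at_translate[of "%x. pj x $ i" w] by simp
  have p0: "pj (w + 0) = 0" using that by simp
  have "mu UNIV (%x. P (pj (w + x)) * (Q (pj (w + x)) * (\<Prod>j\<in>UNIV. pj (w + x) $ j)))"
   using F(4)[OF that(1,2)] by (simp add: h_def)
  note m = mu_factor3[of P "%x. pj (w + x)" Q, OF _ _ hol this, unfolded p0, OF P(1) Q(1)]
  show ?thesis unfolding G_def by (rule liftable_local[OF P(1) Q(1) p0 hol m])
 qed
 define H where "H pj I TT N \<longleftrightarrow> I \<subseteq> {w \<in> ?K. pj w = 0} & finite I & {w \<in> ?K. pj w = 0} \<subseteq> (\<Union>w\<in>I. {y. y - w \<in> N w}) & (\<forall>w\<in>I. G pj w (N w) (TT w))"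
  for pj I TT N
 have "\<exists>I TT N. H pj I TT N"
  if pj: "pj \<in> F" for pj
 proof -
  let ?Z = "{w \<in> ?K. pj w = 0}"
  have "\<forall>w\<in>?Z. \<exists>N T. G pj w N T" using loc[OF pj] by blast
  then obtain N T where NT: "!!w. w \<in> ?Z ==> G pj w (N w) (T w)" by metis
  have contK: "continuous_on ?K pj"
  proof (rule continuous_at_imp_continuous_on, rule ballI)
   fix w assume "w \<in> ?K"
   then show "isCont pj w" by (intro hol_at_map_isCont F(3)[OF pj])
  qed
  have "closedin (top_of_set ?K) (?K \<inter> pj -` {0})" by (rule continuous_closedin_preimage[OF contK]) simp
  moreover have "?K \<inter> pj -` {0} = ?Z" by auto
  ultimately have cK0: "compact ?Z" using compact_cpoly closedin_compact by metis
  have op: "open {y. y - w \<in> N w}" if "w \<in> ?Z" for w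
  proof -
   have "open (N w)" using NT[OF that] by (simp add: G_def)
   then show ?thesis using continuous_open_vimage[of "N w" "%y. y - w"] by (simp add: vimage_def)
  qed
  have "?Z \<subseteq> (\<Union>w\<in>?Z. {y. y - w \<in> N w})" using NT by (fastforce simp: G_def)
  then obtain I where "I \<subseteq> ?Z" "finite I" "?Z \<subseteq> (\<Union>w\<in>I. {y. y - w \<in> N w})"
   using compactE_image[OF cK0, of ?Z "%w. {y. y - w \<in> N w}"] op by blast
  then show ?thesis using NT unfolding H_def by (intro exI[of _ I] exI[of _ T] exI[of _ N] conjI ballI) auto
 qed
 then obtain I TT N where "!!pj. pj \<in> F ==> H pj (I pj) (TT pj) (N pj)" by metis
 note HH = this[unfolded H_def]
 have I: "!!pj. pj \<in> F ==> I pj \<subseteq> {w \<in> ?K. pj w = 0}" "!!pj. pj \<in> F ==> finite (I pj)"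
  "!!pj. pj \<in> F ==> {w \<in> ?K. pj w = 0} \<subseteq> (\<Union>w\<in>I pj. {y. y - w \<in> N pj w})"
  "!!pj w. pj \<in> F ==> w \<in> I pj ==> G pj w (N pj w) (TT pj w)"
  by (rule HH[THEN conjunct1], assumption)
   (rule HH[THEN conjunct2, THEN conjunct1], assumption, rule HH[THEN conjunct2, THEN conjunct2, THEN conjunct1], assumption,
    rule HH[THEN conjunct2, THEN conjunct2, THEN conjunct2, THEN bspec], assumption+)
 define T where "T = (\<Union>pj\<in>F. \<Union>w\<in>I pj. TT pj w)"
 have "finite T" unfolding T_def using F(2) I(2) I(4) by (auto simp: G_def)
 moreover have "\<exists>C>0. \<exists>dl>0. \<forall>z. norm z < dl & P z ~= 0 & Q z ~= 0 & cmod (P z / Q z - c) < dl \<longrightarrow> liftable P Q C z"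
  if c: "c \<notin> T" for c
 proof (rule ccontr)
  assume neg: "\<not> ?thesis"
  have "\<exists>z. norm z < 1 / real (Suc m) & P z ~= 0 & Q z ~= 0 & cmod (P z / Q z - c) < 1 / real (Suc m) & \<not> liftable P Q (real (Suc m)) z" for m
  proof -
   have "real (Suc m) > 0" "1 / real (Suc m) > 0" by auto
   then show ?thesis using neg by blast
  qed
  then obtain z where z: "!!m. norm (z m) < 1 / real (Suc m)" "!!m. P (z m) ~= 0" "!!m. Q (z m) ~= 0"
   "!!m. cmod (P (z m) / Q (z m) - c) < 1 / real (Suc m)" "!!m. \<not> liftable P Q (real (Suc m)) (z m)" by metis
  have z0: "z \<longlonglongrightarrow> 0" by (rule seq_to_0[OF z(1)])
  have "\<exists>pj w w0 r. pj \<in> F & w0 \<in> ?K & pj w0 = 0 & w \<longlonglongrightarrow> w0 & strict_mono (r :: nat => nat) & (\<forall>m. z (r m) = pj (w m))"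
   by (rule seq_in_charts[OF F(1,2) F(3) F(5) z0])
  then obtain pj w w0 r where s: "pj \<in> F" "w0 \<in> ?K" "pj w0 = 0" "w \<longlonglongrightarrow> w0" "strict_mono (r :: nat => nat)"
   "\<forall>m. z (r m) = pj (w m)" by (elim exE conjE)
  have "w0 \<in> (\<Union>w\<in>I pj. {y. y - w \<in> N pj w})" using I(3)[OF s(1)] s(2,3) by blast
  then obtain v where v: "v \<in> I pj" "w0 - v \<in> N pj v" by blast
  have Gv: "open (N pj v)" "\<forall>c. c \<notin> TT pj v \<longrightarrow> (\<exists>C>0. \<exists>dl>0. \<forall>x\<in>N pj v.
   P (pj (v + x)) ~= 0 & Q (pj (v + x)) ~= 0 & cmod (P (pj (v + x)) / Q (pj (v + x)) - c) < dl \<longrightarrow> liftable P Q C (pj (v + x)))"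
   using I(4)[OF s(1) v(1)] by (simp_all add: G_def)
  have "c \<notin> TT pj v" using c s(1) v(1) by (auto simp: T_def)
  then obtain C dl where C: "C > 0" "dl > 0" "!!x. x \<in> N pj v ==>
   P (pj (v + x)) ~= 0 & Q (pj (v + x)) ~= 0 & cmod (P (pj (v + x)) / Q (pj (v + x)) - c) < dl ==> liftable P Q C (pj (v + x))"
   using Gv(2) by meson
  have e1: "\<forall>\<^sub>F m in sequentially. w m - v \<in> N pj v"
   using topological_tendstoD[OF tendsto_diff[OF s(4) tendsto_const[of v]] Gv(1) v(2)] .
  have e2: "\<forall>\<^sub>F m in sequentially. real m \<ge> max C (1 / dl)"
   by (rule eventually_real_ge)
  have "\<forall>\<^sub>F m in sequentially. False"
   using e1 e2
  proof eventually_elim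
   case (elim m)
   have rm: "real m \<le> real (r m)" using seq_suble[OF s(5), of m] by simp
   have "1 / dl \<le> real (r m)" using elim(2) rm by simp
   then have "1 < dl * real (Suc (r m))" using C(2) by (simp add: field_simps add_strict_increasing2)
   then have "1 / real (Suc (r m)) < dl" by (simp add: field_simps)
   then have "liftable P Q C (pj (v + (w m - v)))"
    using z(2,3,4)[of "r m"] s(6) by (intro C(3) elim(1)) (auto intro: less_trans)
   then have L: "liftable P Q C (z (r m))" by (simp add: s(6))
   have "C \<le> real (Suc (r m))" using elim(2) rm by simp
   from liftable_mono[OF L this] show ?case using z(5) by blast
  qed
  then show False by simp
 qed
 ultimately show ?thesis by blast
qed

section \<open>Radial fields\<close>

definition herm :: "complex ^ 'n::finite => complex ^ 'n => complex" where
 "herm v z = (\<Sum>j\<in>UNIV. v $ j * cnj (z $ j))"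

lemma herm_smult: "herm (c *s v) z = c * herm v z"
 by (simp add: herm_def sum_distrib_left mult.assoc)

lemma herm_diff: "herm (v - w) z = herm v z - herm w z"
 by (simp add: herm_def sum_subtractf left_diff_distrib)

lemma herm_bound: "cmod (herm v z) \<le> norm v * norm z"
proof -
 have "cmod (herm v z) \<le> (\<Sum>j\<in>UNIV. cmod (v $ j * cnj (z $ j)))" unfolding herm_def by (rule norm_sum)
 also have "\<dots> = (\<Sum>j\<in>UNIV. \<bar>cmod (v $ j)\<bar> * \<bar>cmod (z $ j)\<bar>)" by (simp add: norm_mult)
 also have "\<dots> \<le> L2_set (%j. cmod (v $ j)) UNIV * L2_set (%j. cmod (z $ j)) UNIV" by (rule L2_set_mult_ineq)
 finally show ?thesis by (simp add: norm_vec_def)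
qed

lemma norm_vec_sq: "(norm (z :: complex ^ 'n::finite))\<^sup>2 = (\<Sum>j\<in>UNIV. (cmod (z $ j))\<^sup>2)"
 by (simp add: norm_vec_def L2_set_def sum_nonneg)

text \<open>\<open>e\<close> has the radial part of the Euler field and is logarithmic for both
  germs. It is applied with \<open>P - c * Q\<close> as first germ: then \<open>e\<close> changes
  \<open>f - c\<close> at most by a multiple of \<open>f - c\<close>, hence hardly changes
  \<open>f\<close> near the fibre over \<open>c\<close>.\<close>

definition radial :: "(complex ^ 'n::finite => complex) => (complex ^ 'n => complex) => real => complex ^ 'n => bool" where
 "radial P Q C z \<longleftrightarrow> (\<exists>e. herm e z = of_real ((norm z)\<^sup>2) & norm e \<le> C * norm z & cmod (dd Q z e) \<le> C * cmod (Q z) & cmod (dd P z e) \<le> C * cmod (P z))"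

lemma radial_mono: "radial P Q C z ==> C \<le> C' ==> radial P Q C' z"
 unfolding radial_def by (meson mult_right_mono norm_ge_zero order_trans)

text \<open>The Euler field of a monomial chart pushes forward to a field which is almost radial and
 logarithmic for P and Q.\<close>

lemma radial_generic:
 fixes P Q :: "complex ^ 'n::finite => complex"
 assumes P: "hol_at P 0" "nz_germ P" and Q: "hol_at Q 0" "nz_germ Q"
 shows "\<exists>C>0. \<exists>dl>0. \<forall>z. norm z < dl & P z ~= 0 & Q z ~= 0 & (\<forall>j. z $ j ~= 0) \<longrightarrow> radial P Q C z"
proof (rule ccontr)
 assume neg: "\<not> ?thesis"
 have "\<exists>z. norm z < 1 / real (Suc m) & z ~= 0 & \<not> radial P Q (real (Suc m)) z" for m
 proof -
  have "real (Suc m) > 0" "1 / real (Suc m) > 0" by auto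
  then obtain z where "norm z < 1 / real (Suc m)" "\<forall>j. z $ j ~= 0" "\<not> radial P Q (real (Suc m)) z" using neg by blast
  then show ?thesis by (intro exI[of _ z]) auto
 qed
 then obtain z where z: "!!m. norm (z m) < 1 / real (Suc m)" "!!m. z m ~= 0" "!!m. \<not> radial P Q (real (Suc m)) (z m)" by metis
 define h where "h z = P z * (Q z * (\<Prod>j\<in>UNIV. z $ j))" for z
 have h: "hol_at h 0" "nz_germ h" unfolding h_def by (intro nz_germ_triple P Q)+
 obtain pj :: "complex ^ 'n => complex ^ 'n" and x r where c: "!!i. hol_at (%w. pj w $ i) 0" "pj 0 = 0" "mu UNIV (%x. h (pj x))"
  "x \<longlonglongrightarrow> 0" "strict_mono (r :: nat => nat)" "!!m. z (r m) = pj (x m)"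
  by (rule seq_chart[OF h seq_to_0[OF z(1)]]) (rule that; (assumption | simp))
 have "mu UNIV (%x. P (pj x) * (Q (pj x) * (\<Prod>j\<in>UNIV. pj x $ j)))" using c(3) by (simp add: h_def)
 note m = mu_factor3[of P pj Q, OF _ _ c(1) this, unfolded c(2), OF P(1) Q(1)]
 obtain al a where a: "hol_at a 0" "a 0 ~= 0" "\<forall>\<^sub>F z in nhds 0. P (pj z) = mon al z * a z" using m(1) by (rule muE)
 obtain bt b where b: "hol_at b 0" "b 0 ~= 0" "\<forall>\<^sub>F z in nhds 0. Q (pj z) = mon bt z * b z" using m(2) by (rule muE)
 define U where "U j gm \<longleftrightarrow> (\<exists>u. hol_at u 0 & u 0 ~= 0 & (\<forall>\<^sub>F z in nhds 0. pj z $ j = mon gm z * u z))" for j gm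
 have "\<forall>j. \<exists>gm. U j gm" using m(3) unfolding mu_def U_def by blast
 then obtain gm where g: "!!j. U j (gm j)" by metis
 \<comment> \<open>The Euler field adds \<open>CARD('n)\<close> logarithmic derivatives; with this
   share the total relative error is \<open>1/2\<close>, below the least total degree of a
   coordinate, which is 1.\<close>
 define ep where "ep = 1 / (2 * real CARD('n))"
 have e: "ep > 0" by (simp add: ep_def)
 define tot where "tot gm = (\<Sum>i\<in>UNIV. real (gm i))" for gm :: "'n => nat"
 have tot0: "tot gm \<ge> 0" for gm unfolding tot_def by (intro sum_nonneg) auto
 have tot1: "tot (gm j) \<ge> 1" for j
 proof -
  obtain u where u: "u 0 ~= 0" "\<forall>\<^sub>F z in nhds 0. pj z $ j = mon (gm j) z * u z" using g[of j] unfolding U_def by blast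
  have "mon (gm j) 0 = 0" using eventually_nhds_x_imp_x[OF u(2)] u(1) c(2) by simp
  then obtain i where "gm j i ~= 0" by (auto simp: mon_eq_0)
  then have "1 \<le> real (gm j i)" by simp
  also have "\<dots> \<le> tot (gm j)" unfolding tot_def by (rule member_le_sum) auto
  finally show ?thesis .
 qed
 have euler: "\<forall>\<^sub>F x in nhds 0. cmod ((\<Sum>i\<in>UNIV. x $ i * pd i g x) - of_real (tot gm) * g x) \<le> 1/2 * cmod (g x)"
  if u: "hol_at u 0" "u 0 ~= 0" "\<forall>\<^sub>F z in nhds 0. g z = mon gm z * u z" for g u gm
  using mu_log_derivative[OF u e]
 proof eventually_elim
  case (elim x)
  have "(\<Sum>i\<in>UNIV. x $ i * pd i g x) - of_real (tot gm) * g x = (\<Sum>i\<in>UNIV. x $ i * pd i g x - of_nat (gm i) * g x)"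
   by (simp add: tot_def sum_subtractf sum_distrib_right)
  also have "cmod \<dots> \<le> (\<Sum>i\<in>(UNIV :: 'n set). ep * cmod (g x))"
   using elim by (intro order_trans[OF norm_sum] sum_mono) blast
  also have "\<dots> = 1/2 * cmod (g x)" by (simp add: ep_def)
  finally show ?case .
 qed
 have limp: "filterlim pj (nhds 0) (nhds 0)" using isCont_nhds[OF hol_at_map_isCont[OF c(1)]] c(2) by simp
 have e1: "\<forall>\<^sub>F x in nhds 0. hol_at P (pj x) & hol_at Q (pj x)"
  using eventually_compose_filterlim[OF hol_at_eventually[OF P(1)] limp] eventually_compose_filterlim[OF hol_at_eventually[OF Q(1)] limp]
  by eventually_elim simp
 have e2: "\<forall>\<^sub>F x in nhds 0. \<forall>j. hol_at (%x. pj x $ j) x"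
  using hol_at_eventually[OF c(1)] by (rule eventually_all_finite)
 have e3: "\<forall>\<^sub>F x in nhds 0. \<forall>j. cmod ((\<Sum>i\<in>UNIV. x $ i * pd i (%x. pj x $ j) x) - of_real (tot (gm j)) * pj x $ j) \<le> 1/2 * cmod (pj x $ j)"
 proof (rule eventually_all_finite)
  fix j
  obtain u where "hol_at u 0" "u 0 ~= 0" "\<forall>\<^sub>F z in nhds 0. pj z $ j = mon (gm j) z * u z" using g[of j] unfolding U_def by blast
  from euler[OF this] show "\<forall>\<^sub>F x in nhds 0. cmod ((\<Sum>i\<in>UNIV. x $ i * pd i (%x. pj x $ j) x) - of_real (tot (gm j)) * pj x $ j) \<le> 1/2 * cmod (pj x $ j)" .
 qed
 define C0 where "C0 = tot al + tot bt + (\<Sum>j\<in>UNIV. tot (gm j)) + 1"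
 have C0j: "tot (gm j) + 1/2 \<le> C0" for j
 proof -
  have "tot (gm j) \<le> (\<Sum>j\<in>UNIV. tot (gm j))" by (rule member_le_sum) (auto intro: tot0)
  then show ?thesis using tot0[of al] tot0[of bt] by (simp add: C0_def)
 qed
 have sumg: "(\<Sum>j\<in>UNIV. tot (gm j)) \<ge> 0" by (intro sum_nonneg tot0)
 have C0ab: "tot al + 1/2 \<le> C0" "tot bt + 1/2 \<le> C0" using tot0[of al] tot0[of bt] sumg by (auto simp: C0_def)
 have C0: "C0 > 0" using tot0[of al] C0ab by linarith
 have logb: "cmod X \<le> C0 * cmod Y" if "cmod (X - of_real k * Y) \<le> 1/2 * cmod Y" "k + 1/2 \<le> C0" "k \<ge> 0" for X Y :: complex and k
 proof -
  have "cmod X \<le> cmod (X - of_real k * Y) + cmod (of_real k * Y)" by (metis diff_add_cancel norm_triangle_ineq)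
  also have "\<dots> \<le> (k + 1/2) * cmod Y" using that(1,3) by (simp add: norm_mult algebra_simps)
  also have "\<dots> \<le> C0 * cmod Y" using that(2) by (intro mult_right_mono) auto
  finally show ?thesis .
 qed
 have main: "\<forall>\<^sub>F x in nhds 0. pj x ~= 0 \<longrightarrow> radial P Q (2 * C0) (pj x)"
  using e1 e2 e3 euler[OF a] euler[OF b]
 proof eventually_elim
  case (elim x)
  show ?case
  proof
   assume nz: "pj x ~= 0"
   define v where "v = (\<chi> j. \<Sum>i\<in>UNIV. x $ i * pd i (%x. pj x $ j) x)"
   have d: "dd g (pj x) v = (\<Sum>i\<in>UNIV. x $ i * pd i (%x. g (pj x)) x)" if "hol_at g (pj x)" for g
   proof -
    have "dd g (pj x) v = (\<Sum>j\<in>UNIV. \<Sum>i\<in>UNIV. x $ i * (pd i (%x. pj x $ j) x * pd j g (pj x)))"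
     by (simp add: dd_def v_def sum_distrib_right mult.assoc)
    also have "\<dots> = (\<Sum>i\<in>UNIV. \<Sum>j\<in>UNIV. x $ i * (pd i (%x. pj x $ j) x * pd j g (pj x)))" by (rule sum.swap)
    finally show ?thesis using elim(2) by (simp add: chain_pd[of g pj x, OF that] sum_distrib_left)
   qed
   have vj: "cmod (v $ j) \<le> C0 * cmod (pj x $ j)" for j
    using logb[OF elim(3)[rule_format, of j] C0j tot0] by (simp add: v_def)
   have nv: "norm v \<le> C0 * norm (pj x)"
   proof -
    have "norm v \<le> norm (of_real C0 *s pj x)" by (rule norm_vec_le) (use vj C0 in \<open>simp add: norm_mult\<close>)
    then show ?thesis using C0 by simp
   qed
   \<comment> \<open>All weights \<open>tot (gm j)\<close> are real and at least 1, so
     \<open>S\<close> dominates the squared norm and an error of half the squared norm cannot cancel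
     it.\<close>
   define S where "S = (\<Sum>j\<in>UNIV. tot (gm j) * (cmod (pj x $ j))\<^sup>2)"
   have S1: "S \<ge> (norm (pj x))\<^sup>2"
    unfolding S_def norm_vec_sq by (intro sum_mono) (use tot1 mult_right_mono[OF tot1] in force)
   have "cmod (herm v (pj x) - of_real S) \<le> 1/2 * (norm (pj x))\<^sup>2"
   proof -
    have "herm v (pj x) - of_real S = (\<Sum>j\<in>UNIV. (v $ j - of_real (tot (gm j)) * pj x $ j) * cnj (pj x $ j))"
     unfolding herm_def S_def of_real_sum sum_subtractf[symmetric]
     by (intro sum.cong refl) (simp only: of_real_mult complex_norm_square left_diff_distrib mult.assoc)
    also have "cmod \<dots> \<le> (\<Sum>j\<in>UNIV. 1/2 * (cmod (pj x $ j))\<^sup>2)"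
    proof (intro order_trans[OF norm_sum] sum_mono)
     fix j
     have "cmod (v $ j - of_real (tot (gm j)) * pj x $ j) \<le> 1/2 * cmod (pj x $ j)" using elim(3) by (simp add: v_def)
     from mult_right_mono[OF this, of "cmod (pj x $ j)"]
     show "cmod ((v $ j - of_real (tot (gm j)) * pj x $ j) * cnj (pj x $ j)) \<le> 1/2 * (cmod (pj x $ j))\<^sup>2"
      by (simp add: norm_mult power2_eq_square)
    qed
    also have "\<dots> = 1/2 * (norm (pj x))\<^sup>2" by (simp add: norm_vec_sq sum_distrib_left)
    finally show ?thesis .
   qed
   then have hv: "cmod (herm v (pj x)) \<ge> 1/2 * (norm (pj x))\<^sup>2"
   proof -
    have "S \<le> cmod (herm v (pj x)) + cmod (herm v (pj x) - of_real S)"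
     using norm_triangle_ineq4[of "herm v (pj x)" "herm v (pj x) - of_real S"] S1 by (simp add: norm_of_real)
    then show ?thesis using S1 \<open>cmod (herm v (pj x) - of_real S) \<le> 1/2 * (norm (pj x))\<^sup>2\<close> by linarith
   qed
   have np: "(norm (pj x))\<^sup>2 > 0" using nz by simp
   then have hv0: "herm v (pj x) ~= 0" using hv by auto
   define s where "s = of_real ((norm (pj x))\<^sup>2) / herm v (pj x)"
   have s2: "cmod s \<le> 2" using hv hv0 np unfolding s_def norm_divide norm_of_real by (simp add: divide_le_eq)
   have sc: "cmod s * A \<le> 2 * C0 * B" if "A \<le> C0 * B" "A \<ge> 0" for A B
    using mult_mono[OF s2 that(1)] that(2) by simp
   show "radial P Q (2 * C0) (pj x)"
    unfolding radial_def
   proof (intro exI[of _ "s *s v"] conjI)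
    show "herm (s *s v) (pj x) = of_real ((norm (pj x))\<^sup>2)" using hv0 by (simp add: herm_smult s_def)
    show "norm (s *s v) \<le> 2 * C0 * norm (pj x)" unfolding norm_vector_smult by (rule sc[OF nv]) simp
    have "cmod (dd Q (pj x) v) \<le> C0 * cmod (Q (pj x))" "cmod (dd P (pj x) v) \<le> C0 * cmod (P (pj x))"
     using elim(1,4,5) C0ab tot0 by (auto simp: d intro: logb)
    then show "cmod (dd Q (pj x) (s *s v)) \<le> 2 * C0 * cmod (Q (pj x))" "cmod (dd P (pj x) (s *s v)) \<le> 2 * C0 * cmod (P (pj x))"
     unfolding dd_smult norm_mult by (auto intro!: sc)
   qed
  qed
 qed
 have e4: "\<forall>\<^sub>F m in sequentially. real m \<ge> 2 * C0"
  by (rule eventually_real_ge)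
 have "\<forall>\<^sub>F m in sequentially. False" using eventually_nhds_seq[OF c(4) main] e4
 proof eventually_elim
  case (elim m)
  have "real m \<le> real (r m)" using seq_suble[OF c(5), of m] by simp
  then have "2 * C0 \<le> real (Suc (r m))" using elim(2) by simp
  moreover have "radial P Q (2 * C0) (z (r m))" unfolding c(6) using elim(1) z(2)[of "r m"] unfolding c(6) by blast
  ultimately show ?case using z(3) radial_mono by blast
 qed
 then show False by simp
qed

text \<open>Prescribing the full Hermitian product with \<open>z\<close>, and not just its real
  part, keeps every complex multiple of \<open>V\<close> tangent to the sphere, as complex controls
  require. With constant bounds on \<open>V\<close> and \<open>W\<close> the condition is closed
  under limits of points off \<open>Q = 0\<close>.\<close>

definition has_fields :: "(complex ^ 'n::finite => complex) => (complex ^ 'n => complex) => real => complex ^ 'n => bool" where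
 "has_fields P Q C z \<longleftrightarrow> (\<exists>V W. dd P z V - (P z / Q z) * dd Q z V = Q z & herm V z = 0 &
  dd P z W - (P z / Q z) * dd Q z W = 0 & herm W z = of_real ((norm z)\<^sup>2) &
  norm V \<le> C & norm W \<le> C & cmod (dd Q z V) \<le> C * cmod (Q z) & cmod (dd Q z W) \<le> C * cmod (Q z))"

text \<open>Since \<open>e\<close> moves \<open>f\<close> by at most a multiple of
  \<open>f - c\<close>, subtracting a small multiple \<open>t\<close> of \<open>v\<close> makes it
  tangent to the fibre; closeness of \<open>f\<close> to \<open>c\<close> ensures that at least half
  of the radial part is left, and rescaling gives \<open>W\<close>. Conversely \<open>V\<close> is
  \<open>v\<close> with its radial part removed by means of \<open>W\<close>, which does not disturb
  \<open>df\<close>.\<close>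

lemma has_fields_combine:
 assumes v: "liftable P Q C1 z" and e: "radial (%z. P z - c * Q z) Q C2 z"
  and hol: "hol_at P z" "hol_at Q z" and Q: "Q z ~= 0" and z: "z ~= 0" "norm z \<le> 1"
  and C: "C1 > 0" "C2 > 0" and close: "2 * C2 * cmod (P z / Q z - c) * C1 \<le> 1/2"
 shows "has_fields P Q (C1 + (C1 + 1) * (2 * (C2 + 1))) z"
proof -
 define f where "f = P z / Q z"
 define D where "D x = dd P z x - f * dd Q z x" for x
 have D_lin: "D (x - y) = D x - D y" "D (t *s x) = t * D x" for x y t
  by (simp_all add: D_def dd_diff dd_smult algebra_simps)
 obtain v where v: "D v = Q z" "norm v \<le> C1 * norm z" "cmod (dd Q z v) \<le> C1 * cmod (Q z)"
  using v unfolding liftable_def D_def f_def by blast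
 obtain e where e: "herm e z = of_real ((norm z)\<^sup>2)" "norm e \<le> C2 * norm z" "cmod (dd Q z e) \<le> C2 * cmod (Q z)"
  "cmod (dd (%z. P z - c * Q z) z e) \<le> C2 * cmod (P z - c * Q z)"
  using e unfolding radial_def by blast
 have pdd: "pd j (%z. P z - c * Q z) z = pd j P z - c * pd j Q z" for j
 proof (rule pd_unique)
  show "((%ze. P (z + ze *s ax j) - c * Q (z + ze *s ax j)) has_field_derivative pd j P z - c * pd j Q z) (at 0)"
   by (intro DERIV_diff DERIV_cmult hol_at_pd_deriv hol)
 qed
 have dP': "dd (%z. P z - c * Q z) z e = dd P z e - c * dd Q z e"
  unfolding dd_def pdd by (simp add: right_diff_distrib sum_subtractf sum_distrib_left algebra_simps)
 have fc: "P z - c * Q z = (f - c) * Q z" using Q by (simp add: f_def field_simps)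
 have De: "cmod (D e) \<le> 2 * C2 * cmod (f - c) * cmod (Q z)"
 proof -
  have "D e = dd (%z. P z - c * Q z) z e - (f - c) * dd Q z e" unfolding D_def dP' by (simp add: algebra_simps)
  then have "cmod (D e) \<le> cmod (dd (%z. P z - c * Q z) z e) + cmod ((f - c) * dd Q z e)" by (simp add: norm_triangle_ineq4)
  also have "cmod (dd (%z. P z - c * Q z) z e) \<le> C2 * cmod (f - c) * cmod (Q z)"
   using e(4) unfolding fc norm_mult by (simp add: mult.assoc)
  also have "cmod ((f - c) * dd Q z e) \<le> cmod (f - c) * (C2 * cmod (Q z))"
   unfolding norm_mult by (intro mult_left_mono e) simp
  finally show ?thesis by (simp add: algebra_simps)
 qed
 define t where "t = D e / Q z"
 have t: "cmod t \<le> 2 * C2 * cmod (f - c)" using De Q by (simp add: t_def norm_divide divide_le_eq)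
 have tC: "cmod t * C1 \<le> 1/2"
 proof -
  have "cmod t * C1 \<le> 2 * C2 * cmod (f - c) * C1" using t C by (intro mult_right_mono) auto
  then show ?thesis using close by (simp add: f_def)
 qed
 define w where "w = e - t *s v"
 have Dw: "D w = 0" using Q v(1) by (simp add: w_def D_lin t_def)
 define N where "N = (norm z)\<^sup>2"
 have N: "N > 0" using z by (simp add: N_def)
 have hv: "cmod (herm v z) \<le> C1 * N"
 proof -
  have "cmod (herm v z) \<le> norm v * norm z" by (rule herm_bound)
  also have "\<dots> \<le> C1 * norm z * norm z" by (intro mult_right_mono v) simp
  finally show ?thesis by (simp add: N_def power2_eq_square mult.assoc)
 qed
 have hw: "cmod (herm w z) \<ge> 1/2 * N"
 proof -
  have "cmod (t * herm v z) \<le> cmod t * (C1 * N)" unfolding norm_mult by (intro mult_left_mono hv) simp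
  also have "\<dots> \<le> 1/2 * N" using mult_right_mono[OF tC less_imp_le[OF N]] by (simp only: mult.assoc)
  finally have "cmod (t * herm v z) \<le> 1/2 * N" .
  moreover have "herm w z = of_real N - t * herm v z" by (simp add: w_def herm_diff herm_smult e(1) N_def)
  ultimately show ?thesis
   using norm_triangle_ineq2[of "of_real N" "t * herm v z"] N by (simp add: norm_of_real)
 qed
 then have hw0: "herm w z ~= 0" using N by auto
 define s where "s = of_real N / herm w z"
 have s2: "cmod s \<le> 2" using hw hw0 N by (simp add: s_def norm_divide divide_le_eq)
 have tri: "cmod t * X \<le> 1/2 * Y" if "X \<le> C1 * Y" "Y \<ge> 0" for X Y
 proof -
  have "cmod t * X \<le> cmod t * (C1 * Y)" by (intro mult_left_mono that) simp
  also have "\<dots> \<le> 1/2 * Y" using mult_right_mono[OF tC that(2)] by (simp only: mult.assoc)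
  finally show ?thesis .
 qed
 define W where "W = s *s w"
 have DW: "D W = 0" by (simp add: W_def D_lin Dw)
 have hW: "herm W z = of_real N" using hw0 by (simp add: W_def herm_smult s_def)
 let ?B = "2 * (C2 + 1)"
 have two: "cmod s * X \<le> ?B * Y" if "X \<le> C2 * Y + 1/2 * Y" "X \<ge> 0" "Y \<ge> 0" for X Y
 proof -
  have "cmod s * X \<le> 2 * (C2 * Y + 1/2 * Y)" using that s2 by (intro mult_mono) auto
  then show ?thesis using that(3) by (simp add: algebra_simps)
 qed
 have nW: "norm W \<le> ?B * norm z"
 proof -
  have "norm w \<le> norm e + cmod t * norm v" unfolding w_def using norm_triangle_ineq4[of e "t *s v"] by simp
  also have "\<dots> \<le> C2 * norm z + 1/2 * norm z" by (intro add_mono e tri v) simp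
  finally show ?thesis unfolding W_def norm_vector_smult by (intro two) auto
 qed
 have qW: "cmod (dd Q z W) \<le> ?B * cmod (Q z)"
 proof -
  have "cmod (dd Q z w) \<le> cmod (dd Q z e) + cmod t * cmod (dd Q z v)"
   unfolding w_def dd_diff dd_smult using norm_triangle_ineq4[of "dd Q z e" "t * dd Q z v"] by (simp add: norm_mult)
  also have "\<dots> \<le> C2 * cmod (Q z) + 1/2 * cmod (Q z)" by (intro add_mono e tri v) simp
  finally show ?thesis unfolding W_def dd_smult norm_mult by (intro two) auto
 qed
 define p where "p = herm v z / of_real N"
 have p: "cmod p \<le> C1" using hv N by (simp add: p_def norm_divide divide_le_eq)
 define V where "V = v - p *s W"
 have DV: "D V = Q z" by (simp add: V_def D_lin v DW)
 have hV: "herm V z = 0" using N by (simp add: V_def herm_diff herm_smult hW p_def)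
 have B0: "?B \<ge> 0" using C by simp
 have nV: "norm V \<le> (C1 + C1 * ?B) * norm z"
 proof -
  have "norm V \<le> norm v + cmod p * norm W" unfolding V_def using norm_triangle_ineq4[of v "p *s W"] by simp
  also have "\<dots> \<le> C1 * norm z + C1 * (?B * norm z)" using p C nW by (intro add_mono v mult_mono) auto
  finally show ?thesis by (simp only: distrib_right mult.assoc)
 qed
 have qV: "cmod (dd Q z V) \<le> (C1 + C1 * ?B) * cmod (Q z)"
 proof -
  have "cmod (dd Q z V) \<le> cmod (dd Q z v) + cmod p * cmod (dd Q z W)"
   unfolding V_def dd_diff dd_smult using norm_triangle_ineq4[of "dd Q z v" "p * dd Q z W"] by (simp add: norm_mult)
  also have "\<dots> \<le> C1 * cmod (Q z) + C1 * (?B * cmod (Q z))" using p C qW by (intro add_mono v mult_mono) auto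
  finally show ?thesis by (simp only: distrib_right mult.assoc)
 qed
 let ?C = "C1 + (C1 + 1) * ?B"
 have le: "C1 + C1 * ?B \<le> ?C" "?B \<le> ?C"
 proof -
  have eq: "?C = (C1 + C1 * ?B) + ?B" by (simp only: distrib_right mult_1 add.assoc)
  have "0 \<le> C1 * ?B" using C B0 by simp
  then show "C1 + C1 * ?B \<le> ?C" "?B \<le> ?C" unfolding eq using B0 C by linarith+
 qed
 have le': "X * norm z \<le> ?C" if "X \<le> ?C" "X \<ge> 0" for X
  using mult_left_mono[OF z(2) that(2)] that(1) by linarith
 show ?thesis
  unfolding has_fields_def
 proof (rule exI[of _ V], rule exI[of _ W], intro conjI)
  show "dd P z V - P z / Q z * dd Q z V = Q z" using DV by (simp add: D_def f_def)
  show "dd P z W - P z / Q z * dd Q z W = 0" using DW by (simp add: D_def f_def)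
  show "herm W z = of_real ((norm z)\<^sup>2)" using hW by (simp add: N_def)
  have "0 \<le> C1 * ?B" using C B0 by simp
  then show "norm V \<le> ?C" using nV le'[OF le(1)] C by linarith
  show "norm W \<le> ?C" using nW le'[OF le(2) B0] by linarith
  show "cmod (dd Q z V) \<le> ?C * cmod (Q z)" by (rule order_trans[OF qV mult_right_mono[OF le(1) norm_ge_zero]])
  show "cmod (dd Q z W) \<le> ?C * cmod (Q z)" by (rule order_trans[OF qW mult_right_mono[OF le(2) norm_ge_zero]])
 qed (rule hV)
qed

text \<open>The bounds confine the fields to a compact set, and all conditions pass to the limit. In
  this way points on coordinate hyperplanes or on the zero set of \<open>P\<close>, where the
  generic estimates say nothing, are reached from generic ones.\<close>

lemma has_fields_closed:
 fixes P Q :: "complex ^ 'n::finite => complex"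
 assumes x: "x \<longlonglongrightarrow> z" and F: "!!m. has_fields P Q C (x m)" and hol: "hol_at P z" "hol_at Q z" and Q: "Q z ~= 0"
 shows "has_fields P Q C z"
proof -
 obtain V W where VW: "!!m. dd P (x m) (V m) - (P (x m) / Q (x m)) * dd Q (x m) (V m) = Q (x m)" "!!m. herm (V m) (x m) = 0"
  "!!m. dd P (x m) (W m) - (P (x m) / Q (x m)) * dd Q (x m) (W m) = 0" "!!m. herm (W m) (x m) = of_real ((norm (x m))\<^sup>2)"
  "!!m. norm (V m) \<le> C" "!!m. norm (W m) \<le> C" "!!m. cmod (dd Q (x m) (V m)) \<le> C * cmod (Q (x m))"
  "!!m. cmod (dd Q (x m) (W m)) \<le> C * cmod (Q (x m))"
  using F unfolding has_fields_def by metis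
 have "compact (cball (0 :: complex ^ 'n) C \<times> cball (0 :: complex ^ 'n) C)" by (intro compact_Times compact_cball)
 then have "seq_compact (cball (0 :: complex ^ 'n) C \<times> cball (0 :: complex ^ 'n) C)" using compact_eq_seq_compact_metric by blast
 then obtain l r where l: "strict_mono (r :: nat => nat)" "(%m. (V (r m), W (r m))) \<longlonglongrightarrow> l"
  using VW(5,6) by (elim seq_compactE[of _ "%m. (V m, W m)"]) (auto simp: o_def)
 have V: "(%m. V (r m)) \<longlonglongrightarrow> fst l" and W: "(%m. W (r m)) \<longlonglongrightarrow> snd l"
  using tendsto_fst[OF l(2)] tendsto_snd[OF l(2)] by auto
 have xr: "(%m. x (r m)) \<longlonglongrightarrow> z" using LIMSEQ_subseq_LIMSEQ[OF x l(1)] by (simp add: o_def)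
 have ct: "(%m. g (x (r m))) \<longlonglongrightarrow> g z" if "hol_at g z" for g
  using filterlim_compose[OF isCont_nhds[OF hol_at_isCont[OF that]] xr] .
 have cd: "(%m. dd g (x (r m)) (Y m)) \<longlonglongrightarrow> dd g z y" if "hol_at g z" "Y \<longlonglongrightarrow> y" for g Y y
  unfolding dd_def by (intro tendsto_sum tendsto_mult tendsto_vec_nth that(2) ct hol_at_pd that(1))
 have ch: "(%m. herm (Y m) (x (r m))) \<longlonglongrightarrow> herm y z" if "Y \<longlonglongrightarrow> y" for Y y
  unfolding herm_def by (intro tendsto_intros that xr)
 have cD: "(%m. dd P (x (r m)) (Y m) - (P (x (r m)) / Q (x (r m))) * dd Q (x (r m)) (Y m)) \<longlonglongrightarrow> dd P z y - (P z / Q z) * dd Q z y" if "Y \<longlonglongrightarrow> y" for Y y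
  by (intro tendsto_intros cd that ct hol Q)
 show ?thesis
  unfolding has_fields_def
 proof (rule exI[of _ "fst l"], rule exI[of _ "snd l"], intro conjI)
  show "dd P z (fst l) - P z / Q z * dd Q z (fst l) = Q z"
   by (rule LIMSEQ_unique[OF cD[OF V, unfolded VW(1)] ct[OF hol(2)]])
  show "herm (fst l) z = 0" by (rule LIMSEQ_unique[OF ch[OF V, unfolded VW(2)] tendsto_const])
  show "dd P z (snd l) - P z / Q z * dd Q z (snd l) = 0" by (rule LIMSEQ_unique[OF cD[OF W, unfolded VW(3)] tendsto_const])
  have "(%m. complex_of_real ((norm (x (r m)))\<^sup>2)) \<longlonglongrightarrow> of_real ((norm z)\<^sup>2)" by (intro tendsto_intros xr)
  then show "herm (snd l) z = of_real ((norm z)\<^sup>2)" by (rule LIMSEQ_unique[OF ch[OF W, unfolded VW(4)]])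
  show "norm (fst l) \<le> C" by (rule LIMSEQ_le_const2[OF tendsto_norm[OF V]]) (use VW(5) in auto)
  show "norm (snd l) \<le> C" by (rule LIMSEQ_le_const2[OF tendsto_norm[OF W]]) (use VW(6) in auto)
  have Qn: "(%m. C * cmod (Q (x (r m)))) \<longlonglongrightarrow> C * cmod (Q z)" by (intro tendsto_intros ct hol)
  show "cmod (dd Q z (fst l)) \<le> C * cmod (Q z)" by (rule LIMSEQ_le[OF tendsto_norm[OF cd[OF hol(2) V]] Qn]) (use VW(7) in auto)
  show "cmod (dd Q z (snd l)) \<le> C * cmod (Q z)" by (rule LIMSEQ_le[OF tendsto_norm[OF cd[OF hol(2) W]] Qn]) (use VW(8) in auto)
 qed
qed

theorem fields_exist:
 fixes P Q :: "complex ^ 'n::finite => complex"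
 assumes P: "hol_at P 0" and Q: "hol_at Q 0" "nz_germ Q"
 shows "\<exists>S. finite S & (\<forall>c. c \<notin> S \<longrightarrow> (\<exists>C>0. \<exists>dl>0. \<forall>z. norm z < dl & Q z ~= 0 & cmod (P z / Q z - c) < dl \<longrightarrow>
  z ~= 0 & hol_at P z & hol_at Q z & has_fields P Q C z))"
\<comment> \<open>If \<open>P\<close> is a constant multiple of \<open>Q\<close> near 0, the
  quotient takes only one value there, and for every other \<open>c\<close> no point satisfies the
  premise.\<close>
proof (cases "\<exists>c0. \<forall>\<^sub>F z in nhds 0. P z = c0 * Q z")
 case True
 then obtain c0 where "\<forall>\<^sub>F z in nhds 0. P z = c0 * Q z" by blast
 then obtain d where d: "d > 0" "!!z. dist z 0 < d ==> P z = c0 * Q z" by (auto simp: eventually_nhds_metric)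
 show ?thesis
 proof (intro exI[of _ "{c0}"] conjI allI impI)
  fix c assume c: "c \<notin> {c0}"
  define dl where "dl = min d (cmod (c0 - c))"
  have "\<not> (norm z < dl & Q z ~= 0 & cmod (P z / Q z - c) < dl)" for z
   using d(2)[of z] by (auto simp: dl_def)
  moreover have "dl > 0" using d c by (simp add: dl_def)
  ultimately show "\<exists>C>0. \<exists>dl>0. \<forall>z. norm z < dl & Q z ~= 0 & cmod (P z / Q z - c) < dl \<longrightarrow>
   z ~= 0 & hol_at P z & hol_at Q z & has_fields P Q C z" using zero_less_one by blast
 qed simp
next
 case False
 have holc: "hol_at (%z. P z - c * Q z) 0" for c by (intro hol_at_diff hol_at_mult P Q) simp
 have nzc: "nz_germ (%z. P z - c * Q z)" for c
  unfolding nz_germ_def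
 proof
  assume "\<forall>\<^sub>F z in nhds 0. P z - c * Q z = 0"
  then have "\<forall>\<^sub>F z in nhds 0. P z = c * Q z" by eventually_elim simp
  then show False using False by blast
 qed
 have nzP: "nz_germ P" using nzc[of 0] by simp
 obtain T where T: "finite T" "!!c. c \<notin> T ==> \<exists>C>0. \<exists>dl>0. \<forall>z. norm z < dl & P z ~= 0 & Q z ~= 0 &
  cmod (P z / Q z - c) < dl \<longrightarrow> liftable P Q C z"
  using liftable_generic[OF P nzP Q] by blast
 show ?thesis
 \<comment> \<open>Excluding the value \<open>P 0 / Q 0\<close> keeps the origin itself, where no
   radial direction exists, out of the region around \<open>f = c\<close>. If
   \<open>Q 0 = 0\<close>, this quotient is 0 by convention.\<close>
 proof (intro exI[of _ "insert (P 0 / Q 0) T"] conjI allI impI)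
  fix c assume c: "c \<notin> insert (P 0 / Q 0) T"
  obtain C1 dl1 where L: "C1 > 0" "dl1 > 0" "!!z. norm z < dl1 & P z ~= 0 & Q z ~= 0 & cmod (P z / Q z - c) < dl1 ==> liftable P Q C1 z"
   using T(2)[of c] c by blast
  obtain C2 dl2 where R: "C2 > 0" "dl2 > 0" "!!z. norm z < dl2 & P z - c * Q z ~= 0 & Q z ~= 0 & (\<forall>j. z $ j ~= 0) ==> radial (%z. P z - c * Q z) Q C2 z"
   using radial_generic[OF holc nzc Q, of c] by blast
  define h where "h z = P z * ((P z - c * Q z) * (\<Prod>j\<in>UNIV. z $ j))" for z
  have h: "hol_at h 0" "nz_germ h" unfolding h_def by (intro nz_germ_triple P holc nzP nzc)+
  obtain r0 where r0: "r0 > 0" "!!V. open V ==> V \<subseteq> ball 0 r0 ==> V ~= {} ==> \<exists>z\<in>V. h z ~= 0"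
   using nz_germ_dense[OF h] by blast
  obtain \<rho> where \<rho>: "\<rho> > 0" "hol P (ball 0 \<rho>)" "hol Q (ball 0 \<rho>)"
   using hol_at_ball2[OF P Q(1)] by blast
  \<comment> \<open>If \<open>f\<close> is within \<open>\<kappa>\<close> of \<open>c\<close>, the
    closeness condition of \<open>has_fields_combine\<close> holds with exactly \<open>1/2\<close>
    as its bound.\<close>
  define \<kappa> where "\<kappa> = 1 / (4 * C2 * C1)"
  have \<kappa>: "\<kappa> > 0" using L R by (simp add: \<kappa>_def)
  define dl where "dl = Min {dl1, dl2, r0, \<rho>, \<kappa>, 1, cmod (P 0 / Q 0 - c)}"
  have "cmod (P 0 / Q 0 - c) > 0" using c by auto
  then have dl: "dl > 0" using L(2) R(2) r0(1) \<rho>(1) \<kappa> by (simp add: dl_def)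
  have dlle: "dl \<le> dl1" "dl \<le> dl2" "dl \<le> r0" "dl \<le> \<rho>" "dl \<le> \<kappa>" "dl \<le> 1" "dl \<le> cmod (P 0 / Q 0 - c)"
   unfolding dl_def by (rule Min_le; simp)+
  let ?C = "C1 + (C1 + 1) * (2 * (C2 + 1))"
  have good: "has_fields P Q ?C z" if z: "norm z < dl" "Q z ~= 0" "cmod (P z / Q z - c) < dl" "h z ~= 0" for z
  proof (rule has_fields_combine[of P Q C1 z c C2])
   have nz: "P z ~= 0" "P z - c * Q z ~= 0" "\<forall>j. z $ j ~= 0" using z(4) by (auto simp: h_def)
   show "liftable P Q C1 z" by (rule L(3)) (use z nz dlle in auto)
   show "radial (%z. P z - c * Q z) Q C2 z" by (rule R(3)) (use z nz dlle in auto)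
   show "z ~= 0" using nz(3) by auto
   show "hol_at P z" "hol_at Q z" using hol_atI[OF \<rho>(2)] hol_atI[OF \<rho>(3)] z(1) dlle by auto
   have "cmod (P z / Q z - c) \<le> \<kappa>" using z dlle by simp
   then have "2 * C2 * C1 * cmod (P z / Q z - c) \<le> 2 * C2 * C1 * \<kappa>" using L R by (intro mult_left_mono) auto
   also have "\<dots> = 1/2" using L R by (simp add: \<kappa>_def field_simps)
   finally show "2 * C2 * cmod (P z / Q z - c) * C1 \<le> 1/2" by (simp add: mult.assoc mult.commute mult.left_commute)
  qed (use z L R dlle in auto)
  have all: "z ~= 0 & hol_at P z & hol_at Q z & has_fields P Q ?C z" if z: "norm z < dl" "Q z ~= 0" "cmod (P z / Q z - c) < dl" for z
  proof -
   have hz: "hol_at P z" "hol_at Q z" using hol_atI[OF \<rho>(2)] hol_atI[OF \<rho>(3)] z(1) dlle by auto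
   have "z ~= 0" using z(3) dlle(7) by auto
   moreover have "has_fields P Q ?C z"
   proof -
    have hq: "hol_at (%z. P z / Q z - c) z" by (intro hol_at_diff hol_at_divide hz z) simp
    have "\<forall>\<^sub>F y in nhds z. cmod (P y / Q y - c) < dl"
     using order_tendstoD(2)[OF tendsto_norm[OF isCont_nhds[OF hol_at_isCont[OF hq]]] z(3)] .
    moreover have "\<forall>\<^sub>F y in nhds z. norm y < dl"
     using order_tendstoD(2)[OF tendsto_norm[OF filterlim_ident[of "nhds z"]] z(1)] .
    ultimately have "\<forall>\<^sub>F y in nhds z. norm y < dl & Q y ~= 0 & cmod (P y / Q y - c) < dl"
     using hol_at_nonzero_ev[OF hz(2) z(2)] by eventually_elim simp
    then obtain d where d: "d > 0" "!!y. dist y z < d ==> norm y < dl & Q y ~= 0 & cmod (P y / Q y - c) < dl"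
     by (auto simp: eventually_nhds_metric)
    have "\<exists>y. dist y z < min d (1 / real (Suc m)) & h y ~= 0" for m
    proof -
     let ?V = "ball z (min d (1 / real (Suc m)))"
     have "?V \<subseteq> ball 0 r0" using d(2) dlle(3) by (force simp: dist_commute)
     moreover have "z \<in> ?V" using d(1) by (auto intro: add_pos_nonneg)
     ultimately obtain y where "y \<in> ?V" "h y ~= 0" using r0(2)[OF open_ball, of z "min d (1 / real (Suc m))"] by blast
     then show ?thesis by (intro exI[of _ y]) (simp add: dist_commute)
    qed
    then obtain y where y: "!!m. dist (y m) z < min d (1 / real (Suc m))" "!!m. h (y m) ~= 0" by metis
    have "(%m. y m - z) \<longlonglongrightarrow> 0" by (rule seq_to_0) (use y(1) in \<open>simp add: dist_norm\<close>)
    then have "y \<longlonglongrightarrow> z" by (simp add: LIM_zero_cancel)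
    moreover have "has_fields P Q ?C (y m)" for m by (rule good) (use d(2)[of "y m"] y in auto)
    ultimately show ?thesis using has_fields_closed hz z(2) by blast
   qed
   ultimately show ?thesis using hz by blast
  qed
  moreover have "?C > 0" using L R by (intro add_pos_nonneg) auto
  ultimately show "\<exists>C>0. \<exists>dl>0. \<forall>z. norm z < dl & Q z ~= 0 & cmod (P z / Q z - c) < dl \<longrightarrow>
   z ~= 0 & hol_at P z & hol_at Q z & has_fields P Q C z" using dl by blast
 qed (use T in auto)
qed

section \<open>Smooth maps\<close>

text \<open>\<open>mf_dd\<close> adds derivatives on the outside, whereas the product and chain
  rules call for an induction that removes the innermost one. This recursion does so, and
  \<open>smooth_iff_ck\<close> identifies the two notions of smoothness.\<close>

primrec ck :: "nat => 'a::euclidean_space set => ('a => 'b::euclidean_space) => bool" where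
 "ck 0 U g \<longleftrightarrow> continuous_on U g"
| "ck (Suc k) U g \<longleftrightarrow> g differentiable_on U & (\<forall>v. ck k U (%x. frechet_derivative g (at x) v))"

lemma frechet_derivative_cong_open:
 assumes "open U" "x \<in> U" "!!y. y \<in> U ==> f y = g y"
 shows "frechet_derivative f (at x) = frechet_derivative g (at x)"
proof -
 have "(f has_derivative D) (at x) \<longleftrightarrow> (g has_derivative D) (at x)" for D
  using has_derivative_transform_within_open[OF _ assms(1,2)] assms(3) by metis
 then show ?thesis unfolding frechet_derivative_def by simp
qed

lemma differentiable_on_cong: "(!!y. y \<in> U ==> f y = g y) ==> f differentiable_on U \<longleftrightarrow> g differentiable_on U"
 unfolding differentiable_on_def
 by (metis differentiable_transform_within zero_less_one)

lemma ck_cong: "open U ==> (!!y. y \<in> U ==> f y = g y) ==> ck k U f \<longleftrightarrow> ck k U g"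
proof (induction k arbitrary: f g)
 case 0 then show ?case by (simp cong: continuous_on_cong)
next
 case (Suc k)
 have "ck k U (%x. frechet_derivative f (at x) v) \<longleftrightarrow> ck k U (%x. frechet_derivative g (at x) v)" for v
  by (rule Suc.IH[OF Suc.prems(1)]) (simp add: frechet_derivative_cong_open[OF Suc.prems(1) _ Suc.prems(2)])
 moreover have "f differentiable_on U \<longleftrightarrow> g differentiable_on U" by (rule differentiable_on_cong[OF Suc.prems(2)])
 ultimately show ?case by simp
qed

lemma mf_dd_snoc: "mf_dd (vs @ [v]) g = mf_dd vs (%x. frechet_derivative g (at x) v)"
 by (induction vs) simp_all

lemma ck_mf_dd: "ck (Suc (length vs)) U g ==> mf_dd vs g differentiable_on U"
proof (induction vs arbitrary: g rule: rev_induct)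
 case (snoc v vs)
 then show ?case unfolding mf_dd_snoc by (intro snoc.IH) simp
qed simp

lemma smooth_iff_ck: "mf_smooth_on U g \<longleftrightarrow> open U & (\<forall>k. ck k U g)"
proof
 assume s: "mf_smooth_on U g"
 have "ck k U h" if "\<forall>vs. mf_dd vs h differentiable_on U" for k h
  using that
 proof (induction k arbitrary: h)
  case 0
  then show ?case using spec[OF 0, of "[]"] by (simp add: differentiable_imp_continuous_on)
 next
  case (Suc k)
  have "mf_dd vs (%x. frechet_derivative h (at x) v) differentiable_on U" for v vs
   using Suc.prems mf_dd_snoc[of vs v h] by metis
  then show ?case using Suc.IH spec[OF Suc.prems, of "[]"] by simp
 qed
 then show "open U & (\<forall>k. ck k U g)" using s unfolding mf_smooth_on_def by blast
next
 assume "open U & (\<forall>k. ck k U g)"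
 then show "mf_smooth_on U g" unfolding mf_smooth_on_def using ck_mf_dd by blast
qed

lemma ck_Suc: "ck (Suc k) U g ==> ck k U g"
proof (induction k arbitrary: g)
 case 0 then show ?case by (simp add: differentiable_imp_continuous_on)
next
 case (Suc k)
 have "ck k U (%x. frechet_derivative g (at x) v)" for v
  using Suc.prems by (intro Suc.IH) simp
 then show ?case using Suc.prems by simp
qed

lemma ck_SucI:
 assumes "open U" "!!x. x \<in> U ==> (g has_derivative g' x) (at x)" "!!v. ck k U (%x. g' x v)"
 shows "ck (Suc k) U g"
proof -
 have "g differentiable_on U"
  unfolding differentiable_on_def using assms(2) by (metis differentiableI differentiable_at_withinI)
 moreover have "ck k U (%x. frechet_derivative g (at x) v)" for v
  by (rule iffD1[OF ck_cong[OF assms(1)] assms(3)[of v]]) (simp add: frechet_derivative_at[OF assms(2)])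
 ultimately show ?thesis by simp
qed

lemma ck_has_derivative:
 assumes "open U" "ck (Suc k) U g" "x \<in> U"
 shows "(g has_derivative frechet_derivative g (at x)) (at x)"
 using assms by (metis ck.simps(2) differentiable_on_eq_differentiable_at frechet_derivative_works)

lemma ck_const: "open U ==> ck k U (%x. c)"
 by (induction k arbitrary: c) (auto intro!: ck_SucI[where g'="%x v. 0"])

lemma ck_bounded_linear:
 assumes "open U" "bounded_linear f" shows "ck k U f"
proof (cases k)
 case 0 then show ?thesis using linear_continuous_on[OF assms(2)] by simp
next
 case (Suc m)
 show ?thesis unfolding Suc
  by (rule ck_SucI[OF assms(1) bounded_linear.has_derivative[OF assms(2) has_derivative_ident]]) (rule ck_const[OF assms(1)])
qed

lemma ck_add: "open U ==> ck k U f ==> ck k U g ==> ck k U (%x. f x + g x)"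
proof (induction k arbitrary: f g)
 case 0 then show ?case by (simp add: continuous_on_add)
next
 case (Suc k)
 show ?case
 proof (rule ck_SucI[OF Suc.prems(1)])
  show "((%x. f x + g x) has_derivative (%v. frechet_derivative f (at x) v + frechet_derivative g (at x) v)) (at x)" if "x \<in> U" for x
   by (intro has_derivative_add ck_has_derivative[OF Suc.prems(1) Suc.prems(2) that] ck_has_derivative[OF Suc.prems(1) Suc.prems(3) that])
  show "ck k U (%x. frechet_derivative f (at x) v + frechet_derivative g (at x) v)" for v
   using Suc.prems by (intro Suc.IH) auto
 qed
qed

lemma ck_bilinear:
 assumes "bounded_bilinear h"
 shows "open U ==> ck k U f ==> ck k U g ==> ck k U (%x. h (f x) (g x))"
proof (induction k arbitrary: f g)
 case 0 then show ?case using bounded_bilinear.continuous_on[OF assms] by simp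
next
 case (Suc k)
 show ?case
 proof (rule ck_SucI[OF Suc.prems(1)])
  show "((%x. h (f x) (g x)) has_derivative (%v. h (f x) (frechet_derivative g (at x) v) + h (frechet_derivative f (at x) v) (g x))) (at x)" if "x \<in> U" for x
   by (intro bounded_bilinear.FDERIV[OF assms] ck_has_derivative[OF Suc.prems(1) Suc.prems(2) that] ck_has_derivative[OF Suc.prems(1) Suc.prems(3) that])
  show "ck k U (%x. h (f x) (frechet_derivative g (at x) v) + h (frechet_derivative f (at x) v) (g x))" for v
   using Suc.prems ck_Suc[OF Suc.prems(2)] ck_Suc[OF Suc.prems(3)]
   by (intro ck_add Suc.IH) auto
 qed
qed

lemma ck_sum: "open U ==> (!!i. i \<in> A ==> ck k U (f i)) ==> ck k U (%x. \<Sum>i\<in>A. f i x)"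
 by (induction A rule: infinite_finite_induct) (auto intro: ck_const ck_add)

lemma ck_linear_compose:
 assumes "bounded_linear l"
 shows "open U ==> ck k U f ==> ck k U (%x. l (f x))"
proof (induction k arbitrary: f)
 case 0 then show ?case using bounded_linear.continuous_on[OF assms] by simp
next
 case (Suc k)
 show ?case
 proof (rule ck_SucI[OF Suc.prems(1)])
  show "((%x. l (f x)) has_derivative (%v. l (frechet_derivative f (at x) v))) (at x)" if "x \<in> U" for x
   by (intro bounded_linear.has_derivative[OF assms] ck_has_derivative[OF Suc.prems(1) Suc.prems(2) that])
  show "ck k U (%x. l (frechet_derivative f (at x) v))" for v
   using Suc.prems by (intro Suc.IH) auto
 qed
qed

lemma ck_compose:
 fixes f :: "'a::euclidean_space => 'b::euclidean_space" and g :: "'b => 'c::euclidean_space"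
 assumes "open U" "open V"
 shows "ck k U f ==> ck k V g ==> f ` U \<subseteq> V ==> ck k U (%x. g (f x))"
proof (induction k arbitrary: f g)
 case 0 then show ?case using continuous_on_compose2 by auto
next
 case (Suc k)
 let ?f' = "%x. frechet_derivative f (at x)" and ?g' = "%y. frechet_derivative g (at y)"
 show ?case
 proof (rule ck_SucI[OF assms(1)])
  fix x assume x: "x \<in> U"
  have g: "(g has_derivative ?g' (f x)) (at (f x))" using ck_has_derivative[OF assms(2) Suc.prems(2)] Suc.prems(3) x by blast
  have D: "((%x. g (f x)) has_derivative (%v. ?g' (f x) (?f' x v))) (at x)"
   using diff_chain_at[OF ck_has_derivative[OF assms(1) Suc.prems(1) x] g] by (simp add: o_def)
  \<comment> \<open>Expanding the inner derivative in a basis turns the chain rule into a finite sum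
    of products in which \<open>g\<close> is differentiated in fixed directions, so that the
    induction hypothesis applies to each factor.\<close>
  have e: "?g' (f x) y = (\<Sum>b\<in>Basis. (y \<bullet> b) *\<^sub>R ?g' (f x) b)" for y
  proof -
   interpret bounded_linear "?g' (f x)" using g by (rule has_derivative_bounded_linear)
   have "?g' (f x) y = ?g' (f x) (\<Sum>b\<in>Basis. (y \<bullet> b) *\<^sub>R b)" by (simp add: euclidean_representation)
   then show ?thesis by (simp add: sum scaleR)
  qed
  show "((%x. g (f x)) has_derivative (%v. \<Sum>b\<in>Basis. (?f' x v \<bullet> b) *\<^sub>R ?g' (f x) b)) (at x)"
   by (rule has_derivative_eq_rhs[OF D]) (rule ext, rule e)
 next
  fix v
  show "ck k U (%x. \<Sum>b\<in>Basis. (?f' x v \<bullet> b) *\<^sub>R ?g' (f x) b)"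
  proof (rule ck_sum[OF assms(1)])
   fix b :: 'b assume "b \<in> Basis"
   have "ck k U (%x. ?f' x v \<bullet> b)"
    using Suc.prems(1) by (intro ck_linear_compose[OF bounded_linear_inner_left assms(1)]) simp
   moreover have "ck k U (%x. ?g' (f x) b)"
    by (rule Suc.IH[of f "%y. ?g' y b"]) (use Suc.prems ck_Suc[OF Suc.prems(1)] in auto)
   ultimately show "ck k U (%x. (?f' x v \<bullet> b) *\<^sub>R ?g' (f x) b)"
    by (rule ck_bilinear[OF bounded_bilinear_scaleR assms(1)])
  qed
 qed
qed

lemma ck_Pair: "open U ==> ck k U f ==> ck k U g ==> ck k U (%x. (f x, g x))"
 using ck_add[of U k "%x. (f x, 0)" "%x. (0, g x)"]
  ck_linear_compose[of "%a. (a, 0)" U k f] ck_linear_compose[of "%b. (0, b)" U k g]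
 by (simp add: bounded_linear_Pair bounded_linear_ident bounded_linear_zero)

lemma ck_inverse: "ck k (- {0}) (inverse :: 'a::{real_normed_field, euclidean_space} => 'a)"
proof (induction k)
 case 0 then show ?case by (auto intro!: continuous_intros)
next
 case (Suc k)
 show ?case
 proof (rule ck_SucI)
  show "(inverse has_derivative (%v. - (inverse x * v * inverse x))) (at x)" if "x \<in> - {0}" for x :: 'a
   using that by (intro has_derivative_inverse') auto
  show "ck k (- {0}) (%x::'a. - (inverse x * v * inverse x))" for v
   by (intro ck_linear_compose[OF bounded_linear_minus[OF bounded_linear_ident]] ck_bilinear[OF bounded_bilinear_mult] Suc ck_const) auto
 qed auto
qed

lemma ck_cos_sin: "ck k UNIV (cos :: real => real) & ck k UNIV (sin :: real => real)"
proof (induction k)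
 case 0 then show ?case by (auto intro!: continuous_intros)
next
 case (Suc k)
 have "ck (Suc k) UNIV (cos :: real => real)"
 proof (rule ck_SucI)
  show "(cos has_derivative (%v. - sin x * v)) (at x)" for x :: real
   by (rule has_derivative_eq_rhs[OF DERIV_cos[unfolded has_field_derivative_def]]) auto
  show "ck k UNIV (%x::real. - sin x * v)" for v
   using Suc by (intro ck_bilinear[OF bounded_bilinear_mult] ck_linear_compose[OF bounded_linear_minus[OF bounded_linear_ident]] ck_const) auto
 qed auto
 moreover have "ck (Suc k) UNIV (sin :: real => real)"
 proof (rule ck_SucI)
  show "(sin has_derivative (%v. cos x * v)) (at x)" for x :: real
   using DERIV_sin[of x] by (simp add: has_field_derivative_def)
  show "ck k UNIV (%x::real. cos x * v)" for v
   using Suc by (intro ck_bilinear[OF bounded_bilinear_mult] ck_const) auto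
 qed auto
 ultimately show ?case by blast
qed

lemma ck_hol: "hol f U ==> ck k U f"
proof (induction k arbitrary: f)
 case 0 then show ?case by (simp add: hol_cont)
next
 case (Suc k)
 show ?case
 proof (rule ck_SucI[OF hol_open[OF Suc.prems] hol_has_derivative[OF Suc.prems]])
  fix v show "ck k U (%x. \<Sum>j\<in>UNIV. v $ j * pd j f x)"
   by (intro ck_sum ck_bilinear[OF bounded_bilinear_mult] ck_const Suc.IH hol_pd hol_open[OF Suc.prems] Suc.prems)
 qed
qed

lemma ck_subset: "ck k U f ==> V \<subseteq> U ==> ck k V f"
 by (induction k arbitrary: f) (auto intro: continuous_on_subset differentiable_on_subset)

lemma ck_vec:
 fixes f :: "'a::euclidean_space => complex ^ 'n::finite"
 assumes "open U" "!!i. ck k U (%x. f x $ i)"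
 shows "ck k U f"
proof -
 have "ck k U (%x. \<Sum>i\<in>UNIV. f x $ i *s ax i)"
  by (intro ck_sum assms(1) ck_linear_compose[OF bounded_linear_smult_left] assms(2))
 then show ?thesis by (simp add: basis_expansion)
qed

section \<open>Holomorphic dependence of integrals on parameters\<close>

lemma pd_diff_bound2:
 assumes "0 < r" "(%ze. f (z + ze *s ax k)) holomorphic_on ball 0 r" "continuous_on (cball 0 r) (%ze. f (z + ze *s ax k))"
  "(%ze. g (w + ze *s ax k)) holomorphic_on ball 0 r" "continuous_on (cball 0 r) (%ze. g (w + ze *s ax k))"
  and B: "!!ze. cmod ze \<le> r ==> cmod (f (z + ze *s ax k) - g (w + ze *s ax k)) \<le> B"
 shows "cmod (pd k f z - pd k g w) \<le> B / r"
proof -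
 let ?g = "%ze. f (z + ze *s ax k) - g (w + ze *s ax k)"
 have "cmod ((deriv ^^ 1) ?g 0) \<le> fact 1 * B / r ^ 1"
  by (rule Cauchy_inequality) (use assms in \<open>auto intro!: holomorphic_on_diff continuous_on_diff\<close>)
 moreover have "deriv ?g 0 = pd k f z - pd k g w"
  unfolding pd_def using assms(1,2,4)
  by (intro deriv_diff) (auto intro: holomorphic_on_imp_differentiable_at[of _ "ball 0 r"])
 ultimately show ?thesis by simp
qed

text \<open>By Osgood's lemma a coordinate line is enough, and on it Leibniz' rule applies if the
  partial derivative of the integrand is jointly continuous. Cauchy's estimate for the difference of
  two integrands, with different points and different \<open>s\<close>, deduces this from joint
  continuity of the integrand.\<close>

lemma hol_integral:
 fixes F :: "complex ^ 'n::finite => real => complex"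
 assumes "open U" and cont: "continuous_on (U \<times> {a..b}) (%(p, s). F p s)"
  and hol: "!!s. s \<in> {a..b} ==> hol (%p. F p s) U"
 shows "hol (%p. integral {a..b} (F p)) U"
proof (rule osgood[OF \<open>open U\<close>])
 have cint: "F p integrable_on {a..b}" if "p \<in> U" for p
 proof (rule integrable_continuous_interval)
  have "continuous_on {a..b} (%s. (p, s))" by (rule continuous_on_Pair[OF continuous_on_const continuous_on_id])
  from continuous_on_compose2[OF cont this] show "continuous_on {a..b} (F p)" using that by auto
 qed
 show "continuous_on U (%p. integral {a..b} (F p))"
  using integral_continuous_on_param[of U a b F] cont by (simp add: cbox_interval)
 fix p0 k assume p0: "p0 \<in> U"
 obtain R where R: "R > 0" "cball p0 R \<subseteq> U" using \<open>open U\<close> p0 open_contains_cball by blast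
 define r where "r = R / 2"
 have r: "r > 0" using R by (simp add: r_def)
 have in_cb: "p0 + ze *s ax k \<in> cball p0 R" if "cmod ze \<le> R" for ze using that by (simp add: dist_norm)
 have inU: "p0 + ze *s ax k \<in> U" if "cmod ze \<le> R" for ze using in_cb[OF that] R by auto
 define fx where "fx ze s = pd k (%p. F p s) (p0 + ze *s ax k)" for ze s
 have "(%ze. integral (cbox a b) (F (p0 + ze *s ax k))) holomorphic_on ball 0 r"
 proof (rule leibniz_rule_holomorphic[where fx=fx and f="%ze. F (p0 + ze *s ax k)" and U="ball 0 r" and a=a and b=b])
  show "((%ze. F (p0 + ze *s ax k) s) has_field_derivative fx ze s) (at ze within ball 0 r)"
   if "ze \<in> ball 0 r" "s \<in> cbox a b" for ze s
  proof -
   have s: "s \<in> {a..b}" and u: "p0 + ze *s ax k \<in> U" using that r inU[of ze] by (auto simp: r_def cbox_interval)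
   show ?thesis unfolding fx_def by (rule has_field_derivative_at_within[OF hol_slice_ax_deriv[OF hol[OF s] u]])
  qed
  show "F (p0 + ze *s ax k) integrable_on cbox a b" if "ze \<in> ball 0 r" for ze
   using cint[OF inU, of ze] that r by (simp add: cbox_interval r_def)
  show "continuous_on (ball 0 r \<times> cbox a b) (%(ze, s). fx ze s)"
   unfolding continuous_on_iff
  proof (intro ballI allI impI)
   fix x :: "complex \<times> real" and e :: real assume x: "x \<in> ball 0 r \<times> cbox a b" and e: "e > 0"
   obtain ze0 s0 where xe: "x = (ze0, s0)" by (cases x)
   have "uniformly_continuous_on (cball p0 R \<times> {a..b}) (%(p, s). F p s)"
    by (intro compact_uniformly_continuous continuous_on_subset[OF cont] compact_Times) (use R in auto)
   note uc = this[unfolded uniformly_continuous_on_def, THEN spec[of _ "e * r / 2"]]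
   have "0 < e * r / 2" using e r by simp
   from uc[THEN mp, OF this] obtain d where d: "d > 0" "!!y y'. y \<in> cball p0 R \<times> {a..b} ==> y' \<in> cball p0 R \<times> {a..b} ==> dist y' y < d ==>
     dist ((%(p, s). F p s) y') ((%(p, s). F p s) y) < e * r / 2"
    by blast
   show "\<exists>d>0. \<forall>x'\<in>ball 0 r \<times> cbox a b. dist x' x < d \<longrightarrow> dist ((%(ze, s). fx ze s) x') ((%(ze, s). fx ze s) x) < e"
   proof (intro exI[of _ "d"] conjI ballI impI d(1))
    fix x' :: "complex \<times> real" assume x': "x' \<in> ball 0 r \<times> cbox a b" "dist x' x < d"
    obtain ze s where x'e: "x' = (ze, s)" by (cases x')
    have ss: "s \<in> {a..b}" "s0 \<in> {a..b}" and zz: "cmod ze < r" "cmod ze0 < r"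
     using x x' by (auto simp: xe x'e cbox_interval)
    have shift: "p0 + ze1 *s ax k + \<xi> *s ax k = p0 + (ze1 + \<xi>) *s ax k" for ze1 \<xi> by (simp add: vec_eq_iff algebra_simps)
    have rad: "cmod (ze1 + \<xi>) \<le> R" if "cmod ze1 < r" "cmod \<xi> \<le> r" for ze1 \<xi>
     using norm_triangle_ineq[of ze1 \<xi>] that by (simp add: r_def)
    have holsl: "(%\<xi>. F (p0 + ze1 *s ax k + \<xi> *s ax k) s1) holomorphic_on ball 0 r &
      continuous_on (cball 0 r) (%\<xi>. F (p0 + ze1 *s ax k + \<xi> *s ax k) s1)" if "cmod ze1 < r" "s1 \<in> {a..b}" for ze1 s1
    proof -
     have sub: "cball 0 r \<subseteq> {\<xi>. p0 + ze1 *s ax k + \<xi> *s ax k \<in> U}"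
     proof
      fix \<xi> :: complex assume "\<xi> \<in> cball 0 r"
      then have "p0 + (ze1 + \<xi>) *s ax k \<in> U" by (intro inU rad that) simp
      then show "\<xi> \<in> {\<xi>. p0 + ze1 *s ax k + \<xi> *s ax k \<in> U}" by (simp only: shift mem_Collect_eq)
     qed
     have h: "(%\<xi>. F (p0 + ze1 *s ax k + \<xi> *s ax k) s1) holomorphic_on cball 0 r"
      using holomorphic_on_subset[OF hol_slice[OF hol[OF that(2)]] sub] .
     then show ?thesis using holomorphic_on_imp_continuous_on holomorphic_on_subset[OF h ball_subset_cball] by blast
    qed
    have "cmod (fx ze s - fx ze0 s0) \<le> (e * r / 2) / r"
     unfolding fx_def
    proof (rule pd_diff_bound2[OF r])
     fix \<xi> assume \<xi>: "cmod \<xi> \<le> r"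
     have "dist (p0 + (ze + \<xi>) *s ax k, s) (p0 + (ze0 + \<xi>) *s ax k, s0) = dist (ze, s) (ze0, s0)"
     proof -
      have "(p0 + (ze + \<xi>) *s ax k) - (p0 + (ze0 + \<xi>) *s ax k) = (ze - ze0) *s ax k" by (simp add: vec_eq_iff algebra_simps)
      then have "dist (p0 + (ze + \<xi>) *s ax k) (p0 + (ze0 + \<xi>) *s ax k) = dist ze ze0"
       unfolding dist_norm by (simp only: norm_vector_smult norm_ax mult_1_right)
      then show ?thesis by (simp add: dist_Pair_Pair)
     qed
     then have "dist (p0 + (ze + \<xi>) *s ax k, s) (p0 + (ze0 + \<xi>) *s ax k, s0) < d" using x'(2) by (simp add: xe x'e)
     then have "dist ((%(p, s). F p s) (p0 + (ze + \<xi>) *s ax k, s)) ((%(p, s). F p s) (p0 + (ze0 + \<xi>) *s ax k, s0)) < e * r / 2"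
      using in_cb[OF rad[OF zz(1) \<xi>]] in_cb[OF rad[OF zz(2) \<xi>]] ss by (intro d(2)) auto
     then show "cmod (F (p0 + ze *s ax k + \<xi> *s ax k) s - F (p0 + ze0 *s ax k + \<xi> *s ax k) s0) \<le> e * r / 2"
      by (simp add: shift dist_norm)
    qed (use holsl zz ss in auto)
    then show "dist ((%(ze, s). fx ze s) x') ((%(ze, s). fx ze s) x) < e" using r e by (simp add: xe x'e dist_norm)
   qed
  qed
 qed simp
 then have "(%ze. integral {a..b} (F (p0 + ze *s ax k))) holomorphic_on ball 0 r" by (simp add: cbox_interval)
 then show "(%ze. integral {a..b} (F (p0 + ze *s ax k))) field_differentiable (at 0)"
  using r by (intro holomorphic_on_imp_differentiable_at[of _ "ball 0 r"]) auto
qed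

section \<open>Flows of real-analytic vector fields\<close>

lemma hol_map_lipschitz:
 fixes g :: "complex ^ 'm::finite => complex ^ 'n::finite"
 assumes "!!i. hol (%z. g z $ i) U" "cball x R \<subseteq> U"
 obtains L where "L \<ge> 0" "!!y z. y \<in> cball x R ==> z \<in> cball x R ==> norm (g y - g z) \<le> L * norm (y - z)"
proof -
 let ?D = "%z h. \<chi> i. \<Sum>k\<in>UNIV. h $ k * pd k (%z. g z $ i) z"
 let ?b = "%z. \<Sum>i\<in>UNIV. \<Sum>k\<in>UNIV. cmod (pd k (%z. g z $ i) z)"
 have "continuous_on (cball x R) ?b"
  by (intro continuous_on_sum continuous_on_norm continuous_on_subset[OF pd_cont[OF assms(1)] assms(2)])
 then have "bounded (?b ` cball x R)" by (intro compact_imp_bounded compact_continuous_image compact_cball)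
 then obtain B where B: "B > 0" "!!z. z \<in> cball x R ==> ?b z \<le> B"
  unfolding bounded_pos by (metis abs_le_D1 image_eqI real_norm_def)
 have "norm (g y - g z) \<le> B * norm (y - z)" if "y \<in> cball x R" "z \<in> cball x R" for y z
 proof (rule differentiable_bound[OF convex_cball _ _ that])
  fix w assume w: "w \<in> cball x R"
  show "(g has_derivative ?D w) (at w within cball x R)"
   using hol_map_has_derivative[OF assms(1)] w assms(2) has_derivative_at_withinI by blast
  show "onorm (?D w) \<le> B"
  proof (rule onorm_le)
   fix h :: "complex ^ 'm"
   have "norm (?D w h) \<le> (\<Sum>i\<in>UNIV. cmod (\<Sum>k\<in>UNIV. h $ k * pd k (%z. g z $ i) w))"
    unfolding norm_vec_def by (rule order_trans[OF L2_set_le_sum]) auto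
   also have "\<dots> \<le> (\<Sum>i\<in>UNIV. \<Sum>k\<in>UNIV. norm h * cmod (pd k (%z. g z $ i) w))"
   proof (rule sum_mono)
    fix i :: 'n
    have "cmod (\<Sum>k\<in>UNIV. h $ k * pd k (%z. g z $ i) w) \<le> (\<Sum>k\<in>UNIV. cmod (h $ k * pd k (%z. g z $ i) w))"
     by (rule norm_sum)
    also have "\<dots> \<le> (\<Sum>k\<in>UNIV. norm h * cmod (pd k (%z. g z $ i) w))"
     unfolding norm_mult by (intro sum_mono mult_right_mono Finite_Cartesian_Product.norm_nth_le norm_ge_zero)
    finally show "cmod (\<Sum>k\<in>UNIV. h $ k * pd k (%z. g z $ i) w) \<le> (\<Sum>k\<in>UNIV. norm h * cmod (pd k (%z. g z $ i) w))" .
   qed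
   also have "\<dots> = norm h * ?b w" by (simp add: sum_distrib_left)
   also have "\<dots> \<le> norm h * B" by (rule mult_left_mono[OF B(2)[OF w] norm_ge_zero])
   finally show "norm (?D w h) \<le> B * norm h" by (simp add: mult.commute)
  qed
 qed
 then show ?thesis using that[of B] B(1) by simp
qed

lemma continuous_on_joint:
 fixes f :: "'a::metric_space => real => 'b::real_normed_vector"
 assumes c: "!!t. t \<in> T ==> continuous_on U (%p. f p t)"
  and l: "!!p t t'. p \<in> U ==> t \<in> T ==> t' \<in> T ==> norm (f p t - f p t') \<le> M * \<bar>t - t'\<bar>"
 shows "continuous_on (U \<times> T) (%(p, t). f p t)"
 unfolding continuous_on_iff
proof (intro ballI allI impI)
 fix x and e :: real assume x: "x \<in> U \<times> T" and e: "e > 0"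
 obtain p0 t0 where x0: "x = (p0, t0)" by (cases x)
 then have pt: "p0 \<in> U" "t0 \<in> T" using x by auto
 obtain d1 where d1: "d1 > 0" "!!p. p \<in> U ==> dist p p0 < d1 ==> dist (f p t0) (f p0 t0) < e / 2"
  using c[OF pt(2)] pt(1) e unfolding continuous_on_iff by (meson half_gt_zero)
 define d where "d = min d1 (e / (2 * (\<bar>M\<bar> + 1)))"
 have d: "d > 0" using d1 e by (simp add: d_def add_nonneg_pos)
 show "\<exists>d>0. \<forall>x'\<in>U \<times> T. dist x' x < d \<longrightarrow> dist ((%(p, t). f p t) x') ((%(p, t). f p t) x) < e"
 proof (intro exI[of _ d] conjI ballI impI d)
  fix x' assume x': "x' \<in> U \<times> T" "dist x' x < d"
  obtain p t where xp: "x' = (p, t)" by (cases x')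
  have pt': "p \<in> U" "t \<in> T" using x' xp by auto
  have "dist p p0 < d" "dist t t0 < d"
   using dist_fst_le[of x' x] dist_snd_le[of x' x] x'(2) by (auto simp: xp x0)
  then have 1: "dist (f p t0) (f p0 t0) < e / 2" and 2: "\<bar>t - t0\<bar> \<le> e / (2 * (\<bar>M\<bar> + 1))"
   using d1(2)[OF pt'(1)] by (auto simp: d_def dist_real_def)
  have "norm (f p t - f p t0) \<le> M * \<bar>t - t0\<bar>" by (rule l[OF pt'(1) pt'(2) pt(2)])
  also have "\<dots> \<le> (\<bar>M\<bar> + 1) * \<bar>t - t0\<bar>" by (intro mult_right_mono) auto
  also have "\<dots> \<le> (\<bar>M\<bar> + 1) * (e / (2 * (\<bar>M\<bar> + 1)))" by (intro mult_left_mono 2) auto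
  also have "\<dots> = e / 2" by (simp add: field_simps add_nonneg_pos)
  finally have "dist (f p t) (f p t0) \<le> e / 2" by (simp add: dist_norm)
  then show "dist ((%(p, t). f p t) x') ((%(p, t). f p t) x) < e"
   using 1 dist_triangle[of "f p t" "f p0 t0" "f p t0"] by (simp add: xp x0)
 qed
qed

lemma picard_hol:
 fixes X :: "complex ^ 'm::finite => complex ^ 'm"
 assumes X: "!!j. hol (%w. X w $ j) (ball x0 R)" and R: "R > 0"
 obtains r h and Y :: "complex ^ 'm => real => complex ^ 'm" where "r > 0" "h > 0"
  "!!p. Y p 0 = p"
  "!!p t. p \<in> ball x0 r ==> t \<in> {0..h} ==> Y p t \<in> ball x0 R"
  "!!p t. p \<in> ball x0 r ==> t \<in> {0..h} ==> (Y p has_vector_derivative X (Y p t)) (at t within {0..h})"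
  "!!t j. t \<in> {0..h} ==> hol (%p. Y p t $ j) (ball x0 r)"
proof -
 \<comment> \<open>Initial values within \<open>r\<close> and displacements of at most
   \<open>r\<close> stay in \<open>?K\<close>, of radius \<open>R / 2\<close>, where the field is
   bounded and Lipschitz.\<close>
 define r where "r = R / 4"
 let ?K = "cball x0 (2 * r)" and ?U = "ball x0 r"
 have r: "r > 0" using R by (simp add: r_def)
 have K: "?K \<subseteq> ball x0 R" using R by (auto simp: r_def)
 obtain L where L: "L \<ge> 0" "!!y z. y \<in> ?K ==> z \<in> ?K ==> norm (X y - X z) \<le> L * norm (y - z)"
  using hol_map_lipschitz[OF X K] by blast
 define M where "M = norm (X x0) + L * (2 * r) + 1"
 have M: "M > 0" using L(1) r by (simp add: M_def add_nonneg_pos)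
 have XM: "norm (X y) \<le> M" if "y \<in> ?K" for y
 proof -
  have "norm (X y - X x0) \<le> L * norm (y - x0)" using L(2)[OF that] r by simp
  also have "\<dots> \<le> L * (2 * r)" using that L(1) by (intro mult_left_mono) (auto simp: dist_norm norm_minus_commute)
  finally show ?thesis using norm_triangle_sub[of "X y" "X x0"] by (simp add: M_def)
 qed
 have contX: "continuous_on ?K X"
  by (rule lipschitz_on_continuous_on[of L]) (use L in \<open>auto simp: lipschitz_on_def dist_norm\<close>)
 \<comment> \<open>The first bound keeps the iterates in \<open>?K\<close>; the second makes
   consecutive differences shrink by a factor of 2.\<close>
 define h where "h = min (r / M) (1 / (2 * (L + 1)))"
 have h: "h > 0" "M * h \<le> r" "L * h \<le> 1 / 2"
 proof -
  show "h > 0" using r M L(1) by (simp add: h_def)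
  have "M * h \<le> M * (r / M)" using M by (intro mult_left_mono) (auto simp: h_def)
  then show "M * h \<le> r" using M by simp
  have "L * h \<le> (L + 1) * (1 / (2 * (L + 1)))" using L(1) \<open>h > 0\<close> by (intro mult_mono) (auto simp: h_def)
  moreover have "L + 1 ~= 0" using L(1) by linarith
  then have "(L + 1) * (1 / (2 * (L + 1))) = 1 / 2" by (simp only: mult.commute[of 2]) simp
  ultimately show "L * h \<le> 1 / 2" by linarith
 qed
 define y :: "nat => complex ^ 'm => real => complex ^ 'm" where "y m = rec_nat (%p t. p) (%_ g p t. p + integral {0..t} (%s. X (g p s))) m" for m
 have y0: "y 0 = (%p t. p)" and ySuc: "!!m. y (Suc m) = (%p t. p + integral {0..t} (%s. X (y m p s)))"
  by (simp_all add: y_def)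
 \<comment> \<open>The three properties are carried along together: values in \<open>?K\<close> make
   the next integrand defined, the Lipschitz bound in time gives joint continuity, and holomorphy in
   \<open>p\<close> is then preserved by integration.\<close>
 have inv: "(\<forall>p\<in>?U. \<forall>t\<in>{0..h}. y m p t \<in> ?K) &
   (\<forall>p\<in>?U. \<forall>t\<in>{0..h}. \<forall>t'\<in>{0..h}. norm (y m p t - y m p t') \<le> M * \<bar>t - t'\<bar>) &
   (\<forall>t\<in>{0..h}. \<forall>j. hol (%p. y m p t $ j) ?U)" for m
 proof (induction m)
  case 0
  show ?case using r M by (auto simp: y0 intro: hol_coord)
 next
  case (Suc m)
  have in_K: "y m p t \<in> ?K" if "p \<in> ?U" "t \<in> {0..h}" for p t using Suc that by blast
  have hy: "hol (%p. y m p t $ j) ?U" if "t \<in> {0..h}" for t j using Suc that by blast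
  have cy: "continuous_on (?U \<times> {0..h}) (%(p, s). y m p s)"
  proof (rule continuous_on_joint[where M=M])
   show "continuous_on ?U (%p. y m p t)" if "t \<in> {0..h}" for t
   proof -
    have "continuous_on ?U (%p. \<chi> j. y m p t $ j)"
     by (intro continuous_on_vec_lambda hol_cont hy that)
    then show ?thesis by simp
   qed
  qed (use Suc in blast)
  have cX: "continuous_on (?U \<times> {0..h}) (%z. X ((%(p, s). y m p s) z))"
   by (rule continuous_on_compose2[OF contX cy]) (use in_K in \<open>auto simp del: mem_cball mem_ball\<close>)
  have ct: "continuous_on {0..h} (%s. X (y m p s))" if "p \<in> ?U" for p
  proof -
   have c: "continuous_on {0..h} (%s. (p, s))" by (rule continuous_on_Pair[OF continuous_on_const continuous_on_id])
   have "(%s. (p, s)) ` {0..h} \<subseteq> ?U \<times> {0..h}" using that by auto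
   from continuous_on_compose2[OF cX c this] show ?thesis by simp
  qed
  have ib: "norm (integral {a..b} (%s. X (y m p s))) \<le> M * (b - a)" if "p \<in> ?U" "a \<le> b" "0 \<le> a" "b \<le> h" for p a b
  proof (rule integral_bound[OF that(2)])
   show "continuous_on {a..b} (%s. X (y m p s))" by (rule continuous_on_subset[OF ct[OF that(1)]]) (use that in auto)
   show "norm (X (y m p t)) \<le> M" if "t \<in> {a..b}" for t
    by (rule XM[OF in_K]) (use that \<open>p \<in> ?U\<close> \<open>0 \<le> a\<close> \<open>b \<le> h\<close> in auto)
  qed
  have 1: "y (Suc m) p t \<in> ?K" if p: "p \<in> ?U" and t: "t \<in> {0..h}" for p t
  proof -
   have "norm (integral {0..t} (%s. X (y m p s))) \<le> M * (t - 0)" by (rule ib[OF p]) (use t in auto)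
   also have "\<dots> \<le> M * h" using t M by (intro mult_left_mono) auto
   finally have "norm (integral {0..t} (%s. X (y m p s))) \<le> r" using h by simp
   moreover have "norm (p - x0) \<le> r" using p by (simp add: dist_norm norm_minus_commute)
   ultimately have "norm (p - x0 + integral {0..t} (%s. X (y m p s))) \<le> 2 * r"
    using norm_triangle_ineq[of "p - x0" "integral {0..t} (%s. X (y m p s))"] by linarith
   then show ?thesis by (simp add: ySuc dist_norm norm_minus_commute algebra_simps)
  qed
  have 2: "norm (y (Suc m) p b - y (Suc m) p a) \<le> M * (b - a)" if "p \<in> ?U" "a \<le> b" "0 \<le> a" "b \<le> h" for p a b
  proof -
   have "integral {0..a} (%s. X (y m p s)) + integral {a..b} (%s. X (y m p s)) = integral {0..b} (%s. X (y m p s))"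
    by (rule Henstock_Kurzweil_Integration.integral_combine)
     (use that in \<open>auto intro!: integrable_continuous_interval continuous_on_subset[OF ct[OF that(1)]]\<close>)
   then have "y (Suc m) p b - y (Suc m) p a = integral {a..b} (%s. X (y m p s))" by (simp add: ySuc algebra_simps)
   then show ?thesis using ib[OF that] by simp
  qed
  have 2: "norm (y (Suc m) p t - y (Suc m) p t') \<le> M * \<bar>t - t'\<bar>" if "p \<in> ?U" "t \<in> {0..h}" "t' \<in> {0..h}" for p t t'
   using 2[OF that(1), of t' t] 2[OF that(1), of t t'] that(2,3)
   by (cases "t' \<le> t") (auto simp: norm_minus_commute)
  have 3: "hol (%p. y (Suc m) p t $ j) ?U" if t: "t \<in> {0..h}" for t j
  proof -
   have "hol (%p. p $ j + integral {0..t} (%s. X (y m p s) $ j)) ?U"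
   proof (intro hol_add hol_coord open_ball hol_integral)
    have "continuous_on (?U \<times> {0..t}) (%z. X ((%(p, s). y m p s) z) $ j)"
     by (intro continuous_on_component continuous_on_subset[OF cX]) (use t in auto)
    then show "continuous_on (?U \<times> {0..t}) (%(p, s). X (y m p s) $ j)" by (simp add: case_prod_unfold)
    show "hol (%p. X (y m p s) $ j) ?U" if "s \<in> {0..t}" for s
    proof (rule hol_compose[OF X])
     show "hol (%p. y m p s $ i) ?U" for i by (rule hy) (use that t in auto)
     show "(%p. y m p s) ` ?U \<subseteq> ball x0 R" using in_K that t K by (auto simp del: mem_cball mem_ball)
    qed
   qed
   then show ?thesis
   proof (rule hol_cong)
    fix p assume p: "p \<in> ?U"
    have "(%s. X (y m p s)) integrable_on {0..t}"
     by (intro integrable_continuous_interval continuous_on_subset[OF ct[OF p]]) (use t in auto)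
    from integral_linear[OF this bounded_linear_vec_nth[of j]]
    show "p $ j + integral {0..t} (%s. X (y m p s) $ j) = y (Suc m) p t $ j" by (simp add: ySuc o_def)
   qed
  qed
  show ?case using 1 2 3 by blast
 qed
 have in_K: "y m p t \<in> ?K" if "p \<in> ?U" "t \<in> {0..h}" for m p t using inv[of m] that by blast
 have hy: "hol (%p. y m p t $ j) ?U" if "t \<in> {0..h}" for m t j using inv[of m] that by blast
 have cy: "continuous_on {0..h} (y m p)" if "p \<in> ?U" for m p
  by (rule lipschitz_on_continuous_on[of M]) (use inv[of m] that M in \<open>auto simp: lipschitz_on_def dist_norm\<close>)
 have cXy: "continuous_on {0..t} (%s. X (y m p s))" if "p \<in> ?U" "t \<in> {0..h}" for m p t
 proof (rule continuous_on_compose2[OF contX])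
  show "continuous_on {0..t} (y m p)" by (rule continuous_on_subset[OF cy[OF that(1)]]) (use that in auto)
  show "y m p ` {0..t} \<subseteq> ?K" using in_K[OF that(1)] that(2) by (auto simp del: mem_cball)
 qed
 have diff: "norm (y (Suc m) p t - y m p t) \<le> r * (1/2) ^ m" if "p \<in> ?U" "t \<in> {0..h}" for m p t
  using that
 proof (induction m arbitrary: t)
  case 0
  have "norm (integral {0..t} (%s. X p)) \<le> M * (t - 0)"
   by (rule integral_bound) (use 0 XM[of p] r in \<open>auto simp: y0\<close>)
  also have "\<dots> \<le> M * h" using 0 M by (intro mult_left_mono) auto
  finally show ?case using h by (simp add: ySuc y0)
 next
  case (Suc m)
  have "norm (integral {0..t} (%s. X (y (Suc m) p s) - X (y m p s))) \<le> (L * (r * (1/2) ^ m)) * (t - 0)"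
  proof (rule integral_bound)
   show "continuous_on {0..t} (%s. X (y (Suc m) p s) - X (y m p s))"
    by (intro continuous_on_diff cXy Suc.prems)
   fix s assume s: "s \<in> {0..t}"
   then have s': "s \<in> {0..h}" using Suc.prems by auto
   have "norm (X (y (Suc m) p s) - X (y m p s)) \<le> L * norm (y (Suc m) p s - y m p s)"
    by (intro L in_K Suc.prems s')
   also have "\<dots> \<le> L * (r * (1/2) ^ m)" by (intro mult_left_mono L Suc.IH Suc.prems s')
   finally show "norm (X (y (Suc m) p s) - X (y m p s)) \<le> L * (r * (1/2) ^ m)" .
  qed (use Suc.prems in auto)
  also have "\<dots> \<le> (L * (r * (1/2) ^ m)) * h" using Suc.prems L(1) r by (intro mult_left_mono) auto
  also have "\<dots> = (L * h) * (r * (1/2) ^ m)" by simp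
  also have "\<dots> \<le> 1/2 * (r * (1/2) ^ m)" by (intro mult_right_mono h) (use r in auto)
  finally have *: "norm (integral {0..t} (%s. X (y (Suc m) p s) - X (y m p s))) \<le> r * (1/2) ^ Suc m" by simp
  have "integral {0..t} (%s. X (y (Suc m) p s) - X (y m p s)) = integral {0..t} (%s. X (y (Suc m) p s)) - integral {0..t} (%s. X (y m p s))"
   by (intro integral_diff integrable_continuous_interval cXy Suc.prems)
  moreover have "y (Suc (Suc m)) p t - y (Suc m) p t = integral {0..t} (%s. X (y (Suc m) p s)) - integral {0..t} (%s. X (y m p s))"
   using fun_cong[OF fun_cong[OF ySuc[of "Suc m"]], of p t] fun_cong[OF fun_cong[OF ySuc[of m]], of p t] by simp
  ultimately show ?case using * by simp
 qed
 define Y where "Y p t = (if t = 0 then p else p + (\<Sum>i. y (Suc i) p t - y i p t))" for p t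
 have tel: "(\<Sum>i<n. y (Suc i) p t - y i p t) = y n p t - p" for n p t
  using sum_lessThan_telescope[of "%i. y i p t" n] by (simp add: y0)
 have yz: "y n p 0 = p" for n p by (cases n) (simp_all add: y0 ySuc)
 have ul: "\<forall>\<^sub>F n in sequentially. \<forall>p\<in>?U. \<forall>t\<in>{0..h}. dist (y n p t) (Y p t) < e" if "e > 0" for e
 proof -
  have "uniform_limit (?U \<times> {0..h}) (%n x. \<Sum>i<n. (%(p, t). y (Suc i) p t - y i p t) x)
    (%x. suminf (%i. (%(p, t). y (Suc i) p t - y i p t) x)) sequentially"
   by (rule Weierstrass_m_test_ev[where M="%m. r * (1/2) ^ m"]) (use diff in \<open>auto intro!: always_eventually summable_mult summable_geometric simp del: mem_ball\<close>)
  then have "\<forall>\<^sub>F n in sequentially. \<forall>x\<in>?U \<times> {0..h}. dist (\<Sum>i<n. (%(p, t). y (Suc i) p t - y i p t) x)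
    (suminf (%i. (%(p, t). y (Suc i) p t - y i p t) x)) < e" using that by (auto simp: uniform_limit_iff)
  then show ?thesis
  proof eventually_elim
   case (elim n)
   have "dist (y n p t) (Y p t) < e" if "p \<in> ?U" "t \<in> {0..h}" for p t
   proof (cases "t = 0")
    case True then show ?thesis using \<open>e > 0\<close> by (simp add: Y_def yz)
   next
    case False
    have "dist (\<Sum>i<n. y (Suc i) p t - y i p t) (\<Sum>i. y (Suc i) p t - y i p t) < e"
     using bspec[OF elim, of "(p, t)"] that by simp
    then have "dist (y n p t - p) (Y p t - p) < e" unfolding tel using False by (simp add: Y_def)
    then show ?thesis by (simp add: dist_norm)
   qed
   then show ?case by blast
  qed
 qed
 have lim: "(%n. y n p t) \<longlonglongrightarrow> Y p t" if "p \<in> ?U" "t \<in> {0..h}" for p t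
  unfolding tendsto_iff
 proof (intro allI impI)
  fix e :: real assume "e > 0"
  from ul[OF this] show "\<forall>\<^sub>F n in sequentially. dist (y n p t) (Y p t) < e" by eventually_elim (use that in blast)
 qed
 have YK: "Y p t \<in> ?K" if "p \<in> ?U" "t \<in> {0..h}" for p t
  by (rule closed_sequentially[OF closed_cball in_K[OF that] lim[OF that]])
 have Yh: "hol (%p. Y p t $ j) ?U" if "t \<in> {0..h}" for t j
 proof (rule hol_uniform_limit[OF open_ball hy[OF that]])
  show "uniform_limit ?U (%n p. y n p t $ j) (%p. Y p t $ j) sequentially"
   unfolding uniform_limit_iff
  proof (intro allI impI)
   fix e :: real assume "e > 0"
   from ul[OF this] show "\<forall>\<^sub>F n in sequentially. \<forall>p\<in>?U. dist (y n p t $ j) (Y p t $ j) < e"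
    by eventually_elim (use that dist_vec_nth_le le_less_trans in blast)
  qed
 qed
 have cY: "continuous_on {0..h} (Y p)" if "p \<in> ?U" for p
 proof (rule uniform_limit_theorem[where F=sequentially])
  show "\<forall>\<^sub>F n in sequentially. continuous_on {0..h} (y n p)" using cy[OF that] by simp
  show "uniform_limit {0..h} (%n. y n p) (Y p) sequentially"
   unfolding uniform_limit_iff
  proof (intro allI impI)
   fix e :: real assume "e > 0"
   from ul[OF this] show "\<forall>\<^sub>F n in sequentially. \<forall>t\<in>{0..h}. dist (y n p t) (Y p t) < e"
    by eventually_elim (use that in blast)
  qed
 qed simp
 have Yint: "Y p t = p + integral {0..t} (%s. X (Y p s))" if p: "p \<in> ?U" and t: "t \<in> {0..h}" for p t
 proof -
  have "uniform_limit {0..t} (%n s. X (y n p s)) (%s. X (Y p s)) sequentially"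
   unfolding uniform_limit_iff
  proof (intro allI impI)
   fix e :: real assume e: "e > 0"
   then have "e / (L + 1) > 0" using L(1) by simp
   from ul[OF this] show "\<forall>\<^sub>F n in sequentially. \<forall>s\<in>{0..t}. dist (X (y n p s)) (X (Y p s)) < e"
   proof eventually_elim
    case (elim n)
    show ?case
    proof
     fix s assume "s \<in> {0..t}"
     then have s: "s \<in> {0..h}" using t by auto
     have "dist (X (y n p s)) (X (Y p s)) \<le> L * norm (y n p s - Y p s)"
      unfolding dist_norm by (intro L in_K YK p s)
     also have "\<dots> \<le> L * (e / (L + 1))" using elim p s by (intro mult_left_mono L) (force simp: dist_norm)
     also have "\<dots> < e" using L(1) e by (simp add: field_simps)
     finally show "dist (X (y n p s)) (X (Y p s)) < e" .
    qed
   qed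
  qed
  then obtain I J where IJ: "!!n. ((%s. X (y n p s)) has_integral I n) {0..t}" "((%s. X (Y p s)) has_integral J) {0..t}" "I \<longlonglongrightarrow> J"
   by (rule uniform_limit_integral[OF _ cXy[OF p t]]) auto
  have "(%n. y (Suc n) p t) \<longlonglongrightarrow> p + J"
   using tendsto_add[OF tendsto_const IJ(3), of p] integral_unique[OF IJ(1)] by (simp add: ySuc)
  then have "Y p t = p + J" using LIMSEQ_unique LIMSEQ_Suc[OF lim[OF p t]] by blast
  then show ?thesis using integral_unique[OF IJ(2)] by simp
 qed
 show ?thesis
 proof (rule that[of r h Y])
  fix p t assume p: "p \<in> ?U" and t: "t \<in> {0..h}"
  show "Y p t \<in> ball x0 R" using YK[OF p t] K by blast
  have c: "continuous_on {0..h} (%s. X (Y p s))"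
   by (rule continuous_on_compose2[OF contX cY[OF p]]) (use YK[OF p] in \<open>auto simp del: mem_cball\<close>)
  have "((%t. p + integral {0..t} (%s. X (Y p s))) has_vector_derivative 0 + X (Y p t)) (at t within {0..h})"
   by (intro has_vector_derivative_add has_vector_derivative_const integral_has_vector_derivative[OF c t])
  then show "(Y p has_vector_derivative X (Y p t)) (at t within {0..h})"
   by (intro has_vector_derivative_transform[OF t Yint[OF p]]) simp_all
 qed (use r h Yh in \<open>auto simp: Y_def\<close>)
qed

section \<open>Solutions: uniqueness and concatenation\<close>

definition sol :: "('a::real_normed_vector => 'a) => 'a set => real => (real => 'a) => bool" where
 "sol X Om T u \<longleftrightarrow> (\<forall>t\<in>{0..T}. u t \<in> Om & (u has_vector_derivative X (u t)) (at t within {0..T}))"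

lemma sol_subinterval: "sol X Om T u ==> T' \<le> T ==> sol X Om T' u"
 unfolding sol_def using has_vector_derivative_within_subset[of u _ _ "{0..T}" "{0..T'}"] by auto

lemma sol_continuous: "sol X Om T u ==> continuous_on {0..T} u"
 unfolding sol_def continuous_on_eq_continuous_within using has_vector_derivative_continuous by blast

text \<open>The times of agreement form a closed set. It is also open: on an interval of radius at
  most \<open>1 / (2 * (L + 1))\<close> around such a time the largest difference is at most half of
  itself, hence zero. Connectedness of the interval finishes the argument.\<close>

lemma sol_unique:
 fixes X :: "'a::euclidean_space => 'a"
 assumes lip: "!!x. x \<in> Om ==> \<exists>d>0. \<exists>L\<ge>0. \<forall>y\<in>ball x d. \<forall>z\<in>ball x d. norm (X y - X z) \<le> L * norm (y - z)"
  and u: "sol X Om T u" and v: "sol X Om T v" and "u 0 = v 0" and t: "t \<in> {0..T}"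
 shows "u t = v t"
proof -
 let ?A = "{t \<in> {0..T}. u t - v t = 0}"
 note cu = sol_continuous[OF u] and cv = sol_continuous[OF v]
 have "closedin (top_of_set {0..T}) ?A"
  by (intro continuous_closedin_preimage_constant continuous_on_diff cu cv)
 moreover have "openin (top_of_set {0..T}) ?A"
  unfolding openin_euclidean_subtopology_iff
 proof (intro conjI ballI)
  fix t0 assume "t0 \<in> ?A"
  then have t0: "t0 \<in> {0..T}" "u t0 = v t0" by auto
  then have "u t0 \<in> Om" using u unfolding sol_def by blast
  then obtain d L where d: "d > 0" and L: "L \<ge> 0" "!!y z. y \<in> ball (u t0) d ==> z \<in> ball (u t0) d ==> norm (X y - X z) \<le> L * norm (y - z)"
   using lip by blast
  obtain e1 where e1: "e1 > 0" "!!s. s \<in> {0..T} ==> dist s t0 < e1 ==> dist (u s) (u t0) < d"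
   using cu t0(1) d unfolding continuous_on_iff by meson
  obtain e2 where e2: "e2 > 0" "!!s. s \<in> {0..T} ==> dist s t0 < e2 ==> dist (v s) (v t0) < d"
   using cv t0(1) d unfolding continuous_on_iff by meson
  define e where "e = min (min e1 e2 / 2) (1 / (2 * (L + 1)))"
  have e: "e > 0" "e < e1" "e < e2" "e \<le> 1 / (2 * (L + 1))" using e1 e2 L(1) by (auto simp: e_def min_def)
  define I where "I = {0..T} \<inter> cball t0 e"
  have I: "compact I" "convex I" "t0 \<in> I" "I \<subseteq> {0..T}"
   using t0 e by (auto simp: I_def intro: convex_Int)
  have "continuous_on I (%s. norm (u s - v s))"
   by (intro continuous_intros continuous_on_subset[OF cu] continuous_on_subset[OF cv] I)
  then obtain t1 where t1: "t1 \<in> I" "!!s. s \<in> I ==> norm (u s - v s) \<le> norm (u t1 - v t1)"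
   using continuous_attains_sup[OF I(1)] I(3) by blast
  let ?M = "norm (u t1 - v t1)"
  have inb: "u s \<in> ball (u t0) d & v s \<in> ball (u t0) d" if "s \<in> I" for s
  proof -
   have "s \<in> {0..T}" "dist s t0 \<le> e" using that by (auto simp: I_def dist_commute)
   then show ?thesis using e1(2)[of s] e2(2)[of s] e t0(2) by (auto simp: dist_commute)
  qed
  have "norm ((u t1 - v t1) - (u t0 - v t0)) \<le> (L * ?M) * norm (t1 - t0)"
  proof (rule differentiable_bound[OF I(2) _ _ t1(1) I(3), where f'="%s h. h *\<^sub>R (X (u s) - X (v s))"])
   fix s assume s: "s \<in> I"
   then have s': "s \<in> {0..T}" using I by auto
   have "(u has_vector_derivative X (u s)) (at s within I)" "(v has_vector_derivative X (v s)) (at s within I)"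
    using u v s' has_vector_derivative_within_subset[OF _ I(4)] unfolding sol_def by blast+
   from has_vector_derivative_diff[OF this]
   show "((%s. u s - v s) has_derivative (%h. h *\<^sub>R (X (u s) - X (v s)))) (at s within I)"
    by (simp add: has_vector_derivative_def)
   show "onorm (%h. h *\<^sub>R (X (u s) - X (v s))) \<le> L * ?M"
   proof (rule onorm_le)
    fix h :: real
    have "norm (X (u s) - X (v s)) \<le> L * norm (u s - v s)" using L(2) inb[OF s] by blast
    also have "\<dots> \<le> L * ?M" by (intro mult_left_mono t1 s L)
    finally show "norm (h *\<^sub>R (X (u s) - X (v s))) \<le> L * ?M * norm h" by (simp add: mult.commute mult_left_mono)
   qed
  qed
  also have "\<dots> \<le> (L * ?M) * (1 / (2 * (L + 1)))"
   using t1(1) e(4) L(1) by (intro mult_left_mono) (auto simp: I_def dist_real_def)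
  also have "\<dots> \<le> ?M / 2"
  proof -
   have "L * (1 / (2 * (L + 1))) \<le> (L + 1) * (1 / (2 * (L + 1)))" using L(1) by (intro mult_right_mono) auto
   moreover have "L + 1 ~= 0" using L(1) by linarith
   then have "(L + 1) * (1 / (2 * (L + 1))) = 1 / 2" by (simp only: mult.commute[of 2]) simp
   ultimately have q: "L * (1 / (2 * (L + 1))) \<le> 1 / 2" by linarith
   have "(L * ?M) * (1 / (2 * (L + 1))) = (L * (1 / (2 * (L + 1)))) * ?M" by simp
   also have "\<dots> \<le> 1 / 2 * ?M" by (rule mult_right_mono[OF q norm_ge_zero])
   finally show ?thesis by simp
  qed
  finally have M0: "?M = 0" using t0(2) by simp
  have "\<forall>s\<in>I. u s - v s = 0"
  proof
   fix s assume "s \<in> I"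
   from t1(2)[OF this] show "u s - v s = 0" unfolding M0 by simp
  qed
  then show "\<exists>e>0. \<forall>s\<in>{0..T}. dist s t0 < e \<longrightarrow> s \<in> ?A"
   using e(1) by (intro exI[of _ e]) (auto simp: I_def dist_commute)
 qed auto
 ultimately have dj: "?A = {} \<or> ?A = {0..T}" using connected_clopen[of "{0..T}", THEN iffD1, OF connected_Icc] by blast
 have h0: "0 \<in> ?A" using t \<open>u 0 = v 0\<close> by auto
 have "?A = {0..T}" using dj h0 by (elim disjE) (simp_all only: empty_iff)
 with t have "t \<in> ?A" by (simp only:)
 then show ?thesis by simp
qed

lemma sol_concat:
 fixes X :: "'a::real_normed_vector => 'a"
 assumes u: "sol X Om a u" and v: "sol X Om b v" and "v 0 = u a" "a \<ge> 0" "b \<ge> 0"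
 shows "sol X Om (a + b) (%t. if t \<in> {0..a} then u t else v (t - a))"
 unfolding sol_def
proof (intro ballI conjI)
 fix t assume t: "t \<in> {0..a + b}"
 show "(if t \<in> {0..a} then u t else v (t - a)) \<in> Om" using u v t by (auto simp: sol_def)
 have v': "((%t. v (t - a)) has_vector_derivative X (v (t - a))) (at t within {a..a + b})" if "t \<in> {a..a + b}"
 proof -
  have "(%t. t - a) ` {a..a + b} \<subseteq> {0..b}" by auto
  moreover have "(v has_vector_derivative X (v (t - a))) (at (t - a) within {0..b})" using v that by (auto simp: sol_def)
  ultimately have "(v has_vector_derivative X (v (t - a))) (at (t - a) within (%t. t - a) ` {a..a + b})"
   using has_vector_derivative_within_subset by blast
  moreover have "((%t. t - a) has_vector_derivative 1) (at t within {a..a + b})"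
   by (auto intro!: derivative_eq_intros)
  ultimately show ?thesis using vector_diff_chain_within[of "%t. t - a" 1 t "{a..a + b}" v] by (simp add: o_def)
 qed
 have "((%t. if t \<in> {0..a} then u t else v (t - a)) has_vector_derivative (if t \<in> {0..a} then X (u t) else X (v (t - a)))) (at t within {0..a + b})"
 proof (rule has_vector_derivative_If_within_closures[where T="{a..a + b}" and f="u" and g="%t. v (t - a)" and f'="%t. X (u t)" and g'="%t. X (v (t - a))"])
  have i: "{0..a} \<union> closure {0..a} \<inter> closure {a..a + b} = {0..a}" "{a..a + b} \<union> closure {0..a} \<inter> closure {a..a + b} = {a..a + b}"
   using assms by auto
  show "(u has_vector_derivative X (u t)) (at t within {0..a} \<union> closure {0..a} \<inter> closure {a..a + b})"
   if "t \<in> {0..a} \<union> closure {0..a} \<inter> closure {a..a + b}" using that u unfolding i by (simp add: sol_def)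
  show "((%t. v (t - a)) has_vector_derivative X (v (t - a))) (at t within {a..a + b} \<union> closure {0..a} \<inter> closure {a..a + b})"
   if "t \<in> {a..a + b} \<union> closure {0..a} \<inter> closure {a..a + b}" using that v' unfolding i by simp
 qed (use t assms in \<open>auto simp: closure_closed\<close>)
 then show "((%t. if t \<in> {0..a} then u t else v (t - a)) has_vector_derivative X (if t \<in> {0..a} then u t else v (t - a))) (at t within {0..a + b})"
  by (simp add: if_distrib[of X])
qed

text \<open>A real-analytic function of z is a holomorphic function of the independent variables z and w, restricted
 to w = cnj z; the map swp is the conjugation whose fixed points are these pairs. The Picard iterates of
 the extended field are holomorphic in the initial value, so their limit is, and real flows are smooth.\<close>

definition dbl :: "complex ^ 'm::finite => complex ^ ('m \<times> bool)" where
 "dbl x = (\<chi> i. if snd i then cnj (x $ fst i) else x $ fst i)"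

definition undbl :: "complex ^ ('m::finite \<times> bool) => complex ^ 'm" where
 "undbl w = (\<chi> j. w $ (j, False))"

definition swp :: "complex ^ ('m::finite \<times> bool) => complex ^ ('m \<times> bool)" where
 "swp w = (\<chi> i. cnj (w $ (fst i, \<not> snd i)))"

definition ra :: "(complex ^ 'm::finite => complex) => complex ^ 'm => bool" where
 "ra g x \<longleftrightarrow> (\<exists>G. hol_at G (dbl x) & (\<forall>\<^sub>F y in nhds x. g y = G (dbl y)))"

lemma bounded_linear_dbl: "bounded_linear dbl"
 unfolding linear_conv_bounded_linear[symmetric]
 by (rule linearI) (auto simp: dbl_def vec_eq_iff complex_eq_iff)

lemma bounded_linear_undbl: "bounded_linear undbl"
 unfolding linear_conv_bounded_linear[symmetric]
 by (rule linearI) (auto simp: undbl_def vec_eq_iff complex_eq_iff)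

lemma bounded_linear_swp: "bounded_linear swp"
 unfolding linear_conv_bounded_linear[symmetric]
 by (rule linearI) (auto simp: swp_def vec_eq_iff complex_eq_iff)

lemma dbl_nth [simp]: "dbl x $ i = (if snd i then cnj (x $ fst i) else x $ fst i)" by (simp add: dbl_def)

lemma undbl_nth [simp]: "undbl w $ j = w $ (j, False)" by (simp add: undbl_def)

lemma swp_nth [simp]: "swp w $ i = cnj (w $ (fst i, \<not> snd i))" by (simp add: swp_def)

lemma undbl_dbl [simp]: "undbl (dbl x) = x" by (simp add: undbl_def dbl_def vec_eq_iff)

lemma swp_dbl [simp]: "swp (dbl x) = dbl x" by (simp add: swp_def dbl_def vec_eq_iff)

lemma swp_swp [simp]: "swp (swp w) = w" by (simp add: swp_def vec_eq_iff)

lemma dbl_undbl: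
 assumes "swp w = w" shows "dbl (undbl w) = w"
proof -
 have "swp w $ (j, True) = w $ (j, True)" for j using assms by simp
 then have "cnj (w $ (j, False)) = w $ (j, True)" for j by (simp add: swp_def)
 then show ?thesis by (auto simp: dbl_def undbl_def vec_eq_iff)
qed

lemma norm_swp [simp]: "norm (swp w) = norm w"
proof -
 have "(\<Sum>i\<in>UNIV. (cmod (w $ (fst i, \<not> snd i)))\<^sup>2) = (\<Sum>i\<in>UNIV. (cmod (w $ i))\<^sup>2)"
  by (rule sum.reindex_bij_witness[of _ "%i. (fst i, \<not> snd i)" "%i. (fst i, \<not> snd i)"]) auto
 then show ?thesis by (simp add: norm_vec_def L2_set_def swp_def)
qed

text \<open>Conjugation and \<open>swp\<close> are both antilinear, so the composite derivative is
  complex-linear again. This is what makes the conjugate of a real-analytic function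
  real-analytic.\<close>

lemma hol_at_swp:
 assumes "hol_at G (swp w)"
 shows "hol_at (%w. cnj (G (swp w))) w"
proof -
 obtain U where U: "swp w \<in> U" "hol G U" using assms by (auto simp: hol_at_def)
 have "hol (%w. cnj (G (swp w))) (swp -` U)"
  unfolding mf_holomorphic_on_def
 proof (intro conjI ballI)
  show "open (swp -` U)"
   by (intro open_vimage hol_open[OF U(2)] bounded_linear.continuous_on[OF bounded_linear_swp continuous_on_id])
  fix z assume "z \<in> swp -` U"
  then obtain D where D: "(G has_derivative D) (at (swp z))" "!!h. D (\<i> *s h) = \<i> * D h"
   using U(2) by (auto simp: mf_holomorphic_on_def)
  have "((%w. G (swp w)) has_derivative (%h. D (swp h))) (at z)"
   using diff_chain_at[OF bounded_linear.has_derivative[OF bounded_linear_swp has_derivative_ident] D(1)] by (simp add: o_def)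
  from bounded_linear.has_derivative[OF bounded_linear_cnj this]
  have "((%w. cnj (G (swp w))) has_derivative (%h. cnj (D (swp h)))) (at z)" .
  moreover have "cnj (D (swp (\<i> *s h))) = \<i> * cnj (D (swp h))" for h
  proof -
   have "swp (\<i> *s h) = - (\<i> *s swp h)" by (simp add: swp_def vec_eq_iff)
   then show ?thesis by (simp add: linear_neg[OF has_derivative_linear[OF D(1)]] D(2))
  qed
  ultimately show "\<exists>D. ((%w. cnj (G (swp w))) has_derivative D) (at z) & (\<forall>h. D (\<i> *s h) = \<i> * D h)" by blast
 qed
 then show ?thesis using U(1) by (intro hol_atI) auto
qed

section \<open>Real-analytic functions and equivariant extensions\<close>

lemma ra_hol:
 assumes "hol_at g x" shows "ra g x"
proof -
 have "hol_at (%w. g (undbl w)) (dbl x)"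
  by (rule hol_at_compose) (use assms in simp_all)
 then show ?thesis unfolding ra_def by (intro exI[of _ "%w. g (undbl w)"]) simp
qed

lemma ra_add: "ra f x ==> ra g x ==> ra (%y. f y + g y) x"
proof -
 assume "ra f x" "ra g x"
 then obtain F G where F: "hol_at F (dbl x)" "\<forall>\<^sub>F y in nhds x. f y = F (dbl y)" "hol_at G (dbl x)" "\<forall>\<^sub>F y in nhds x. g y = G (dbl y)"
  by (auto simp: ra_def)
 have "\<forall>\<^sub>F y in nhds x. f y + g y = F (dbl y) + G (dbl y)" using F(2,4) by eventually_elim simp
 then show ?thesis unfolding ra_def using hol_at_add[OF F(1,3)] by (intro exI[of _ "%w. F w + G w"]) simp
qed

lemma ra_mult: "ra f x ==> ra g x ==> ra (%y. f y * g y) x"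
proof -
 assume "ra f x" "ra g x"
 then obtain F G where F: "hol_at F (dbl x)" "\<forall>\<^sub>F y in nhds x. f y = F (dbl y)" "hol_at G (dbl x)" "\<forall>\<^sub>F y in nhds x. g y = G (dbl y)"
  by (auto simp: ra_def)
 have "\<forall>\<^sub>F y in nhds x. f y * g y = F (dbl y) * G (dbl y)" using F(2,4) by eventually_elim simp
 then show ?thesis unfolding ra_def using hol_at_mult[OF F(1,3)] by (intro exI[of _ "%w. F w * G w"]) simp
qed

lemma ra_const: "ra (%y. c) x" by (rule ra_hol) simp

lemma ra_diff: "ra f x ==> ra g x ==> ra (%y. f y - g y) x"
 using ra_add[of f x "%y. - 1 * g y"] ra_mult[OF ra_const[of "- 1" x], of g] by simp

lemma ra_sum: "(!!i. i \<in> A ==> ra (f i) x) ==> ra (%y. \<Sum>i\<in>A. f i y) x"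
 by (induction A rule: infinite_finite_induct) (auto intro: ra_add ra_const)

lemma ra_cnj: "ra f x ==> ra (%y. cnj (f y)) x"
proof -
 assume "ra f x"
 then obtain F where F: "hol_at F (dbl x)" "\<forall>\<^sub>F y in nhds x. f y = F (dbl y)" by (auto simp: ra_def)
 have "hol_at (%w. cnj (F (swp w))) (dbl x)" using F(1) by (intro hol_at_swp) simp
 moreover have "\<forall>\<^sub>F y in nhds x. cnj (f y) = cnj (F (swp (dbl y)))" using F(2) by eventually_elim simp
 ultimately show ?thesis unfolding ra_def by (intro exI[of _ "%w. cnj (F (swp w))"]) simp
qed

lemma ra_inverse: "ra f x ==> f x ~= 0 ==> ra (%y. inverse (f y)) x"
proof -
 assume f: "ra f x" "f x ~= 0"
 then obtain F where F: "hol_at F (dbl x)" "\<forall>\<^sub>F y in nhds x. f y = F (dbl y)" by (auto simp: ra_def)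
 have "F (dbl x) ~= 0" using eventually_nhds_x_imp_x[OF F(2)] f by simp
 then have "hol_at (%w. inverse (F w)) (dbl x)" by (rule hol_at_inverse[OF F(1)])
 moreover have "\<forall>\<^sub>F y in nhds x. inverse (f y) = inverse (F (dbl y))" using F(2) by eventually_elim simp
 ultimately show ?thesis unfolding ra_def by (intro exI[of _ "%w. inverse (F w)"]) simp
qed

lemma ra_divide: "ra f x ==> ra g x ==> g x ~= 0 ==> ra (%y. f y / g y) x"
 unfolding divide_inverse by (intro ra_mult ra_inverse)

text \<open>Half of the components extend \<open>X\<close>; the other half are defined as conjugates
  of these at the swapped point. The equivariance under \<open>swp\<close> obtained by this
  definition keeps trajectories that start at a point \<open>dbl p\<close> inside the image of
  \<open>dbl\<close>.\<close>

lemma ra_map_extension: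
 fixes X :: "complex ^ 'm::finite => complex ^ 'm"
 assumes "!!j. ra (%x. X x $ j) x0"
 obtains G and r where "!!j. hol (%w. G w $ j) (ball (dbl x0) r)" "r > 0"
  "!!w. G (swp w) = swp (G w)" "\<forall>\<^sub>F y in nhds x0. G (dbl y) = dbl (X y)"
proof -
 obtain H where H: "!!j. hol_at (H j) (dbl x0)" "!!j. \<forall>\<^sub>F y in nhds x0. X y $ j = H j (dbl y)"
  using assms unfolding ra_def by metis
 define G where "G w = (\<chi> i. if snd i then cnj (H (fst i) (swp w)) else H (fst i) w)" for w
 have hG: "hol_at (%w. G w $ i) (dbl x0)" for i
 proof (cases "snd i")
  case True
  then have "(%w. G w $ i) = (%w. cnj (H (fst i) (swp w)))" by (simp add: G_def)
  then show ?thesis using hol_at_swp[of "H (fst i)" "dbl x0"] H(1) by simp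
 next
  case False
  then have "(%w. G w $ i) = H (fst i)" by (simp add: G_def)
  then show ?thesis using H(1) by simp
 qed
 then obtain r where r: "!!i. r i > 0" "!!i. hol (%w. G w $ i) (ball (dbl x0) (r i))"
  unfolding hol_at_ball by metis
 have m: "Min (range r) > 0" "!!i. Min (range r) \<le> r i" using r(1) by (auto simp: Min_gr_iff)
 show ?thesis
 proof (rule that[of G "Min (range r)"])
  show "hol (%w. G w $ j) (ball (dbl x0) (Min (range r)))" for j
   by (rule hol_subset[OF r(2)[of j] open_ball subset_ball[OF m(2)]])
  show "G (swp w) = swp (G w)" for w by (auto simp: G_def vec_eq_iff)
  have "\<forall>\<^sub>F y in nhds x0. \<forall>j. X y $ j = H j (dbl y)" by (rule eventually_all_finite) (rule H(2))
  then show "\<forall>\<^sub>F y in nhds x0. G (dbl y) = dbl (X y)"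
   by eventually_elim (auto simp: G_def vec_eq_iff)
 qed (rule m)
qed

lemma hol_map_locally_lipschitz:
 fixes g :: "complex ^ 'm::finite => complex ^ 'n::finite"
 assumes g: "!!i. hol (%z. g z $ i) U" and x: "x \<in> U"
 shows "\<exists>d>0. \<exists>L\<ge>0. \<forall>y\<in>ball x d. \<forall>z\<in>ball x d. norm (g y - g z) \<le> L * norm (y - z)"
proof -
 obtain d where d: "d > 0" "cball x d \<subseteq> U" using hol_open[OF g] x open_contains_cball by blast
 obtain L where L: "L \<ge> 0" "!!y z. y \<in> cball x d ==> z \<in> cball x d ==> norm (g y - g z) \<le> L * norm (y - z)"
  using hol_map_lipschitz[OF g d(2)] by blast
 show ?thesis by (rule exI[of _ d], rule conjI[OF d(1)], rule exI[of _ L], rule conjI[OF L(1)]) (use L(2) in auto)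
qed

lemma ra_locally_lipschitz:
 fixes X :: "complex ^ 'm::finite => complex ^ 'm"
 assumes "!!j. ra (%x. X x $ j) x0"
 shows "\<exists>d>0. \<exists>L\<ge>0. \<forall>y\<in>ball x0 d. \<forall>z\<in>ball x0 d. norm (X y - X z) \<le> L * norm (y - z)"
proof -
 obtain G r where G: "!!j. hol (%w. G w $ j) (ball (dbl x0) r)" "r > 0" "\<forall>\<^sub>F y in nhds x0. G (dbl y) = dbl (X y)"
  by (rule ra_map_extension[OF assms]) blast
 obtain d1 L where d1: "d1 > 0" and L: "L \<ge> 0" "!!y z. y \<in> ball (dbl x0) d1 ==> z \<in> ball (dbl x0) d1 ==> norm (G y - G z) \<le> L * norm (y - z)"
  using hol_map_locally_lipschitz[OF G(1), of "dbl x0"] G(2) by (auto simp del: mem_ball)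
 obtain d2 where d2: "d2 > 0" "!!y. dist y x0 < d2 ==> G (dbl y) = dbl (X y)" using G(3) by (auto simp: eventually_nhds_metric)
 obtain K where K: "K > 0" "!!x. norm (dbl x :: complex ^ ('m \<times> bool)) \<le> norm x * K" using bounded_linear.pos_bounded[OF bounded_linear_dbl] by blast
 obtain K' where K': "K' > 0" "!!x. norm (undbl x :: complex ^ 'm) \<le> norm x * K'" using bounded_linear.pos_bounded[OF bounded_linear_undbl] by blast
 note dd = bounded_linear.linear[OF bounded_linear_dbl, THEN linear_diff] and ud = bounded_linear.linear[OF bounded_linear_undbl, THEN linear_diff]
 define d where "d = min d2 (d1 / K)"
 have inb: "dbl y \<in> ball (dbl x0) d1" if "y \<in> ball x0 d" for y
 proof -
  have "norm (dbl (x0 - y)) \<le> norm (x0 - y) * K" by (rule K)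
  also have "\<dots> < d1" using that K(1) by (simp add: d_def dist_norm pos_less_divide_eq)
  finally show ?thesis by (simp add: dd dist_norm)
 qed
 have "norm (X y - X z) \<le> (K' * L * K) * norm (y - z)" if y: "y \<in> ball x0 d" and z: "z \<in> ball x0 d" for y z
 proof -
  have "X y - X z = undbl (G (dbl y) - G (dbl z))" using d2(2)[of y] d2(2)[of z] y z by (simp add: ud d_def dist_commute)
  then have "norm (X y - X z) \<le> norm (G (dbl y) - G (dbl z)) * K'" using K'(2) by simp
  also have "\<dots> \<le> (L * norm (dbl y - dbl z)) * K'" by (intro mult_right_mono L inb y z) (use K' in simp)
  also have "\<dots> \<le> (L * (norm (y - z) * K)) * K'"
   using K(2)[of "y - z"] L(1) K'(1) by (intro mult_right_mono mult_left_mono) (auto simp: dd)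
  finally show ?thesis by (simp add: mult_ac)
 qed
 moreover have "d > 0" "K' * L * K \<ge> 0" using d1 d2 K K' L by (auto simp: d_def)
 ultimately show ?thesis by blast
qed

section \<open>Smooth flows of real-analytic fields\<close>

definition local_flow :: "('a::euclidean_space => 'a) => 'a set => 'a set => real => ('a => real => 'a) => bool" where
 "local_flow X Om U h Y \<longleftrightarrow> open U & (\<forall>p\<in>U. Y p 0 = p & sol X Om h (Y p)) & (\<forall>t\<in>{0..h}. \<forall>k. ck k U (%p. Y p t))"

lemma local_flow_subset:
 assumes "local_flow X Om U h Y" "open V" "V \<subseteq> U" "h' \<le> h"
 shows "local_flow X Om V h' Y"
 unfolding local_flow_def
proof (intro conjI ballI allI assms(2))
 show "Y p 0 = p" "sol X Om h' (Y p)" if "p \<in> V" for p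
  using assms that sol_subinterval[OF _ assms(4)] unfolding local_flow_def by blast+
 show "ck k V (%p. Y p t)" if "t \<in> {0..h'}" for t k
 proof -
  have "t \<in> {0..h}" using that assms(4) by auto
  then have "ck k U (%p. Y p t)" using assms(1) unfolding local_flow_def by blast
  then show ?thesis using ck_subset assms(3) by blast
 qed
qed

lemma local_flow_exists:
 fixes X :: "complex ^ 'm::finite => complex ^ 'm"
 assumes Om: "open Om" "x0 \<in> Om" and X: "!!j. ra (%x. X x $ j) x0"
 obtains U h Y where "x0 \<in> U" "h > 0" "local_flow X Om U h Y"
proof -
 obtain G R0 where G: "!!j. hol (%w. G w $ j) (ball (dbl x0) R0)" "R0 > 0" "!!w. G (swp w) = swp (G w)" "\<forall>\<^sub>F y in nhds x0. G (dbl y) = dbl (X y)"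
  by (rule ra_map_extension[OF X]) blast
 have "\<forall>\<^sub>F y in nhds x0. y \<in> Om & G (dbl y) = dbl (X y)" using G(4) eventually_nhds_in_open[OF Om] by eventually_elim simp
 then obtain d where d: "d > 0" "!!y. dist y x0 < d ==> y \<in> Om & G (dbl y) = dbl (X y)" by (auto simp: eventually_nhds_metric)
 obtain K where K: "K > 0" "!!x. norm (dbl x :: complex ^ ('m \<times> bool)) \<le> norm x * K" using bounded_linear.pos_bounded[OF bounded_linear_dbl] by blast
 obtain K' where K': "K' > 0" "!!x. norm (undbl x :: complex ^ 'm) \<le> norm x * K'" using bounded_linear.pos_bounded[OF bounded_linear_undbl] by blast
 note dd = bounded_linear.linear[OF bounded_linear_dbl, THEN linear_diff] and ud = bounded_linear.linear[OF bounded_linear_undbl, THEN linear_diff]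
  and sd = bounded_linear.linear[OF bounded_linear_swp, THEN linear_diff]
 define R where "R = min R0 (d / K')"
 have R: "R > 0" using G(2) d K' by (simp add: R_def)
 have GR: "hol (%w. G w $ j) (ball (dbl x0) R)" for j by (rule hol_subset[OF G(1)]) (auto simp: R_def)
 obtain r h and Z :: "complex ^ ('m \<times> bool) => real => complex ^ ('m \<times> bool)" where r: "r > 0" "h > 0" and Z: "!!p. Z p 0 = p"
  "!!p t. p \<in> ball (dbl x0) r ==> t \<in> {0..h} ==> Z p t \<in> ball (dbl x0) R"
  "!!p t. p \<in> ball (dbl x0) r ==> t \<in> {0..h} ==> (Z p has_vector_derivative G (Z p t)) (at t within {0..h})"
  "!!t j. t \<in> {0..h} ==> hol (%p. Z p t $ j) (ball (dbl x0) r)"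
  by (rule picard_hol[OF GR R]) (rule that; (assumption | simp))
 let ?U = "ball x0 (r / K)"
 have inb: "dbl y \<in> ball (dbl x0) r" if "y \<in> ?U" for y
 proof -
  have "norm (dbl (x0 - y)) \<le> norm (x0 - y) * K" by (rule K)
  also have "\<dots> < r" using that K(1) by (simp add: dist_norm pos_less_divide_eq)
  finally show ?thesis by (simp add: dd dist_norm)
 qed
 define Y where "Y p t = undbl (Z (dbl p) t)" for p t
 \<comment> \<open>Applying \<open>swp\<close> to the extended trajectory gives a solution with the
   same initial value, because \<open>dbl p\<close> is fixed by \<open>swp\<close>. By uniqueness
   the trajectory is fixed too, so it projects to a solution of the original equation.\<close>
 have real: "dbl (Y p t) = Z (dbl p) t" if p: "p \<in> ?U" and t: "t \<in> {0..h}" for p t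
 proof -
  have s1: "sol G (ball (dbl x0) R) h (Z (dbl p))" unfolding sol_def using Z(2,3)[OF inb[OF p]] by blast
  have s2: "sol G (ball (dbl x0) R) h (%t. swp (Z (dbl p) t))"
   unfolding sol_def
  proof (intro ballI conjI)
   fix t assume t: "t \<in> {0..h}"
   have "norm (swp (dbl x0 - Z (dbl p) t)) < R" using Z(2)[OF inb[OF p] t] by (simp add: dist_norm)
   then show "swp (Z (dbl p) t) \<in> ball (dbl x0) R" unfolding sd by (simp add: dist_norm)
   show "((%t. swp (Z (dbl p) t)) has_vector_derivative G (swp (Z (dbl p) t))) (at t within {0..h})"
    unfolding G(3) by (rule bounded_linear.has_vector_derivative[OF bounded_linear_swp Z(3)[OF inb[OF p] t]])
  qed
  have "swp (Z (dbl p) t) = Z (dbl p) t"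
  proof (rule sol_unique[OF _ s2 s1 _ t])
   show "\<exists>d>0. \<exists>L\<ge>0. \<forall>y\<in>ball x d. \<forall>z\<in>ball x d. norm (G y - G z) \<le> L * norm (y - z)" if "x \<in> ball (dbl x0) R" for x
    by (rule hol_map_locally_lipschitz[OF GR that])
   show "swp (Z (dbl p) 0) = Z (dbl p) 0" by (simp only: Z(1) swp_dbl)
  qed
  then show ?thesis unfolding Y_def by (rule dbl_undbl)
 qed
 have near: "dist (Y p t) x0 < d" if p: "p \<in> ?U" and t: "t \<in> {0..h}" for p t
 proof -
  have "norm (undbl (Z (dbl p) t - dbl x0)) \<le> norm (Z (dbl p) t - dbl x0) * K'" by (rule K')
  also have "\<dots> < d" using Z(2)[OF inb[OF p] t] K'(1) by (simp add: R_def dist_norm norm_minus_commute pos_less_divide_eq)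
  finally show ?thesis by (simp add: ud Y_def dist_norm)
 qed
 have "local_flow X Om ?U h Y"
  unfolding local_flow_def sol_def
 proof (intro conjI ballI allI open_ball)
  fix p assume p: "p \<in> ?U"
  show "Y p 0 = p" by (simp add: Y_def Z(1))
  fix t assume t: "t \<in> {0..h}"
  show "Y p t \<in> Om" using d(2)[OF near[OF p t]] by blast
  have "(Y p has_vector_derivative undbl (G (Z (dbl p) t))) (at t within {0..h})"
   unfolding Y_def by (rule bounded_linear.has_vector_derivative[OF bounded_linear_undbl Z(3)[OF inb[OF p] t]])
  moreover have "undbl (G (Z (dbl p) t)) = X (Y p t)" using d(2)[OF near[OF p t]] real[OF p t] by (metis undbl_dbl)
  ultimately show "(Y p has_vector_derivative X (Y p t)) (at t within {0..h})" by simp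
 next
  fix t k assume t: "t \<in> {0..h}"
  show "ck k ?U (%p. Y p t)"
  proof (rule ck_vec[OF open_ball])
   fix j
   have "ck k ?U (%p. (%w. Z w t $ (j, False)) (dbl p))"
    by (rule ck_compose[OF open_ball open_ball ck_bounded_linear[OF open_ball bounded_linear_dbl] ck_hol[OF Z(4)[OF t]]]) (use inb in \<open>auto simp del: mem_ball\<close>)
   then show "ck k ?U (%p. Y p t $ j)" by (simp add: Y_def undbl_def)
  qed
 qed
 moreover have "x0 \<in> ?U" using r K by simp
 ultimately show ?thesis using that r(2) by blast
qed

lemma has_vector_derivative_singleton: "(f has_vector_derivative D) (at x within {x})"
 unfolding has_vector_derivative_def has_derivative_within by (simp add: bounded_linear_scaleR_left at_within_def)

text \<open>Finitely many local flows cover the compact set \<open>K\<close> and have a common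
  lifetime \<open>H\<close>, so \<open>N\<close> steps of length \<open>1 / N\<close> reach time 1,
  and composing the smooth step maps preserves smoothness. Only the trajectory of \<open>p\<close>
  has to be trapped: at each step nearby initial values follow it, on a neighbourhood shrunk by
  continuity.\<close>

lemma flow_exists:
 fixes X :: "complex ^ 'm::finite => complex ^ 'm"
 assumes Om: "open Om" and X: "!!x j. x \<in> Om ==> ra (%x. X x $ j) x"
  and p: "p \<in> Om" and K: "compact K" "K \<subseteq> Om"
  and trap: "!!T u. 0 \<le> T ==> T \<le> 1 ==> sol X Om T u ==> u 0 = p ==> u T \<in> K"
 obtains U Y where "open U" "p \<in> U" "!!q. q \<in> U ==> sol X Om 1 (Y q)" "!!q. q \<in> U ==> Y q 0 = q" "!!k. ck k U (%q. Y q 1)"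
proof -
 have "\<exists>U h Y. x \<in> U & h > 0 & local_flow X Om U h Y" if "x \<in> K" for x
  using local_flow_exists[OF Om _ X] that K(2) by (metis subsetD)
 then obtain U h Y where UhY: "!!x. x \<in> K ==> x \<in> U x & h x > 0 & local_flow X Om (U x) (h x) (Y x)" by metis
 obtain D where D: "D \<subseteq> K" "finite D" "K \<subseteq> (\<Union>x\<in>D. U x)"
  by (rule compactE_image[OF K(1), of K U]) (use UhY in \<open>auto simp: local_flow_def\<close>)
 define H where "H = Min (insert 1 (h ` D))"
 have H: "H > 0" "!!x. x \<in> D ==> H \<le> h x" using D UhY by (auto simp: H_def)
 obtain N :: nat where N: "1 / H < real N" using reals_Archimedean2 by blast
 then have N0: "N > 0" using H(1) by (metis divide_nonneg_pos gr0I not_less of_nat_0 zero_le_one less_le_trans order_less_imp_le)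
 have NH: "1 / real N \<le> H" using N H(1) N0 by (simp add: field_simps)
 have step: "k \<le> N ==> \<exists>V Z. open V & p \<in> V & (\<forall>q\<in>V. Z q 0 = q & sol X Om (real k / real N) (Z q)) & (\<forall>m. ck m V (%q. Z q (real k / real N)))" for k
 proof (induction k)
  case 0
  have "sol X Om 0 (%t. q)" if "q \<in> Om" for q using that by (simp add: sol_def has_vector_derivative_singleton)
  then show ?case using Om p by (intro exI[of _ Om] exI[of _ "%q t. q"]) (auto intro: ck_bounded_linear bounded_linear_ident)
 next
  case (Suc k)
  let ?a = "real k / real N" and ?b = "1 / real N"
  have ab: "?a \<ge> 0" "?b > 0" "?a \<le> 1" "?a + ?b = real (Suc k) / real N" using N0 Suc.prems by (auto simp: field_simps)
  from Suc obtain V Z where V: "open V" "p \<in> V" "!!q. q \<in> V ==> Z q 0 = q" "!!q. q \<in> V ==> sol X Om ?a (Z q)" "!!m. ck m V (%q. Z q ?a)"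
   by auto
  have "Z p ?a \<in> K" by (rule trap[OF ab(1,3) V(4)[OF V(2)] V(3)[OF V(2)]])
  then obtain x where x: "x \<in> D" "Z p ?a \<in> U x" using D(3) by blast
  have lf: "local_flow X Om (U x) ?b (Y x)"
   by (rule local_flow_subset[of _ _ "U x" "h x"]) (use UhY[of x] x D(1) H(2)[OF x(1)] NH in \<open>auto simp: local_flow_def\<close>)
  have oU: "open (U x)" and lf2: "!!q. q \<in> U x ==> Y x q 0 = q & sol X Om ?b (Y x q)" and lf3: "!!m. ck m (U x) (%q. Y x q ?b)"
   using lf ab(2) unfolding local_flow_def by auto
  define V' where "V' = V \<inter> (%q. Z q ?a) -` U x"
  define Z' where "Z' q t = (if t \<in> {0..?a} then Z q t else Y x (Z q ?a) (t - ?a))" for q t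
  have "continuous_on V (%q. Z q ?a)" using V(5)[of 0] by simp
  then have oV': "open V'" unfolding V'_def by (metis Int_commute V(1) continuous_on_open_vimage oU)
  have pV': "p \<in> V'" using V(2) x by (simp add: V'_def)
  have Z1: "Z' q 0 = q & sol X Om (real (Suc k) / real N) (Z' q)" if q: "q \<in> V'" for q
  proof
   have q': "q \<in> V" "Z q ?a \<in> U x" using q by (auto simp: V'_def)
   show "Z' q 0 = q" using ab(1) V(3)[OF q'(1)] by (simp add: Z'_def)
   have "sol X Om (?a + ?b) (%t. if t \<in> {0..?a} then Z q t else Y x (Z q ?a) (t - ?a))"
    by (rule sol_concat[OF V(4)[OF q'(1)]]) (use lf2[OF q'(2)] ab in auto)
   then show "sol X Om (real (Suc k) / real N) (Z' q)" unfolding ab(4) Z'_def[abs_def] .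
  qed
  have end_eq: "Z' q (real (Suc k) / real N) = Y x (Z q ?a) ?b" for q
  proof -
   have 1: "real (Suc k) / real N - ?a = ?b" using ab(4) by linarith
   have 2: "real (Suc k) / real N \<notin> {0..?a}" using ab(2,4) unfolding atLeastAtMost_iff by linarith
   show ?thesis unfolding Z'_def if_not_P[OF 2] 1 by (rule refl)
  qed
  have "ck m V' (%q. (%y. Y x y ?b) (Z q ?a))" for m
   by (rule ck_compose[OF oV' oU ck_subset[OF V(5)] lf3]) (auto simp: V'_def)
  then have "ck m V' (%q. Z' q (real (Suc k) / real N))" for m unfolding end_eq .
  then show ?case using oV' pV' Z1 by (intro exI[of _ V'] exI[of _ Z']) blast
 qed
 from step[of N] N0 obtain V Z where "open V" "p \<in> V" "\<forall>q\<in>V. Z q 0 = q & sol X Om 1 (Z q)" "\<forall>m. ck m V (%q. Z q 1)"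
  by auto
 then show ?thesis using that[of V Z] by blast
qed

section \<open>The controlled flow\<close>

text \<open>The vector slv q a b is the solution v of Bf q v a = al, Bf q v b = bt of least norm for the Hermitian
 form Bf q, so it obeys every bound that any solution obeys; unlike an arbitrary choice of solutions it
 depends real-analytically on the data.\<close>

definition ev :: "complex ^ 'n::finite => complex ^ 'n => complex" where
 "ev l v = (\<Sum>j\<in>UNIV. l $ j * v $ j)"

definition cj :: "complex ^ 'n::finite => complex ^ 'n" where
 "cj v = (\<chi> j. cnj (v $ j))"

text \<open>The standard Hermitian product plus a rank-one term. With \<open>q = dlog Q\<close> the
  associated norm measures at once the length of a vector and the rate at which it changes
  \<open>log Q\<close>.\<close>

definition Bf :: "complex ^ 'n::finite => complex ^ 'n => complex ^ 'n => complex" where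
 "Bf q x y = ev (cj y) x + ev q x * cnj (ev q y)"

text \<open>The Riesz representative of the functional \<open>ev l\<close> for \<open>Bf q\<close>,
  by the Sherman-Morrison formula for a rank-one perturbation of the identity. The only division is
  by \<open>1 + (norm q)\<close> squared, so the result is real-analytic in \<open>q\<close> and
  \<open>l\<close>.\<close>

definition rep :: "complex ^ 'n::finite => complex ^ 'n => complex ^ 'n" where
 "rep q l = cj l - (ev q (cj l) / (1 + ev q (cj q))) *s cj q"

definition gram :: "complex ^ 'n::finite => complex ^ 'n => complex ^ 'n => complex" where
 "gram q a b = Bf q a a * Bf q b b - Bf q a b * Bf q b a"

definition slv :: "complex ^ 'n::finite => complex ^ 'n => complex ^ 'n => complex => complex => complex ^ 'n" where
 "slv q a b al bt = ((al * Bf q b b - bt * Bf q b a) / gram q a b) *s a + ((bt * Bf q a a - al * Bf q a b) / gram q a b) *s b"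

lemma cj_nth [simp]: "cj v $ j = cnj (v $ j)" by (simp add: cj_def)

lemma ev_add: "ev l (x + y) = ev l x + ev l y" by (simp add: ev_def algebra_simps sum.distrib)
lemma ev_diff: "ev l (x - y) = ev l x - ev l y" by (simp add: ev_def algebra_simps sum_subtractf)
lemma ev_smult: "ev l (c *s x) = c * ev l x" by (simp add: ev_def sum_distrib_left algebra_simps)
lemma ev_commute: "ev l x = ev x l" by (simp add: ev_def mult.commute)
lemma ev_cnj: "cnj (ev l x) = ev (cj l) (cj x)" by (simp add: ev_def)
lemma cj_cj [simp]: "cj (cj x) = x" by (simp add: vec_eq_iff)
lemma cj_diff: "cj (x - y) = cj x - cj y" by (simp add: vec_eq_iff)
lemma cj_smult: "cj (c *s x) = cnj c *s cj x" by (simp add: vec_eq_iff)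

lemma ev_cj_self: "ev (cj x) x = of_real ((norm x)\<^sup>2)"
 by (simp add: ev_def norm_vec_sq complex_norm_square[symmetric] mult.commute)

lemma gram_denominator: "1 + ev q (cj q) = of_real (1 + (norm q)\<^sup>2)" "1 + ev q (cj q) ~= 0"
proof -
 show e: "1 + ev q (cj q) = of_real (1 + (norm q)\<^sup>2)" using ev_cj_self[of q] by (simp add: ev_commute)
 have "1 + (norm q)\<^sup>2 ~= 0" using zero_le_power2[of "norm q"] by linarith
 then show "1 + ev q (cj q) ~= 0" unfolding e of_real_eq_0_iff .
qed

lemma Bf_rep: "Bf q v (rep q l) = ev l v"
proof -
 define n where "n = 1 + ev q (cj q)"
 define \<kappa> where "\<kappa> = ev q (cj l) / n"
 have n: "n ~= 0" using gram_denominator(2)[of q] by (simp add: n_def)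
 have r: "rep q l = cj l - \<kappa> *s cj q" by (simp add: rep_def \<kappa>_def n_def)
 have "ev q (rep q l) = ev q (cj l) - \<kappa> * (n - 1)" unfolding r ev_diff ev_smult by (simp add: n_def)
 also have "ev q (cj l) = \<kappa> * n" using n by (simp add: \<kappa>_def)
 finally have "ev q (rep q l) = \<kappa>" by (simp add: algebra_simps)
 moreover have "ev (cj (rep q l)) v = ev l v - cnj \<kappa> * ev q v"
  unfolding ev_commute[of _ v] r cj_diff cj_smult cj_cj ev_diff ev_smult ..
 ultimately show ?thesis by (simp add: Bf_def)
qed

lemma Bf_add: "Bf q (x + y) w = Bf q x w + Bf q y w" by (simp add: Bf_def ev_add algebra_simps)
lemma Bf_diff: "Bf q (x - y) w = Bf q x w - Bf q y w" by (simp add: Bf_def ev_diff algebra_simps)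
lemma Bf_smult: "Bf q (c *s x) w = c * Bf q x w" by (simp add: Bf_def ev_smult algebra_simps)
lemma Bf_sym: "cnj (Bf q x y) = Bf q y x" by (simp add: Bf_def ev_cnj ev_commute)

lemma Bf_add_right: "Bf q w (x + y) = Bf q w x + Bf q w y"
 by (metis Bf_add Bf_sym complex_cnj_add complex_cnj_cnj)
lemma Bf_diff_right: "Bf q w (x - y) = Bf q w x - Bf q w y"
 by (metis Bf_diff Bf_sym complex_cnj_diff complex_cnj_cnj)
lemma Bf_smult_right: "Bf q w (c *s x) = cnj c * Bf q w x"
 by (metis Bf_smult Bf_sym complex_cnj_mult complex_cnj_cnj)

lemma Bf_self: "Bf q x x = of_real ((norm x)\<^sup>2 + (cmod (ev q x))\<^sup>2)"
 by (simp add: Bf_def ev_cj_self complex_norm_square[symmetric])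

lemma Bf_self_eq_0: "Bf q x x = 0 ==> x = 0"
 unfolding Bf_self of_real_eq_0_iff by (simp add: sum_power2_eq_zero_iff)

text \<open>A zero Gram determinant would make \<open>a\<close> and \<open>b\<close> linearly
  dependent, and the values of \<open>V\<close> and \<open>W\<close> on them exclude that, being
  triangular with nonzero diagonal.\<close>

lemma gram_nonzero:
 assumes "Bf q V a = 1" "Bf q V b = 0" "Bf q W b ~= 0"
 shows "gram q a b ~= 0"
proof
 assume g: "gram q a b = 0"
 define y where "y = Bf q b b *s a - Bf q a b *s b"
 have "Bf q y a = 0" using g by (simp add: y_def Bf_diff Bf_smult gram_def mult.commute)
 moreover have "Bf q y b = 0" by (simp add: y_def Bf_diff Bf_smult)
 ultimately have "Bf q y y = 0" by (subst (2) y_def) (simp add: Bf_diff_right Bf_smult_right)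
 then have "y = 0" by (rule Bf_self_eq_0)
 then have "Bf q V y = 0" by (simp add: Bf_def ev_def)
 then have "Bf q b b = 0" unfolding y_def Bf_diff_right Bf_smult_right assms Bf_sym by simp
 then have "b = 0" by (rule Bf_self_eq_0)
 then show False using assms(3) by (simp add: Bf_def ev_def)
qed

lemma slv_solves:
 assumes "gram q a b ~= 0"
 shows "Bf q (slv q a b al bt) a = al" "Bf q (slv q a b al bt) b = bt"
proof -
 let ?g = "gram q a b"
 have "Bf q (slv q a b al bt) a = ((al * Bf q b b - bt * Bf q b a) * Bf q a a + (bt * Bf q a a - al * Bf q a b) * Bf q b a) / ?g"
  by (simp add: slv_def Bf_add Bf_smult add_divide_distrib)
 also have "(al * Bf q b b - bt * Bf q b a) * Bf q a a + (bt * Bf q a a - al * Bf q a b) * Bf q b a = al * ?g"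
  by (simp add: gram_def algebra_simps)
 finally show "Bf q (slv q a b al bt) a = al" using assms by simp
 have "Bf q (slv q a b al bt) b = ((al * Bf q b b - bt * Bf q b a) * Bf q a b + (bt * Bf q a a - al * Bf q a b) * Bf q b b) / ?g"
  by (simp add: slv_def Bf_add Bf_smult add_divide_distrib)
 also have "(al * Bf q b b - bt * Bf q b a) * Bf q a b + (bt * Bf q a a - al * Bf q a b) * Bf q b b = bt * ?g"
  by (simp add: gram_def algebra_simps)
 finally show "Bf q (slv q a b al bt) b = bt" using assms by simp
qed

text \<open>Two solutions differ by a vector that is \<open>Bf\<close>-orthogonal to
  \<open>a\<close> and \<open>b\<close>, hence to \<open>slv\<close>, which lies in their span;
  Pythagoras gives the inequality.\<close>

lemma slv_minimal:
 assumes "gram q a b ~= 0" "Bf q v a = al" "Bf q v b = bt"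
 shows "(cmod (ev q (slv q a b al bt)))\<^sup>2 \<le> (norm v)\<^sup>2 + (cmod (ev q v))\<^sup>2"
proof -
 define s where "s = slv q a b al bt"
 define d where "d = v - s"
 have 0: "Bf q d a = 0" "Bf q d b = 0" using slv_solves[OF assms(1)] assms by (simp_all add: d_def s_def Bf_diff)
 have ds: "Bf q d s = 0" unfolding s_def slv_def Bf_add_right Bf_smult_right 0 by simp
 then have sd: "Bf q s d = 0" using Bf_sym[of q d s] by simp
 have "v = s + d" by (simp add: d_def)
 then have "Bf q v v = Bf q s s + Bf q d d" by (simp add: Bf_add Bf_add_right ds sd)
 then have "complex_of_real ((norm v)\<^sup>2 + (cmod (ev q v))\<^sup>2) = of_real (((norm s)\<^sup>2 + (cmod (ev q s))\<^sup>2) + ((norm d)\<^sup>2 + (cmod (ev q d))\<^sup>2))"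
  unfolding Bf_self by simp
 then have "(norm v)\<^sup>2 + (cmod (ev q v))\<^sup>2 = ((norm s)\<^sup>2 + (cmod (ev q s))\<^sup>2) + ((norm d)\<^sup>2 + (cmod (ev q d))\<^sup>2)"
  by (simp only: of_real_eq_iff)
 moreover have "0 \<le> (norm s)\<^sup>2" "0 \<le> (norm d)\<^sup>2" "0 \<le> (cmod (ev q d))\<^sup>2" by auto
 ultimately show ?thesis unfolding s_def by linarith
qed

lemma slv_minus: "slv q a b (- al) (- bt) = - slv q a b al bt"
 by (simp add: slv_def vec_eq_iff algebra_simps diff_divide_distrib)

section \<open>Real-analytic dependence of the least-norm solution\<close>

lemma ra_ev: "(!!j. ra (%s. l s $ j) x) ==> (!!j. ra (%s. v s $ j) x) ==> ra (%s. ev (l s) (v s)) x"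
 unfolding ev_def by (intro ra_sum ra_mult)

lemma ra_cj: "ra (%s. v s $ j) x ==> ra (%s. cj (v s) $ j) x"
 unfolding cj_nth by (rule ra_cnj)

lemma ra_Bf:
 assumes "!!j. ra (%s. q s $ j) x" "!!j. ra (%s. v s $ j) x" "!!j. ra (%s. w s $ j) x"
 shows "ra (%s. Bf (q s) (v s) (w s)) x"
 unfolding Bf_def by (intro ra_add ra_mult ra_cnj ra_ev ra_cj assms)

lemma ra_rep:
 assumes "!!j. ra (%s. q s $ j) x" "!!j. ra (%s. l s $ j) x"
 shows "ra (%s. rep (q s) (l s) $ j) x"
 unfolding rep_def vector_minus_component vector_smult_component
 by (intro ra_diff ra_mult ra_divide ra_add ra_const ra_ev ra_cj assms gram_denominator(2))

lemma ra_slv: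
 assumes q: "!!j. ra (%s. q s $ j) x" and a: "!!j. ra (%s. a s $ j) x" and b: "!!j. ra (%s. b s $ j) x"
  and "ra al x" "ra bt x" "gram (q x) (a x) (b x) ~= 0"
 shows "ra (%s. slv (q s) (a s) (b s) (al s) (bt s) $ j) x"
proof -
 have g: "ra (%s. gram (q s) (a s) (b s)) x" unfolding gram_def by (intro ra_diff ra_mult ra_Bf q a b)
 show ?thesis unfolding slv_def vector_add_component vector_smult_component
  by (intro ra_add ra_mult ra_divide ra_diff g ra_Bf q a b assms)
qed

text \<open>\<open>N t * exp (- k * t)\<close> does not decrease. Applied to a function and to its
  negative, the bound also yields exact exponential growth.\<close>

lemma gronwall_lower:
 fixes N :: "real => real"
 assumes "0 \<le> T" and d: "!!t. t \<in> {0..T} ==> (N has_vector_derivative N' t) (at t within {0..T})"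
  and b: "!!t. t \<in> {0..T} ==> k * N t \<le> N' t"
 shows "N 0 * exp (k * T) \<le> N T"
proof -
 have "N 0 * exp (- k * 0) \<le> N T * exp (- k * T)"
 proof (rule DERIV_nonneg_imp_increasing_open[OF \<open>0 \<le> T\<close>])
  fix t assume t: "0 < t" "t < T"
  have "(N has_real_derivative N' t) (at t)"
   using d[of t] t by (simp add: has_real_derivative_iff_has_vector_derivative at_within_Icc_at)
  then have "((%t. N t * exp (- k * t)) has_real_derivative (N' t - k * N t) * exp (- k * t)) (at t)"
   by (auto intro!: derivative_eq_intros simp: algebra_simps)
  moreover have "(N' t - k * N t) * exp (- k * t) \<ge> 0" using b[of t] t by simp
  ultimately show "\<exists>y. ((%t. N t * exp (- k * t)) has_real_derivative y) (at t) & 0 \<le> y" by blast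
 next
  have "continuous_on {0..T} N"
   unfolding continuous_on_eq_continuous_within using d has_vector_derivative_continuous by blast
  then show "continuous_on {0..T} (%t. N t * exp (- k * t))" by (intro continuous_intros)
 qed
 then have "N 0 * exp (k * T) \<le> N T * exp (- k * T) * exp (k * T)" by (intro mult_right_mono) auto
 then show ?thesis by (simp add: mult.assoc flip: exp_add)
qed

lemma deriv_inner_self:
 fixes f :: "real => 'a::real_inner"
 assumes "(f has_vector_derivative D) F" "F = at t within S"
 shows "((%t. f t \<bullet> f t) has_vector_derivative 2 * (f t \<bullet> D)) F"
 using bounded_bilinear.has_vector_derivative[OF bounded_bilinear_inner assms(1)[unfolded assms(2)] assms(1)[unfolded assms(2)]]
 by (simp add: assms(2) inner_commute)

lemma inner_vec_complex: "(x :: complex ^ 'n::finite) \<bullet> y = Re (ev (cj x) y)"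
 by (simp add: inner_vec_def ev_def inner_complex_def)

text \<open>A state consists of the point and of two constant complex controls:
  \<open>Inr True\<close> holds the prescribed velocity \<open>\<eta>\<close> of \<open>f\<close>,
  \<open>Inr False\<close> the radial rate \<open>sg\<close>. With the controls as coordinates there
  is a single autonomous field, and smoothness in the controls is part of smoothness in the initial
  state.\<close>

definition zc :: "complex ^ ('n::finite + bool) => complex ^ 'n" where
 "zc s = (\<chi> j. s $ Inl j)"

definition mk :: "complex ^ 'n::finite => complex => complex => complex ^ ('n + bool)" where
 "mk z \<eta> sg = (\<chi> i. case i of Inl j => z $ j | Inr b => if b then \<eta> else sg)"

lemma mk_nth [simp]: "mk z \<eta> sg $ Inl j = z $ j" "mk z \<eta> sg $ Inr True = \<eta>" "mk z \<eta> sg $ Inr False = sg"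
 by (simp_all add: mk_def)

lemma zc_nth [simp]: "zc s $ j = s $ Inl j" by (simp add: zc_def)

lemma zc_mk [simp]: "zc (mk z \<eta> sg) = z" by (simp add: vec_eq_iff)

lemma state_eq_iff: "s = s' \<longleftrightarrow> zc s = zc s' & s $ Inr True = s' $ Inr True & s $ Inr False = s' $ Inr False"
proof
 assume a: "zc s = zc s' & s $ Inr True = s' $ Inr True & s $ Inr False = s' $ Inr False"
 have "s $ i = s' $ i" for i
 proof (cases i)
  case (Inl j) then show ?thesis using a zc_nth[of s j] zc_nth[of s' j] by simp
 next
  case (Inr b) then show ?thesis using a by (cases b) auto
 qed
 then show "s = s'" by (simp add: vec_eq_iff)
qed auto

lemma bounded_linear_zc: "bounded_linear zc"
 unfolding linear_conv_bounded_linear[symmetric] by (rule linearI) (auto simp: vec_eq_iff)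

definition rev_state :: "complex ^ ('n::finite + bool) => complex ^ ('n + bool)" where
 "rev_state s = mk (zc s) (- s $ Inr True) (- s $ Inr False)"

lemma bounded_linear_rev_state: "bounded_linear rev_state"
 unfolding linear_conv_bounded_linear[symmetric]
 by (rule linearI) (auto simp: rev_state_def state_eq_iff vec_eq_iff)

text \<open>The output of \<open>fields_exist\<close> at one good value \<open>c\<close>, with a
  single \<open>dl\<close> as radius both of the ball around the origin and of the disc around
  \<open>c\<close>.\<close>

locale tube =
 fixes P Q :: "complex ^ 'n::finite => complex" and c :: complex and dl C :: real
 assumes dl: "dl > 0" and C: "C > 0"
  and hP: "hol P (ball 0 dl)" and hQ: "hol Q (ball 0 dl)"
  and fields: "!!z. norm z < dl ==> Q z ~= 0 ==> cmod (P z / Q z - c) < dl ==> z ~= 0 & has_fields P Q C z"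
begin

definition f where "f z = P z / Q z"
definition Om where "Om = {z. norm z < dl & Q z ~= 0 & cmod (f z - c) < dl}"
text \<open>The coefficient vector of \<open>dlog Q\<close>; in the same way \<open>lv\<close> is
  that of \<open>df\<close>. Then \<open>av\<close> and \<open>bv\<close> represent
  \<open>df\<close> and the Hermitian product with \<open>z\<close> for the form
  \<open>Bf\<close>.\<close>

definition qv where "qv z = (\<chi> j. pd j Q z / Q z)"
definition lv where "lv z = (\<chi> j. (pd j P z - f z * pd j Q z) / Q z)"
definition av where "av z = rep (qv z) (lv z)"
definition bv where "bv z = rep (qv z) (cj z)"
definition X where "X z \<eta> sg = slv (qv z) (av z) (bv z) \<eta> (sg * ev (cj z) z)"
definition XF where "XF s = mk (X (zc s) (s $ Inr True) (s $ Inr False)) 0 0"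
definition Oms where "Oms = zc -` Om"

lemma in_Om: "z \<in> Om ==> norm z < dl & Q z ~= 0 & cmod (f z - c) < dl & hol_at P z & hol_at Q z"
 using hol_atI[OF hP] hol_atI[OF hQ] by (auto simp: Om_def)

lemma open_Om: "open Om"
 unfolding open_subopen[of Om]
proof
 fix z assume "z \<in> Om"
 then have z: "norm z < dl" "Q z ~= 0" "cmod (f z - c) < dl" "hol_at P z" "hol_at Q z" using in_Om by auto
 have hq: "hol_at (%z. f z - c) z" unfolding f_def by (intro hol_at_diff hol_at_divide z hol_at_const)
 have "\<forall>\<^sub>F y in nhds z. cmod (f y - c) < dl"
  using order_tendstoD(2)[OF tendsto_norm[OF isCont_nhds[OF hol_at_isCont[OF hq]]] z(3)] .
 moreover have "\<forall>\<^sub>F y in nhds z. norm y < dl"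
  using order_tendstoD(2)[OF tendsto_norm[OF filterlim_ident[of "nhds z"]] z(1)] .
 ultimately have "\<forall>\<^sub>F y in nhds z. y \<in> Om"
  using hol_at_nonzero_ev[OF z(5) z(2)] by eventually_elim (simp add: Om_def)
 then show "\<exists>T. open T & z \<in> T & T \<subseteq> Om" unfolding eventually_nhds by blast
qed

lemma open_Oms: "open Oms"
 unfolding Oms_def by (intro open_vimage open_Om bounded_linear.continuous_on[OF bounded_linear_zc continuous_on_id])

lemma ev_lv: "ev (lv z) v = (dd P z v - f z * dd Q z v) / Q z"
 by (simp add: ev_def lv_def dd_def sum_distrib_left sum_divide_distrib flip: sum_subtractf)
  (simp add: algebra_simps)

lemma ev_qv: "ev (qv z) v = dd Q z v / Q z"
 by (simp add: ev_def qv_def dd_def sum_divide_distrib mult.commute)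

lemma ev_cj: "ev (cj z) v = herm v z" by (simp add: ev_def herm_def mult.commute)

text \<open>The combination \<open>\<eta> *s V + sg *s W\<close> solves the same two equations with
  length and \<open>dlog Q\<close> bounded by \<open>C * (cmod \<eta> + cmod sg)\<close>. Minimality
  transfers the bound to \<open>X\<close>, and the factor 2 is a round upper estimate of the square
  root of 2.\<close>

lemma X_props:
 assumes "z \<in> Om"
 shows "gram (qv z) (av z) (bv z) ~= 0" "ev (lv z) (X z \<eta> sg) = \<eta>" "ev (cj z) (X z \<eta> sg) = sg * of_real ((norm z)\<^sup>2)"
  "cmod (ev (qv z) (X z \<eta> sg)) \<le> 2 * C * (cmod \<eta> + cmod sg)"
proof -
 have z: "Q z ~= 0" "z ~= 0" and F: "has_fields P Q C z" using in_Om[OF assms] fields[of z] by (auto simp: f_def)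
 obtain V W where V: "dd P z V - f z * dd Q z V = Q z" "herm V z = 0" "norm V \<le> C" "cmod (dd Q z V) \<le> C * cmod (Q z)"
  and W: "dd P z W - f z * dd Q z W = 0" "herm W z = of_real ((norm z)\<^sup>2)" "norm W \<le> C" "cmod (dd Q z W) \<le> C * cmod (Q z)"
  using F unfolding has_fields_def f_def[symmetric] by blast
 have B: "Bf (qv z) v (av z) = ev (lv z) v" "Bf (qv z) v (bv z) = ev (cj z) v" for v by (simp_all add: av_def bv_def Bf_rep)
 have lV: "ev (lv z) V = 1" "ev (cj z) V = 0" "ev (lv z) W = 0" "ev (cj z) W = of_real ((norm z)\<^sup>2)"
  using V W z by (simp_all add: ev_lv ev_cj)
 show g: "gram (qv z) (av z) (bv z) ~= 0"
  by (rule gram_nonzero[of _ V _ _ W]) (use z in \<open>simp_all add: B lV\<close>)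
 show "ev (lv z) (X z \<eta> sg) = \<eta>" "ev (cj z) (X z \<eta> sg) = sg * of_real ((norm z)\<^sup>2)"
  using slv_solves[OF g] unfolding B X_def ev_cj_self by blast+
 define v where "v = \<eta> *s V + sg *s W"
 let ?B = "C * (cmod \<eta> + cmod sg)"
 have "(cmod (ev (qv z) (X z \<eta> sg)))\<^sup>2 \<le> (norm v)\<^sup>2 + (cmod (ev (qv z) v))\<^sup>2"
  unfolding X_def by (rule slv_minimal[OF g]) (simp_all add: B v_def ev_add ev_smult lV ev_cj_self)
 moreover have "norm v \<le> ?B"
 proof -
  have "norm v \<le> cmod \<eta> * norm V + cmod sg * norm W" unfolding v_def by (rule order_trans[OF norm_triangle_ineq]) simp
  also have "\<dots> \<le> cmod \<eta> * C + cmod sg * C" by (intro add_mono mult_left_mono V W) auto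
  finally show ?thesis by (simp add: algebra_simps)
 qed
 moreover have "cmod (ev (qv z) v) \<le> ?B"
 proof -
  have q: "cmod (ev (qv z) V) \<le> C" "cmod (ev (qv z) W) \<le> C"
   using V(4) W(4) z(1) by (simp_all add: ev_qv norm_divide pos_divide_le_eq)
  have "cmod (ev (qv z) v) \<le> cmod \<eta> * cmod (ev (qv z) V) + cmod sg * cmod (ev (qv z) W)"
   unfolding v_def ev_add ev_smult by (rule order_trans[OF norm_triangle_ineq]) (simp add: norm_mult)
  also have "\<dots> \<le> cmod \<eta> * C + cmod sg * C" by (intro add_mono mult_left_mono q) auto
  finally show ?thesis by (simp add: algebra_simps)
 qed
 ultimately have "(cmod (ev (qv z) (X z \<eta> sg)))\<^sup>2 \<le> ?B\<^sup>2 + ?B\<^sup>2"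
  by (meson add_mono norm_ge_zero order_trans power_mono)
 also have "\<dots> \<le> (2 * ?B)\<^sup>2" unfolding four_x_squared[symmetric] using zero_le_power2[of ?B] by linarith
 finally show "cmod (ev (qv z) (X z \<eta> sg)) \<le> 2 * C * (cmod \<eta> + cmod sg)"
  using power2_le_imp_le[of _ "2 * ?B"] C by (simp add: mult.assoc)
qed

lemma ra_XF:
 assumes "s \<in> Oms"
 shows "ra (%s. XF s $ i) s"
proof -
 have z: "zc s \<in> Om" using assms by (simp add: Oms_def)
 note o = in_Om[OF z]
 have Q0: "Q (zc s) ~= 0" and hP': "hol_at P (zc s)" and hQ': "hol_at Q (zc s)" using o by auto
 have cz: "ra (%s. g (zc s)) s" if "hol_at g (zc s)" for g
  by (rule ra_hol, rule hol_at_compose[where f=g and g=zc]) (use that in simp_all)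
 have f': "ra (%s. f (zc s)) s" by (rule cz) (unfold f_def, intro hol_at_divide hP' hQ' Q0)
 have q: "ra (%s. qv (zc s) $ j) s" for j
  unfolding qv_def vec_lambda_beta by (intro ra_divide cz hol_at_pd hQ' Q0)
 have l: "ra (%s. lv (zc s) $ j) s" for j
  unfolding lv_def vec_lambda_beta by (intro ra_divide ra_diff ra_mult f' cz hol_at_pd hQ' hP' Q0)
 have zr: "ra (%s. zc s $ j) s" for j by (rule ra_hol) simp
 have a: "ra (%s. av (zc s) $ j) s" for j unfolding av_def by (intro ra_rep q l)
 have b: "ra (%s. bv (zc s) $ j) s" for j unfolding bv_def by (intro ra_rep q ra_cj zr)
 have c: "ra (%s. s $ i) s" for i by (rule ra_hol) simp
 show ?thesis
 proof (cases i)
  case (Inl j)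
  have "ra (%s. X (zc s) (s $ Inr True) (s $ Inr False) $ j) s"
   unfolding X_def by (intro ra_slv q a b c ra_mult ra_ev ra_cj zr X_props(1)[OF z])
  then show ?thesis by (simp add: Inl XF_def)
 next
  case (Inr b')
  then have "(%s. XF s $ i) = (%s. 0)" by (cases b') (simp_all add: XF_def)
  then show ?thesis by (simp add: ra_const)
 qed
qed

text \<open>The derivatives of \<open>f\<close> and of the squared norm along the field are
  prescribed exactly, so both evolve by closed formulas, the norm seeing only the real part of
  \<open>sg\<close>. For \<open>Q\<close> only the logarithmic derivative is bounded, and Gronwall's
  inequality converts that into a lower bound for its modulus.\<close>

lemma trajectory:
 assumes u: "sol XF Oms T u" and T: "0 \<le> T" and u0: "u 0 = mk z0 \<eta> sg"
 shows "u T = mk (zc (u T)) \<eta> sg" "f (zc (u T)) = f z0 + of_real T * \<eta>" "norm (zc (u T)) = norm z0 * exp (T * Re sg)"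
  "cmod (Q z0) * exp (- (2 * C * (cmod \<eta> + cmod sg)) * T) \<le> cmod (Q (zc (u T)))"
proof -
 let ?I = "{0..T}" and ?z = "%t. zc (u t)"
 have ud: "(u has_vector_derivative XF (u t)) (at t within ?I)" and zOm: "?z t \<in> Om" if "t \<in> ?I" for t
  using u that by (auto simp: sol_def Oms_def)
 have 0: "0 \<in> ?I" and TT: "T \<in> ?I" using T by auto
 have par: "u t $ Inr b = u 0 $ Inr b" if t: "t \<in> ?I" for t b
 proof -
  have "((%t. u t $ Inr b) has_vector_derivative 0) (at t within ?I)" if "t \<in> ?I" for t
   using bounded_linear.has_vector_derivative[OF bounded_linear_vec_nth[of "Inr b"] ud[OF that]] by (cases b) (simp_all add: XF_def)
  then obtain k where "!!t. t \<in> ?I ==> u t $ Inr b = k"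
   using has_vector_derivative_zero_constant[of ?I "%t. u t $ Inr b"] by auto
  then show ?thesis using t 0 by metis
 qed
 then have \<eta>sg: "u t $ Inr True = \<eta>" "u t $ Inr False = sg" if "t \<in> ?I" for t using that u0 by auto
 show "u T = mk (zc (u T)) \<eta> sg" using \<eta>sg[OF TT] by (simp add: state_eq_iff)
 define D where "D t = X (?z t) \<eta> sg" for t
 have zd: "(?z has_vector_derivative D t) (at t within ?I)" if "t \<in> ?I" for t
  using bounded_linear.has_vector_derivative[OF bounded_linear_zc ud[OF that]] \<eta>sg[OF that] by (simp add: XF_def D_def)
 have gd: "((%t. g (?z t)) has_vector_derivative dd g (?z t) (D t)) (at t within ?I)" if "t \<in> ?I" and g: "hol g (ball 0 dl)" for g t
 proof -
  have "?z t \<in> ball 0 dl" using in_Om[OF zOm[OF that(1)]] by simp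
  from hol_has_derivative[OF g this] have "(g has_derivative dd g (?z t)) (at (?z t))" by (simp add: dd_def[abs_def])
  from vector_derivative_diff_chain_within[OF zd[OF that(1)] has_derivative_at_withinI[OF this]]
  show ?thesis by (simp add: o_def)
 qed
 have fd: "((%t. f (?z t)) has_vector_derivative \<eta>) (at t within ?I)" if t: "t \<in> ?I" for t
 proof -
  have Q0: "Q (?z t) ~= 0" using in_Om[OF zOm[OF t]] by simp
  let ?p = "dd P (?z t) (D t)" and ?q = "dd Q (?z t) (D t)"
  have "((%t. P (?z t) / Q (?z t)) has_derivative (%h. ((h *\<^sub>R ?p) * Q (?z t) - P (?z t) * (h *\<^sub>R ?q)) / (Q (?z t) * Q (?z t)))) (at t within ?I)"
   by (rule has_derivative_divide'[OF gd[OF t hP, unfolded has_vector_derivative_def] gd[OF t hQ, unfolded has_vector_derivative_def] Q0])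
  moreover have "((h *\<^sub>R ?p) * Q (?z t) - P (?z t) * (h *\<^sub>R ?q)) / (Q (?z t) * Q (?z t)) = h *\<^sub>R \<eta>" for h
  proof -
   have e: "\<eta> = (?p - f (?z t) * ?q) / Q (?z t)" using X_props(2)[OF zOm[OF t], of \<eta> sg] by (simp add: ev_lv D_def)
   have e1: "(?p * Q (?z t) - P (?z t) * ?q) / (Q (?z t) * Q (?z t)) = \<eta>" using e Q0 by (simp add: f_def field_simps)
   have e2: "(h *\<^sub>R ?p) * Q (?z t) - P (?z t) * (h *\<^sub>R ?q) = of_real h * (?p * Q (?z t) - P (?z t) * ?q)"
    by (simp add: scaleR_conv_of_real algebra_simps)
   show ?thesis unfolding e2 times_divide_eq_right[symmetric] e1 by (simp add: scaleR_conv_of_real)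
  qed
  ultimately show ?thesis by (simp add: f_def has_vector_derivative_def)
 qed
 have "((%t. f (?z t) - of_real t * \<eta>) has_vector_derivative 0) (at t within ?I)" if "t \<in> ?I" for t
 proof -
  have "((%t. t *\<^sub>R \<eta>) has_vector_derivative \<eta>) (at t within ?I)"
   unfolding has_vector_derivative_def by (rule bounded_linear_imp_has_derivative[OF bounded_linear_scaleR_left])
  from has_vector_derivative_diff[OF fd[OF that] this] show ?thesis by (simp add: scaleR_conv_of_real)
 qed
 then obtain k where k: "!!t. t \<in> ?I ==> f (?z t) - of_real t * \<eta> = k"
  using has_vector_derivative_zero_constant[of ?I "%t. f (?z t) - of_real t * \<eta>"] by auto
 have "f (?z T) - of_real T * \<eta> = f (?z 0) - of_real 0 * \<eta>" using k[OF TT] k[OF 0] by simp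
 then show "f (zc (u T)) = f z0 + of_real T * \<eta>" by (simp add: u0 algebra_simps)
 have nd: "((%t. ?z t \<bullet> ?z t) has_vector_derivative 2 * (?z t \<bullet> D t)) (at t within ?I)" if "t \<in> ?I" for t
  by (rule deriv_inner_self[OF zd[OF that] refl])
 have ne: "2 * (?z t \<bullet> D t) = (2 * Re sg) * (?z t \<bullet> ?z t)" if "t \<in> ?I" for t
  using X_props(3)[OF zOm[OF that], of \<eta> sg] by (simp add: inner_vec_complex D_def ev_cj_self)
 have "(?z 0 \<bullet> ?z 0) * exp (2 * Re sg * T) \<le> ?z T \<bullet> ?z T"
  by (rule gronwall_lower[OF T nd]) (use ne in auto)
 moreover have "- (?z 0 \<bullet> ?z 0) * exp (2 * Re sg * T) \<le> - (?z T \<bullet> ?z T)"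
  by (rule gronwall_lower[OF T has_vector_derivative_minus[OF nd]]) (use ne in auto)
 ultimately have "(norm (?z T))\<^sup>2 = (norm z0 * exp (T * Re sg))\<^sup>2"
  by (simp add: u0 dot_square_norm power_mult_distrib exp_double[symmetric] mult_ac)
 then show "norm (zc (u T)) = norm z0 * exp (T * Re sg)" by (simp add: power2_eq_iff_nonneg)
 let ?B = "2 * C * (cmod \<eta> + cmod sg)"
 have "(Q (?z 0) \<bullet> Q (?z 0)) * exp ((- 2 * ?B) * T) \<le> Q (?z T) \<bullet> Q (?z T)"
 proof (rule gronwall_lower[OF T deriv_inner_self[OF gd[OF _ hQ] refl]])
  fix t assume t: "t \<in> ?I"
  let ?Q = "Q (?z t)"
  have Q0: "?Q ~= 0" using in_Om[OF zOm[OF t]] by simp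
  have e: "dd Q (?z t) (D t) = ?Q * ev (qv (?z t)) (D t)" using Q0 by (simp add: ev_qv)
  have "\<bar>?Q \<bullet> (?Q * ev (qv (?z t)) (D t))\<bar> \<le> norm ?Q * norm (?Q * ev (qv (?z t)) (D t))" by (rule Cauchy_Schwarz_ineq2)
  also have "\<dots> = (norm ?Q)\<^sup>2 * cmod (ev (qv (?z t)) (D t))" by (simp add: norm_mult power2_eq_square)
  also have "\<dots> \<le> (norm ?Q)\<^sup>2 * ?B" unfolding D_def by (intro mult_left_mono X_props zOm t) simp
  finally have "- (?B * (?Q \<bullet> ?Q)) \<le> ?Q \<bullet> dd Q (?z t) (D t)" unfolding e by (simp add: dot_square_norm mult.commute abs_le_iff)
  then show "(- 2 * ?B) * (?Q \<bullet> ?Q) \<le> 2 * (?Q \<bullet> dd Q (?z t) (D t))" by simp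
 qed auto
 moreover have "exp ((- 2 * ?B) * T) = (exp (- ?B * T))\<^sup>2" unfolding exp_double[symmetric] by (simp add: algebra_simps)
 ultimately have "(cmod (Q z0) * exp (- ?B * T))\<^sup>2 \<le> (cmod (Q (?z T)))\<^sup>2"
  by (simp only: u0 zc_mk dot_square_norm power_mult_distrib)
 then show "cmod (Q z0) * exp (- ?B * T) \<le> cmod (Q (zc (u T)))" by (rule power2_le_imp_le) simp
qed

text \<open>Not the admissibility of coordinate changes. Along a trajectory \<open>f\<close> runs
  through a segment and the norm is monotone, so it is enough that the final value and the final
  radius lie in the tube.\<close>

definition adm :: "complex ^ 'n => complex => complex => bool" where
 "adm z \<eta> sg \<longleftrightarrow> z \<in> Om & cmod (f z + \<eta> - c) < dl & norm z * exp (Re sg) < dl"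

lemma adm_flow:
 assumes "adm z \<eta> sg"
 obtains U Y where "open U" "mk z \<eta> sg \<in> U" "!!q. q \<in> U ==> sol XF Oms 1 (Y q)" "!!q. q \<in> U ==> Y q 0 = q" "!!k. ck k U (%q. Y q 1)"
proof -
 have z: "z \<in> Om" "cmod (f z + \<eta> - c) < dl" "norm z * exp (Re sg) < dl" using assms by (auto simp: adm_def)
 note zo = in_Om[OF z(1)]
 define R where "R = max (norm z) (norm z * exp (Re sg))"
 define e where "e = max (cmod (f z - c)) (cmod (f z + \<eta> - c))"
 define m where "m = cmod (Q z) * exp (- (2 * C * (cmod \<eta> + cmod sg)))"
 have R: "R < dl" "e < dl" "m > 0" using z zo by (auto simp: R_def e_def m_def)
 \<comment> \<open>The trap, written with products in place of quotients so that it is visibly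
   closed: radius at most \<open>R\<close>, distance of \<open>f\<close> from \<open>c\<close> at
   most \<open>e\<close>, and modulus of \<open>Q\<close> at least \<open>m\<close>, which is the
   bound of \<open>trajectory\<close> at time 1.\<close>
 define K where "K = {w \<in> {w \<in> cball 0 R. m \<le> cmod (Q w)}. cmod (P w - c * Q w) \<le> e * cmod (Q w)}"
 have cPQ: "continuous_on (cball 0 R) P" "continuous_on (cball 0 R) Q"
  using R by (auto intro!: continuous_on_subset[OF hol_cont[OF hP]] continuous_on_subset[OF hol_cont[OF hQ]])
 have "closed K" unfolding K_def
  by (intro continuous_on_closed_Collect_le closed_cball continuous_intros cPQ continuous_on_subset[OF cPQ(1)] continuous_on_subset[OF cPQ(2)]) auto
 moreover have "bounded K" by (rule bounded_subset[OF bounded_cball[of 0 R]]) (auto simp: K_def)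
 ultimately have Kc: "compact K" by (simp add: compact_eq_bounded_closed)
 have KO: "K \<subseteq> Om"
 proof
  fix w assume w: "w \<in> K"
  then have Qw: "Q w ~= 0" and n: "norm w < dl" using R by (auto simp: K_def)
  have "f w - c = (P w - c * Q w) / Q w" using Qw by (simp add: f_def field_simps)
  then have "cmod (f w - c) \<le> e" using w Qw by (simp add: K_def norm_divide pos_divide_le_eq)
  then show "w \<in> Om" using Qw n R by (simp add: Om_def)
 qed
 let ?K = "(%w. mk w \<eta> sg) ` K"
 have "continuous_on K (%w. mk w \<eta> sg)" unfolding mk_def
 proof (rule continuous_on_vec_lambda)
  fix i :: "'n + bool"
  show "continuous_on K (%w. case i of Inl j => w $ j | Inr b => if b then \<eta> else sg)"
   by (cases i) (auto intro!: continuous_intros)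
 qed
 then have "compact ?K" using compact_continuous_image Kc by blast
 moreover have "?K \<subseteq> Oms" using KO by (auto simp: Oms_def)
 moreover have "mk z \<eta> sg \<in> Oms" using z by (simp add: Oms_def)
 moreover have "u T \<in> ?K" if T: "0 \<le> T" "T \<le> 1" and u: "sol XF Oms T u" "u 0 = mk z \<eta> sg" for T u
 proof -
  note tr = trajectory[OF u(1) T(1) u(2)]
  let ?w = "zc (u T)"
  have "u T \<in> Oms" using u(1) T by (auto simp: sol_def)
  then have wo: "?w \<in> Om" by (simp add: Oms_def)
  then have Qw: "Q ?w ~= 0" using in_Om by blast
  have "exp (T * Re sg) \<le> max 1 (exp (Re sg))"
  proof (cases "Re sg \<ge> 0")
   case True then have "T * Re sg \<le> Re sg" using T by (simp add: mult_left_le_one_le)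
   then show ?thesis by (simp add: le_max_iff_disj)
  next
   case False then have "T * Re sg \<le> 0" using T by (simp add: mult_nonneg_nonpos)
   then show ?thesis by (simp add: le_max_iff_disj)
  qed
  then have "norm ?w \<le> norm z * max 1 (exp (Re sg))" unfolding tr(3) by (rule mult_left_mono) simp
  then have "norm ?w \<le> R" by (simp add: R_def max_mult_distrib_left)
  moreover have "m \<le> cmod (Q ?w)"
  proof -
   have "m \<le> cmod (Q z) * exp (- (2 * C * (cmod \<eta> + cmod sg)) * T)"
    unfolding m_def using T C by (intro mult_left_mono) (auto simp: mult_left_le)
   then show ?thesis using tr(4) by linarith
  qed
  moreover have "cmod (P ?w - c * Q ?w) \<le> e * cmod (Q ?w)"
  proof -
   have "f ?w - c = (1 - T) *\<^sub>R (f z - c) + T *\<^sub>R (f z + \<eta> - c)" unfolding tr(2) by (simp add: scaleR_conv_of_real algebra_simps)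
   then have "cmod (f ?w - c) \<le> (1 - T) * cmod (f z - c) + T * cmod (f z + \<eta> - c)"
    using norm_triangle_ineq[of "(1 - T) *\<^sub>R (f z - c)" "T *\<^sub>R (f z + \<eta> - c)"] T by simp
   also have "\<dots> \<le> (1 - T) * e + T * e" using T by (intro add_mono mult_left_mono) (auto simp: e_def)
   finally have "cmod (f ?w - c) \<le> e" by (simp add: algebra_simps)
   moreover have "P ?w - c * Q ?w = (f ?w - c) * Q ?w" using Qw by (simp add: f_def field_simps)
   ultimately show ?thesis by (simp add: norm_mult mult_right_mono)
  qed
  ultimately have "?w \<in> K" by (simp add: K_def)
  then show ?thesis using tr(1) by blast
 qed
 ultimately show ?thesis
  using flow_exists[OF open_Oms ra_XF, of "mk z \<eta> sg" ?K] that by blast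
qed

text \<open>The time-one map. The choice is harmless by uniqueness (\<open>Fl_eq\<close>), and it
  makes the flow one global function, so that the local smooth flows all describe the same
  map.\<close>

definition Fl :: "complex ^ ('n + bool) => complex ^ 'n" where
 "Fl s = (SOME w. \<exists>u. sol XF Oms 1 u & u 0 = s & w = zc (u 1))"

lemma Fl_eq:
 assumes u: "sol XF Oms 1 u"
 shows "Fl (u 0) = zc (u 1)"
 unfolding Fl_def
proof (rule some_equality)
 show "\<exists>v. sol XF Oms 1 v & v 0 = u 0 & zc (u 1) = zc (v 1)" using u by blast
 fix w assume "\<exists>v. sol XF Oms 1 v & v 0 = u 0 & w = zc (v 1)"
 then obtain v where v: "sol XF Oms 1 v" "v 0 = u 0" "w = zc (v 1)" by blast
 have "v 1 = u 1"
 proof (rule sol_unique[OF _ v(1) u v(2)])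
  show "\<exists>d>0. \<exists>L\<ge>0. \<forall>y\<in>ball x d. \<forall>z\<in>ball x d. norm (XF y - XF z) \<le> L * norm (y - z)" if "x \<in> Oms" for x
   by (rule ra_locally_lipschitz[OF ra_XF[OF that]])
 qed simp
 then show "w = zc (u 1)" using v by simp
qed

lemma Fl_smooth:
 assumes "adm z \<eta> sg"
 shows "\<exists>U. mk z \<eta> sg \<in> U & mf_smooth_on U Fl"
proof -
 obtain U Y where U: "open U" "mk z \<eta> sg \<in> U" "!!q. q \<in> U ==> sol XF Oms 1 (Y q)" "!!q. q \<in> U ==> Y q 0 = q" "!!k. ck k U (%q. Y q 1)"
  using adm_flow[OF assms] by blast
 have "ck k U Fl" for k
  by (rule iffD1[OF ck_cong[OF U(1)] ck_linear_compose[OF bounded_linear_zc U(1) U(5)]]) (use Fl_eq[OF U(3)] U(4) in simp)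
 then show ?thesis using U(1,2) by (auto simp: smooth_iff_ck)
qed

lemma Fl_props:
 assumes "adm z \<eta> sg"
 shows "adm (Fl (mk z \<eta> sg)) (- \<eta>) (- sg)" "f (Fl (mk z \<eta> sg)) = f z + \<eta>" "norm (Fl (mk z \<eta> sg)) = norm z * exp (Re sg)"
  "Fl (mk (Fl (mk z \<eta> sg)) (- \<eta>) (- sg)) = z"
proof -
 obtain u where u: "sol XF Oms 1 u" "u 0 = mk z \<eta> sg" using adm_flow[OF assms] by metis
 note tr = trajectory[OF u(1) zero_le_one u(2)]
 have w: "Fl (mk z \<eta> sg) = zc (u 1)" using Fl_eq[OF u(1)] u(2) by simp
 show f: "f (Fl (mk z \<eta> sg)) = f z + \<eta>" and n: "norm (Fl (mk z \<eta> sg)) = norm z * exp (Re sg)" using tr w by simp_all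
 have z: "z \<in> Om" using assms by (simp add: adm_def)
 show "adm (Fl (mk z \<eta> sg)) (- \<eta>) (- sg)"
  unfolding adm_def
 proof (intro conjI)
  show "Fl (mk z \<eta> sg) \<in> Om" unfolding w using u(1) by (simp add: sol_def Oms_def)
  show "cmod (f (Fl (mk z \<eta> sg)) + - \<eta> - c) < dl" unfolding f using in_Om[OF z] by simp
  have "norm z * exp (Re sg) * exp (- Re sg) = norm z" by (simp add: mult.assoc flip: exp_add)
  then show "norm (Fl (mk z \<eta> sg)) * exp (Re (- sg)) < dl" unfolding n uminus_complex.simps using in_Om[OF z] by (simp only:)
 qed
 \<comment> \<open>The field is odd in the controls, so running a trajectory backwards with both
   controls negated gives a trajectory again: opposite controls invert the flow.\<close>
 define v where "v t = rev_state (u (1 - t))" for t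
 have XFrev: "XF (rev_state s) = - rev_state (XF s)" for s
  by (simp add: XF_def rev_state_def X_def slv_minus state_eq_iff vec_eq_iff)
 have "sol XF Oms 1 v"
  unfolding sol_def
 proof (intro ballI conjI)
  fix t :: real assume t: "t \<in> {0..1}"
  then have t': "1 - t \<in> {0..1}" by auto
  have ut: "u (1 - t) \<in> Oms" "(u has_vector_derivative XF (u (1 - t))) (at (1 - t) within {0..1})" using u(1) t' by (auto simp: sol_def)
  show "v t \<in> Oms" using ut(1) by (simp add: v_def Oms_def rev_state_def)
  have "((%t. 1 - t) has_vector_derivative - 1) (at t within {0..1::real})" by (auto intro!: derivative_eq_intros)
  moreover have "(u has_vector_derivative XF (u (1 - t))) (at (1 - t) within (%t. 1 - t) ` {0..1})"
   by (rule has_vector_derivative_within_subset[OF ut(2)]) auto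
  ultimately have "((%t. u (1 - t)) has_vector_derivative - XF (u (1 - t))) (at t within {0..1})"
   using vector_diff_chain_within[of "%t. 1 - t" "- 1" t "{0..1}" u] by (simp add: o_def)
  from bounded_linear.has_vector_derivative[OF bounded_linear_rev_state this]
  show "(v has_vector_derivative XF (v t)) (at t within {0..1})"
   unfolding v_def XFrev bounded_linear.linear[OF bounded_linear_rev_state, THEN linear_neg] .
 qed
 from Fl_eq[OF this] show "Fl (mk (Fl (mk z \<eta> sg)) (- \<eta>) (- sg)) = z"
  using tr(1) u(2) unfolding v_def w by (simp add: rev_state_def) (metis mk_nth zc_mk)
qed

lemma Fl_0:
 assumes "z \<in> Om" shows "Fl (mk z 0 0) = z"
proof -
 have "XF (mk z 0 0) = 0" by (simp add: XF_def X_def slv_def state_eq_iff vec_eq_iff)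
 then have "sol XF Oms 1 (%t. mk z 0 0)" using assms by (simp add: sol_def Oms_def)
 from Fl_eq[OF this] show ?thesis by simp
qed

end

section \<open>Trivialisation over the Riemann sphere\<close>

lemma smooth_mapI:
 assumes "!!x. x \<in> S ==> \<exists>U. x \<in> U & mf_smooth_on U g"
 shows "mf_smooth_map_on S g"
 unfolding mf_smooth_map_on_def
proof
 fix x assume "x \<in> S"
 then obtain U where "x \<in> U" "mf_smooth_on U g" using assms by blast
 then show "\<exists>U G. open U & x \<in> U & mf_smooth_on U G & (\<forall>y\<in>U \<inter> S. G y = g y)"
  by (intro exI[of _ U] exI[of _ g]) (simp add: mf_smooth_on_def)
qed

lemma smooth_mapE:
 assumes "mf_smooth_map_on S f" "x \<in> S"
 obtains U F where "x \<in> U" "mf_smooth_on U F" "!!y. y \<in> U ==> y \<in> S ==> F y = f y"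
proof -
 have "\<exists>U G. open U & x \<in> U & mf_smooth_on U G & (\<forall>y\<in>U \<inter> S. G y = f y)"
  by (rule bspec[OF assms(1)[unfolded mf_smooth_map_on_def] assms(2)])
 then show thesis
 proof (elim exE conjE)
  fix U G assume "x \<in> U" "mf_smooth_on U G" "\<forall>y\<in>U \<inter> S. G y = f y"
  then show thesis by (intro that[of U G]) auto
 qed
qed

lemma smooth_map_cong:
 assumes "mf_smooth_map_on S g" "!!x. x \<in> S ==> g x = g' x"
 shows "mf_smooth_map_on S g'"
 using assms unfolding mf_smooth_map_on_def by (metis IntD2)

lemma smooth_map_compose:
 assumes f: "mf_smooth_map_on S f" and g: "mf_smooth_map_on T g" and im: "!!x. x \<in> S ==> f x \<in> T"
 shows "mf_smooth_map_on S (%x. g (f x))"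
 unfolding mf_smooth_map_on_def
proof
 fix x assume x: "x \<in> S"
 obtain U F where U: "x \<in> U" "mf_smooth_on U F" "!!y. y \<in> U ==> y \<in> S ==> F y = f y"
  by (rule smooth_mapE[OF f x]) (rule that; assumption)
 obtain V G where V: "f x \<in> V" "mf_smooth_on V G" "!!y. y \<in> V ==> y \<in> T ==> G y = g y"
  by (rule smooth_mapE[OF g im[OF x]]) (rule that; assumption)
 have oU: "open U" and oV: "open V" and ckF: "!!k. ck k U F" and ckG: "!!k. ck k V G"
  using U(2) V(2) by (auto simp: smooth_iff_ck)
 define W where "W = U \<inter> F -` V"
 have "continuous_on U F" using ckF[of 0] by simp
 then have oW: "open W" unfolding W_def by (metis Int_commute oU continuous_on_open_vimage oV)
 have "ck k W (%x. G (F x))" for k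
  by (rule ck_compose[OF oW oV ck_subset[OF ckF] ckG]) (auto simp: W_def)
 then have "mf_smooth_on W (%x. G (F x))" using oW by (simp add: smooth_iff_ck)
 moreover have "x \<in> W" using U V x by (simp add: W_def)
 moreover have "\<forall>y\<in>W \<inter> S. G (F y) = g (f y)" using U(3) V(3) im by (auto simp: W_def)
 ultimately show "\<exists>U G. open U & x \<in> U & mf_smooth_on U G & (\<forall>y\<in>U \<inter> S. G y = g (f y))" using oW by blast
qed

lemma smooth_map_Pair:
 assumes f: "mf_smooth_map_on S f" and g: "mf_smooth_map_on S g"
 shows "mf_smooth_map_on S (%x. (f x, g x))"
 unfolding mf_smooth_map_on_def
proof
 fix x assume x: "x \<in> S"
 obtain U F where U: "x \<in> U" "mf_smooth_on U F" "!!y. y \<in> U ==> y \<in> S ==> F y = f y"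
  by (rule smooth_mapE[OF f x]) (rule that; assumption)
 obtain V G where V: "x \<in> V" "mf_smooth_on V G" "!!y. y \<in> V ==> y \<in> S ==> G y = g y"
  by (rule smooth_mapE[OF g x]) (rule that; assumption)
 have o: "open (U \<inter> V)" and ckF: "!!k. ck k U F" and ckG: "!!k. ck k V G"
  using U(2) V(2) by (auto simp: smooth_iff_ck)
 have "ck k (U \<inter> V) (%x. (F x, G x))" for k
  by (rule ck_Pair[OF o ck_subset[OF ckF] ck_subset[OF ckG]]) auto
 then have "mf_smooth_on (U \<inter> V) (%x. (F x, G x))" using o by (simp add: smooth_iff_ck)
 then show "\<exists>U G. open U & x \<in> U & mf_smooth_on U G & (\<forall>y\<in>U \<inter> S. G y = (f y, g y))"
  using o U V by (intro exI[of _ "U \<inter> V"] exI[of _ "%x. (F x, G x)"]) auto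
qed

lemma smooth_map_linear: "bounded_linear l ==> mf_smooth_map_on S l"
 by (rule smooth_mapI) (auto simp: smooth_iff_ck intro!: exI[of _ UNIV] ck_bounded_linear)

lemma smooth_map_linear_compose: "bounded_linear l ==> mf_smooth_map_on S g ==> mf_smooth_map_on S (%x. l (g x))"
 by (rule smooth_map_compose[OF _ smooth_map_linear[of l UNIV]]) auto

lemma smooth_map_const: "mf_smooth_map_on S (%x. c)"
 by (rule smooth_mapI) (auto simp: smooth_iff_ck intro!: exI[of _ UNIV] ck_const)

lemma smooth_map_diff:
 assumes "mf_smooth_map_on S f" "mf_smooth_map_on S g"
 shows "mf_smooth_map_on S (%x. f x - g x)"
proof -
 have "bounded_linear (%p :: 'b \<times> 'b. fst p - snd p)" by (intro bounded_linear_sub bounded_linear_fst bounded_linear_snd)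
 from smooth_map_linear_compose[OF this smooth_map_Pair[OF assms]] show ?thesis by simp
qed

lemma mf_diffeoI:
 assumes "mf_smooth_map_on S g" "mf_smooth_map_on T h" "!!x. x \<in> S ==> g x \<in> T" "!!y. y \<in> T ==> h y \<in> S"
  "!!x. x \<in> S ==> h (g x) = x" "!!y. y \<in> T ==> g (h y) = y"
 shows "mf_diffeo S T g"
 unfolding mf_diffeo_def by (rule exI[of _ h]) (use assms in auto)

lemma mf_diffeomorphic_sym: "mf_diffeomorphic S T ==> mf_diffeomorphic T S"
 unfolding mf_diffeomorphic_def mf_diffeo_def by blast

lemma mf_diffeomorphic_trans:
 assumes "mf_diffeomorphic S T" "mf_diffeomorphic T R"
 shows "mf_diffeomorphic S R"
proof -
 obtain g g' where g: "mf_smooth_map_on S g" "mf_smooth_map_on T g'" "g ` S \<subseteq> T" "g' ` T \<subseteq> S" "\<forall>x\<in>S. g' (g x) = x" "\<forall>y\<in>T. g (g' y) = y"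
  using assms(1) unfolding mf_diffeomorphic_def mf_diffeo_def by blast
 obtain h h' where h: "mf_smooth_map_on T h" "mf_smooth_map_on R h'" "h ` T \<subseteq> R" "h' ` R \<subseteq> T" "\<forall>x\<in>T. h' (h x) = x" "\<forall>y\<in>R. h (h' y) = y"
  using assms(2) unfolding mf_diffeomorphic_def mf_diffeo_def by blast
 have "mf_diffeo S R (%x. h (g x))"
 proof (rule mf_diffeoI[where h="%y. g' (h' y)"])
  show "mf_smooth_map_on S (%x. h (g x))" by (rule smooth_map_compose[OF g(1) h(1)]) (use g in auto)
  show "mf_smooth_map_on R (%x. g' (h' x))" by (rule smooth_map_compose[OF h(2) g(2)]) (use h in auto)
 qed (use g h in \<open>auto simp: image_subset_iff\<close>)
 then show ?thesis unfolding mf_diffeomorphic_def by blast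
qed

section \<open>Stereographic projection from infinity as affine coordinate\<close>

definition st :: "complex \<times> real => complex" where
 "st w = inverse (1 - snd w) *\<^sub>R fst w"

lemma hopf_eq: "mf_hopf t 1 = (inverse (1 + t \<bullet> t) *\<^sub>R (2 *\<^sub>R t), (t \<bullet> t - 1) * inverse (1 + t \<bullet> t))"
 by (simp add: mf_hopf_def dot_square_norm scaleR_conv_of_real divide_inverse add.commute)

lemma one_plus_inner: "1 + t \<bullet> t ~= (0 :: real)" for t :: complex
 using inner_ge_zero[of t] by linarith

lemma smooth_hopf: "mf_smooth_on UNIV (%t. mf_hopf t 1)"
proof -
 have i: "ck k UNIV (%t::complex. t \<bullet> t)" for k
  by (rule ck_bilinear[OF bounded_bilinear_inner]) (auto intro: ck_bounded_linear bounded_linear_ident)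
 have n: "ck k UNIV (%t::complex. 1 + t \<bullet> t)" for k by (intro ck_add ck_const i) auto
 have v: "ck k UNIV (%t::complex. inverse (1 + t \<bullet> t))" for k
  by (rule ck_compose[OF open_UNIV _ n ck_inverse]) (use one_plus_inner in auto)
 have "ck k UNIV (%t::complex. (inverse (1 + t \<bullet> t) *\<^sub>R (2 *\<^sub>R t), (t \<bullet> t + (- 1)) * inverse (1 + t \<bullet> t)))" for k
  by (intro ck_Pair ck_bilinear[OF bounded_bilinear_scaleR] ck_bilinear[OF bounded_bilinear_mult] v ck_add i ck_const
    ck_bounded_linear[OF open_UNIV bounded_linear_scaleR_right] open_UNIV)
 then show ?thesis by (simp add: smooth_iff_ck hopf_eq[abs_def])
qed

lemma smooth_st: "mf_smooth_on {w. snd w ~= 1} st"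
proof -
 have o: "open {w :: complex \<times> real. snd w ~= 1}"
  by (intro open_Collect_neq continuous_intros)
 have n: "ck k {w :: complex \<times> real. snd w ~= 1} (%w. 1 + - snd w)" for k
  by (intro ck_add ck_const o ck_bounded_linear[OF o] bounded_linear_minus bounded_linear_snd)
 have iv: "ck k {w :: complex \<times> real. snd w ~= 1} (%w. inverse (1 + - snd w))" for k
  by (rule ck_compose[OF o _ n ck_inverse]) auto
 have "ck k {w :: complex \<times> real. snd w ~= 1} (%w. inverse (1 + - snd w) *\<^sub>R fst w)" for k
  by (rule ck_bilinear[OF bounded_bilinear_scaleR o iv ck_bounded_linear[OF o bounded_linear_fst]])
 then show ?thesis using o by (simp add: smooth_iff_ck st_def[abs_def])
qed

lemma st_hopf: "st (mf_hopf t 1) = t"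
proof -
 let ?n = "1 + t \<bullet> t"
 have "1 - (t \<bullet> t - 1) * inverse ?n = 2 * inverse ?n" using one_plus_inner[of t] by (simp add: field_simps)
 then show ?thesis using one_plus_inner[of t] by (simp add: st_def hopf_eq)
qed

lemma hopf_sphere: "mf_hopf t 1 \<in> mf_CP1"
proof -
 let ?n = "1 + t \<bullet> t"
 have "mf_hopf t 1 \<bullet> mf_hopf t 1 = (4 * (t \<bullet> t) + (t \<bullet> t - 1)\<^sup>2) * (inverse ?n)\<^sup>2"
  by (simp add: hopf_eq power2_eq_square algebra_simps)
 also have "4 * (t \<bullet> t) + (t \<bullet> t - 1)\<^sup>2 = ?n\<^sup>2" by (simp add: power2_eq_square algebra_simps)
 also have "?n\<^sup>2 * (inverse ?n)\<^sup>2 = 1" using one_plus_inner[of t] by (simp add: power_mult_distrib[symmetric])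
 finally show ?thesis by (simp add: norm_eq_1)
qed

lemma hopf_not_infinity: "snd (mf_hopf t 1) ~= 1"
 using one_plus_inner[of t] by (simp add: hopf_eq field_simps)

lemma sphere_snd:
 assumes "w \<in> mf_CP1" "w ~= (0, 1)" shows "snd w ~= 1"
proof
 assume 1: "snd w = 1"
 have "w \<bullet> w = 1" using assms(1) by (simp add: norm_eq_1)
 then have "fst w \<bullet> fst w = 0" using 1 by (simp add: inner_prod_def)
 then show False using assms(2) 1 by (simp add: prod_eq_iff)
qed

lemma hopf_st:
 assumes "w \<in> mf_CP1" "w ~= (0, 1)" shows "mf_hopf (st w) 1 = w"
proof -
 define x y where "x = fst w" and "y = snd w"
 have y: "1 - y ~= 0" using sphere_snd[OF assms] by (simp add: y_def)
 have "w \<bullet> w = 1" using assms(1) by (simp add: norm_eq_1)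
 then have xx: "x \<bullet> x = 1 - y * y" by (simp add: inner_prod_def x_def y_def)
 have tt: "st w \<bullet> st w = (1 + y) * inverse (1 - y)"
 proof -
  have "st w \<bullet> st w = inverse (1 - y) * (inverse (1 - y) * (1 - y * y))" by (simp add: st_def x_def[symmetric] y_def[symmetric] xx)
  also have "1 - y * y = (1 - y) * (1 + y)" by (simp add: algebra_simps)
  finally show ?thesis using y by simp
 qed
 have n: "1 + st w \<bullet> st w = 2 * inverse (1 - y)" unfolding tt using y by (simp add: field_simps)
 have "inverse (1 + st w \<bullet> st w) *\<^sub>R (2 *\<^sub>R st w) = x" unfolding n using y by (simp add: st_def x_def y_def)
 moreover have "(st w \<bullet> st w - 1) * inverse (1 + st w \<bullet> st w) = y" unfolding n unfolding tt using y by (simp add: field_simps)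
 ultimately show ?thesis by (simp add: hopf_eq x_def y_def)
qed

lemma hopf_quotient:
 assumes "b ~= 0" shows "mf_hopf a b = mf_hopf (a / b) 1"
proof -
 have n: "(cmod a)\<^sup>2 + (cmod b)\<^sup>2 ~= 0" using assms by (simp add: sum_power2_eq_zero_iff)
 have b2: "complex_of_real ((cmod b)\<^sup>2) = b * cnj b" by (rule complex_norm_square)
 have "(cmod (a / b))\<^sup>2 + (cmod 1)\<^sup>2 = ((cmod a)\<^sup>2 + (cmod b)\<^sup>2) / (cmod b)\<^sup>2"
  using assms by (simp add: norm_divide power_divide add_divide_distrib)
 moreover have "(cmod (a / b))\<^sup>2 - (cmod 1)\<^sup>2 = ((cmod a)\<^sup>2 - (cmod b)\<^sup>2) / (cmod b)\<^sup>2"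
  using assms by (simp add: norm_divide power_divide diff_divide_distrib)
 moreover have "2 * (a / b) * cnj 1 / complex_of_real (((cmod a)\<^sup>2 + (cmod b)\<^sup>2) / (cmod b)\<^sup>2) = 2 * a * cnj b / complex_of_real ((cmod a)\<^sup>2 + (cmod b)\<^sup>2)"
  unfolding of_real_divide b2 using assms by simp
 ultimately show ?thesis using assms unfolding mf_hopf_def by simp
qed

lemma map_infinity: "\<not> (P z = 0 & Q z = 0) ==> Q z = 0 ==> mf_map P Q z = (0, 1)"
 by (simp add: mf_map_def mf_hopf_def)

lemma circle_loop_sphere:
 assumes "mf_tangent_frame c u v" "c \<in> mf_CP1"
 shows "mf_circle_loop c u v r t \<in> mf_CP1"
proof -
 have c: "c \<bullet> c = 1" using assms(2) by (simp add: norm_eq_1)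
 have o: "u \<bullet> u = 1" "v \<bullet> v = 1" "u \<bullet> v = 0" "v \<bullet> u = 0" "c \<bullet> u = 0" "u \<bullet> c = 0" "c \<bullet> v = 0" "v \<bullet> c = 0"
  using assms(1) by (auto simp: mf_tangent_frame_def inner_commute)
 let ?w = "cos (2 * pi * t) *\<^sub>R u + sin (2 * pi * t) *\<^sub>R v"
 have ww: "?w \<bullet> ?w = 1"
  using sin_cos_squared_add[of "2 * pi * t"] by (simp add: inner_add_left inner_add_right o power2_eq_square)
 have cw: "c \<bullet> ?w = 0" "?w \<bullet> c = 0" by (simp_all add: inner_add_left inner_add_right o)
 have "mf_circle_loop c u v r t \<bullet> mf_circle_loop c u v r t = cos r * cos r * (c \<bullet> c) + 2 * (cos r * sin r * (c \<bullet> ?w)) + sin r * sin r * (?w \<bullet> ?w)"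
  unfolding mf_circle_loop_def
  by (simp only: inner_add_left[of "cos r *\<^sub>R c"] inner_add_right[of _ "cos r *\<^sub>R c"] inner_scaleR_left inner_scaleR_right cw) (simp add: algebra_simps)
 also have "\<dots> = 1" unfolding cw ww c using sin_cos_squared_add[of r] by (simp add: power2_eq_square)
 finally show ?thesis by (simp add: norm_eq_1)
qed

lemma smooth_circle_loop: "mf_smooth_on UNIV (mf_circle_loop c u v r)"
proof -
 have l: "ck k UNIV (%t::real. 2 * pi * t)" for k by (rule ck_bounded_linear[OF open_UNIV bounded_linear_mult_right])
 have cs: "ck k UNIV (%t. cos (2 * pi * t))" "ck k UNIV (%t. sin (2 * pi * t))" for k
  using ck_compose[OF open_UNIV open_UNIV l, of k cos] ck_compose[OF open_UNIV open_UNIV l, of k sin] ck_cos_sin by auto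
 have "ck k UNIV (%t. cos r *\<^sub>R c + sin r *\<^sub>R (cos (2 * pi * t) *\<^sub>R u + sin (2 * pi * t) *\<^sub>R v))" for k
  by (intro ck_add ck_const open_UNIV ck_linear_compose[OF bounded_linear_scaleR_right] ck_bilinear[OF bounded_bilinear_scaleR] cs)
 then show ?thesis by (simp add: smooth_iff_ck mf_circle_loop_def[abs_def])
qed

lemma bounded_linear_mk: "bounded_linear (%p. mk (fst p) (fst (snd p)) (snd (snd p)))"
 unfolding linear_conv_bounded_linear[symmetric] by (rule linearI) (auto simp: state_eq_iff vec_eq_iff)

section \<open>Fibration, fibres and monodromy over a small disc\<close>

context tube
begin

lemma smooth_f: "mf_smooth_on Om f"
proof -
 have "Om \<subseteq> ball 0 dl" by (auto simp: Om_def)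
 then have "hol P Om" "hol Q Om" using hol_subset[OF hP open_Om] hol_subset[OF hQ open_Om] by auto
 then have "hol (%z. P z / Q z) Om" by (rule hol_divide) (simp add: Om_def)
 then show ?thesis using ck_hol open_Om by (auto simp: smooth_iff_ck f_def[abs_def])
qed

lemma smooth_Fl:
 assumes "mf_smooth_map_on S x" "mf_smooth_map_on S \<eta>" "mf_smooth_map_on S sg" and a: "!!p. p \<in> S ==> adm (x p) (\<eta> p) (sg p)"
 shows "mf_smooth_map_on S (%p. Fl (mk (x p) (\<eta> p) (sg p)))"
proof (rule smooth_map_compose[where T="{mk z \<eta> sg | z \<eta> sg. adm z \<eta> sg}"])
 show "mf_smooth_map_on S (%p. mk (x p) (\<eta> p) (sg p))"
  using smooth_map_linear_compose[OF bounded_linear_mk smooth_map_Pair[OF assms(1) smooth_map_Pair[OF assms(2,3)]]] by simp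
 show "mf_smooth_map_on {mk z \<eta> sg | z \<eta> sg. adm z \<eta> sg} Fl" by (rule smooth_mapI) (use Fl_smooth in auto)
qed (use a in auto)

definition nb :: "complex \<times> real => bool" where
 "nb w \<longleftrightarrow> w \<in> mf_CP1 & w ~= (0, 1) & cmod (st w - c) < dl"

lemma map_eq: "Q z ~= 0 ==> mf_map P Q z = mf_hopf (f z) 1"
 unfolding mf_map_def f_def by (rule hopf_quotient)

text \<open>At a zero of \<open>Q\<close> inside the domain the map takes the value infinity, which
  \<open>nb\<close> excludes. Fibres over nearby points of the sphere thus become level sets of
  \<open>f\<close> in \<open>Om\<close>, to which the flow applies.\<close>

lemma fibre_iff:
 assumes "nb w" "ep < dl"
 shows "x \<in> mf_dom P Q ep & mf_map P Q x = w \<longleftrightarrow> x \<in> Om & norm x \<le> ep & f x = st w"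
proof
 assume x: "x \<in> mf_dom P Q ep & mf_map P Q x = w"
 then have Q0: "Q x ~= 0" using map_infinity[of P x Q] assms(1) by (auto simp: mf_dom_def nb_def)
 then have "f x = st w" using map_eq st_hopf x by metis
 then show "x \<in> Om & norm x \<le> ep & f x = st w" using x Q0 assms by (auto simp: mf_dom_def Om_def nb_def)
next
 assume x: "x \<in> Om & norm x \<le> ep & f x = st w"
 then have "Q x ~= 0" by (simp add: Om_def)
 then show "x \<in> mf_dom P Q ep & mf_map P Q x = w" using x map_eq hopf_st[of w] assms(1) by (auto simp: mf_dom_def nb_def)
qed

lemma adm_fibre:
 assumes "x \<in> Om" "norm x \<le> ep" "ep < dl" "f x = st w" "nb w'"
 shows "adm x (st w' - st w) 0"
 using assms by (simp add: adm_def nb_def)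

lemma nb_st_smooth: "mf_smooth_map_on {w. nb w} st"
proof (rule smooth_mapI)
 fix x assume "x \<in> {w. nb w}"
 then have "snd x ~= 1" using sphere_snd[of x] by (simp add: nb_def)
 then show "\<exists>U. x \<in> U & mf_smooth_on U st" using smooth_st by (intro exI[of _ "{w. snd w ~= 1}"]) simp
qed

text \<open>With radial control 0 the flow preserves every sphere, so it acts on the closed ball of
  each radius, boundary included. The control \<open>st b - f x\<close> brings a point to the fibre
  over \<open>b\<close>, and its negative brings it back. This trivialises the map over all of
  \<open>V\<close>; the radius 1 in the proof is arbitrary.\<close>

lemma fibration:
 assumes V: "!!w. w \<in> V ==> nb w" and ep: "ep < dl"
 shows "mf_fibration_over (mf_dom P Q ep) (mf_map P Q) V"
 unfolding mf_fibration_over_def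
proof
 fix b assume b: "b \<in> V"
 let ?A = "{x \<in> mf_dom P Q ep. mf_map P Q x \<in> V \<inter> ball b 1}" and ?F = "{x \<in> mf_dom P Q ep. mf_map P Q x = b}"
 define ph where "ph x = (mf_map P Q x, Fl (mk x (st b - f x) 0))" for x
 define ps where "ps = (%(d, y). Fl (mk y (st d - st b) 0))"
 have A: "x \<in> Om & norm x \<le> ep & f x = st (mf_map P Q x) & mf_map P Q x \<in> V \<inter> ball b 1" if "x \<in> ?A" for x
  using fibre_iff[OF V ep, of "mf_map P Q x" x] that by auto
 have F: "x \<in> ?F \<longleftrightarrow> x \<in> Om & norm x \<le> ep & f x = st b" for x using fibre_iff[OF V[OF b] ep, of x] by auto
 have admA: "adm x (st b - f x) 0" if "x \<in> ?A" for x
  using A[OF that] adm_fibre[of x ep "mf_map P Q x" b] V[OF b] ep by simp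
 have admB: "adm y (st d - st b) 0" if "d \<in> V" "y \<in> ?F" for d y
  using adm_fibre[of y ep b d] V[OF that(1)] that(2)[unfolded F] ep by simp
 have "mf_diffeo ?A ((V \<inter> ball b 1) \<times> ?F) ph"
 proof (rule mf_diffeoI[where h=ps])
  have sx: "mf_smooth_map_on ?A (%x. x)" by (rule smooth_map_linear[OF bounded_linear_ident])
  have sf: "mf_smooth_map_on ?A f"
  proof (rule smooth_mapI)
   fix x assume "x \<in> ?A"
   then have "x \<in> Om" using A by blast
   then show "\<exists>U. x \<in> U & mf_smooth_on U f" using smooth_f by blast
  qed
  have "mf_smooth_map_on ?A (%x. mf_hopf (f x) 1)"
   by (rule smooth_map_compose[OF sf smooth_mapI[of UNIV]]) (use smooth_hopf in auto)
  then have "mf_smooth_map_on ?A (mf_map P Q)"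
  proof (rule smooth_map_cong)
   fix x assume "x \<in> ?A"
   then have "Q x ~= 0" using A[of x] in_Om[of x] by blast
   then show "mf_hopf (f x) 1 = mf_map P Q x" by (rule map_eq[symmetric])
  qed
  moreover have "mf_smooth_map_on ?A (%x. Fl (mk x (st b - f x) 0))"
   by (intro smooth_Fl sx smooth_map_diff smooth_map_const sf admA)
  ultimately show "mf_smooth_map_on ?A ph" unfolding ph_def[abs_def] by (rule smooth_map_Pair)
  let ?B = "(V \<inter> ball b 1) \<times> ?F"
  have aB: "adm (snd p) (st (fst p) - st b) 0" if "p \<in> ?B" for p
  proof (rule admB)
   show "fst p \<in> V" "snd p \<in> ?F" using that unfolding mem_Times_iff by blast+
  qed
  have "mf_smooth_map_on ?B (%p. st (fst p))"
   by (rule smooth_map_compose[OF smooth_map_linear[OF bounded_linear_fst] nb_st_smooth]) (use V in auto)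
  then have "mf_smooth_map_on ?B (%p. Fl (mk (snd p) (st (fst p) - st b) 0))"
   by (intro smooth_Fl smooth_map_linear[OF bounded_linear_snd] smooth_map_diff smooth_map_const aB)
  then show "mf_smooth_map_on ?B ps" by (simp add: ps_def case_prod_unfold)
  show "ph x \<in> ?B" if x: "x \<in> ?A" for x
  proof -
   note p = Fl_props[OF admA[OF x]]
   have "Fl (mk x (st b - f x) 0) \<in> ?F" unfolding F using p A[OF x] by (simp add: adm_def)
   then show ?thesis using A[OF x] by (simp add: ph_def)
  qed
  show "ps p \<in> ?A" if "p \<in> ?B" for p
  proof -
   obtain d y where p: "p = (d, y)" "d \<in> V" "d \<in> ball b 1" "y \<in> ?F"
    using \<open>p \<in> ?B\<close> by (elim SigmaE IntE) (rule that; assumption)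
   note q = Fl_props[OF admB[OF p(2,4)]]
   have "Fl (mk y (st d - st b) 0) \<in> mf_dom P Q ep & mf_map P Q (Fl (mk y (st d - st b) 0)) = d"
    unfolding fibre_iff[OF V[OF p(2)] ep] using q p(4)[unfolded F] by (simp add: adm_def)
   then have m1: "Fl (mk y (st d - st b) 0) \<in> mf_dom P Q ep" and m2: "mf_map P Q (Fl (mk y (st d - st b) 0)) = d" by blast+
   have e: "ps p = Fl (mk y (st d - st b) 0)" by (simp add: ps_def p(1))
   show ?thesis unfolding e mem_Collect_eq m2 by (intro conjI IntI m1 p(2,3))
  qed
  show "ps (ph x) = x" if "x \<in> ?A" for x
   using Fl_props(4)[OF admA[OF that]] A[OF that] by (simp add: ps_def ph_def)
  show "ph (ps p) = p" if "p \<in> ?B" for p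
  proof -
   obtain d y where p: "p = (d, y)" "d \<in> V" "d \<in> ball b 1" "y \<in> ?F"
    using \<open>p \<in> ?B\<close> by (elim SigmaE IntE) (rule that; assumption)
   note q = Fl_props[OF admB[OF p(2,4)]]
   have m: "Fl (mk y (st d - st b) 0) \<in> mf_dom P Q ep & mf_map P Q (Fl (mk y (st d - st b) 0)) = d"
    unfolding fibre_iff[OF V[OF p(2)] ep] using q p(4)[unfolded F] by (simp add: adm_def)
   have "f (Fl (mk y (st d - st b) 0)) = st d" using q(2) p(4)[unfolded F] by simp
   then show ?thesis using m q(4) by (simp add: ph_def ps_def p(1))
  qed
 qed
 then show "\<exists>r>0. \<exists>ph. mf_diffeo {x \<in> mf_dom P Q ep. mf_map P Q x \<in> V \<inter> ball b r} ((V \<inter> ball b r) \<times> ?F) ph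
   & (\<forall>x\<in>{x \<in> mf_dom P Q ep. mf_map P Q x \<in> V \<inter> ball b r}. fst (ph x) = mf_map P Q x)"
  by (intro exI[of _ 1] conjI exI[of _ ph]) (simp_all add: ph_def)
qed

text \<open>The radial control \<open>ln (e' / e)\<close> multiplies norms by \<open>e' / e\<close>
  and carries one ball to the other, while the value control moves \<open>w\<close> to
  \<open>w'\<close>. Exchanging the roles of the two fibres negates both controls, which gives the
  inverse map.\<close>

lemma fibres_diffeomorphic:
 assumes w: "nb w" "nb w'" and ep: "0 < ep" "ep < dl" "0 < ep'" "ep' < dl"
 shows "mf_diffeomorphic (mf_fibre P Q ep w) (mf_fibre P Q ep' w')"
proof -
 have F: "x \<in> mf_fibre P Q e v \<longleftrightarrow> x \<in> Om & norm x \<le> e & f x = st v" if "nb v" "e < dl" for x e v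
  using fibre_iff[OF that] by (simp add: mf_fibre_def)
 define g where "g v v' e e' x = Fl (mk x (st v' - st v) (of_real (ln (e' / e))))" for v v' and e e' :: real and x
 have key: "adm x (st v' - st v) (of_real (ln (e' / e))) & g v v' e e' x \<in> mf_fibre P Q e' v' & g v' v e' e (g v v' e e' x) = x"
  if v: "nb v" "nb v'" and e: "0 < e" "e < dl" "0 < e'" "e' < dl" and x: "x \<in> mf_fibre P Q e v" for v v' e e' x
 proof -
  have x': "x \<in> Om" "norm x \<le> e" "f x = st v" using x F[OF v(1) e(2)] by auto
  have ex: "exp (ln (e' / e)) = e' / e" using e by simp
  have "norm x * (e' / e) \<le> e * (e' / e)" using x'(2) e by (intro mult_right_mono) auto
  then have n: "norm x * exp (ln (e' / e)) \<le> e'" unfolding ex using e by simp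
  then have a: "adm x (st v' - st v) (of_real (ln (e' / e)))" using x' v e by (simp add: adm_def nb_def)
  note p = Fl_props[OF a]
  have "g v v' e e' x \<in> mf_fibre P Q e' v'" unfolding F[OF v(2) e(4)] g_def using p n x'(3) by (simp add: adm_def)
  moreover have "ln (e / e') = - ln (e' / e)" using e by (simp add: ln_div)
  then have "g v' v e' e (g v v' e e' x) = x" using p(4) by (simp add: g_def)
  ultimately show ?thesis using a by blast
 qed
 have s: "mf_smooth_map_on (mf_fibre P Q e v) (g v v' e e')" if v: "nb v" "nb v'" and e: "0 < e" "e < dl" "0 < e'" "e' < dl" for v v' e e'
  unfolding g_def[abs_def]
  by (intro smooth_Fl smooth_map_linear[OF bounded_linear_ident] smooth_map_const) (use key[OF that] in blast)
 have "mf_diffeo (mf_fibre P Q ep w) (mf_fibre P Q ep' w') (g w w' ep ep')"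
  by (rule mf_diffeoI[OF s[OF w ep] s[OF w(2,1) ep(3,4,1,2)]])
   (use key[OF w ep] key[OF w(2,1) ep(3,4,1,2)] in blast)+
 then show ?thesis unfolding mf_diffeomorphic_def by blast
qed

text \<open>The whole loop lies in a disc over which the flow trivialises. Carrying the fibre over
  \<open>gm t\<close> back to the fibre over \<open>gm 0\<close> by the flow turns any
  trivialisation along the loop into an isotopy of one fibre. It starts at the identity, and as the
  loop closes up the flow is trivial again at \<open>t = 1\<close>, so it ends at the
  monodromy.\<close>

lemma monodromy:
 assumes gm: "mf_smooth_on UNIV gm" "!!t. t \<in> {0..1} ==> nb (gm t)" "gm 1 = gm 0" and ep: "ep < dl"
 shows "mf_monodromy_isotopic_to_id (mf_dom P Q ep) (mf_map P Q) gm"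
 unfolding mf_monodromy_isotopic_to_id_def
proof (intro allI impI)
 fix \<Phi> assume tr: "mf_trivialisation_along (mf_dom P Q ep) (mf_map P Q) gm \<Phi>"
 let ?I = "{0..1::real}"
 define F where "F = {x \<in> mf_dom P Q ep. mf_map P Q x = gm 0}"
 define Pb where "Pb = {(y, t). y \<in> mf_dom P Q ep & t \<in> ?I & mf_map P Q y = gm t}"
 have Pb: "(y, t) \<in> Pb \<longleftrightarrow> t \<in> ?I & y \<in> Om & norm y \<le> ep & f y = st (gm t)" for y t
  using fibre_iff[OF gm(2) ep, of t y] by (auto simp: Pb_def)
 have F: "y \<in> F \<longleftrightarrow> y \<in> Om & norm y \<le> ep & f y = st (gm 0)" for y
  using fibre_iff[OF gm(2) ep, of 0 y] by (auto simp: F_def)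
 define G where "G = (%(x, t). (\<Phi> (x, t), t))"
 have \<Phi>0: "\<Phi> (x, 0) = x" if "x \<in> F" for x using tr that by (simp add: mf_trivialisation_along_def F_def)
 have "mf_diffeo (F \<times> ?I) Pb G" using tr by (simp add: mf_trivialisation_along_def F_def Pb_def G_def)
 then obtain k where k: "mf_smooth_map_on (F \<times> ?I) G" "mf_smooth_map_on Pb k" "G ` (F \<times> ?I) \<subseteq> Pb" "k ` Pb \<subseteq> F \<times> ?I"
   "!!x. x \<in> F \<times> ?I ==> k (G x) = x" "!!y. y \<in> Pb ==> G (k y) = y"
  unfolding mf_diffeo_def by blast
 have n0: "nb (gm 0)" using gm(2) by simp
 define H where "H p = Fl (mk (\<Phi> p) (st (gm 0) - st (gm (snd p))) 0)" for p
 \<comment> \<open>The flow in the opposite direction, from the fibre over \<open>gm 0\<close> to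
   that over \<open>gm t\<close>; followed by the inverse \<open>k\<close> of the trivialisation it
   inverts the isotopy.\<close>
 define B where "B p = Fl (mk (fst p) (st (gm (snd p)) - st (gm 0)) 0)" for p
 have GP: "(\<Phi> (x, t), t) \<in> Pb" if "x \<in> F" "t \<in> ?I" for x t using k(3) that by (force simp: G_def)
 have admH: "adm (\<Phi> (x, t)) (st (gm 0) - st (gm t)) 0" if "x \<in> F" "t \<in> ?I" for x t
  using GP[OF that] adm_fibre[of "\<Phi> (x, t)" ep "gm t" "gm 0"] n0 ep unfolding Pb by blast
 have admB: "adm y (st (gm t) - st (gm 0)) 0" if "y \<in> F" "t \<in> ?I" for y t
  using that adm_fibre[of y ep "gm 0" "gm t"] gm(2) ep unfolding F by blast
 have HF: "H (x, t) \<in> F" if "x \<in> F" "t \<in> ?I" for x t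
  using Fl_props[OF admH[OF that]] GP[OF that] unfolding F Pb H_def by (simp add: adm_def)
 have BP: "(B (y, t), t) \<in> Pb" if "y \<in> F" "t \<in> ?I" for y t
  using Fl_props[OF admB[OF that]] that unfolding F Pb B_def by (simp add: adm_def)
 have sgm: "mf_smooth_map_on (F \<times> ?I) (%p. st (gm (snd p)))"
 proof (rule smooth_map_compose[OF _ nb_st_smooth])
  show "mf_smooth_map_on (F \<times> ?I) (%p. gm (snd p))"
   by (rule smooth_map_compose[OF smooth_map_linear[OF bounded_linear_snd] smooth_mapI[of UNIV]]) (use gm(1) in auto)
 qed (use gm(2) in auto)
 have s\<Phi>: "mf_smooth_map_on (F \<times> ?I) \<Phi>"
  by (rule smooth_map_cong[OF smooth_map_linear_compose[OF bounded_linear_fst k(1)]]) (auto simp: G_def)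
 have sH: "mf_smooth_map_on (F \<times> ?I) H"
  unfolding H_def[abs_def] by (intro smooth_Fl s\<Phi> smooth_map_diff smooth_map_const sgm) (use admH in auto)
 have sB: "mf_smooth_map_on (F \<times> ?I) B"
  unfolding B_def[abs_def] by (intro smooth_Fl smooth_map_linear[OF bounded_linear_fst] smooth_map_diff smooth_map_const sgm) (use admB in auto)
 have "mf_diffeo (F \<times> ?I) (F \<times> ?I) (%(x, t). (H (x, t), t))"
 proof (rule mf_diffeoI[where h="%p. k (B p, snd p)"])
  show "mf_smooth_map_on (F \<times> ?I) (%(x, t). (H (x, t), t))"
   using smooth_map_Pair[OF sH smooth_map_linear[OF bounded_linear_snd]] by (simp add: case_prod_unfold)
  show "mf_smooth_map_on (F \<times> ?I) (%p. k (B p, snd p))"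
   by (rule smooth_map_compose[OF smooth_map_Pair[OF sB smooth_map_linear[OF bounded_linear_snd]] k(2)]) (use BP in auto)
  show "(case p of (x, t) => (H (x, t), t)) \<in> F \<times> ?I" if "p \<in> F \<times> ?I" for p using HF that by auto
  show "k (B p, snd p) \<in> F \<times> ?I" if "p \<in> F \<times> ?I" for p
  proof -
   have "(B p, snd p) \<in> Pb" using BP that by auto
   then show ?thesis using k(4) by blast
  qed
  show "k (B (case p of (x, t) => (H (x, t), t)), snd (case p of (x, t) => (H (x, t), t))) = p" if "p \<in> F \<times> ?I" for p
  proof -
   obtain x t where p: "p = (x, t)" "x \<in> F" "t \<in> ?I" using \<open>p \<in> F \<times> ?I\<close> by auto
   have "B (H (x, t), t) = \<Phi> (x, t)" using Fl_props(4)[OF admH[OF p(2,3)]] by (simp add: B_def H_def)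
   then show ?thesis using k(5)[of p] p by (simp add: G_def)
  qed
  show "(case k (B p, snd p) of (x, t) => (H (x, t), t)) = p" if "p \<in> F \<times> ?I" for p
  proof -
   obtain y t where p: "p = (y, t)" "y \<in> F" "t \<in> ?I" using \<open>p \<in> F \<times> ?I\<close> by auto
   obtain x s where xs: "k (B (y, t), t) = (x, s)" by (cases "k (B (y, t), t)")
   have "G (x, s) = (B (y, t), t)" using k(6)[OF BP[OF p(2,3)]] xs by simp
   then have e: "s = t" "\<Phi> (x, t) = B (y, t)" by (auto simp: G_def)
   have "H (x, t) = y" using Fl_props(4)[OF admB[OF p(2,3)]] by (simp add: H_def e B_def)
   then show ?thesis using xs e by (simp add: p)
  qed
 qed
 moreover have "H (x, 0) = x & H (x, 1) = \<Phi> (x, 1)" if x: "x \<in> F" for x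
 proof
  show "H (x, 0) = x" using Fl_0[of x] x F by (simp add: H_def \<Phi>0[OF x])
  have "\<Phi> (x, 1) \<in> Om" using GP[OF x, of 1] unfolding Pb by simp
  then show "H (x, 1) = \<Phi> (x, 1)" using Fl_0 by (simp add: H_def gm(3))
 qed
 ultimately show "mf_isotopic_to_id {x \<in> mf_dom P Q ep. mf_map P Q x = gm 0} (%x. \<Phi> (x, 1))"
  unfolding mf_isotopic_to_id_def F_def[symmetric] by blast
qed

lemma nb_near: "\<exists>d>0. \<forall>w\<in>mf_CP1. dist w (mf_hopf c 1) < d \<longrightarrow> nb w"
proof -
 have "isCont st (mf_hopf c 1)"
  using smooth_st hopf_not_infinity[of c]
  by (metis (mono_tags, lifting) ck.simps(1) continuous_on_eq_continuous_at mem_Collect_eq smooth_iff_ck)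
 then have "(st \<longlongrightarrow> c) (nhds (mf_hopf c 1))" using isCont_nhds[where f=st and x="mf_hopf c 1"] by (simp add: st_hopf)
 then have "\<forall>\<^sub>F w in nhds (mf_hopf c 1). dist (st w) c < dl" using dl by (simp add: tendsto_iff)
 moreover have "\<forall>\<^sub>F w in nhds (mf_hopf c 1). w \<in> {w. snd w ~= 1}"
  by (rule eventually_nhds_in_open) (use smooth_st hopf_not_infinity in \<open>auto simp: mf_smooth_on_def\<close>)
 ultimately have "\<forall>\<^sub>F w in nhds (mf_hopf c 1). dist (st w) c < dl & snd w ~= 1" by eventually_elim simp
 then show ?thesis unfolding eventually_nhds_metric by (force simp: nb_def dist_norm)
qed

end

section \<open>From single values to the connected set of good values\<close>

theorem theorem1:
  fixes P Q :: "complex ^ 'n \<Rightarrow> complex" and \<rho> :: real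
  assumes "\<rho> > 0"
    and "mf_holomorphic_on P (ball 0 \<rho>)" and "mf_holomorphic_on Q (ball 0 \<rho>)"
    and "\<not> (\<forall>z\<in>ball 0 \<rho>. Q z = 0)"
  shows "\<exists>\<Sigma>. finite \<Sigma> \<and> \<Sigma> \<subseteq> mf_CP1 \<and>
     \<comment> \<open>the c-Milnor fibres, for c outside Sigma, are all diffeomorphic to each other\<close>
     (\<forall>c1\<in>mf_CP1 - \<Sigma>. \<forall>c2\<in>mf_CP1 - \<Sigma>. \<exists>\<epsilon>0>0. \<forall>\<epsilon>1 \<epsilon>2.
        0 < \<epsilon>1 \<and> \<epsilon>1 \<le> \<epsilon>0 \<and> 0 < \<epsilon>2 \<and> \<epsilon>2 \<le> \<epsilon>0 \<longrightarrow>
        (\<exists>\<delta>>0. \<forall>c1' \<in> mf_CP1. \<forall>c2' \<in> mf_CP1.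
            0 < dist c1' c1 \<and> dist c1' c1 < \<delta> \<and> 0 < dist c2' c2 \<and> dist c2' c2 < \<delta> \<longrightarrow>
            mf_diffeomorphic (mf_fibre P Q \<epsilon>1 c1') (mf_fibre P Q \<epsilon>2 c2'))) \<and>
     \<comment> \<open>the c-monodromy, for c outside Sigma, is isotopic to the identity\<close>
     (\<forall>c\<in>mf_CP1 - \<Sigma>. \<exists>\<epsilon>0>0. \<forall>\<epsilon>. 0 < \<epsilon> \<and> \<epsilon> \<le> \<epsilon>0 \<longrightarrow>
        (\<exists>\<delta>>0. mf_fibration_over (mf_dom P Q \<epsilon>) (mf_map P Q) (mf_CP1 \<inter> ball c \<delta> - {c}) \<and>
           (\<forall>u v r. mf_tangent_frame c u v \<and> 0 < r \<and> r < pi / 2 \<and>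
               mf_circle_loop c u v r ` {0..1} \<subseteq> ball c \<delta> \<longrightarrow>
               mf_monodromy_isotopic_to_id (mf_dom P Q \<epsilon>) (mf_map P Q) (mf_circle_loop c u v r)))) \<and>
     \<comment> \<open>in particular, finitely many atypical values\<close>
     finite {c \<in> mf_CP1. \<not> mf_typical P Q c}"
proof -
 have h0: "hol_at P 0" "hol_at Q 0" using hol_atI[OF assms(2), of 0] hol_atI[OF assms(3), of 0] assms(1) by auto
 have nz: "nz_germ Q"
  unfolding nz_germ_def
 proof
  assume "\<forall>\<^sub>F z in nhds 0. Q z = 0"
  then obtain V where V: "open V" "0 \<in> V" "\<forall>z\<in>V. Q z = 0" unfolding eventually_nhds by blast
  have "Q w = 0" if "w \<in> ball 0 \<rho>" for w
   by (rule hol_identity[OF assms(3) convex_ball _ _ _ _ that, of "V \<inter> ball 0 \<rho>"]) (use V assms(1) in auto)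
  then show False using assms(4) by blast
 qed
 obtain S where S: "finite S" "!!c. c \<notin> S ==> \<exists>C>0. \<exists>dl>0. \<forall>z. norm z < dl & Q z ~= 0 & cmod (P z / Q z - c) < dl \<longrightarrow>
   z ~= 0 & hol_at P z & hol_at Q z & has_fields P Q C z"
  using fields_exist[OF h0 nz] by blast
 have tube: "\<exists>dl>0. \<exists>C. tube P Q c dl C" if c: "c \<notin> S" for c
 proof -
  obtain C dl where C: "C > 0" "dl > 0" "\<forall>z. norm z < dl & Q z ~= 0 & cmod (P z / Q z - c) < dl \<longrightarrow>
   z ~= 0 & hol_at P z & hol_at Q z & has_fields P Q C z" using S(2)[OF c] by blast
  have "tube P Q c (min dl \<rho>) C"
  proof (rule tube.intro)
   show "min dl \<rho> > 0" "C > 0" using C assms(1) by auto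
   show "hol P (ball 0 (min dl \<rho>))" "hol Q (ball 0 (min dl \<rho>))"
    using hol_subset[OF assms(2) open_ball] hol_subset[OF assms(3) open_ball] by (auto simp: subset_ball)
   show "z ~= 0 & has_fields P Q C z" if "norm z < min dl \<rho>" "Q z ~= 0" "cmod (P z / Q z - c) < min dl \<rho>" for z
    using C(3) that by auto
  qed
  moreover have "min dl \<rho> > 0" using C assms(1) by auto
  ultimately show ?thesis by blast
 qed
 define h where "h t = mf_hopf t 1" for t
 \<comment> \<open>Infinity is always included, as the affine coordinate does not reach it.\<close>
 define \<Sigma> where "\<Sigma> = insert (0, 1) (h ` S)"
 define nice where "nice ep w ep' w' \<longleftrightarrow> mf_diffeomorphic (mf_fibre P Q ep w) (mf_fibre P Q ep' w')" for ep w ep' w'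
 have coord: "st c \<notin> S & h (st c) = c" if "c \<in> mf_CP1 - \<Sigma>" for c
 proof -
  have e: "h (st c) = c" using hopf_st[of c] that by (auto simp: h_def \<Sigma>_def)
  moreover have "st c \<notin> S" using that imageI[of "st c" S h] unfolding e \<Sigma>_def by blast
  ultimately show ?thesis by blast
 qed
 \<comment> \<open>One tube yields all local conclusions with common bounds; the radii are limited
   to half of \<open>dl\<close> because the statements about the tube require radii strictly below
   it.\<close>
 have loc: "\<exists>e>0. \<exists>d>0.
   (\<forall>w\<in>mf_CP1. \<forall>w'\<in>mf_CP1. \<forall>ep ep'. dist w (h t) < d & dist w' (h t) < d & 0 < ep & ep \<le> e & 0 < ep' & ep' \<le> e \<longrightarrow> nice ep w ep' w') &
   (\<forall>ep V. ep \<le> e & V \<subseteq> mf_CP1 \<inter> ball (h t) d \<longrightarrow> mf_fibration_over (mf_dom P Q ep) (mf_map P Q) V) &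
   (\<forall>ep gm. ep \<le> e & mf_smooth_on UNIV gm & gm 1 = gm 0 & gm ` {0..1} \<subseteq> mf_CP1 \<inter> ball (h t) d \<longrightarrow>
    mf_monodromy_isotopic_to_id (mf_dom P Q ep) (mf_map P Q) gm)" if t: "t \<notin> S" for t
 proof -
  obtain dl C where "dl > 0" "tube P Q t dl C" using tube[OF t] by blast
  then interpret T: tube P Q t dl C by blast
  obtain d where d: "d > 0" "!!w. w \<in> mf_CP1 ==> dist w (h t) < d ==> T.nb w" using T.nb_near unfolding h_def by blast
  have e: "dl / 2 > 0" "dl / 2 < dl" using T.dl by auto
  have nbV: "T.nb w" if "w \<in> mf_CP1 \<inter> ball (h t) d" for w using d(2)[of w] that by (simp add: dist_commute)
  show ?thesis
  proof (rule exI[of _ "dl / 2"], rule conjI[OF e(1)], rule exI[of _ d], rule conjI[OF d(1)], intro conjI ballI allI impI)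
   fix w w' ep ep' assume w: "w \<in> mf_CP1" "w' \<in> mf_CP1" and a: "dist w (h t) < d & dist w' (h t) < d & 0 < ep & ep \<le> dl / 2 & 0 < ep' & ep' \<le> dl / 2"
   show "nice ep w ep' w'" unfolding nice_def
    by (rule T.fibres_diffeomorphic[OF d(2)[OF w(1)] d(2)[OF w(2)]]) (use a e in auto)
  next
   fix ep V assume a: "ep \<le> dl / 2 & V \<subseteq> mf_CP1 \<inter> ball (h t) d"
   show "mf_fibration_over (mf_dom P Q ep) (mf_map P Q) V"
    by (rule T.fibration[OF nbV]) (use a e in auto)
  next
   fix ep and gm :: "real => complex \<times> real" assume a: "ep \<le> dl / 2 & mf_smooth_on UNIV gm & gm 1 = gm 0 & gm ` {0..1} \<subseteq> mf_CP1 \<inter> ball (h t) d"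
   show "mf_monodromy_isotopic_to_id (mf_dom P Q ep) (mf_map P Q) gm"
   proof (rule T.monodromy)
    show "T.nb (gm s)" if "s \<in> {0..1}" for s by (rule nbV) (use a that in blast)
   qed (use a e in auto)
  qed
 qed
 define R where "R t t' \<longleftrightarrow> (\<exists>e>0. \<forall>ep ep'. 0 < ep & ep \<le> e & 0 < ep' & ep' \<le> e \<longrightarrow> nice ep (h t) ep' (h t'))" for t t'
 have nice_sym: "nice ep w ep' w' ==> nice ep' w' ep w" for ep w ep' w' unfolding nice_def by (rule mf_diffeomorphic_sym)
 have nice_trans: "nice ep w ep' w' ==> nice ep' w' ep'' w'' ==> nice ep w ep'' w''" for ep w ep' w' ep'' w''
  unfolding nice_def by (rule mf_diffeomorphic_trans)
 have hc: "continuous_on UNIV h" using smooth_hopf unfolding smooth_iff_ck h_def[abs_def] by (metis ck.simps(1))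
 \<comment> \<open>Locally any two values are related, \<open>R\<close> is an equivalence relation
   on the good values, and the plane without a finite set is connected.\<close>
 have conn: "R t1 t2" if "t1 \<notin> S" "t2 \<notin> S" for t1 t2
 proof (rule connected_equivalence_relation[of "UNIV - S"])
  show "connected (UNIV - S)" by (rule connected_open_delete_finite) (use S(1) in auto)
  show "R y x" if "R x y" for x y using that nice_sym unfolding R_def by blast
  show "R x z" if xy: "R x y" and yz: "R y z" for x y z
  proof -
   obtain e1 where e1: "e1 > 0" "!!ep ep'. 0 < ep & ep \<le> e1 & 0 < ep' & ep' \<le> e1 ==> nice ep (h x) ep' (h y)" using xy unfolding R_def by blast
   obtain e2 where e2: "e2 > 0" "!!ep ep'. 0 < ep & ep \<le> e2 & 0 < ep' & ep' \<le> e2 ==> nice ep (h y) ep' (h z)" using yz unfolding R_def by blast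
   have "nice ep (h x) ep' (h z)" if "0 < ep & ep \<le> min e1 e2 & 0 < ep' & ep' \<le> min e1 e2" for ep ep'
    by (rule nice_trans[OF e1(2)[of ep ep] e2(2)[of ep ep']]) (use that in auto)
   then show ?thesis unfolding R_def using e1(1) e2(1) by (intro exI[of _ "min e1 e2"]) auto
  qed
  show "\<exists>T. openin (top_of_set (UNIV - S)) T & a \<in> T & (\<forall>x\<in>T. R a x)" if a: "a \<in> UNIV - S" for a
  proof -
   obtain e d where e: "e > 0" "d > 0" "!!w w' ep ep'. w \<in> mf_CP1 ==> w' \<in> mf_CP1 ==> dist w (h a) < d & dist w' (h a) < d & 0 < ep & ep \<le> e & 0 < ep' & ep' \<le> e ==> nice ep w ep' w'"
    using loc[of a] a by auto
   have "openin (top_of_set (UNIV - S)) ((UNIV - S) \<inter> h -` ball (h a) d)"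
    by (rule openin_open_Int[OF open_vimage[OF open_ball hc]])
   moreover have "R a x" if "x \<in> h -` ball (h a) d" for x
    unfolding R_def using e(1) e(3)[of "h a" "h x"] e(2) that hopf_sphere unfolding h_def
    by (intro exI[of _ e]) (simp add: dist_commute)
   ultimately show ?thesis using \<open>a \<in> UNIV - S\<close> e(2) by (intro exI[of _ "(UNIV - S) \<inter> h -` ball (h a) d"]) auto
  qed
 qed (use that in auto)
 have typical: "mf_typical P Q c" if c: "c \<in> mf_CP1 - \<Sigma>" for c
 proof -
  obtain e d where e: "e > 0" "d > 0" "!!ep V. ep \<le> e & V \<subseteq> mf_CP1 \<inter> ball c d ==> mf_fibration_over (mf_dom P Q ep) (mf_map P Q) V"
   using loc[of "st c"] coord[OF c] by auto
  then show ?thesis unfolding mf_typical_def by blast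
 qed
 show ?thesis
 proof (rule exI[of _ \<Sigma>], intro conjI ballI)
  show "finite \<Sigma>" using S(1) by (simp add: \<Sigma>_def)
  show "\<Sigma> \<subseteq> mf_CP1" using hopf_sphere by (auto simp: \<Sigma>_def h_def norm_Pair)
  show "finite {c \<in> mf_CP1. \<not> mf_typical P Q c}"
   by (rule finite_subset[of _ \<Sigma>]) (use typical S(1) in \<open>auto simp: \<Sigma>_def\<close>)
 next
  fix c1 c2 assume c: "c1 \<in> mf_CP1 - \<Sigma>" "c2 \<in> mf_CP1 - \<Sigma>"
  obtain e1 d1 where e1: "e1 > 0" "d1 > 0" "!!w w' ep ep'. w \<in> mf_CP1 ==> w' \<in> mf_CP1 ==> dist w c1 < d1 & dist w' c1 < d1 & 0 < ep & ep \<le> e1 & 0 < ep' & ep' \<le> e1 ==> nice ep w ep' w'"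
   using loc[of "st c1"] coord[OF c(1)] by auto
  obtain e2 d2 where e2: "e2 > 0" "d2 > 0" "!!w w' ep ep'. w \<in> mf_CP1 ==> w' \<in> mf_CP1 ==> dist w c2 < d2 & dist w' c2 < d2 & 0 < ep & ep \<le> e2 & 0 < ep' & ep' \<le> e2 ==> nice ep w ep' w'"
   using loc[of "st c2"] coord[OF c(2)] by auto
  obtain e3 where e3: "e3 > 0" "!!ep ep'. 0 < ep & ep \<le> e3 & 0 < ep' & ep' \<le> e3 ==> nice ep c1 ep' c2"
   using conn[of "st c1" "st c2"] coord[OF c(1)] coord[OF c(2)] unfolding R_def by auto
  let ?e = "min e1 (min e2 e3)"
  \<comment> \<open>Three comparisons: from \<open>c1'\<close> to \<open>c1\<close> inside the ball
    of radius \<open>ep1\<close>, from \<open>c1\<close> to \<open>c2\<close> with the change of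
    radius to \<open>ep2\<close>, and from \<open>c2\<close> to \<open>c2'\<close> inside the second
    ball.\<close>
  have main: "nice ep1 c1' ep2 c2'"
   if ep: "0 < ep1 & ep1 \<le> ?e & 0 < ep2 & ep2 \<le> ?e" and c': "c1' \<in> mf_CP1" "c2' \<in> mf_CP1" "dist c1' c1 < min d1 d2" "dist c2' c2 < min d1 d2" for ep1 ep2 c1' c2'
  proof (rule nice_trans[OF _ nice_trans])
   show "nice ep1 c1' ep1 c1" by (rule e1(3)) (use ep c' c e1 in auto)
   show "nice ep1 c1 ep2 c2" by (rule e3(2)) (use ep in auto)
   show "nice ep2 c2 ep2 c2'" by (rule e2(3)) (use ep c' c e2 in auto)
  qed
  show "\<exists>ep0>0. \<forall>ep1 ep2. 0 < ep1 & ep1 \<le> ep0 & 0 < ep2 & ep2 \<le> ep0 \<longrightarrow>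
    (\<exists>dl>0. \<forall>c1' \<in> mf_CP1. \<forall>c2' \<in> mf_CP1.
      0 < dist c1' c1 & dist c1' c1 < dl & 0 < dist c2' c2 & dist c2' c2 < dl \<longrightarrow>
      mf_diffeomorphic (mf_fibre P Q ep1 c1') (mf_fibre P Q ep2 c2'))"
  proof (rule exI[of _ ?e], intro conjI allI impI)
   show "0 < ?e" using e1(1) e2(1) e3(1) by simp
   fix ep1 ep2 assume ep: "0 < ep1 & ep1 \<le> ?e & 0 < ep2 & ep2 \<le> ?e"
   show "\<exists>dl>0. \<forall>c1' \<in> mf_CP1. \<forall>c2' \<in> mf_CP1. 0 < dist c1' c1 & dist c1' c1 < dl & 0 < dist c2' c2 & dist c2' c2 < dl \<longrightarrow>
      mf_diffeomorphic (mf_fibre P Q ep1 c1') (mf_fibre P Q ep2 c2')"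
    unfolding nice_def[symmetric] using e1(2) e2(2) main[OF ep] by (intro exI[of _ "min d1 d2"] conjI ballI impI) auto
  qed
 next
  fix c assume c: "c \<in> mf_CP1 - \<Sigma>"
  obtain e d where e: "e > 0" "d > 0" "!!ep V. ep \<le> e & V \<subseteq> mf_CP1 \<inter> ball c d ==> mf_fibration_over (mf_dom P Q ep) (mf_map P Q) V"
   "!!ep gm. ep \<le> e & mf_smooth_on UNIV gm & gm 1 = gm 0 & gm ` {0..1} \<subseteq> mf_CP1 \<inter> ball c d ==> mf_monodromy_isotopic_to_id (mf_dom P Q ep) (mf_map P Q) gm"
   using loc[of "st c"] coord[OF c] by auto
  have mon: "mf_monodromy_isotopic_to_id (mf_dom P Q ep) (mf_map P Q) (mf_circle_loop c u v r)"
   if "ep \<le> e" "mf_tangent_frame c u v" "mf_circle_loop c u v r ` {0..1} \<subseteq> ball c d" for ep u v r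
  proof (rule e(4), intro conjI that(1) smooth_circle_loop)
   show "mf_circle_loop c u v r 1 = mf_circle_loop c u v r 0" by (simp add: mf_circle_loop_def)
   show "mf_circle_loop c u v r ` {0..1} \<subseteq> mf_CP1 \<inter> ball c d" using that(3) circle_loop_sphere[OF that(2)] c by blast
  qed
  have fib: "mf_fibration_over (mf_dom P Q ep) (mf_map P Q) (mf_CP1 \<inter> ball c d - {c})" if "ep \<le> e" for ep
   by (rule e(3)) (use that in auto)
  show "\<exists>ep0>0. \<forall>ep. 0 < ep & ep \<le> ep0 \<longrightarrow>
    (\<exists>dl>0. mf_fibration_over (mf_dom P Q ep) (mf_map P Q) (mf_CP1 \<inter> ball c dl - {c}) &
     (\<forall>u v r. mf_tangent_frame c u v & 0 < r & r < pi / 2 &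
       mf_circle_loop c u v r ` {0..1} \<subseteq> ball c dl \<longrightarrow>
       mf_monodromy_isotopic_to_id (mf_dom P Q ep) (mf_map P Q) (mf_circle_loop c u v r)))"
   by (rule exI[of _ e], rule conjI[OF e(1)], intro allI impI, rule exI[of _ d], intro conjI allI impI e(2) fib mon) blast+
 qed
qed

end
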